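(* Let $\phi: G\times M\to M$ be a Nil-Anosov action, let $\mathcal N$ be the Lie algebra of the nilradical $N$ of $G$, let $\mathfrak a\in\mathcal N$ be any Anosov element for $\phi$ lying in $\mathcal N$, and let $\xi=(E^{ss},E^{uu})$ be the hyperbolic splitting for which $\mathfrak a$ is Anosov. Then $\xi$ is preserved by the action of $G$, i.e. $D\phi^g(E^{ss})=E^{ss}$ and $D\phi^g(E^{uu})=E^{uu}$ for every $g\in G$. In particular, each of the foliations $\mathcal F^{ss}[\xi]$, $\mathcal F^{uu}[\xi]$, $\mathcal F^{s}[\xi]$, $\mathcal F^{u}[\xi]$ is $G$-invariant.
   Context: Setting: $G$ is a connected, simply connected Lie group of dimension $k$ with Lie algebra $\mathcal G$; $M$ is a closed $C^\infty$ manifold of dimension $n+k$ endowed with a Riemannian metric; $\phi:G\times M\to M$ is a smooth locally free action (every isotropy group is discrete). For $g\in G$, $\phi^g$ denotes the diffeomorphism $x\mapsto \phi(g,x)$; $\mathcal O$ is the orbit foliation and $T\mathcal O$ its tangent bundle. $G$-splitting: a pair $\xi=(E_1,E_2)$ of subbundles of $TM$ with $TM=E_1\oplus T\mathcal O\oplus E_2$. Anosov element: $\mathfrak a\in\mathcal G$ is $\xi$-Anosov, with $\xi=(E^{ss},E^{uu})$ a continuous $G$-splitting, if, with $g=\phi^{\exp\mathfrak a}$, the splitting $\xi$ is $Dg$-invariant and there are constants $\lambda>0$, $C>0$ such that, at every point of $M$ and for all $n\ge 0$, the four quantities $\|Dg^n|_{E^{ss}}\|$, $\|Dg^{-n}|_{E^{uu}}\|$,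 $\frac{\|Dg^n|_{E^{ss}}\|}{m(Dg^n|_{T\mathcal O})}$, $\frac{\|Dg^n|_{T\mathcal O}\|}{m(Dg^n|_{E^{uu}})}$ are all $\le Ce^{-\lambda n}$, where $m$ denotes the co-norm. $\mathfrak a$ is an Anosov element if it is $\xi$-Anosov for some $\xi$; this $\xi$ (the hyperbolic splitting of $\mathfrak a$) is then unique. Foliations: for such $\xi$ the bundles $E^{ss}$, $E^{uu}$, $T\mathcal O\oplus E^{ss}$, $T\mathcal O\oplus E^{uu}$ are integrable (Hirsch-Pugh-Shub); the corresponding foliations are denoted $\mathcal F^{ss}[\xi]$, $\mathcal F^{uu}[\xi]$, $\mathcal F^{s}[\xi]$, $\mathcal F^{u}[\xi]$. Nil-Anosov action: $G$ has a nontrivial nilradical $N$ with Lie algebra $\mathcal N$, and some $\mathfrak a\in\mathcal N$ is an Anosov element for $\phi$. *)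

theory Defs
  imports
    "HOL-Analysis.Analysis"
    "HOL-Algebra.Group_Action"
    "HOL-Library.Disjoint_Sets"
begin

section \<open>Smooth manifolds\<close>

text \<open>
  A manifold without boundary is a Hausdorff, second countable type \<open>'m\<close> together with an atlas of
  charts \<open>(U, c)\<close> into a Euclidean space \<open>'e\<close>; its dimension is \<open>DIM('e)\<close>.  The coordinate map
  \<open>c\<close> is only meaningful on \<open>U\<close>.
\<close>

primrec Ck_on :: "nat \<Rightarrow> 'a::real_normed_vector set \<Rightarrow> ('a \<Rightarrow> 'b::real_normed_vector) \<Rightarrow> bool" where
  "Ck_on 0 S f \<longleftrightarrow> continuous_on S f"
| "Ck_on (Suc r) S f \<longleftrightarrow>
     (\<forall>x\<in>S. f differentiable (at x)) \<and> (\<forall>v. Ck_on r S (\<lambda>x. frechet_derivative f (at x) v))"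

text \<open>Only used for open sets \<open>S\<close> in finite-dimensional spaces.\<close>
definition smooth_on :: "'a::real_normed_vector set \<Rightarrow> ('a \<Rightarrow> 'b::real_normed_vector) \<Rightarrow> bool" where
  "smooth_on S f \<longleftrightarrow> (\<forall>r. Ck_on r S f)"

type_synonym ('m, 'e) chart = "'m set \<times> ('m \<Rightarrow> 'e)"
type_synonym ('m, 'e) atlas = "('m, 'e) chart set"

definition chart_inv :: "('m, 'e) chart \<Rightarrow> 'e \<Rightarrow> 'm" where
  "chart_inv c = inv_into (fst c) (snd c)"

definition smooth_atlas ::
  "('m::{t2_space,second_countable_topology}, 'e::euclidean_space) atlas \<Rightarrow> bool" where
  "smooth_atlas A \<longleftrightarrow>
     (\<Union>c\<in>A. fst c) = UNIV \<and>
     (\<forall>c\<in>A. open (fst c) \<and> open (snd c ` fst c) \<and>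
            homeomorphism (fst c) (snd c ` fst c) (snd c) (chart_inv c)) \<and>
     (\<forall>c\<in>A. \<forall>d\<in>A. smooth_on (snd c ` (fst c \<inter> fst d)) (snd d \<circ> chart_inv c))"

definition euclidean_atlas :: "('e, 'e) atlas" where
  "euclidean_atlas = {(UNIV, id)}"

definition product_atlas :: "('g, 'b) atlas \<Rightarrow> ('m, 'e) atlas \<Rightarrow> ('g \<times> 'm, 'b \<times> 'e) atlas" where
  "product_atlas A B = (\<lambda>(c, d). (fst c \<times> fst d, map_prod (snd c) (snd d))) ` (A \<times> B)"

definition smooth_map ::
  "('m::topological_space, 'e::euclidean_space) atlas \<Rightarrow>
   ('n::topological_space, 'f::euclidean_space) atlas \<Rightarrow> ('m \<Rightarrow> 'n) \<Rightarrow> bool" where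
  "smooth_map A B f \<longleftrightarrow> continuous_on UNIV f \<and>
     (\<forall>c\<in>A. \<forall>d\<in>B. smooth_on (snd c ` (fst c \<inter> f -` fst d)) (snd d \<circ> f \<circ> chart_inv c))"

text \<open>
  Tangent vectors.  At every point \<open>x\<close> one chart around \<open>x\<close> is selected once and for all, and
  \<open>T\<^sub>xM\<close> is identified with \<open>'e\<close> through the differential of that chart.  Hence tangent vectors at
  different points can only be compared after passing to a common chart.
\<close>

definition chart_at :: "('m, 'e) atlas \<Rightarrow> 'm \<Rightarrow> ('m, 'e) chart" where
  "chart_at A x = (SOME c. c \<in> A \<and> x \<in> fst c)"

text \<open>The tangent map \<open>T\<^sub>xM \<rightarrow> T\<^bsub>f x\<^esub>N\<close> of a map that is differentiable at \<open>x\<close>.\<close>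
definition tangent_map ::
  "('m, 'e::euclidean_space) atlas \<Rightarrow> ('n, 'f::euclidean_space) atlas \<Rightarrow>
   ('m \<Rightarrow> 'n) \<Rightarrow> 'm \<Rightarrow> 'e \<Rightarrow> 'f" where
  "tangent_map A B f x =
     frechet_derivative (snd (chart_at B (f x)) \<circ> f \<circ> chart_inv (chart_at A x))
       (at (snd (chart_at A x) x))"

text \<open>The representation of the tangent vector \<open>v \<in> T\<^sub>xM\<close> in the chart \<open>c\<close>.\<close>
definition in_chart ::
  "('m, 'e::euclidean_space) atlas \<Rightarrow> ('m, 'e) chart \<Rightarrow> 'm \<Rightarrow> 'e \<Rightarrow> 'e" where
  "in_chart A c x v = tangent_map A euclidean_atlas (snd c) x v"

text \<open>The tangent vector at \<open>chart_inv c p\<close> that is represented by \<open>u\<close> in the chart \<open>c\<close>.\<close>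
definition from_chart ::
  "('m, 'e::euclidean_space) atlas \<Rightarrow> ('m, 'e) chart \<Rightarrow> 'e \<Rightarrow> 'e \<Rightarrow> 'e" where
  "from_chart A c p u = tangent_map euclidean_atlas A (chart_inv c) p u"

definition continuous_vector_field_on ::
  "('m::topological_space, 'e::euclidean_space) atlas \<Rightarrow> 'm set \<Rightarrow> ('m \<Rightarrow> 'e) \<Rightarrow> bool" where
  "continuous_vector_field_on A U X \<longleftrightarrow>
     (\<forall>c\<in>A. continuous_on (U \<inter> fst c) (\<lambda>y. in_chart A c y (X y)))"

text \<open>
  \<open>E x\<close> is the fibre over \<open>x\<close>; a continuous subbundle has local continuous frames.
\<close>
definition continuous_subbundle ::
  "('m::topological_space, 'e::euclidean_space) atlas \<Rightarrow> ('m \<Rightarrow> 'e set) \<Rightarrow> bool" where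
  "continuous_subbundle A E \<longleftrightarrow>
     (\<forall>x. \<exists>U r X. open U \<and> x \<in> U \<and>
        (\<forall>i<r. continuous_vector_field_on A U (X i)) \<and>
        (\<forall>y\<in>U. inj_on (\<lambda>i::nat. X i y) {..<r} \<and> independent ((\<lambda>i. X i y) ` {..<r}) \<and>
               span ((\<lambda>i. X i y) ` {..<r}) = E y))"

definition bundle_sum :: "('m \<Rightarrow> 'e::plus set) \<Rightarrow> ('m \<Rightarrow> 'e set) \<Rightarrow> 'm \<Rightarrow> 'e set" where
  "bundle_sum E F x = {v + w | v w. v \<in> E x \<and> w \<in> F x}"

text \<open>Smoothness of \<open>\<rho>\<close> is smoothness of its coefficients in every chart.\<close>
definition riemannian_metric ::
  "('m, 'e::euclidean_space) atlas \<Rightarrow> ('m \<Rightarrow> 'e \<Rightarrow> 'e \<Rightarrow> real) \<Rightarrow> bool" where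
  "riemannian_metric A \<rho> \<longleftrightarrow>
     (\<forall>x. bilinear (\<rho> x) \<and> (\<forall>v w. \<rho> x v w = \<rho> x w v) \<and> (\<forall>v. v \<noteq> 0 \<longrightarrow> \<rho> x v v > 0)) \<and>
     (\<forall>c\<in>A. \<forall>u v. smooth_on (snd c ` fst c)
        (\<lambda>p. \<rho> (chart_inv c p) (from_chart A c p u) (from_chart A c p v)))"

definition rnorm :: "('m \<Rightarrow> 'e \<Rightarrow> 'e \<Rightarrow> real) \<Rightarrow> 'm \<Rightarrow> 'e \<Rightarrow> real" where
  "rnorm \<rho> x v = sqrt (\<rho> x v v)"

text \<open>
  Norm and co-norm of \<open>Df\<close> on the fibre \<open>E x\<close>.  The values are extended nonnegative reals, so that
  a zero fibre has norm \<open>0\<close> and co-norm \<open>\<infinity>\<close>.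
\<close>
definition norm_on ::
  "('m, 'e::euclidean_space) atlas \<Rightarrow> ('m \<Rightarrow> 'e \<Rightarrow> 'e \<Rightarrow> real) \<Rightarrow> ('m \<Rightarrow> 'm) \<Rightarrow> ('m \<Rightarrow> 'e set)
   \<Rightarrow> 'm \<Rightarrow> ennreal" where
  "norm_on A \<rho> f E x =
     (SUP v\<in>{v \<in> E x. rnorm \<rho> x v = 1}. ennreal (rnorm \<rho> (f x) (tangent_map A A f x v)))"

definition conorm_on ::
  "('m, 'e::euclidean_space) atlas \<Rightarrow> ('m \<Rightarrow> 'e \<Rightarrow> 'e \<Rightarrow> real) \<Rightarrow> ('m \<Rightarrow> 'm) \<Rightarrow> ('m \<Rightarrow> 'e set)
   \<Rightarrow> 'm \<Rightarrow> ennreal" where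
  "conorm_on A \<rho> f E x =
     (INF v\<in>{v \<in> E x. rnorm \<rho> x v = 1}. ennreal (rnorm \<rho> (f x) (tangent_map A A f x v)))"

definition bundle_invariant ::
  "('m, 'e::euclidean_space) atlas \<Rightarrow> ('m \<Rightarrow> 'm) \<Rightarrow> ('m \<Rightarrow> 'e set) \<Rightarrow> bool" where
  "bundle_invariant A f E \<longleftrightarrow> (\<forall>x. tangent_map A A f x ` E x = E (f x))"


section \<open>Lie groups and their Lie algebras\<close>

definition lie_group ::
  "'g::{t2_space,second_countable_topology} monoid \<Rightarrow> ('g, 'b::euclidean_space) atlas \<Rightarrow> bool" where
  "lie_group G A \<longleftrightarrow> group G \<and> carrier G = UNIV \<and> smooth_atlas A \<and>
     smooth_map (product_atlas A A) A (\<lambda>(g, h). g \<otimes>\<^bsub>G\<^esub> h) \<and>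
     smooth_map A A (\<lambda>g. inv\<^bsub>G\<^esub> g)"

text \<open>The bracket of two smooth vector fields at \<open>x\<close>, computed in the selected chart at \<open>x\<close>.\<close>
definition vf_bracket ::
  "('m, 'e::euclidean_space) atlas \<Rightarrow> ('m \<Rightarrow> 'e) \<Rightarrow> ('m \<Rightarrow> 'e) \<Rightarrow> 'm \<Rightarrow> 'e" where
  "vf_bracket A X Y x =
     (let c = chart_at A x; p = snd c x;
          X' = (\<lambda>q. in_chart A c (chart_inv c q) (X (chart_inv c q)));
          Y' = (\<lambda>q. in_chart A c (chart_inv c q) (Y (chart_inv c q)))
      in frechet_derivative Y' (at p) (X' p) - frechet_derivative X' (at p) (Y' p))"

definition left_invariant_field ::
  "'g monoid \<Rightarrow> ('g, 'b::euclidean_space) atlas \<Rightarrow> 'b \<Rightarrow> 'g \<Rightarrow> 'b" where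
  "left_invariant_field G A u g = tangent_map A A (\<lambda>h. g \<otimes>\<^bsub>G\<^esub> h) \<one>\<^bsub>G\<^esub> u"

text \<open>The Lie algebra of \<open>G\<close> is the tangent space at the identity, that is, the type \<open>'b\<close>, with this bracket.\<close>
definition lie_bracket ::
  "'g monoid \<Rightarrow> ('g, 'b::euclidean_space) atlas \<Rightarrow> 'b \<Rightarrow> 'b \<Rightarrow> 'b" where
  "lie_bracket G A u v =
     vf_bracket A (left_invariant_field G A u) (left_invariant_field G A v) \<one>\<^bsub>G\<^esub>"

definition one_parameter_subgroup ::
  "'g::topological_space monoid \<Rightarrow> ('g, 'b::euclidean_space) atlas \<Rightarrow> 'b \<Rightarrow> (real \<Rightarrow> 'g) \<Rightarrow> bool" where
  "one_parameter_subgroup G A a \<gamma> \<longleftrightarrow>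
     smooth_map euclidean_atlas A \<gamma> \<and> (\<forall>s t. \<gamma> (s + t) = \<gamma> s \<otimes>\<^bsub>G\<^esub> \<gamma> t) \<and>
     tangent_map euclidean_atlas A \<gamma> 0 1 = a"

definition lie_exp ::
  "'g::topological_space monoid \<Rightarrow> ('g, 'b::euclidean_space) atlas \<Rightarrow> 'b \<Rightarrow> 'g" where
  "lie_exp G A a = (THE \<gamma>. one_parameter_subgroup G A a \<gamma>) 1"

definition lie_ideal :: "('b::real_vector \<Rightarrow> 'b \<Rightarrow> 'b) \<Rightarrow> 'b set \<Rightarrow> bool" where
  "lie_ideal br I \<longleftrightarrow> subspace I \<and> (\<forall>u. \<forall>v\<in>I. br u v \<in> I)"

primrec lower_central :: "('b::real_vector \<Rightarrow> 'b \<Rightarrow> 'b) \<Rightarrow> 'b set \<Rightarrow> nat \<Rightarrow> 'b set" where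
  "lower_central br I 0 = I"
| "lower_central br I (Suc j) = span {br u v | u v. u \<in> I \<and> v \<in> lower_central br I j}"

definition nilpotent_ideal :: "('b::real_vector \<Rightarrow> 'b \<Rightarrow> 'b) \<Rightarrow> 'b set \<Rightarrow> bool" where
  "nilpotent_ideal br I \<longleftrightarrow> lie_ideal br I \<and> (\<exists>j. lower_central br I j = {0})"

text \<open>The sum of all nilpotent ideals, which is the largest nilpotent ideal.\<close>
definition nilradical :: "('b::real_vector \<Rightarrow> 'b \<Rightarrow> 'b) \<Rightarrow> 'b set" where
  "nilradical br = span (\<Union>{I. nilpotent_ideal br I})"


section \<open>Locally free actions and Anosov elements\<close>

definition smooth_locally_free_action ::
  "'g::topological_space monoid \<Rightarrow> ('g, 'b::euclidean_space) atlas \<Rightarrow>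
   ('m::topological_space, 'e::euclidean_space) atlas \<Rightarrow> ('g \<Rightarrow> 'm \<Rightarrow> 'm) \<Rightarrow> bool" where
  "smooth_locally_free_action G A B \<phi> \<longleftrightarrow> group_action G UNIV \<phi> \<and>
     smooth_map (product_atlas A B) B (\<lambda>(g, x). \<phi> g x) \<and>
     (\<forall>x. discrete (stabilizer G \<phi> x))"

definition orbit_tangent ::
  "'g monoid \<Rightarrow> ('g, 'b::euclidean_space) atlas \<Rightarrow> ('m, 'e::euclidean_space) atlas \<Rightarrow>
   ('g \<Rightarrow> 'm \<Rightarrow> 'm) \<Rightarrow> 'm \<Rightarrow> 'e set" where
  "orbit_tangent G A B \<phi> x = range (tangent_map A B (\<lambda>g. \<phi> g x) \<one>\<^bsub>G\<^esub>)"

definition continuous_G_splitting ::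
  "'g monoid \<Rightarrow> ('g, 'b::euclidean_space) atlas \<Rightarrow> ('m::topological_space, 'e::euclidean_space) atlas \<Rightarrow>
   ('g \<Rightarrow> 'm \<Rightarrow> 'm) \<Rightarrow> ('m \<Rightarrow> 'e set) \<times> ('m \<Rightarrow> 'e set) \<Rightarrow> bool" where
  "continuous_G_splitting G A B \<phi> \<xi> \<longleftrightarrow>
     continuous_subbundle B (fst \<xi>) \<and> continuous_subbundle B (snd \<xi>) \<and>
     (\<forall>x v. \<exists>!p. case p of (u, w, z) \<Rightarrow>
        u \<in> fst \<xi> x \<and> w \<in> orbit_tangent G A B \<phi> x \<and> z \<in> snd \<xi> x \<and> v = u + w + z)"

definition xi_anosov ::
  "'g::topological_space monoid \<Rightarrow> ('g, 'b::euclidean_space) atlas \<Rightarrow>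
   ('m::topological_space, 'e::euclidean_space) atlas \<Rightarrow> ('m \<Rightarrow> 'e \<Rightarrow> 'e \<Rightarrow> real) \<Rightarrow>
   ('g \<Rightarrow> 'm \<Rightarrow> 'm) \<Rightarrow> ('m \<Rightarrow> 'e set) \<times> ('m \<Rightarrow> 'e set) \<Rightarrow> 'b \<Rightarrow> bool" where
  "xi_anosov G A B \<rho> \<phi> \<xi> a \<longleftrightarrow>
     (let f = \<phi> (lie_exp G A a); Ess = fst \<xi>; Euu = snd \<xi>; T = orbit_tangent G A B \<phi>
      in continuous_G_splitting G A B \<phi> \<xi> \<and>
         bundle_invariant B f Ess \<and> bundle_invariant B f Euu \<and>
         (\<exists>\<kappa>>0. \<exists>C>0. \<forall>x. \<forall>j::nat. let \<epsilon> = ennreal (C * exp (- \<kappa> * real j)) in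
            norm_on B \<rho> (f ^^ j) Ess x \<le> \<epsilon> \<and>
            norm_on B \<rho> (inv_into UNIV f ^^ j) Euu x \<le> \<epsilon> \<and>
            norm_on B \<rho> (f ^^ j) Ess x / conorm_on B \<rho> (f ^^ j) T x \<le> \<epsilon> \<and>
            norm_on B \<rho> (f ^^ j) T x / conorm_on B \<rho> (f ^^ j) Euu x \<le> \<epsilon>))"

definition anosov_element ::
  "'g::topological_space monoid \<Rightarrow> ('g, 'b::euclidean_space) atlas \<Rightarrow>
   ('m::topological_space, 'e::euclidean_space) atlas \<Rightarrow> ('m \<Rightarrow> 'e \<Rightarrow> 'e \<Rightarrow> real) \<Rightarrow>
   ('g \<Rightarrow> 'm \<Rightarrow> 'm) \<Rightarrow> 'b \<Rightarrow> bool" where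
  "anosov_element G A B \<rho> \<phi> a \<longleftrightarrow> (\<exists>\<xi>. xi_anosov G A B \<rho> \<phi> \<xi> a)"

definition nil_anosov_action ::
  "'g::topological_space monoid \<Rightarrow> ('g, 'b::euclidean_space) atlas \<Rightarrow>
   ('m::topological_space, 'e::euclidean_space) atlas \<Rightarrow> ('m \<Rightarrow> 'e \<Rightarrow> 'e \<Rightarrow> real) \<Rightarrow>
   ('g \<Rightarrow> 'm \<Rightarrow> 'm) \<Rightarrow> bool" where
  "nil_anosov_action G A B \<rho> \<phi> \<longleftrightarrow>
     smooth_locally_free_action G A B \<phi> \<and>
     nilradical (lie_bracket G A) \<noteq> {0} \<and>
     (\<exists>a \<in> nilradical (lie_bracket G A). anosov_element G A B \<rho> \<phi> a)"


section \<open>Foliations\<close>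

text \<open>
  A continuous foliation with \<open>C\<^sup>1\<close> leaves tangent to the bundle \<open>E\<close>, given by its set of leaves.
  Around every point there is a foliation chart \<open>\<psi> : U \<rightarrow> 'e\<close> with inverse \<open>\<theta>\<close>, whose plaques are
  the preimages of the translates of a subspace \<open>P\<close>.  The map \<open>\<theta>\<close> is only continuous transversally
  to \<open>P\<close>, but along \<open>P\<close> it is \<open>C\<^sup>1\<close>: \<open>X e y\<close> is the derivative of \<open>\<theta>\<close> in the direction \<open>e \<in> P\<close>
  at \<open>\<psi> y\<close>.  Since a leaf meets \<open>U\<close> in countably many plaques, these are the path components of
  its intersection with \<open>U\<close>.
\<close>
definition foliation_tangent_to ::
  "('m::topological_space, 'e::euclidean_space) atlas \<Rightarrow> ('m \<Rightarrow> 'e set) \<Rightarrow> 'm set set \<Rightarrow> bool" where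
  "foliation_tangent_to A E \<F> \<longleftrightarrow>
     partition_on UNIV \<F> \<and> (\<forall>L\<in>\<F>. path_connected L) \<and>
     (\<forall>x. \<exists>U (\<psi> :: 'm \<Rightarrow> 'e) \<theta> P X.
        open U \<and> x \<in> U \<and> homeomorphism U UNIV \<psi> \<theta> \<and> subspace P \<and>
        (\<forall>L\<in>\<F>. \<forall>y\<in>L \<inter> U. path_component_set (L \<inter> U) y = \<theta> ` {\<psi> y + e | e. e \<in> P}) \<and>
        (\<forall>e\<in>P. continuous_vector_field_on A U (X e)) \<and>
        (\<forall>y\<in>U. \<forall>e\<in>P.
           ((\<lambda>t::real. snd (chart_at A y) (\<theta> (\<psi> y + t *\<^sub>R e))) has_vector_derivative X e y) (at 0)) \<and>
        (\<forall>y\<in>U. inj_on (\<lambda>e. X e y) P \<and> (\<lambda>e. X e y) ` P = E y))"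

definition foliation_invariant :: "'g monoid \<Rightarrow> ('g \<Rightarrow> 'm \<Rightarrow> 'm) \<Rightarrow> 'm set set \<Rightarrow> bool" where
  "foliation_invariant G \<phi> \<F> \<longleftrightarrow> (\<forall>g\<in>carrier G. \<forall>L\<in>\<F>. \<phi> g ` L \<in> \<F>)"

end

theory Submission
  imports Defs
begin

text \<open>
  Let \<open>f\<close> be the exponential of \<open>a\<close>.  As \<open>a\<close> lies in the nilradical, the Lie algebra has a
  finite decreasing chain of \<open>Ad\<close>-invariant subspaces \<open>D i\<close> with \<open>[a, D i] \<subseteq> D (i + 1)\<close>, so \<open>Ad f\<close> is
  unipotent and \<open>Df\<close> grows at most polynomially along the orbits.  Hence \<open>Ess\<close> consists of the vectors
  that \<open>f\<close> contracts exponentially, and the set of elements that preserve both bundles is a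
  closed subgroup.  By downward induction on \<open>i\<close> it contains \<open>exp u\<close> for \<open>u \<in> D i\<close>: the curve
  \<open>s \<mapsto> exp (-s u) f exp (s u) f\<^sup>-\<^sup>1\<close> is driven by vectors of \<open>D (i + 1)\<close>, so its elements preserve the
  splitting by the induction hypothesis; thus conjugates of \<open>f\<close> by elements \<open>h\<close> near the identity
  preserve the splitting and still contract \<open>Ess\<close>, whence \<open>h\<close> preserves \<open>Ess\<close>.

  Foliations tangent to a bundle that contains the orbit directions are saturated by orbits, by
  Nagumo's invariance theorem applied to plaques.  A foliation tangent to \<open>Ess\<close>, which is only
  continuous, contains every \<open>C\<^sup>1\<close> curve tangent to \<open>Ess\<close> in a leaf: a curve leaving a plaque would have a
  displacement from the plaque with a substantial centre-unstable component, and this shrinks under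
  \<open>f\<^sup>n\<close> only subexponentially, whereas the lengths of curves tangent to \<open>Ess\<close> shrink exponentially.
  Since the action maps curves tangent to \<open>Ess\<close> to such curves, it maps leaves to leaves.
\<close>

section \<open>Calculus of \<open>C\<^sup>k\<close> maps\<close>

text \<open>\<open>nilradical\<close> is only a span, so \<open>a\<close> is a finite sum of
  elements of possibly different nilpotent ideals. The chain \<open>D\<close> therefore uses
  brackets with all these ideals at once; it ends because a long iterated bracket must use one of
  them too often. Growth along the orbits is polynomial for \<open>f\<close> and for
  \<open>inv f\<close>, so replacing \<open>f\<close>, \<open>Es\<close>, \<open>Eu\<close> by
  \<open>inv f\<close>, \<open>Eu\<close>, \<open>Es\<close> is a symmetry of the setting and only
  stable statements are proved directly. A vector with nonzero centre-unstable part cannot decay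
  exponentially; this turns preservation of \<open>Es\<close> into a closed condition on the group
  element. Nagumo's theorem works in three places: on the group acting on itself, where it replaces
  the closed subgroup theorem; on the Lie algebra, for ideals under \<open>Ad\<close>; and on
  plaques. It fits because the driving fields are Lipschitz, whatever the regularity of the
  invariant set.\<close>

lemma Ck_on_imp_continuous_on: "Ck_on r S f \<Longrightarrow> continuous_on S f"
  by (cases r) (auto intro!: differentiable_imp_continuous_on simp: differentiable_on_def differentiable_at_withinI)

lemma Ck_on_SucD: "Ck_on (Suc r) S f \<Longrightarrow> Ck_on r S f"
proof (induction r arbitrary: f)
  case 0
  then show ?case by (metis Ck_on_imp_continuous_on Ck_on.simps(1))
next
  case (Suc r)
  then show ?case unfolding Ck_on.simps(2)[of "Suc r"] Ck_on.simps(2)[of r S f] by blast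
qed

lemma frechet_derivative_cong_open:
  assumes "open S" "x \<in> S" "\<And>y. y \<in> S \<Longrightarrow> f y = g y"
  shows "frechet_derivative f (at x) = frechet_derivative g (at x)"
    "f differentiable (at x) \<longleftrightarrow> g differentiable (at x)"
proof -
  have "(f has_derivative D) (at x) \<longleftrightarrow> (g has_derivative D) (at x)" for D
    using assms by (metis has_derivative_transform_within_open)
  then show "frechet_derivative f (at x) = frechet_derivative g (at x)"
    "f differentiable (at x) \<longleftrightarrow> g differentiable (at x)"
    by (auto simp: frechet_derivative_def differentiable_def)
qed

lemma Ck_on_cong:
  assumes "open S" "\<And>y. y \<in> S \<Longrightarrow> f y = g y" "Ck_on r S f"
  shows "Ck_on r S g"
  using assms(2,3)
proof (induction r arbitrary: f g)
  case 0 then show ?case using continuous_on_cong by (metis Ck_on.simps(1))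
next
  case (Suc r)
  have *: "frechet_derivative f (at x) v = frechet_derivative g (at x) v" if "x \<in> S" for x v
    using frechet_derivative_cong_open(1)[OF assms(1) that, of f g] Suc.prems(1) by simp
  have "Ck_on r S (\<lambda>x. frechet_derivative g (at x) v)" for v
    by (rule Suc.IH[of "\<lambda>x. frechet_derivative f (at x) v"]) (use * Suc.prems(2) in auto)
  moreover have "g differentiable (at x)" if "x \<in> S" for x
    using frechet_derivative_cong_open(2)[OF assms(1) that, of f g] Suc.prems that by simp
  ultimately show ?case by simp
qed

lemma Ck_on_SucI:
  assumes "open S" "\<And>x. x \<in> S \<Longrightarrow> (f has_derivative D x) (at x)" "\<And>v. Ck_on r S (\<lambda>x. D x v)"
  shows "Ck_on (Suc r) S f"
proof -
  have "frechet_derivative f (at x) = D x" if "x \<in> S" for x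
    using frechet_derivative_at[OF assms(2)[OF that]] by simp
  then have "Ck_on r S (\<lambda>x. frechet_derivative f (at x) v)" for v
    by (intro Ck_on_cong[OF assms(1) _ assms(3)[of v]]) simp
  then show ?thesis using assms(2) by (auto simp: differentiable_def)
qed

lemma Ck_on_SucE:
  assumes "Ck_on (Suc r) S f" "x \<in> S"
  shows "(f has_derivative frechet_derivative f (at x)) (at x)"
  using assms by (simp add: frechet_derivative_works)

lemma Ck_on_const: "open S \<Longrightarrow> Ck_on r S (\<lambda>x. c)"
proof (induction r arbitrary: c)
  case (Suc r)
  then show ?case by (intro Ck_on_SucI[where D="\<lambda>x v. 0"]) (auto intro: has_derivative_const)
qed auto

lemma Ck_on_add:
  "open S \<Longrightarrow> Ck_on r S f \<Longrightarrow> Ck_on r S g \<Longrightarrow> Ck_on r S (\<lambda>x. f x + g x)"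
proof (induction r arbitrary: f g)
  case (Suc r)
  show ?case
    by (rule Ck_on_SucI[OF Suc.prems(1) has_derivative_add])
      (use Suc in \<open>auto intro: Ck_on_SucE simp: frechet_derivative_works\<close>)
qed (auto intro: continuous_intros)

lemma Ck_on_sum:
  "open S \<Longrightarrow> (\<And>i. i \<in> I \<Longrightarrow> Ck_on r S (f i)) \<Longrightarrow> Ck_on r S (\<lambda>x. \<Sum>i\<in>I. f i x)"
  by (induction I rule: infinite_finite_induct) (auto intro: Ck_on_const Ck_on_add)

lemma Ck_on_bounded_linear:
  "open S \<Longrightarrow> bounded_linear L \<Longrightarrow> Ck_on r S f \<Longrightarrow> Ck_on r S (\<lambda>x. L (f x))"
proof (induction r arbitrary: f)
  case 0
  then show ?case by (auto intro: bounded_linear.continuous_on)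
next
  case (Suc r)
  show ?case
    by (rule Ck_on_SucI[OF Suc.prems(1) bounded_linear.has_derivative])
      (use Suc in \<open>auto simp: frechet_derivative_works\<close>)
qed

lemma Ck_on_scaleR:
  fixes h :: "'a::real_normed_vector \<Rightarrow> real"
  shows "open S \<Longrightarrow> Ck_on r S h \<Longrightarrow> Ck_on r S f \<Longrightarrow> Ck_on r S (\<lambda>x. h x *\<^sub>R f x)"
proof (induction r arbitrary: h f)
  case (Suc r)
  show ?case
  proof (rule Ck_on_SucI[OF Suc.prems(1) has_derivative_scaleR])
    fix v
    show "Ck_on r S (\<lambda>x. h x *\<^sub>R frechet_derivative f (at x) v + frechet_derivative h (at x) v *\<^sub>R f x)"
      using Suc by (intro Ck_on_add Suc.IH) (auto dest: Ck_on_SucD simp del: Ck_on.simps, auto)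
  next
    fix x assume "x \<in> S"
    then show "(h has_derivative frechet_derivative h (at x)) (at x)" "(f has_derivative frechet_derivative f (at x)) (at x)"
      using Suc.prems Ck_on_SucE by blast+
  qed
qed (auto intro: continuous_intros)

lemma linear_basis_expansion:
  fixes L :: "'b::euclidean_space \<Rightarrow> 'c::real_vector"
  assumes "linear L"
  shows "L v = (\<Sum>b\<in>Basis. (v \<bullet> b) *\<^sub>R L b)"
  by (metis (mono_tags, lifting) assms euclidean_representation linear_scale linear_sum sum.cong)

text \<open>\<open>Ck_on\<close> only knows derivatives in fixed directions, whereas the chain rule
  differentiates \<open>g\<close> in the moving direction given by the derivative of
  \<open>f\<close>. Expanding that direction in \<open>Basis\<close> gives a finite sum of products
  to which the induction hypothesis applies.\<close>

lemma Ck_on_compose: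
  fixes f :: "'a::real_normed_vector \<Rightarrow> 'b::euclidean_space" and g :: "'b \<Rightarrow> 'c::real_normed_vector"
  assumes "open S" "open T" "f ` S \<subseteq> T"
  shows "Ck_on r S f \<Longrightarrow> Ck_on r T g \<Longrightarrow> Ck_on r S (\<lambda>x. g (f x))"
proof (induction r arbitrary: g)
  case 0
  then show ?case using assms by (auto intro: continuous_on_compose2)
next
  case (Suc r)
  show ?case
  proof (rule Ck_on_SucI[OF assms(1)])
    fix x assume x: "x \<in> S"
    have g: "(g has_derivative frechet_derivative g (at (f x))) (at (f x))"
      using Suc.prems(2) x assms(3) by (intro Ck_on_SucE) auto
    have "((g \<circ> f) has_derivative frechet_derivative g (at (f x)) \<circ> frechet_derivative f (at x)) (at x)"
      by (rule diff_chain_at[OF Ck_on_SucE[OF Suc.prems(1) x] g])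
    moreover have "frechet_derivative g (at (f x)) \<circ> frechet_derivative f (at x) =
      (\<lambda>v. \<Sum>b\<in>Basis. (frechet_derivative f (at x) v \<bullet> b) *\<^sub>R frechet_derivative g (at (f x)) b)"
      unfolding o_def by (rule ext, rule linear_basis_expansion[OF has_derivative_linear[OF g]])
    ultimately show "((\<lambda>x. g (f x)) has_derivative
      (\<lambda>v. \<Sum>b\<in>Basis. (frechet_derivative f (at x) v \<bullet> b) *\<^sub>R frechet_derivative g (at (f x)) b)) (at x)"
      by (simp add: o_def)
  next
    fix v
    have f: "Ck_on r S f" by (rule Ck_on_SucD[OF Suc.prems(1)])
    show "Ck_on r S (\<lambda>x. \<Sum>b\<in>Basis. (frechet_derivative f (at x) v \<bullet> b) *\<^sub>R frechet_derivative g (at (f x)) b)"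
      using Suc.prems
      by (intro Ck_on_sum Ck_on_scaleR assms(1) Suc.IH f
          Ck_on_bounded_linear[OF _ bounded_linear_inner_left]) auto
  qed
qed

text \<open>Joint continuity in point and direction follows from continuity for the finitely many
  basis directions.\<close>

lemma C1_derivative_continuous:
  fixes f :: "'a::euclidean_space \<Rightarrow> 'b::real_normed_vector"
  assumes "Ck_on (Suc r) S f"
  shows "continuous_on (S \<times> UNIV) (\<lambda>(x, v). frechet_derivative f (at x) v)"
proof -
  have c: "continuous_on S (\<lambda>x. frechet_derivative f (at x) b)" for b
    using assms Ck_on_imp_continuous_on[of r] by auto
  have "continuous_on (S \<times> UNIV) (\<lambda>z. \<Sum>b\<in>Basis. (snd z \<bullet> b) *\<^sub>R frechet_derivative f (at (fst z)) b)"
    by (intro continuous_intros continuous_on_compose2[OF c]) auto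
  then show ?thesis
    by (rule continuous_on_eq)
      (auto intro!: linear_basis_expansion[symmetric] has_derivative_linear[OF Ck_on_SucE[OF assms]])
qed

text \<open>The derivative is bounded on the compact product of a small ball with the unit ball of
  directions; convexity of the ball and the mean value inequality do the rest.\<close>

lemma C1_lipschitz:
  fixes f :: "'a::euclidean_space \<Rightarrow> 'b::real_normed_vector"
  assumes "Ck_on (Suc r) S f" "open S" "x0 \<in> S"
  obtains e K where "e > 0" "K \<ge> 0" "cball x0 e \<subseteq> S"
    "\<And>x y. x \<in> cball x0 e \<Longrightarrow> y \<in> cball x0 e \<Longrightarrow> norm (f x - f y) \<le> K * norm (x - y)"
proof -
  obtain e where e: "e > 0" "cball x0 e \<subseteq> S"
    using assms(2,3) open_contains_cball by blast
  let ?D = "\<lambda>z. frechet_derivative f (at (fst z)) (snd z)"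
  have cont: "continuous_on (cball x0 e \<times> cball 0 1) ?D"
    using C1_derivative_continuous[OF assms(1)] e(2)
    by (rule_tac continuous_on_subset) (auto simp: case_prod_beta)
  have "bounded (?D ` (cball x0 e \<times> cball 0 1))"
    by (intro compact_imp_bounded compact_continuous_image[OF cont] compact_Times compact_cball)
  then obtain K where "\<forall>y\<in>?D ` (cball x0 e \<times> cball 0 1). norm y \<le> K"
    unfolding bounded_iff by blast
  then have K: "\<And>z. z \<in> cball x0 e \<times> cball 0 1 \<Longrightarrow> norm (?D z) \<le> K" by blast
  have hd: "(f has_derivative frechet_derivative f (at x)) (at x)" if "x \<in> cball x0 e" for x
    using Ck_on_SucE[OF assms(1)] e that by auto
  have "norm (?D (x0, 0)) \<le> K" using e by (intro K) simp
  then have K0: "K \<ge> 0" using norm_ge_zero order_trans by blast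
  have on: "onorm (frechet_derivative f (at x)) \<le> K" if x: "x \<in> cball x0 e" for x
  proof (rule onorm_le)
    fix v :: 'a
    interpret bounded_linear "frechet_derivative f (at x)" using hd[OF x] by (rule has_derivative_bounded_linear)
    show "norm (frechet_derivative f (at x) v) \<le> K * norm v"
    proof (cases "v = 0")
      case False
      have "norm (frechet_derivative f (at x) ((1 / norm v) *\<^sub>R v)) \<le> K"
        using K[of "(x, (1 / norm v) *\<^sub>R v)"] x False by auto
      then show ?thesis using False by (simp add: scaleR field_simps)
    next
      case True
      then show ?thesis using zero by simp
    qed
  qed
  have "norm (f x - f y) \<le> K * norm (x - y)" if "x \<in> cball x0 e" "y \<in> cball x0 e" for x y
    by (rule differentiable_bound[of "cball x0 e" f "\<lambda>x. frechet_derivative f (at x)"])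
      (use that on hd in \<open>auto intro: has_derivative_at_withinI\<close>)
  then show ?thesis using that e K0 by blast
qed

section \<open>Symmetry of second derivatives\<close>

lemma mvt_twice:
  fixes f :: "'a::euclidean_space \<Rightarrow> real"
  assumes C2: "Ck_on 2 S f" and s: "s > 0"
    and inS: "\<And>a b. 0 \<le> a \<Longrightarrow> a \<le> 1 \<Longrightarrow> 0 \<le> b \<Longrightarrow> b \<le> 1 \<Longrightarrow> x + (a * s) *\<^sub>R u + (b * s) *\<^sub>R v \<in> S"
  obtains a b where "0 \<le> a" "a \<le> 1" "0 \<le> b" "b \<le> 1"
    "f (x + s *\<^sub>R u + s *\<^sub>R v) - f (x + s *\<^sub>R u) - f (x + s *\<^sub>R v) + f x =
     s\<^sup>2 * frechet_derivative (\<lambda>y. frechet_derivative f (at y) u) (at (x + (a * s) *\<^sub>R u + (b * s) *\<^sub>R v)) v"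
proof -
  have C: "Ck_on (Suc (Suc 0)) S f" using C2 by (simp add: numeral_2_eq_2)
  have C': "Ck_on (Suc 0) S (\<lambda>y. frechet_derivative f (at y) u)" using C by simp
  define g where "g = (\<lambda>a. f (x + (a * s) *\<^sub>R u + (1 * s) *\<^sub>R v) - f (x + (a * s) *\<^sub>R u + (0 * s) *\<^sub>R v))"
  have sub: "((\<lambda>a. f (x + (a * s) *\<^sub>R u + (b * s) *\<^sub>R v)) has_real_derivative
      s * frechet_derivative f (at (x + (a * s) *\<^sub>R u + (b * s) *\<^sub>R v)) u) (at a)"
    if "0 \<le> a" "a \<le> 1" "0 \<le> b" "b \<le> 1" for a b
  proof -
    have f: "(f has_derivative frechet_derivative f (at (x + (a * s) *\<^sub>R u + (b * s) *\<^sub>R v))) (at (x + (a * s) *\<^sub>R u + (b * s) *\<^sub>R v))"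
      by (rule Ck_on_SucE[OF C inS]) (use that in auto)
    have "((\<lambda>a. x + (a * s) *\<^sub>R u + (b * s) *\<^sub>R v) has_derivative (\<lambda>h. (h * s) *\<^sub>R u)) (at a)"
      by (auto intro!: derivative_eq_intros)
    from has_derivative_compose[OF this f] show ?thesis
      unfolding has_field_derivative_def
      by (rule has_derivative_eq_rhs) (auto simp: linear_cmul[OF has_derivative_linear[OF f]])
  qed
  have "\<exists>z>0. z < 1 \<and> g 1 - g 0 = (1 - 0) * (s * frechet_derivative f (at (x + (z * s) *\<^sub>R u + (1 * s) *\<^sub>R v)) u
     - s * frechet_derivative f (at (x + (z * s) *\<^sub>R u + (0 * s) *\<^sub>R v)) u)"
    unfolding g_def
  proof (rule MVT2)
    fix a :: real assume "0 \<le> a" "a \<le> 1"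
    then show "((\<lambda>a. f (x + (a * s) *\<^sub>R u + (1 * s) *\<^sub>R v) - f (x + (a * s) *\<^sub>R u + (0 * s) *\<^sub>R v)) has_real_derivative
       s * frechet_derivative f (at (x + (a * s) *\<^sub>R u + (1 * s) *\<^sub>R v)) u
        - s * frechet_derivative f (at (x + (a * s) *\<^sub>R u + (0 * s) *\<^sub>R v)) u) (at a)"
      by (intro DERIV_diff sub) auto
  qed simp
  then obtain a where a: "0 < a" "a < 1" "g 1 - g 0 = s * (frechet_derivative f (at (x + (a * s) *\<^sub>R u + (1 * s) *\<^sub>R v)) u
     - frechet_derivative f (at (x + (a * s) *\<^sub>R u + (0 * s) *\<^sub>R v)) u)"
    by (auto simp: algebra_simps)
  define h where "h = (\<lambda>y. frechet_derivative f (at y) u)"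
  have sub': "((\<lambda>b. h (x + (a * s) *\<^sub>R u + (b * s) *\<^sub>R v)) has_real_derivative
      s * frechet_derivative h (at (x + (a * s) *\<^sub>R u + (b * s) *\<^sub>R v)) v) (at b)"
    if "0 \<le> b" "b \<le> 1" for b
  proof -
    have f: "(h has_derivative frechet_derivative h (at (x + (a * s) *\<^sub>R u + (b * s) *\<^sub>R v))) (at (x + (a * s) *\<^sub>R u + (b * s) *\<^sub>R v))"
      unfolding h_def by (rule Ck_on_SucE[OF C' inS]) (use that a in auto)
    have "((\<lambda>b. x + (a * s) *\<^sub>R u + (b * s) *\<^sub>R v) has_derivative (\<lambda>h. (h * s) *\<^sub>R v)) (at b)"
      by (auto intro!: derivative_eq_intros)
    from has_derivative_compose[OF this f] show ?thesis
      unfolding has_field_derivative_def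
      by (rule has_derivative_eq_rhs) (auto simp: linear_cmul[OF has_derivative_linear[OF f]])
  qed
  have "\<exists>z>0. z < 1 \<and> h (x + (a * s) *\<^sub>R u + (1 * s) *\<^sub>R v) - h (x + (a * s) *\<^sub>R u + (0 * s) *\<^sub>R v) =
     (1 - 0) * (s * frechet_derivative h (at (x + (a * s) *\<^sub>R u + (z * s) *\<^sub>R v)) v)"
    by (rule MVT2) (auto intro!: sub' simp del: mult_1 mult_zero_left)
  then obtain b where b: "0 < b" "b < 1" "h (x + (a * s) *\<^sub>R u + (1 * s) *\<^sub>R v) - h (x + (a * s) *\<^sub>R u + (0 * s) *\<^sub>R v) =
     s * frechet_derivative h (at (x + (a * s) *\<^sub>R u + (b * s) *\<^sub>R v)) v"
    by auto
  have "f (x + s *\<^sub>R u + s *\<^sub>R v) - f (x + s *\<^sub>R u) - f (x + s *\<^sub>R v) + f x = g 1 - g 0"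
    by (simp add: g_def)
  also have "\<dots> = s * (h (x + (a * s) *\<^sub>R u + (1 * s) *\<^sub>R v) - h (x + (a * s) *\<^sub>R u + (0 * s) *\<^sub>R v))"
    using a(3) by (simp add: h_def)
  also have "\<dots> = s * (s * frechet_derivative h (at (x + (a * s) *\<^sub>R u + (b * s) *\<^sub>R v)) v)"
    unfolding b(3) ..
  also have "\<dots> = s\<^sup>2 * frechet_derivative h (at (x + (a * s) *\<^sub>R u + (b * s) *\<^sub>R v)) v"
    by (simp add: power2_eq_square)
  finally show ?thesis using that[of a b] a b unfolding h_def by linarith
qed

text \<open>The second difference quotient over the parallelogram spanned by \<open>s u\<close> and
  \<open>s v\<close> is symmetric in \<open>u\<close> and \<open>v\<close>, and by
  \<open>mvt_twice\<close> it converges to either mixed derivative as \<open>s\<close> tends to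
  0.\<close>

lemma second_derivative_symmetric_real:
  fixes f :: "'a::euclidean_space \<Rightarrow> real"
  assumes C2: "Ck_on 2 S f" and S: "open S" "x \<in> S"
  shows "frechet_derivative (\<lambda>y. frechet_derivative f (at y) u) (at x) v =
         frechet_derivative (\<lambda>y. frechet_derivative f (at y) v) (at x) u"
proof -
  define B where "B = (\<lambda>u v y. frechet_derivative (\<lambda>y. frechet_derivative f (at y) u) (at y) v)"
  have "Ck_on 0 S (B u v)" for u v using C2 by (simp add: B_def numeral_2_eq_2)
  then have cB: "isCont (B u v) x" for u v
    using S \<open>Ck_on 0 S (B u v)\<close> by (metis Ck_on.simps(1) continuous_on_eq_continuous_at)
  define lim where "lim = (\<lambda>u v. \<forall>e>0. \<exists>d>0. \<forall>s. 0 < s \<and> s < d \<longrightarrow>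
     \<bar>(f (x + s *\<^sub>R u + s *\<^sub>R v) - f (x + s *\<^sub>R u) - f (x + s *\<^sub>R v) + f x) / s\<^sup>2 - B u v x\<bar> < e)"
  have L: "lim u v" for u v
    unfolding lim_def
  proof (intro allI impI)
    fix e :: real assume "e > 0"
    then obtain d1 where d1: "d1 > 0" "\<And>y. dist y x < d1 \<Longrightarrow> dist (B u v y) (B u v x) < e"
      using cB[of u v] unfolding continuous_at_eps_delta by blast
    obtain d2 where d2: "d2 > 0" "ball x d2 \<subseteq> S" using S open_contains_ball by blast
    \<comment> \<open>Chosen so that for \<open>s < d\<close> the whole parallelogram lies within
      \<open>min d1 d2\<close> of \<open>x\<close>.\<close>
    define d where "d = min d1 d2 / (norm u + norm v + 1)"
    have dpos: "d > 0" using d1 d2 by (auto simp: d_def add_nonneg_pos)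
    moreover have "\<bar>(f (x + s *\<^sub>R u + s *\<^sub>R v) - f (x + s *\<^sub>R u) - f (x + s *\<^sub>R v) + f x) / s\<^sup>2 - B u v x\<bar> < e"
      if s: "0 < s \<and> s < d" for s
    proof -
      have near: "dist (x + (a * s) *\<^sub>R u + (b * s) *\<^sub>R v) x < min d1 d2"
        if "0 \<le> a" "a \<le> 1" "0 \<le> b" "b \<le> 1" for a b
      proof -
        have "dist (x + (a * s) *\<^sub>R u + (b * s) *\<^sub>R v) x \<le> norm ((a * s) *\<^sub>R u) + norm ((b * s) *\<^sub>R v)"
          unfolding dist_norm add.assoc add_diff_cancel_left' by (rule norm_triangle_ineq)
        also have "\<dots> \<le> s * norm u + s * norm v"
          using that s by (auto intro!: add_mono mult_right_mono mult_left_le_one_le)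
        also have "\<dots> \<le> s * (norm u + norm v + 1)" using s by (simp add: algebra_simps)
        also have "\<dots> < d * (norm u + norm v + 1)"
          using s by (intro mult_strict_right_mono) (auto simp: add_nonneg_pos)
        also have "\<dots> = min d1 d2"
          using add_nonneg_pos[of "norm u + norm v" 1] by (simp add: d_def)
        finally show ?thesis .
      qed
      have inS: "x + (a * s) *\<^sub>R u + (b * s) *\<^sub>R v \<in> S" if "0 \<le> a" "a \<le> 1" "0 \<le> b" "b \<le> 1" for a b
        using near[OF that] d2 by (auto simp: subset_iff dist_commute)
      obtain a b where ab: "0 \<le> a" "a \<le> 1" "0 \<le> b" "b \<le> 1"
        and eq: "f (x + s *\<^sub>R u + s *\<^sub>R v) - f (x + s *\<^sub>R u) - f (x + s *\<^sub>R v) + f x =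
            s\<^sup>2 * B u v (x + (a * s) *\<^sub>R u + (b * s) *\<^sub>R v)"
        using mvt_twice[OF C2, of s x u v] inS s unfolding B_def by blast
      show ?thesis using d1(2)[of "x + (a * s) *\<^sub>R u + (b * s) *\<^sub>R v"] near[OF ab] s
        by (simp add: eq dist_real_def)
    qed
    ultimately show "\<exists>d>0. \<forall>s. 0 < s \<and> s < d \<longrightarrow>
     \<bar>(f (x + s *\<^sub>R u + s *\<^sub>R v) - f (x + s *\<^sub>R u) - f (x + s *\<^sub>R v) + f x) / s\<^sup>2 - B u v x\<bar> < e" by blast
  qed
  have "\<not> \<bar>B u v x - B v u x\<bar> > 0"
  proof
    assume "\<bar>B u v x - B v u x\<bar> > 0"
    then have e: "\<bar>B u v x - B v u x\<bar> / 2 > 0" by simp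
    obtain d1 d2 where d: "d1 > 0" "d2 > 0"
      "\<And>s. 0 < s \<Longrightarrow> s < d1 \<Longrightarrow> \<bar>(f (x + s *\<^sub>R u + s *\<^sub>R v) - f (x + s *\<^sub>R u) - f (x + s *\<^sub>R v) + f x) / s\<^sup>2 - B u v x\<bar> < \<bar>B u v x - B v u x\<bar> / 2"
      "\<And>s. 0 < s \<Longrightarrow> s < d2 \<Longrightarrow> \<bar>(f (x + s *\<^sub>R v + s *\<^sub>R u) - f (x + s *\<^sub>R v) - f (x + s *\<^sub>R u) + f x) / s\<^sup>2 - B v u x\<bar> < \<bar>B u v x - B v u x\<bar> / 2"
      using L[of u v] L[of v u] e unfolding lim_def by metis
    define s where "s = min d1 d2 / 2"
    have s: "0 < s" "s < d1" "s < d2" using d by (auto simp: s_def)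
    have "f (x + s *\<^sub>R v + s *\<^sub>R u) - f (x + s *\<^sub>R v) - f (x + s *\<^sub>R u) + f x =
      f (x + s *\<^sub>R u + s *\<^sub>R v) - f (x + s *\<^sub>R u) - f (x + s *\<^sub>R v) + f x"
      by (simp add: algebra_simps)
    then obtain q where q: "\<bar>q - B u v x\<bar> < \<bar>B u v x - B v u x\<bar> / 2" "\<bar>q - B v u x\<bar> < \<bar>B u v x - B v u x\<bar> / 2"
      using d(3)[OF s(1,2)] d(4)[OF s(1,3)] by metis
    have "\<bar>B u v x - B v u x\<bar> \<le> \<bar>q - B u v x\<bar> + \<bar>q - B v u x\<bar>" by arith
    with add_strict_mono[OF q] show False by simp
  qed
  then show ?thesis by (simp add: B_def)
qed

lemma second_derivative_symmetric:
  fixes f :: "'a::euclidean_space \<Rightarrow> 'b::euclidean_space"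
  assumes C2: "Ck_on 2 S f" and S: "open S" "x \<in> S"
  shows "frechet_derivative (\<lambda>y. frechet_derivative f (at y) u) (at x) v =
         frechet_derivative (\<lambda>y. frechet_derivative f (at y) v) (at x) u"
proof (rule euclidean_eqI)
  fix b :: 'b
  have C: "Ck_on (Suc (Suc 0)) S f" using C2 by (simp add: numeral_2_eq_2)
  have 1: "frechet_derivative (\<lambda>y. f y \<bullet> b) (at y) w = frechet_derivative f (at y) w \<bullet> b" if "y \<in> S" for y w
    using has_derivative_inner_left[OF Ck_on_SucE[OF C that], of b]
    by (metis frechet_derivative_at)
  have 2: "frechet_derivative (\<lambda>y. frechet_derivative f (at y) w \<bullet> b) (at x) z =
     frechet_derivative (\<lambda>y. frechet_derivative f (at y) w) (at x) z \<bullet> b" for w z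
  proof -
    have "Ck_on (Suc 0) S (\<lambda>y. frechet_derivative f (at y) w)" using C by simp
    from has_derivative_inner_left[OF Ck_on_SucE[OF this S(2)], of b] show ?thesis
      by (metis frechet_derivative_at)
  qed
  have 3: "frechet_derivative (\<lambda>y. frechet_derivative f (at y) w \<bullet> b) (at x) z =
     frechet_derivative (\<lambda>y. frechet_derivative (\<lambda>y. f y \<bullet> b) (at y) w) (at x) z" for w z
    by (rule arg_cong[where f="\<lambda>f. f z"], rule frechet_derivative_cong_open(1)[OF S]) (simp add: 1)
  have "Ck_on 2 S (\<lambda>y. f y \<bullet> b)"
    by (rule Ck_on_bounded_linear[OF S(1) bounded_linear_inner_left C2])
  from second_derivative_symmetric_real[OF this S, of u v]
  show "frechet_derivative (\<lambda>y. frechet_derivative f (at y) u) (at x) v \<bullet> b =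
         frechet_derivative (\<lambda>y. frechet_derivative f (at y) v) (at x) u \<bullet> b"
    by (simp add: 2[symmetric] 3)
qed

section \<open>Tangent maps\<close>

text \<open>Continuity is demanded separately: a coordinate map has arbitrary values off its domain,
  so differentiability of the coordinate expression alone would not force \<open>f\<close> to map a
  neighbourhood of \<open>x\<close> into the chart at \<open>f x\<close>.\<close>

definition tdiff ::
  "('m::t2_space, 'e::euclidean_space) atlas \<Rightarrow> ('n::t2_space, 'f::euclidean_space) atlas \<Rightarrow>
   ('m \<Rightarrow> 'n) \<Rightarrow> 'm \<Rightarrow> bool" where
  "tdiff A B f x \<longleftrightarrow> isCont f x \<and>
     (snd (chart_at B (f x)) \<circ> f \<circ> chart_inv (chart_at A x)) differentiable (at (snd (chart_at A x) x))"

lemma smooth_atlas_chart: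
  assumes "smooth_atlas A" "c \<in> A"
  shows "open (fst c)" "open (snd c ` fst c)"
    "continuous_on (fst c) (snd c)" "continuous_on (snd c ` fst c) (chart_inv c)"
    "\<And>x. x \<in> fst c \<Longrightarrow> chart_inv c (snd c x) = x"
    "\<And>p. p \<in> snd c ` fst c \<Longrightarrow> snd c (chart_inv c p) = p"
    "\<And>p. p \<in> snd c ` fst c \<Longrightarrow> chart_inv c p \<in> fst c"
  using assms unfolding smooth_atlas_def homeomorphism_def by blast+

lemma chart_at_props:
  assumes "smooth_atlas A"
  shows "chart_at A x \<in> A" "x \<in> fst (chart_at A x)"
proof -
  have "\<exists>c. c \<in> A \<and> x \<in> fst c" using assms unfolding smooth_atlas_def by blast
  then have "chart_at A x \<in> A \<and> x \<in> fst (chart_at A x)" unfolding chart_at_def by (rule someI_ex)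
  then show "chart_at A x \<in> A" "x \<in> fst (chart_at A x)" by auto
qed

lemma smooth_atlas_isCont:
  assumes "smooth_atlas A" "c \<in> A"
  shows "x \<in> fst c \<Longrightarrow> isCont (snd c) x" "p \<in> snd c ` fst c \<Longrightarrow> isCont (chart_inv c) p"
  using smooth_atlas_chart[OF assms] continuous_on_eq_continuous_at by blast+

lemma chart_at_euclidean [simp]: "chart_at euclidean_atlas x = (UNIV, id)"
  by (auto simp: chart_at_def euclidean_atlas_def)

lemma chart_inv_id [simp]: "chart_inv (UNIV, id) = id"
  by (simp add: chart_inv_def)

lemma Ck_on_id: "open S \<Longrightarrow> Ck_on r S (\<lambda>x. x)"
  by (cases r) (auto intro: Ck_on_SucI[where D="\<lambda>x v. v"] Ck_on_const simp del: Ck_on.simps(2))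

lemma smooth_atlas_euclidean: "smooth_atlas (euclidean_atlas :: ('e::euclidean_space, 'e) atlas)"
  by (auto simp: smooth_atlas_def euclidean_atlas_def smooth_on_def o_def id_def[symmetric] homeomorphism_def
      intro!: Ck_on_id[unfolded id_def[symmetric]])

lemma isCont_eventually_in:
  assumes "isCont f x" "open V" "f x \<in> V"
  shows "\<forall>\<^sub>F y in nhds x. f y \<in> V"
proof -
  have "(f \<longlongrightarrow> f x) (nhds x)" using assms(1) by (simp add: continuous_at tendsto_at_iff_tendsto_nhds)
  then show ?thesis using assms(2,3) by (rule topological_tendstoD)
qed

lemma tangent_map_cong:
  assumes A: "smooth_atlas A" and eq: "\<forall>\<^sub>F y in nhds x. f y = g y"
  shows "tangent_map A B f x = tangent_map A B g x" "tdiff A B f x \<longleftrightarrow> tdiff A B g x"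
proof -
  define c where "c = chart_at A x"
  have c: "c \<in> A" "x \<in> fst c" using chart_at_props[OF A] by (auto simp: c_def)
  note ch = smooth_atlas_chart[OF A c(1)]
  have fx: "f x = g x" using eq by (rule eventually_nhds_x_imp_x)
  obtain U where U: "open U" "x \<in> U" "\<And>y. y \<in> U \<Longrightarrow> f y = g y" using eq by (auto simp: eventually_nhds)
  define W where "W = snd c ` fst c \<inter> chart_inv c -` U"
  have W: "open W" "snd c x \<in> W"
    using c ch U unfolding W_def by (auto intro: continuous_open_preimage)
  have e: "(snd (chart_at B (f x)) \<circ> f \<circ> chart_inv c) y = (snd (chart_at B (f x)) \<circ> g \<circ> chart_inv c) y"
    if "y \<in> W" for y using that U by (simp add: W_def)
  show "tangent_map A B f x = tangent_map A B g x"
    using frechet_derivative_cong_open(1)[OF W, of "snd (chart_at B (f x)) \<circ> f \<circ> chart_inv c"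
        "snd (chart_at B (f x)) \<circ> g \<circ> chart_inv c", OF e]
    by (simp add: tangent_map_def fx c_def)
  have "isCont f x \<longleftrightarrow> isCont g x" by (rule isCont_cong[OF eq])
  then show "tdiff A B f x \<longleftrightarrow> tdiff A B g x"
    using frechet_derivative_cong_open(2)[OF W, of "snd (chart_at B (f x)) \<circ> f \<circ> chart_inv c"
        "snd (chart_at B (f x)) \<circ> g \<circ> chart_inv c", OF e]
    by (simp add: tdiff_def fx c_def)
qed

lemma tdiff_linear:
  "tdiff A B f x \<Longrightarrow> linear (tangent_map A B f x)"
  unfolding tdiff_def tangent_map_def by (metis frechet_derivative_works has_derivative_linear)

lemma tdiff_compose:
  assumes A: "smooth_atlas A" and B: "smooth_atlas B" and f: "tdiff A B f x" and g: "tdiff B C g (f x)"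
  shows "tdiff A C (\<lambda>y. g (f y)) x"
    "tangent_map A C (\<lambda>y. g (f y)) x v = tangent_map B C g (f x) (tangent_map A B f x v)"
proof -
  define c where "c = chart_at A x"
  define d where "d = chart_at B (f x)"
  define e where "e = chart_at C (g (f x))"
  have c: "c \<in> A" "x \<in> fst c" and d: "d \<in> B" "f x \<in> fst d"
    using chart_at_props[OF A] chart_at_props[OF B] by (auto simp: c_def d_def)
  note ch = smooth_atlas_chart[OF A c(1)] and dh = smooth_atlas_chart[OF B d(1)]
  have fc: "isCont f x" and gc: "isCont g (f x)" using f g by (auto simp: tdiff_def)
  have f': "((snd d \<circ> f \<circ> chart_inv c) has_derivative tangent_map A B f x) (at (snd c x))"
    using f unfolding tdiff_def tangent_map_def by (simp add: c_def d_def frechet_derivative_works)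
  have g': "((snd e \<circ> g \<circ> chart_inv d) has_derivative tangent_map B C g (f x)) (at (snd d (f x)))"
    using g unfolding tdiff_def tangent_map_def by (simp add: e_def d_def frechet_derivative_works)
  have pt: "(snd d \<circ> f \<circ> chart_inv c) (snd c x) = snd d (f x)" using ch c by simp
  have h: "((snd e \<circ> g \<circ> chart_inv d) \<circ> (snd d \<circ> f \<circ> chart_inv c) has_derivative
     tangent_map B C g (f x) \<circ> tangent_map A B f x) (at (snd c x))"
    by (rule diff_chain_at[OF f']) (use g' pt in simp)
  \<comment> \<open>On this neighbourhood the intermediate chart \<open>d\<close> cancels, so the
    composite of the two representatives is the representative of the composite.\<close>
  obtain U where U: "open U" "x \<in> U" "f ` U \<subseteq> fst d"
    using isCont_eventually_in[OF fc dh(1) d(2)] unfolding eventually_nhds by blast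
  define W where "W = snd c ` fst c \<inter> chart_inv c -` U"
  have W: "open W" "snd c x \<in> W"
    using c ch U unfolding W_def by (auto intro: continuous_open_preimage)
  have "((snd e \<circ> (\<lambda>y. g (f y)) \<circ> chart_inv c) has_derivative
     tangent_map B C g (f x) \<circ> tangent_map A B f x) (at (snd c x))"
    by (rule has_derivative_transform_within_open[OF h W]) (use U dh in \<open>auto simp: W_def image_subset_iff\<close>)
  moreover have "isCont (\<lambda>y. g (f y)) x" using isCont_o2[OF fc gc] by (simp add: o_def)
  ultimately show "tdiff A C (\<lambda>y. g (f y)) x"
    "tangent_map A C (\<lambda>y. g (f y)) x v = tangent_map B C g (f x) (tangent_map A B f x v)"
    unfolding tdiff_def tangent_map_def[of A C]
    by (auto simp: c_def e_def differentiable_def frechet_derivative_at[symmetric])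
qed

lemma tdiff_id:
  assumes A: "smooth_atlas A"
  shows "tdiff A A (\<lambda>y. y) x" "tangent_map A A (\<lambda>y. y) x v = v"
proof -
  define c where "c = chart_at A x"
  have c: "c \<in> A" "x \<in> fst c" using chart_at_props[OF A] by (auto simp: c_def)
  note ch = smooth_atlas_chart[OF A c(1)]
  have "((snd c \<circ> (\<lambda>y. y) \<circ> chart_inv c) has_derivative (\<lambda>v. v)) (at (snd c x))"
    by (rule has_derivative_transform_within_open[OF has_derivative_ident ch(2)]) (use c ch in auto)
  then show "tdiff A A (\<lambda>y. y) x" "tangent_map A A (\<lambda>y. y) x v = v"
    unfolding tdiff_def tangent_map_def
    by (auto simp: c_def differentiable_def frechet_derivative_at[symmetric])
qed

lemma tdiff_euclidean:
  "tdiff euclidean_atlas euclidean_atlas f x \<longleftrightarrow> f differentiable (at x)"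
  "tangent_map euclidean_atlas euclidean_atlas f x = frechet_derivative f (at x)"
  by (auto simp: tdiff_def tangent_map_def differentiable_imp_continuous_within)

lemma smooth_on_differentiable:
  "smooth_on S f \<Longrightarrow> x \<in> S \<Longrightarrow> f differentiable (at x)"
  unfolding smooth_on_def by (metis Ck_on.simps(2))

lemma tdiff_smooth_map:
  assumes "smooth_atlas A" "smooth_atlas B" "smooth_map A B f"
  shows "tdiff A B f x"
proof -
  have "isCont f x" using assms(3) by (simp add: smooth_map_def continuous_on_eq_continuous_at)
  then show ?thesis
    using assms(3) chart_at_props[OF assms(1), of x] chart_at_props[OF assms(2), of "f x"]
    unfolding tdiff_def smooth_map_def by (auto intro!: smooth_on_differentiable)
qed

lemma tdiff_chart:
  assumes A: "smooth_atlas A" and c: "c \<in> A" "x \<in> fst c"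
  shows "tdiff A euclidean_atlas (snd c) x"
proof -
  have "smooth_on (snd (chart_at A x) ` (fst (chart_at A x) \<inter> fst c)) (snd c \<circ> chart_inv (chart_at A x))"
    using A c chart_at_props[OF A, of x] unfolding smooth_atlas_def by blast
  then show ?thesis
    using smooth_atlas_isCont(1)[OF A c] c chart_at_props[OF A, of x]
    by (auto simp: tdiff_def intro!: smooth_on_differentiable)
qed

lemma tdiff_chart_inv:
  assumes A: "smooth_atlas A" and c: "c \<in> A" "p \<in> snd c ` fst c"
  shows "tdiff euclidean_atlas A (chart_inv c) p"
proof -
  define d where "d = chart_at A (chart_inv c p)"
  have d: "d \<in> A" "chart_inv c p \<in> fst d" using chart_at_props[OF A] by (auto simp: d_def)
  have "smooth_on (snd c ` (fst c \<inter> fst d)) (snd d \<circ> chart_inv c)"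
    using A c d unfolding smooth_atlas_def by blast
  moreover have "p \<in> snd c ` (fst c \<inter> fst d)"
    using smooth_atlas_chart[OF A c(1)] c(2) d(2) by (metis IntI image_eqI)
  ultimately show ?thesis
    using smooth_atlas_isCont(2)[OF A c]
    by (auto simp: tdiff_def d_def intro!: smooth_on_differentiable)
qed

lemma in_chart_from_chart:
  assumes A: "smooth_atlas A" and c: "c \<in> A" "p \<in> snd c ` fst c"
  shows "in_chart A c (chart_inv c p) (from_chart A c p v) = v"
proof -
  note ch = smooth_atlas_chart[OF A c(1)]
  have "tangent_map euclidean_atlas euclidean_atlas (\<lambda>y. snd c (chart_inv c y)) p v =
     tangent_map A euclidean_atlas (snd c) (chart_inv c p) (tangent_map euclidean_atlas A (chart_inv c) p v)"
    by (rule tdiff_compose(2)[OF smooth_atlas_euclidean A tdiff_chart_inv[OF A c] tdiff_chart[OF A c(1)]])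
      (use ch c in auto)
  moreover have "tangent_map euclidean_atlas euclidean_atlas (\<lambda>y. snd c (chart_inv c y)) p v =
     tangent_map euclidean_atlas euclidean_atlas (\<lambda>y. y) p v"
    by (rule arg_cong[where f="\<lambda>f. f v"], rule tangent_map_cong(1)[OF smooth_atlas_euclidean])
      (use ch c in \<open>auto simp: eventually_nhds\<close>)
  ultimately show ?thesis
    using tdiff_id(2)[OF smooth_atlas_euclidean, of p v] unfolding in_chart_def from_chart_def by metis
qed

lemma from_chart_in_chart:
  assumes A: "smooth_atlas A" and c: "c \<in> A" "x \<in> fst c"
  shows "from_chart A c (snd c x) (in_chart A c x v) = v"
proof -
  note ch = smooth_atlas_chart[OF A c(1)]
  have "tangent_map A A (\<lambda>y. chart_inv c (snd c y)) x v =
     tangent_map euclidean_atlas A (chart_inv c) (snd c x) (tangent_map A euclidean_atlas (snd c) x v)"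
    by (rule tdiff_compose(2)[OF A smooth_atlas_euclidean tdiff_chart[OF A c] tdiff_chart_inv[OF A c(1)]])
      (use ch c in auto)
  moreover have "tangent_map A A (\<lambda>y. chart_inv c (snd c y)) x v = tangent_map A A (\<lambda>y. y) x v"
    by (rule arg_cong[where f="\<lambda>f. f v"], rule tangent_map_cong(1)[OF A])
      (use ch c in \<open>auto simp: eventually_nhds\<close>)
  ultimately show ?thesis
    using tdiff_id(2)[OF A, of x v] unfolding in_chart_def from_chart_def by metis
qed

lemma linear_in_chart: "smooth_atlas A \<Longrightarrow> c \<in> A \<Longrightarrow> x \<in> fst c \<Longrightarrow> linear (in_chart A c x)"
  unfolding in_chart_def by (simp add: tdiff_chart tdiff_linear)

lemma linear_from_chart: "smooth_atlas A \<Longrightarrow> c \<in> A \<Longrightarrow> p \<in> snd c ` fst c \<Longrightarrow> linear (from_chart A c p)"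
  unfolding from_chart_def by (simp add: tdiff_chart_inv tdiff_linear)

lemma in_chart_at:
  assumes A: "smooth_atlas A"
  shows "in_chart A (chart_at A x) x v = v"
proof -
  define c where "c = chart_at A x"
  have c: "c \<in> A" "x \<in> fst c" using chart_at_props[OF A] by (auto simp: c_def)
  note ch = smooth_atlas_chart[OF A c(1)]
  have "frechet_derivative (snd c \<circ> chart_inv c) (at (snd c x)) = frechet_derivative (\<lambda>p. p) (at (snd c x))"
    by (rule frechet_derivative_cong_open(1)[OF ch(2)]) (use c ch in auto)
  then show ?thesis by (simp add: in_chart_def tangent_map_def c_def)
qed

lemma in_chart_tangent_map:
  assumes A: "smooth_atlas A" and B: "smooth_atlas B" and c: "c \<in> A" "x \<in> fst c"
    and d: "d \<in> B" "f x \<in> fst d" and f: "tdiff A B f x"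
  shows "((\<lambda>p. snd d (f (chart_inv c p))) has_derivative
      (\<lambda>u. in_chart B d (f x) (tangent_map A B f x (from_chart A c (snd c x) u)))) (at (snd c x))"
proof -
  note ch = smooth_atlas_chart[OF A c(1)]
  have p: "snd c x \<in> snd c ` fst c" "chart_inv c (snd c x) = x" using c ch by auto
  have 1: "tdiff euclidean_atlas B (\<lambda>p. f (chart_inv c p)) (snd c x)"
    "\<And>u. tangent_map euclidean_atlas B (\<lambda>p. f (chart_inv c p)) (snd c x) u =
      tangent_map A B f x (from_chart A c (snd c x) u)"
    using tdiff_compose[OF smooth_atlas_euclidean A tdiff_chart_inv[OF A c(1) p(1)], of B f] f p
    by (auto simp: from_chart_def)
  have 2: "tdiff euclidean_atlas euclidean_atlas (\<lambda>p. snd d (f (chart_inv c p))) (snd c x)"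
    "\<And>u. tangent_map euclidean_atlas euclidean_atlas (\<lambda>p. snd d (f (chart_inv c p))) (snd c x) u =
      in_chart B d (f x) (tangent_map A B f x (from_chart A c (snd c x) u))"
    using tdiff_compose[OF smooth_atlas_euclidean B 1(1), of euclidean_atlas "snd d"] tdiff_chart[OF B d] p
    by (auto simp: in_chart_def 1(2))
  have "(\<lambda>p. snd d (f (chart_inv c p))) differentiable (at (snd c x))"
    using 2(1) by (simp add: tdiff_euclidean)
  moreover have "frechet_derivative (\<lambda>p. snd d (f (chart_inv c p))) (at (snd c x)) =
      (\<lambda>u. in_chart B d (f x) (tangent_map A B f x (from_chart A c (snd c x) u)))"
    using 2(2) unfolding tdiff_euclidean by (rule ext)
  ultimately show ?thesis unfolding frechet_derivative_works by (rule subst[rotated])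
qed

text \<open>Differentiability may be tested in any charts around \<open>x\<close> and
  \<open>f x\<close>, not just in the selected ones: near \<open>x\<close> the map \<open>f\<close>
  is its coordinate expression composed with two charts, all of which are differentiable.\<close>

lemma tdiffI_chart:
  assumes A: "smooth_atlas A" and B: "smooth_atlas B" and c: "c \<in> A" "x \<in> fst c"
    and d: "d \<in> B" "f x \<in> fst d" and f: "isCont f x"
    and D: "(\<lambda>p. snd d (f (chart_inv c p))) differentiable (at (snd c x))"
  shows "tdiff A B f x"
proof -
  note ch = smooth_atlas_chart[OF A c(1)] and dh = smooth_atlas_chart[OF B d(1)]
  have 1: "tdiff A euclidean_atlas (\<lambda>y. snd d (f (chart_inv c (snd c y)))) x"
    by (rule tdiff_compose(1)[OF A smooth_atlas_euclidean tdiff_chart[OF A c]])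
      (use D in \<open>simp add: tdiff_euclidean\<close>)
  have 2: "tdiff A B (\<lambda>y. chart_inv d (snd d (f (chart_inv c (snd c y))))) x"
    by (rule tdiff_compose(1)[OF A smooth_atlas_euclidean 1]) (use ch dh c d tdiff_chart_inv[OF B d(1)] in auto)
  have "\<forall>\<^sub>F y in nhds x. y \<in> fst c" using ch(1) c(2) by (rule eventually_nhds_in_open)
  moreover have "\<forall>\<^sub>F y in nhds x. f y \<in> fst d" by (rule isCont_eventually_in[OF f dh(1) d(2)])
  ultimately have "\<forall>\<^sub>F y in nhds x. chart_inv d (snd d (f (chart_inv c (snd c y)))) = f y"
    by eventually_elim (use ch dh in auto)
  from tangent_map_cong(2)[OF A this] 2 show ?thesis by blast
qed

text \<open>The derivative is two-sided, so a curve that is used on a closed interval must have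
  velocities at the end points in this sense as well.\<close>

definition has_velocity ::
  "('m::t2_space, 'e::euclidean_space) atlas \<Rightarrow> (real \<Rightarrow> 'm) \<Rightarrow> 'e \<Rightarrow> real \<Rightarrow> bool" where
  "has_velocity A \<sigma> v t \<longleftrightarrow>
     tdiff euclidean_atlas A \<sigma> t \<and> tangent_map euclidean_atlas A \<sigma> t 1 = v"

lemma has_velocity_chart:
  assumes A: "smooth_atlas A" and c: "c \<in> A" "\<sigma> t \<in> fst c"
  shows "has_velocity A \<sigma> v t \<longleftrightarrow>
    isCont \<sigma> t \<and> ((\<lambda>s. snd c (\<sigma> s)) has_vector_derivative in_chart A c (\<sigma> t) v) (at t)"
    (is "_ \<longleftrightarrow> ?R")
proof -
  let ?e = "(UNIV, id) :: (real, real) chart"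
  have e: "?e \<in> euclidean_atlas" "t \<in> fst ?e" by (auto simp: euclidean_atlas_def)
  have "from_chart euclidean_atlas ?e t v = v" for v
  proof -
    have "from_chart euclidean_atlas ?e t v = tangent_map euclidean_atlas euclidean_atlas id t v"
      unfolding from_chart_def chart_inv_id ..
    then show ?thesis using tdiff_id(2)[OF smooth_atlas_euclidean, of t v] by (simp add: id_def)
  qed
  then have fe: "from_chart euclidean_atlas ?e t = (\<lambda>v. v)" by (rule ext)
  have main: "((\<lambda>s. snd c (\<sigma> s)) has_vector_derivative in_chart A c (\<sigma> t) (tangent_map euclidean_atlas A \<sigma> t 1)) (at t)"
    if td: "tdiff euclidean_atlas A \<sigma> t"
  proof -
    have lin: "linear (\<lambda>u. in_chart A c (\<sigma> t) (tangent_map euclidean_atlas A \<sigma> t u))"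
      using linear_compose[OF tdiff_linear[OF td] linear_in_chart[OF A c]] by (simp add: o_def)
    have "in_chart A c (\<sigma> t) (tangent_map euclidean_atlas A \<sigma> t u) =
        u *\<^sub>R in_chart A c (\<sigma> t) (tangent_map euclidean_atlas A \<sigma> t 1)" for u
      using linear_cmul[OF lin, of u 1] by simp
    then have eq: "(\<lambda>u. in_chart A c (\<sigma> t) (tangent_map euclidean_atlas A \<sigma> t u)) =
        (\<lambda>u. u *\<^sub>R in_chart A c (\<sigma> t) (tangent_map euclidean_atlas A \<sigma> t 1))" by (rule ext)
    have "((\<lambda>s. snd c (\<sigma> s)) has_derivative
        (\<lambda>u. in_chart A c (\<sigma> t) (tangent_map euclidean_atlas A \<sigma> t u))) (at t)"
      using in_chart_tangent_map[where f = \<sigma> and x = t, OF smooth_atlas_euclidean A e c td] by (simp add: fe)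
    then show ?thesis unfolding has_vector_derivative_def eq .
  qed
  show ?thesis
  proof
    assume h: "has_velocity A \<sigma> v t"
    then have td: "tdiff euclidean_atlas A \<sigma> t" by (simp add: has_velocity_def)
    then have "isCont \<sigma> t" by (simp add: tdiff_def)
    with main[OF td] h show ?R by (simp add: has_velocity_def)
  next
    assume R: ?R
    have td: "tdiff euclidean_atlas A \<sigma> t"
      by (rule tdiffI_chart[where f = \<sigma> and x = t, OF smooth_atlas_euclidean A e c])
        (use R in \<open>auto simp: has_vector_derivative_def differentiable_def\<close>)
    from R have "((\<lambda>s. snd c (\<sigma> s)) has_vector_derivative in_chart A c (\<sigma> t) v) (at t)" ..
    with main[OF td]
    have "in_chart A c (\<sigma> t) (tangent_map euclidean_atlas A \<sigma> t 1) = in_chart A c (\<sigma> t) v"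
      by (rule vector_derivative_unique_at)
    then have "tangent_map euclidean_atlas A \<sigma> t 1 = v" using from_chart_in_chart[OF A c] by metis
    then show "has_velocity A \<sigma> v t" using td by (simp add: has_velocity_def)
  qed
qed

lemma has_velocity_chart_at:
  assumes "smooth_atlas A"
  shows "has_velocity A \<sigma> v t \<longleftrightarrow>
    isCont \<sigma> t \<and> ((\<lambda>s. snd (chart_at A (\<sigma> t)) (\<sigma> s)) has_vector_derivative v) (at t)"
  using has_velocity_chart[where c = "chart_at A (\<sigma> t)" and \<sigma> = \<sigma> and t = t and v = v and A = A]
    assms chart_at_props[OF assms] in_chart_at[OF assms] by simp

lemma has_velocity_map:
  assumes "smooth_atlas A" "smooth_atlas B" "has_velocity A \<sigma> v t" "tdiff A B f (\<sigma> t)"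
  shows "has_velocity B (\<lambda>s. f (\<sigma> s)) (tangent_map A B f (\<sigma> t) v) t"
  using tdiff_compose[where A = euclidean_atlas and f = \<sigma> and x = t and g = f and C = B,
      OF smooth_atlas_euclidean assms(1)] assms(3,4)
  by (auto simp: has_velocity_def)

lemma has_velocity_unique: "has_velocity A \<sigma> v t \<Longrightarrow> has_velocity A \<sigma> w t \<Longrightarrow> v = w"
  by (auto simp: has_velocity_def)

lemma has_velocity_reparam:
  fixes h :: "real \<Rightarrow> real"
  assumes "smooth_atlas A" "has_velocity A \<sigma> v (h t)" "(h has_real_derivative k) (at t)"
  shows "has_velocity A (\<lambda>s. \<sigma> (h s)) (k *\<^sub>R v) t"
proof -
  note lin = linear_in_chart[OF assms(1) chart_at_props[OF assms(1)]]
  have 1: "isCont \<sigma> (h t)" "((\<lambda>s. snd (chart_at A (\<sigma> (h t))) (\<sigma> s)) has_vector_derivative v) (at (h t))"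
    using assms(2) has_velocity_chart_at[OF assms(1)] by auto
  have "((\<lambda>s. snd (chart_at A (\<sigma> (h t))) (\<sigma> s)) \<circ> h has_vector_derivative k *\<^sub>R v) (at t)"
    by (rule vector_diff_chain_at[OF assms(3)[unfolded has_real_derivative_iff_has_vector_derivative] 1(2)])
  moreover have "isCont (\<lambda>s. \<sigma> (h s)) t"
    using isCont_o2[OF DERIV_isCont[OF assms(3)] 1(1)] by (simp add: o_def)
  ultimately show ?thesis by (simp add: has_velocity_chart_at[OF assms(1)] o_def)
qed

section \<open>Maps of two variables\<close>

definition loc_rep where
  "loc_rep c d e F = (\<lambda>z. snd e (F (chart_inv c (fst z), chart_inv d (snd z))))"

definition loc_dom where
  "loc_dom c d e F = {z \<in> (snd c ` fst c) \<times> (snd d ` fst d). F (chart_inv c (fst z), chart_inv d (snd z)) \<in> fst e}"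

text \<open>Covers the group multiplication and the action at once, and replaces charts of
  \<open>product_atlas\<close> by coordinate expressions in two variables.\<close>

locale smooth_bimap =
  fixes A :: "('g::{t2_space,second_countable_topology}, 'b::euclidean_space) atlas"
    and B :: "('m::{t2_space,second_countable_topology}, 'e::euclidean_space) atlas"
    and C :: "('n::{t2_space,second_countable_topology}, 'f::euclidean_space) atlas"
    and F :: "'g \<times> 'm \<Rightarrow> 'n"
  assumes A: "smooth_atlas A" and B: "smooth_atlas B" and C: "smooth_atlas C"
    and F: "smooth_map (product_atlas A B) C F"
begin

lemma cont: "continuous_on UNIV F"
  using F by (simp add: smooth_map_def)

lemma loc_dom_open:
  assumes c: "c \<in> A" and d: "d \<in> B" and e: "e \<in> C"
  shows "open (loc_dom c d e F)"
proof -
  note ch = smooth_atlas_chart[OF A c] and dh = smooth_atlas_chart[OF B d] and eh = smooth_atlas_chart[OF C e]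
  let ?S = "(snd c ` fst c) \<times> (snd d ` fst d)"
  have "continuous_on ?S (\<lambda>z. F (chart_inv c (fst z), chart_inv d (snd z)))"
    by (intro continuous_on_compose2[OF cont] continuous_intros continuous_on_compose2[OF ch(4)]
        continuous_on_compose2[OF dh(4)]) auto
  then have "open (?S \<inter> (\<lambda>z. F (chart_inv c (fst z), chart_inv d (snd z))) -` fst e)"
    using ch dh eh by (intro continuous_open_preimage open_Times)
  moreover have "?S \<inter> (\<lambda>z. F (chart_inv c (fst z), chart_inv d (snd z))) -` fst e = loc_dom c d e F"
    by (auto simp: loc_dom_def)
  ultimately show ?thesis by simp
qed

lemma loc_rep_Ck:
  assumes c: "c \<in> A" and d: "d \<in> B" and e: "e \<in> C"
  shows "Ck_on r (loc_dom c d e F) (loc_rep c d e F)"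
proof -
  note ch = smooth_atlas_chart[OF A c] and dh = smooth_atlas_chart[OF B d]
  define p where "p = (fst c \<times> fst d, map_prod (snd c) (snd d))"
  have pin: "p \<in> product_atlas A B"
    using c d by (force simp: product_atlas_def p_def)
  have inj: "inj_on (snd p) (fst p)"
    by (rule inj_on_inverseI[where g="map_prod (chart_inv c) (chart_inv d)"]) (use ch dh in \<open>auto simp: p_def\<close>)
  have pinv: "chart_inv p (snd c x, snd d y) = (x, y)" if "x \<in> fst c" "y \<in> fst d" for x y
    using inv_into_f_f[OF inj, of "(x, y)"] that by (simp add: chart_inv_def p_def)
  have S: "snd p ` (fst p \<inter> F -` fst e) = loc_dom c d e F"
  proof (intro equalityI subsetI)
    fix z assume "z \<in> snd p ` (fst p \<inter> F -` fst e)"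
    then show "z \<in> loc_dom c d e F" using ch dh by (auto simp: p_def loc_dom_def)
  next
    fix z assume "z \<in> loc_dom c d e F"
    then show "z \<in> snd p ` (fst p \<inter> F -` fst e)"
      using ch dh by (intro image_eqI[where x="(chart_inv c (fst z), chart_inv d (snd z))"])
        (auto simp: p_def loc_dom_def)
  qed
  have "Ck_on r (loc_dom c d e F) (snd e \<circ> F \<circ> chart_inv p)"
    using F pin e unfolding smooth_map_def smooth_on_def S[symmetric] by blast
  then show ?thesis
    by (rule Ck_on_cong[OF loc_dom_open[OF c d e], rotated])
      (use ch dh in \<open>auto simp: loc_dom_def loc_rep_def pinv\<close>)
qed

lemma in_loc_dom:
  assumes "c \<in> A" "d \<in> B" "e \<in> C" "g \<in> fst c" "x \<in> fst d" "F (g, x) \<in> fst e"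
  shows "(snd c g, snd d x) \<in> loc_dom c d e F"
  using assms smooth_atlas_chart[OF A] smooth_atlas_chart[OF B] by (auto simp: loc_dom_def)

lemma loc_rep_derivative:
  assumes "c \<in> A" "d \<in> B" "e \<in> C" "z \<in> loc_dom c d e F"
  shows "(loc_rep c d e F has_derivative frechet_derivative (loc_rep c d e F) (at z)) (at z)"
  using Ck_on_SucE[OF loc_rep_Ck[OF assms(1-3), of "Suc 0"] assms(4)] .

lemma tdiff_partial1: "tdiff A C (\<lambda>h. F (h, x)) g"
proof -
  define c d e where "c = chart_at A g" and "d = chart_at B x" and "e = chart_at C (F (g, x))"
  have c: "c \<in> A" "g \<in> fst c" and d: "d \<in> B" "x \<in> fst d" and e: "e \<in> C" "F (g, x) \<in> fst e"
    using chart_at_props[OF A] chart_at_props[OF B] chart_at_props[OF C] by (auto simp: c_def d_def e_def)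
  have xx: "chart_inv d (snd d x) = x" using smooth_atlas_chart[OF B d(1)] d by simp
  have "continuous_on UNIV (\<lambda>h. F (h, x))" by (intro continuous_on_compose2[OF cont] continuous_intros) auto
  then have ic: "isCont (\<lambda>h. F (h, x)) g" by (simp add: continuous_on_eq_continuous_at)
  have "((\<lambda>p. (p, snd d x)) has_derivative (\<lambda>v. (v, 0))) (at (snd c g))"
    by (auto intro!: derivative_eq_intros)
  from has_derivative_compose[OF this loc_rep_derivative[OF c(1) d(1) e(1) in_loc_dom[OF c(1) d(1) e(1) c(2) d(2) e(2)]]]
  have "((\<lambda>p. snd e (F (chart_inv c p, x))) has_derivative
    (\<lambda>v. frechet_derivative (loc_rep c d e F) (at (snd c g, snd d x)) (v, 0))) (at (snd c g))"
    by (simp add: loc_rep_def xx)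
  then show ?thesis
    by (intro tdiffI_chart[where f="\<lambda>h. F (h, x)", OF A C c e ic]) (auto simp: differentiable_def)
qed

lemma tdiff_partial2: "tdiff B C (\<lambda>y. F (g, y)) x"
proof -
  define c d e where "c = chart_at A g" and "d = chart_at B x" and "e = chart_at C (F (g, x))"
  have c: "c \<in> A" "g \<in> fst c" and d: "d \<in> B" "x \<in> fst d" and e: "e \<in> C" "F (g, x) \<in> fst e"
    using chart_at_props[OF A] chart_at_props[OF B] chart_at_props[OF C] by (auto simp: c_def d_def e_def)
  have xx: "chart_inv c (snd c g) = g" using smooth_atlas_chart[OF A c(1)] c by simp
  have "continuous_on UNIV (\<lambda>h. F (g, h))" by (intro continuous_on_compose2[OF cont] continuous_intros) auto
  then have ic: "isCont (\<lambda>h. F (g, h)) x" by (simp add: continuous_on_eq_continuous_at)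
  have "((\<lambda>p. (snd c g, p)) has_derivative (\<lambda>v. (0, v))) (at (snd d x))"
    by (auto intro!: derivative_eq_intros)
  from has_derivative_compose[OF this loc_rep_derivative[OF c(1) d(1) e(1) in_loc_dom[OF c(1) d(1) e(1) c(2) d(2) e(2)]]]
  have "((\<lambda>p. snd e (F (g, chart_inv d p))) has_derivative
    (\<lambda>v. frechet_derivative (loc_rep c d e F) (at (snd c g, snd d x)) (0, v))) (at (snd d x))"
    by (simp add: loc_rep_def xx)
  then show ?thesis
    by (intro tdiffI_chart[where f="\<lambda>h. F (g, h)", OF B C d e ic]) (auto simp: differentiable_def)
qed

text \<open>The total derivative is the sum of its restrictions to the two slices through the point,
  and each slice is the coordinate expression of a partial map.\<close>

lemma loc_rep_tangent:
  assumes c: "c \<in> A" "g \<in> fst c" and d: "d \<in> B" "x \<in> fst d" and e: "e \<in> C" "F (g, x) \<in> fst e"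
  shows "frechet_derivative (loc_rep c d e F) (at (snd c g, snd d x)) (u, v) =
    in_chart C e (F (g, x)) (tangent_map A C (\<lambda>h. F (h, x)) g (from_chart A c (snd c g) u) +
      tangent_map B C (\<lambda>y. F (g, y)) x (from_chart B d (snd d x) v))"
proof -
  let ?D = "frechet_derivative (loc_rep c d e F) (at (snd c g, snd d x))"
  have D: "(loc_rep c d e F has_derivative ?D) (at (snd c g, snd d x))"
    by (rule loc_rep_derivative[OF c(1) d(1) e(1) in_loc_dom[OF c(1) d(1) e(1) c(2) d(2) e(2)]])
  have gg: "chart_inv c (snd c g) = g" and xx: "chart_inv d (snd d x) = x"
    using smooth_atlas_chart[OF A c(1)] smooth_atlas_chart[OF B d(1)] c d by auto
  have "((\<lambda>p. (p, snd d x)) has_derivative (\<lambda>v. (v, 0))) (at (snd c g))"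
    by (auto intro!: derivative_eq_intros)
  from has_derivative_compose[OF this D]
  have 1: "((\<lambda>p. snd e (F (chart_inv c p, x))) has_derivative (\<lambda>v. ?D (v, 0))) (at (snd c g))"
    by (simp add: loc_rep_def xx)
  have D1: "?D (u, 0) = in_chart C e (F (g, x)) (tangent_map A C (\<lambda>h. F (h, x)) g (from_chart A c (snd c g) u))"
    using has_derivative_unique[OF 1 in_chart_tangent_map[where f="\<lambda>h. F (h, x)", OF A C c e tdiff_partial1]]
    by (rule fun_cong)
  have "((\<lambda>p. (snd c g, p)) has_derivative (\<lambda>v. (0, v))) (at (snd d x))"
    by (auto intro!: derivative_eq_intros)
  from has_derivative_compose[OF this D]
  have 2: "((\<lambda>p. snd e (F (g, chart_inv d p))) has_derivative (\<lambda>v. ?D (0, v))) (at (snd d x))"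
    by (simp add: loc_rep_def gg)
  have D2: "?D (0, v) = in_chart C e (F (g, x)) (tangent_map B C (\<lambda>y. F (g, y)) x (from_chart B d (snd d x) v))"
    using has_derivative_unique[OF 2 in_chart_tangent_map[where f="\<lambda>h. F (g, h)", OF B C d e tdiff_partial2]]
    by (rule fun_cong)
  have "?D (u, v) = ?D (u, 0) + ?D (0, v)"
    using linear_add[OF has_derivative_linear[OF D], of "(u, 0)" "(0, v)"] by simp
  then show ?thesis
    unfolding D1 D2 using linear_add[OF linear_in_chart[OF C e]] by simp
qed

lemma has_velocity_bimap:
  assumes s: "has_velocity A \<sigma> u t" and r: "has_velocity B \<tau> v t"
  shows "has_velocity C (\<lambda>s. F (\<sigma> s, \<tau> s))
    (tangent_map A C (\<lambda>h. F (h, \<tau> t)) (\<sigma> t) u + tangent_map B C (\<lambda>y. F (\<sigma> t, y)) (\<tau> t) v) t"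
proof -
  define g x where "g = \<sigma> t" and "x = \<tau> t"
  define c d e where "c = chart_at A g" and "d = chart_at B x" and "e = chart_at C (F (g, x))"
  have c: "c \<in> A" "g \<in> fst c" and d: "d \<in> B" "x \<in> fst d" and e: "e \<in> C" "F (g, x) \<in> fst e"
    using chart_at_props[OF A] chart_at_props[OF B] chart_at_props[OF C] by (auto simp: c_def d_def e_def)
  note ch = smooth_atlas_chart[OF A c(1)] and dh = smooth_atlas_chart[OF B d(1)]
  have sv: "isCont \<sigma> t" "((\<lambda>s. snd c (\<sigma> s)) has_vector_derivative in_chart A c g u) (at t)"
    using s has_velocity_chart[OF A c(1), of \<sigma> t u] c(2) by (auto simp: g_def)
  have rv: "isCont \<tau> t" "((\<lambda>s. snd d (\<tau> s)) has_vector_derivative in_chart B d x v) (at t)"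
    using r has_velocity_chart[OF B d(1), of \<tau> t v] d(2) by (auto simp: x_def)
  let ?D = "frechet_derivative (loc_rep c d e F) (at (snd c g, snd d x))"
  have D: "(loc_rep c d e F has_derivative ?D) (at (snd c g, snd d x))"
    by (rule loc_rep_derivative[OF c(1) d(1) e(1) in_loc_dom[OF c(1) d(1) e(1) c(2) d(2) e(2)]])
  have "((\<lambda>s. (snd c (\<sigma> s), snd d (\<tau> s))) has_derivative (\<lambda>h. (h *\<^sub>R in_chart A c g u, h *\<^sub>R in_chart B d x v))) (at t)"
    using sv(2) rv(2) unfolding has_vector_derivative_def by (rule has_derivative_Pair)
  from has_derivative_compose[OF this, of "loc_rep c d e F" ?D] D
  have "((\<lambda>s. loc_rep c d e F (snd c (\<sigma> s), snd d (\<tau> s))) has_derivative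
     (\<lambda>h. ?D (h *\<^sub>R in_chart A c g u, h *\<^sub>R in_chart B d x v))) (at t)"
    by (simp add: g_def x_def)
  moreover have "?D (h *\<^sub>R in_chart A c g u, h *\<^sub>R in_chart B d x v) = h *\<^sub>R in_chart C e (F (g, x))
     (tangent_map A C (\<lambda>h. F (h, x)) g u + tangent_map B C (\<lambda>y. F (g, y)) x v)" for h
    using linear_cmul[OF has_derivative_linear[OF D], of h "(in_chart A c g u, in_chart B d x v)"]
    by (simp add: loc_rep_tangent[OF c d e] from_chart_in_chart[OF A c] from_chart_in_chart[OF B d])
  ultimately have vd: "((\<lambda>s. loc_rep c d e F (snd c (\<sigma> s), snd d (\<tau> s))) has_vector_derivative in_chart C e (F (g, x))
     (tangent_map A C (\<lambda>h. F (h, x)) g u + tangent_map B C (\<lambda>y. F (g, y)) x v)) (at t)"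
    by (simp add: has_vector_derivative_def)
  have "\<forall>\<^sub>F s in nhds t. \<sigma> s \<in> fst c" "\<forall>\<^sub>F s in nhds t. \<tau> s \<in> fst d"
    using isCont_eventually_in[OF sv(1) ch(1)] isCont_eventually_in[OF rv(1) dh(1)] c d
    by (auto simp: g_def x_def)
  then have ev: "\<forall>\<^sub>F s in nhds t. loc_rep c d e F (snd c (\<sigma> s), snd d (\<tau> s)) = snd e (F (\<sigma> s, \<tau> s))"
    by eventually_elim (use ch dh in \<open>auto simp: loc_rep_def\<close>)
  then obtain U where U: "open U" "t \<in> U"
    "\<And>s. s \<in> U \<Longrightarrow> loc_rep c d e F (snd c (\<sigma> s), snd d (\<tau> s)) = snd e (F (\<sigma> s, \<tau> s))"
    by (auto simp: eventually_nhds)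
  have vd': "((\<lambda>s. snd e (F (\<sigma> s, \<tau> s))) has_vector_derivative in_chart C e (F (g, x))
     (tangent_map A C (\<lambda>h. F (h, x)) g u + tangent_map B C (\<lambda>y. F (g, y)) x v)) (at t)"
    by (rule has_vector_derivative_transform_within_open[OF vd U])
  have "isCont F (\<sigma> t, \<tau> t)" using cont by (simp add: continuous_on_eq_continuous_at)
  from isCont_o2[OF isCont_Pair[OF sv(1) rv(1)] this]
  have ic: "isCont (\<lambda>s. F (\<sigma> s, \<tau> s)) t" .
  show ?thesis
    using has_velocity_chart[where \<sigma>="\<lambda>s. F (\<sigma> s, \<tau> s)" and t=t and c=e and A=C] C e ic vd'
    by (simp add: g_def x_def)
qed

end

section \<open>An invariance principle for closed sets\<close>

text \<open>Gronwall's inequality for a function with only an upper bound on its right-hand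
  increments. \<open>D\<close> is compared with an exponential barrier; the supremum of the times up
  to which \<open>D\<close> stays below it can always be pushed further.\<close>

lemma dini_gronwall:
  fixes D :: "real \<Rightarrow> real"
  assumes cont: "continuous_on {a..b} D" and D0: "D a \<le> 0" and K: "K \<ge> 0"
    and step: "\<And>t \<eta>. a \<le> t \<Longrightarrow> t < b \<Longrightarrow> \<eta> > 0 \<Longrightarrow>
      \<forall>\<^sub>F s in at_right 0. D (t + s) \<le> D t + s * (K * D t + \<eta>)"
    and t: "t \<in> {a..b}"
  shows "D t \<le> 0"
proof (rule field_le_epsilon)
  fix \<epsilon> :: real assume e: "\<epsilon> > 0"
  \<comment> \<open>The barrier \<open>B\<close> starts at \<eta> and reaches exactly \<epsilon> at
    time \<open>b\<close>.\<close>
  define \<eta> where "\<eta> = \<epsilon> / exp ((K + 1) * (b - a))"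
  have \<eta>: "\<eta> > 0" using e by (simp add: \<eta>_def)
  define B where "B = (\<lambda>t. \<eta> * exp ((K + 1) * (t - a)))"
  define S where "S = {s \<in> {a..b}. \<forall>r\<in>{a..s}. D r \<le> B r}"
  have ab: "a \<le> b" using t by simp
  have aS: "a \<in> S" using ab D0 \<eta> by (auto simp: S_def B_def)
  have bdd: "bdd_above S" by (auto simp: S_def bdd_above_def)
  define m where "m = Sup S"
  have m: "a \<le> m" "m \<le> b" using aS bdd by (auto simp: m_def cSup_upper S_def intro!: cSup_least)
  have less: "D r \<le> B r" if r: "a \<le> r" "r < m" for r
  proof -
    obtain s where "s \<in> S" "r < s" using r(2) aS less_cSup_iff[OF _ bdd] unfolding m_def by blast
    then show ?thesis using r by (auto simp: S_def)
  qed
  have contB: "continuous_on {a..b} B" unfolding B_def by (intro continuous_intros)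
  have mB: "D m \<le> B m"
  proof (cases "a < m")
    case True
    have "closed {r \<in> {a..m}. D r \<le> B r}"
      using m by (intro continuous_closed_preimage_constant continuous_on_closed_Collect_le
          continuous_on_subset[OF cont] continuous_on_subset[OF contB]) auto
    moreover have "m islimpt {a..<m}" using True by (simp add: islimpt_Ico)
    ultimately have "m \<in> {r \<in> {a..m}. D r \<le> B r}"
      using less unfolding closed_limpt by (elim allE impE) (auto elim!: islimpt_subset)
    then show ?thesis by simp
  next
    case False
    then show ?thesis using m D0 \<eta> by (auto simp: B_def)
  qed
  have "m = b"
  proof (rule ccontr)
    assume "m \<noteq> b"
    then have mb: "m < b" using m by simp
    have "\<forall>\<^sub>F s in at_right 0. D (m + s) \<le> D m + s * (K * D m + \<eta>)"
      using step m mb \<eta> by blast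
    then obtain d where d: "d > 0" "\<And>s. 0 < s \<Longrightarrow> s < d \<Longrightarrow> D (m + s) \<le> D m + s * (K * D m + \<eta>)"
      by (auto simp: eventually_at_right_field)
    define d' where "d' = min (d / 2) (b - m)"
    have d': "d' > 0" "d' < d" "m + d' \<le> b" using d mb by (auto simp: d'_def)
    have "D r \<le> B r" if r: "r \<in> {a..m + d'}" for r
    proof (cases "r \<le> m")
      case True
      then show ?thesis using less mB r by (cases "r = m") auto
    next
      case False
      define s where "s = r - m"
      have s: "0 < s" "s < d" "r = m + s" using False r d' by (auto simp: s_def)
      \<comment> \<open>The barrier grows at rate \<open>K + 1\<close> and not \<open>K\<close>: the
        extra unit absorbs the error \<eta>, which never exceeds the barrier.\<close>
      have eB: "\<eta> \<le> B m" using \<eta> K m by (simp add: B_def mult_nonneg_nonneg)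
      have "D r \<le> D m + s * (K * D m + \<eta>)" using d(2)[OF s(1,2)] s(3) by simp
      also have "\<dots> \<le> B m + s * (K * B m + B m)"
        using mB K s eB by (intro add_mono mult_left_mono) auto
      also have "\<dots> = B m * (1 + (K + 1) * s)" by (simp add: algebra_simps)
      also have "\<dots> \<le> B m * exp ((K + 1) * s)"
        using \<eta> by (intro mult_left_mono exp_ge_add_one_self) (auto simp: B_def)
      also have "\<dots> = B r" by (simp add: B_def s(3) exp_add[symmetric] algebra_simps)
      finally show ?thesis .
    qed
    then have "m + d' \<in> S" using m d' by (auto simp: S_def)
    then have "m + d' \<le> m" unfolding m_def using bdd by (rule cSup_upper)
    then show False using d' by simp
  qed
  then have "D t \<le> B t" using less mB t by (cases "t = m") auto
  also have "\<dots> \<le> \<eta> * exp ((K + 1) * (b - a))"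
    unfolding B_def using t K \<eta> by (intro mult_left_mono) (auto intro!: mult_left_mono)
  also have "\<dots> = \<epsilon>" by (simp add: \<eta>_def)
  finally show "D t \<le> 0 + \<epsilon>" by simp
qed

lemma has_vector_derivative_right_expansion:
  assumes "(x has_vector_derivative v) (at t)" "\<eta> > 0"
  shows "\<forall>\<^sub>F s in at_right 0. norm (x (t + s) - x t - s *\<^sub>R v) \<le> s * \<eta>"
proof -
  obtain d where d: "d > 0" "\<And>y. norm (y - t) < d \<Longrightarrow> norm (x y - x t - (y - t) *\<^sub>R v) \<le> \<eta> * norm (y - t)"
    using assms unfolding has_vector_derivative_def has_derivative_at_alt by blast
  have "norm (x (t + s) - x t - s *\<^sub>R v) \<le> s * \<eta>" if "0 < s" "s < d" for s
    using d(2)[of "t + s"] that by (simp add: mult.commute)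
  then show ?thesis using d(1) by (auto simp: eventually_at_right_field)
qed

text \<open>Nagumo's theorem; the distance to \<open>Q\<close> is differentiated through a nearest point.\<close>
lemma nagumo_invariance:
  fixes x :: "real \<Rightarrow> 'a::euclidean_space"
  assumes cl: "closed Q" and x0: "x a \<in> Q" and cont: "continuous_on {a..b} x" and K: "K \<ge> 0"
    and deriv: "\<And>t. a \<le> t \<Longrightarrow> t < b \<Longrightarrow> (x has_vector_derivative x' t) (at t)"
    and sub: "\<And>t w. a \<le> t \<Longrightarrow> t < b \<Longrightarrow> w \<in> Q \<Longrightarrow> dist (x t) w = infdist (x t) Q \<Longrightarrow>
      \<exists>\<omega> v. \<omega> 0 = w \<and> (\<omega> has_vector_derivative v) (at 0) \<and> (\<forall>\<^sub>F s in at_right 0. \<omega> s \<in> Q) \<and>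
        norm (x' t - v) \<le> K * norm (x t - w)"
    and t: "t \<in> {a..b}"
  shows "x t \<in> Q"
proof -
  have ne: "Q \<noteq> {}" using x0 by auto
  define D where "D = (\<lambda>t. infdist (x t) Q)"
  have "D t \<le> 0"
  proof (rule dini_gronwall[OF _ _ K _ t])
    show "continuous_on {a..b} D" unfolding D_def using cont by (rule continuous_on_infdist)
    show "D a \<le> 0" using x0 by (simp add: D_def)
    fix t \<eta> :: real assume t: "a \<le> t" "t < b" and \<eta>: "\<eta> > 0"
    obtain w where w: "w \<in> Q" "infdist (x t) Q = dist (x t) w"
      using infdist_attains_inf[OF cl ne] by blast
    obtain \<omega> v where o: "\<omega> 0 = w" "(\<omega> has_vector_derivative v) (at 0)" "\<forall>\<^sub>F s in at_right 0. \<omega> s \<in> Q"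
      "norm (x' t - v) \<le> K * norm (x t - w)"
      using sub[OF t w(1)] w(2) by metis
    have "\<forall>\<^sub>F s in at_right 0. norm (x (t + s) - x t - s *\<^sub>R x' t) \<le> s * (\<eta> / 2)"
      using has_vector_derivative_right_expansion[OF deriv[OF t], of "\<eta> / 2"] \<eta> by simp
    moreover have "\<forall>\<^sub>F s in at_right 0. norm (\<omega> (0 + s) - \<omega> 0 - s *\<^sub>R v) \<le> s * (\<eta> / 2)"
      using has_vector_derivative_right_expansion[OF o(2), of "\<eta> / 2"] \<eta> by simp
    moreover have "\<forall>\<^sub>F s in at_right (0::real). 0 < s" by (simp add: eventually_at_right_less)
    ultimately show "\<forall>\<^sub>F s in at_right 0. D (t + s) \<le> D t + s * (K * D t + \<eta>)"
      using o(3)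
    proof eventually_elim
      case (elim s)
      have eq: "x (t + s) - \<omega> s = (x (t + s) - x t - s *\<^sub>R x' t) + (x t - w) + s *\<^sub>R (x' t - v) - (\<omega> s - w - s *\<^sub>R v)"
        by (simp add: algebra_simps)
      have "D (t + s) \<le> dist (x (t + s)) (\<omega> s)" unfolding D_def using elim by (intro infdist_le)
      also have "dist (x (t + s)) (\<omega> s) \<le> norm (x (t + s) - x t - s *\<^sub>R x' t) + norm (x t - w)
          + norm (s *\<^sub>R (x' t - v)) + norm (\<omega> s - w - s *\<^sub>R v)"
        unfolding dist_norm eq
        by (intro order_trans[OF norm_triangle_ineq4] add_right_mono order_trans[OF norm_triangle_ineq] order_refl)
      also have "\<dots> \<le> s * (\<eta> / 2) + norm (x t - w) + s * (K * norm (x t - w)) + s * (\<eta> / 2)"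
        using elim o by (intro add_mono) (auto intro!: mult_left_mono)
      also have "norm (x t - w) = D t" using w(2) by (simp add: D_def dist_norm)
      finally show ?case by (simp add: algebra_simps)
    qed
  qed
  then have "infdist (x t) Q = 0" using infdist_nonneg[of "x t" Q] by (simp add: D_def)
  then show ?thesis using in_closed_iff_infdist_zero[OF cl ne] by simp
qed

section \<open>Lie groups and smooth actions\<close>

lemma has_velocity_euclidean:
  fixes f :: "real \<Rightarrow> 'a::euclidean_space"
  shows
  "has_velocity euclidean_atlas f v t \<longleftrightarrow> (f has_vector_derivative v) (at t)"
proof -
  have "in_chart euclidean_atlas (UNIV, id) (f t) v = v"
    using in_chart_at[OF smooth_atlas_euclidean, of "f t" v] by simp
  then have "has_velocity euclidean_atlas f v t \<longleftrightarrow> isCont f t \<and> (f has_vector_derivative v) (at t)"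
    using has_velocity_chart_at[OF smooth_atlas_euclidean, of f v t] by simp
  then show ?thesis using has_vector_derivative_continuous by blast
qed

locale lie_grp = group G for G :: "'g::{t2_space,second_countable_topology} monoid" (structure) +
  fixes AG :: "('g, 'b::euclidean_space) atlas"
  assumes lie: "lie_group G AG"
begin

lemma car [simp]: "x \<in> carrier G"
  using lie by (simp add: lie_group_def)

lemma atlas_G: "smooth_atlas AG"
  using lie by (simp add: lie_group_def)

lemma mult_bimap: "smooth_bimap AG AG AG (\<lambda>(g, h). g \<otimes> h)"
  using lie by unfold_locales (auto simp: lie_group_def)

lemma tdiff_left: "tdiff AG AG (\<lambda>h. g \<otimes> h) x"
  using smooth_bimap.tdiff_partial2[OF mult_bimap, of g x] by simp

lemma tdiff_right: "tdiff AG AG (\<lambda>h. h \<otimes> g) x"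
  using smooth_bimap.tdiff_partial1[OF mult_bimap, of g x] by simp

lemma continuous_mult: "continuous_on UNIV (\<lambda>(g, h). g \<otimes> h)"
  using smooth_bimap.cont[OF mult_bimap] .

lemma continuous_inv: "continuous_on UNIV (\<lambda>g. inv g)"
  using lie by (simp add: lie_group_def smooth_map_def)

lemma continuous_on_mult [continuous_intros]:
  "continuous_on S f \<Longrightarrow> continuous_on S g \<Longrightarrow> continuous_on S (\<lambda>x. f x \<otimes> g x)"
  using continuous_on_compose2[OF continuous_mult, of S "\<lambda>x. (f x, g x)"]
  by (auto intro: continuous_intros)

lemma continuous_on_inv' [continuous_intros]:
  "continuous_on S f \<Longrightarrow> continuous_on S (\<lambda>x. inv (f x))"
  using continuous_on_compose2[OF continuous_inv, of S f] by auto

definition Ad where "Ad g u = tangent_map AG AG (\<lambda>h. g \<otimes> h \<otimes> inv g) \<one> u"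

lemma tdiff_conj: "tdiff AG AG (\<lambda>h. g \<otimes> h \<otimes> inv g) x"
  by (rule tdiff_compose(1)[OF atlas_G atlas_G tdiff_left tdiff_right])

lemma Ad_linear: "linear (Ad g)"
  using tdiff_linear[OF tdiff_conj, of g "\<one>"] by (simp add: Ad_def[abs_def])

lemma Ad_mult: "Ad (g \<otimes> h) u = Ad g (Ad h u)"
proof -
  have "(\<lambda>k. (g \<otimes> h) \<otimes> k \<otimes> inv (g \<otimes> h)) = (\<lambda>k. g \<otimes> (h \<otimes> k \<otimes> inv h) \<otimes> inv g)"
    by (simp add: inv_mult_group m_assoc)
  then show ?thesis
    using tdiff_compose(2)[where f="\<lambda>k. h \<otimes> k \<otimes> inv h" and x="\<one>", OF atlas_G atlas_G tdiff_conj tdiff_conj[of g], of u]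
    by (simp add: Ad_def)
qed

lemma Ad_one [simp]: "Ad \<one> u = u"
  using tdiff_id(2)[OF atlas_G, of "\<one>" u] by (simp add: Ad_def)

lemma Ad_inv [simp]: "Ad (inv g) (Ad g u) = u" "Ad g (Ad (inv g) u) = u"
  by (simp_all add: Ad_mult[symmetric])

text \<open>The right logarithmic derivative of \<open>\<gamma>\<close> at \<open>t\<close>.\<close>
definition rlog where "rlog \<gamma> u t \<longleftrightarrow> has_velocity AG (\<lambda>s. \<gamma> s \<otimes> inv (\<gamma> t)) u t"

lemma rlog_of_velocity:
  assumes "has_velocity AG \<gamma> w t"
  shows "rlog \<gamma> (tangent_map AG AG (\<lambda>h. h \<otimes> inv (\<gamma> t)) (\<gamma> t) w) t"
  unfolding rlog_def by (rule has_velocity_map[OF atlas_G atlas_G assms tdiff_right])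

text \<open>Right translations do not change the right logarithmic derivative. With \<open>k\<close>
  equal to 1 or -1 a curve can thus be restarted at the identity from any of its points, in either
  direction of time.\<close>

lemma rlog_shift:
  assumes "rlog \<gamma> u (t0 + k * \<tau>)"
  shows "rlog (\<lambda>s. \<gamma> (t0 + k * s) \<otimes> inv (\<gamma> t0)) (k *\<^sub>R u) \<tau>"
proof -
  have "has_velocity AG (\<lambda>s. \<gamma> (t0 + k * s) \<otimes> inv (\<gamma> (t0 + k * \<tau>))) (k *\<^sub>R u) \<tau>"
    by (rule has_velocity_reparam[where h = "\<lambda>s. t0 + k * s" and t = \<tau> and k = k
          and \<sigma> = "\<lambda>s. \<gamma> s \<otimes> inv (\<gamma> (t0 + k * \<tau>))", OF atlas_G])
      (use assms in \<open>auto simp: rlog_def intro!: derivative_eq_intros\<close>)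
  moreover have "g \<otimes> inv h \<otimes> inv (g' \<otimes> inv h) = g \<otimes> inv g'" for g g' h
    by (simp add: inv_mult_group m_assoc[symmetric]) (simp add: m_assoc)
  ultimately show ?thesis unfolding rlog_def by simp
qed

text \<open>A germ at time 0 of a curve through the identity that is driven by bounded vectors of
  \<open>U\<close>; the driving vector may depend on time in any manner.\<close>

definition ctrl where
  "ctrl U \<beta> \<gamma> \<longleftrightarrow> \<gamma> 0 = \<one> \<and> (\<exists>\<delta>>0. \<forall>t. \<bar>t\<bar> < \<delta> \<longrightarrow> (\<exists>u\<in>U. norm u \<le> \<beta> \<and> rlog \<gamma> u t))"

definition c1 where "c1 = chart_at AG \<one>"
definition p1 where "p1 = snd c1 \<one>"
text \<open>A straight segment in the chart at the identity, in general not a one-parameter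
  subgroup. Its end points \<open>line v 1\<close> fill a neighbourhood of the identity without
  recourse to the exponential map.\<close>

definition line where "line v t = chart_inv c1 (p1 + t *\<^sub>R v)"

lemma c1: "c1 \<in> AG" "\<one> \<in> fst c1"
  using chart_at_props[OF atlas_G] by (auto simp: c1_def)

lemma in_c1 [simp]: "in_chart AG c1 \<one> u = u"
  by (simp add: c1_def in_chart_at[OF atlas_G])

lemma from_c1 [simp]: "from_chart AG c1 p1 u = u"
  using from_chart_in_chart[OF atlas_G c1, of u] by (simp add: p1_def)

lemma p1: "p1 \<in> snd c1 ` fst c1" "chart_inv c1 p1 = \<one>"
  using c1 smooth_atlas_chart[OF atlas_G c1(1)] by (auto simp: p1_def)

end

locale smooth_action = lie_grp G AG
  for G :: "'g::{t2_space,second_countable_topology} monoid" (structure)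
    and AG :: "('g, 'b::euclidean_space) atlas" +
  fixes AM :: "('m::{t2_space,second_countable_topology}, 'e::euclidean_space) atlas"
    and \<phi> :: "'g \<Rightarrow> 'm \<Rightarrow> 'm"
  assumes atlas_M: "smooth_atlas AM"
    and act_mult: "\<phi> (g \<otimes> h) x = \<phi> g (\<phi> h x)"
    and act_one [simp]: "\<phi> \<one> x = x"
    and act_smooth: "smooth_map (product_atlas AG AM) AM (\<lambda>(g, x). \<phi> g x)"
begin

lemma act_bimap: "smooth_bimap AG AM AM (\<lambda>(g, x). \<phi> g x)"
  using atlas_G atlas_M act_smooth by unfold_locales

lemma act_inv [simp]: "\<phi> (inv g) (\<phi> g x) = x" "\<phi> g (\<phi> (inv g) x) = x"
  by (simp_all add: act_mult[symmetric])

lemma tdiff_act: "tdiff AM AM (\<phi> g) x"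
  using smooth_bimap.tdiff_partial2[OF act_bimap, of g x] by simp

lemma tdiff_orbit: "tdiff AG AM (\<lambda>g. \<phi> g x) g"
  using smooth_bimap.tdiff_partial1[OF act_bimap, of x g] by simp

lemma continuous_act: "continuous_on UNIV (\<lambda>(g, x). \<phi> g x)"
  using smooth_bimap.cont[OF act_bimap] .

text \<open>\<open>T g x\<close> is the differential of the diffeomorphism of \<open>g\<close> at
  \<open>x\<close>, and \<open>X x u\<close> is the value at \<open>x\<close> of the fundamental
  vector field of \<open>u\<close>; the range of \<open>X x\<close> is the fibre of
  \<open>orbit_tangent\<close>.\<close>

definition T where "T g x = tangent_map AM AM (\<phi> g) x"
definition X where "X x u = tangent_map AG AM (\<lambda>g. \<phi> g x) \<one> u"

lemma T_linear: "linear (T g x)"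
  unfolding T_def by (rule tdiff_linear[OF tdiff_act])

lemma X_linear: "linear (X x)"
  using tdiff_linear[OF tdiff_orbit, of x "\<one>"] by (simp add: X_def[abs_def])

lemma T_mult: "T (g \<otimes> h) x v = T g (\<phi> h x) (T h x v)"
proof -
  have "\<phi> (g \<otimes> h) = (\<lambda>x. \<phi> g (\<phi> h x))" by (simp add: act_mult fun_eq_iff)
  then show ?thesis
    using tdiff_compose(2)[where f="\<phi> h" and x=x, OF atlas_M atlas_M tdiff_act tdiff_act[of g], of v]
    by (simp add: T_def)
qed

lemma T_one [simp]: "T \<one> x v = v"
proof -
  have "\<phi> \<one> = (\<lambda>x. x)" by (simp add: fun_eq_iff)
  then show ?thesis using tdiff_id(2)[OF atlas_M, of x v] by (simp add: T_def)
qed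

lemma T_inv [simp]: "T (inv g) (\<phi> g x) (T g x v) = v" "T g (\<phi> (inv g) x) (T (inv g) x v) = v"
  using T_mult[of "inv g" g x v] T_mult[of g "inv g" x v] by auto

text \<open>Applying \<open>h\<close> and then \<open>g\<close> to \<open>x\<close> is the same as
  applying \<open>g h inv g\<close> to the point \<open>\<phi> g x\<close>; differentiating at
  \<open>h = \<one>\<close> gives equivariance.\<close>

lemma T_X: "T g x (X x u) = X (\<phi> g x) (Ad g u)"
proof -
  have "(\<lambda>h. \<phi> g (\<phi> h x)) = (\<lambda>h. \<phi> (g \<otimes> h \<otimes> inv g) (\<phi> g x))"
    by (simp add: act_mult)
  moreover have "tangent_map AG AM (\<lambda>h. \<phi> g (\<phi> h x)) \<one> u = T g x (X x u)"
    using tdiff_compose(2)[where f="\<lambda>h. \<phi> h x" and x="\<one>", OF atlas_G atlas_M tdiff_orbit tdiff_act[of g], of u]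
    by (simp add: T_def X_def)
  moreover have "tangent_map AG AM (\<lambda>h. \<phi> (g \<otimes> h \<otimes> inv g) (\<phi> g x)) \<one> u = X (\<phi> g x) (Ad g u)"
    using tdiff_compose(2)[where f="\<lambda>h. g \<otimes> h \<otimes> inv g" and x="\<one>", OF atlas_G atlas_G tdiff_conj tdiff_orbit[of "\<phi> g x"], of u]
    by (simp add: Ad_def X_def)
  ultimately show ?thesis by simp
qed

lemma orbit_velocity_one:
  assumes "has_velocity AG \<gamma> u t" "\<gamma> t = \<one>"
  shows "has_velocity AM (\<lambda>s. \<phi> (\<gamma> s) y) (X y u) t"
  using has_velocity_map[where f="\<lambda>g. \<phi> g y", OF atlas_G atlas_M assms(1) tdiff_orbit] assms(2)
  by (simp add: X_def)

text \<open>Seen from the point \<open>\<phi> (\<gamma> t) y\<close>, the orbit curve is moved by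
  \<open>\<gamma> s \<otimes> inv (\<gamma> t)\<close>, which passes through the identity with
  velocity \<open>u\<close>. Driven curves thus become integral curves of time-dependent fundamental
  fields.\<close>

lemma orbit_velocity:
  assumes "rlog \<gamma> u t"
  shows "has_velocity AM (\<lambda>s. \<phi> (\<gamma> s) y) (X (\<phi> (\<gamma> t) y) u) t"
  using orbit_velocity_one[OF assms[unfolded rlog_def], of "\<phi> (\<gamma> t) y"] by (simp add: act_mult)

text \<open>Exhibits the fundamental field in a chart as a partial derivative of the action at the
  identity, hence as a smooth object.\<close>

lemma X_chart:
  assumes d: "d \<in> AM" and p: "p \<in> snd d ` fst d"
  shows "in_chart AM d (chart_inv d p) (X (chart_inv d p) u) =
    frechet_derivative (loc_rep c1 d d (\<lambda>(g, x). \<phi> g x)) (at (p1, p)) (u, 0)"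
proof -
  define x where "x = chart_inv d p"
  have x: "x \<in> fst d" "snd d x = p" using smooth_atlas_chart[OF atlas_M d] p by (auto simp: x_def)
  have z: "from_chart AM d p 0 = 0" by (rule linear_0[OF linear_from_chart[OF atlas_M d p]])
  have z': "tangent_map AM AM (\<lambda>y. y) x 0 = 0" by (rule tdiff_id(2)[OF atlas_M])
  show ?thesis
    using smooth_bimap.loc_rep_tangent[OF act_bimap c1 d x(1) d, of u 0] x z z'
    by (simp add: x_def[symmetric] p1_def[symmetric] X_def)
qed

text \<open>The action is twice continuously differentiable, so the basis fields are Lipschitz near
  \<open>y\<close>; linearity in \<open>u\<close> makes the constant proportional to
  \<open>norm u\<close>.\<close>

lemma X_lipschitz:
  assumes d: "d \<in> AM" "y \<in> fst d"
  obtains r K where "r > 0" "K \<ge> 0" "cball (snd d y) r \<subseteq> snd d ` fst d"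
    "\<And>p q u. p \<in> cball (snd d y) r \<Longrightarrow> q \<in> cball (snd d y) r \<Longrightarrow>
      norm (in_chart AM d (chart_inv d p) (X (chart_inv d p) u) -
        in_chart AM d (chart_inv d q) (X (chart_inv d q) u)) \<le> K * norm u * norm (p - q)"
proof -
  let ?F = "\<lambda>(g, x). \<phi> g x"
  let ?S = "loc_dom c1 d d ?F" and ?L = "loc_rep c1 d d ?F"
  have z0: "(p1, snd d y) \<in> ?S"
    using smooth_bimap.in_loc_dom[OF act_bimap c1(1) d(1) d(1) c1(2) d(2)] d by (simp add: p1_def)
  have op: "open ?S" by (rule smooth_bimap.loc_dom_open[OF act_bimap c1(1) d(1) d(1)])
  have Ck: "Ck_on (Suc (Suc 0)) ?S ?L" by (rule smooth_bimap.loc_rep_Ck[OF act_bimap c1(1) d(1) d(1)])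
  have "\<exists>e K. e > 0 \<and> K \<ge> 0 \<and> cball (p1, snd d y) e \<subseteq> ?S \<and>
    (\<forall>x\<in>cball (p1, snd d y) e. \<forall>z\<in>cball (p1, snd d y) e.
      norm (frechet_derivative ?L (at x) (b, 0) - frechet_derivative ?L (at z) (b, 0)) \<le> K * norm (x - z))"
    for b
  proof -
    have "Ck_on (Suc 0) ?S (\<lambda>x. frechet_derivative ?L (at x) (b, 0))" using Ck by simp
    from C1_lipschitz[OF this op z0] show ?thesis by metis
  qed
  then obtain e K where eK: "\<And>b. e b > 0" "\<And>b. K b \<ge> 0" "\<And>b. cball (p1, snd d y) (e b) \<subseteq> ?S"
    "\<And>b x z. x \<in> cball (p1, snd d y) (e b) \<Longrightarrow> z \<in> cball (p1, snd d y) (e b) \<Longrightarrow>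
      norm (frechet_derivative ?L (at x) (b, 0) - frechet_derivative ?L (at z) (b, 0)) \<le> K b * norm (x - z)"
    by metis
  define r where "r = Min (e ` Basis)"
  have r: "r > 0" "\<And>b. b \<in> Basis \<Longrightarrow> r \<le> e b" using eK(1) by (auto simp: r_def)
  have inS: "(p1, p) \<in> cball (p1, snd d y) (e b)" if "p \<in> cball (snd d y) r" "b \<in> Basis" for p b
    using that r(2)[of b] by (auto simp: dist_Pair_Pair)
  have sub: "cball (snd d y) r \<subseteq> snd d ` fst d"
  proof
    fix p assume "p \<in> cball (snd d y) r"
    then have "(p1, p) \<in> ?S" using inS eK(3) nonempty_Basis by blast
    then show "p \<in> snd d ` fst d" by (simp add: loc_dom_def)
  qed
  have fin: "norm (in_chart AM d (chart_inv d p) (X (chart_inv d p) u) -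
        in_chart AM d (chart_inv d q) (X (chart_inv d q) u)) \<le> (\<Sum>b\<in>Basis. K b) * norm u * norm (p - q)"
    if p: "p \<in> cball (snd d y) r" and q: "q \<in> cball (snd d y) r" for p q u
  proof -
    have exp: "in_chart AM d (chart_inv d p) (X (chart_inv d p) u) =
      (\<Sum>b\<in>Basis. (u \<bullet> b) *\<^sub>R frechet_derivative ?L (at (p1, p)) (b, 0))" if "p \<in> cball (snd d y) r" for p
    proof -
      have pp: "p \<in> snd d ` fst d" using that sub by blast
      have "linear (\<lambda>u. in_chart AM d (chart_inv d p) (X (chart_inv d p) u))"
        using linear_compose[OF X_linear linear_in_chart[OF atlas_M d(1)]] smooth_atlas_chart(7)[OF atlas_M d(1) pp]
        by (simp add: o_def)
      from linear_basis_expansion[OF this, of u] show ?thesis by (simp add: X_chart[OF d(1) pp])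
    qed
    have "norm (in_chart AM d (chart_inv d p) (X (chart_inv d p) u) -
        in_chart AM d (chart_inv d q) (X (chart_inv d q) u)) =
      norm (\<Sum>b\<in>Basis. (u \<bullet> b) *\<^sub>R (frechet_derivative ?L (at (p1, p)) (b, 0) - frechet_derivative ?L (at (p1, q)) (b, 0)))"
      by (simp add: exp[OF p] exp[OF q] sum_subtractf scaleR_diff_right)
    also have "\<dots> \<le> (\<Sum>b\<in>Basis. norm u * (K b * norm (p - q)))"
    proof (rule sum_norm_le)
      fix b :: 'b assume b: "b \<in> Basis"
      have "norm (frechet_derivative ?L (at (p1, p)) (b, 0) - frechet_derivative ?L (at (p1, q)) (b, 0)) \<le> K b * norm ((p1, p) - (p1, q))"
        by (rule eK(4)[OF inS[OF p b] inS[OF q b]])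
      then show "norm ((u \<bullet> b) *\<^sub>R (frechet_derivative ?L (at (p1, p)) (b, 0) - frechet_derivative ?L (at (p1, q)) (b, 0))) \<le> norm u * (K b * norm (p - q))"
        using Basis_le_norm[OF b, of u] by (auto simp: norm_Pair intro!: mult_mono)
    qed
    also have "\<dots> = (\<Sum>b\<in>Basis. K b) * norm u * norm (p - q)"
      by (simp add: sum_distrib_left sum_distrib_right mult_ac)
    finally show ?thesis .
  qed
  show ?thesis by (rule that[OF r(1) sum_nonneg[OF eK(2)] sub fin])
qed

text \<open>Nagumo's theorem in a chart: every fundamental field admits curves inside
  \<open>Q\<close>, and the field at the moving point differs from the field at its nearest point of
  \<open>Q\<close> by at most the Lipschitz constant times the distance. Only a compact piece of
  \<open>Q\<close> around \<open>y\<close> enters.\<close>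

lemma local_invariance:
  assumes d: "d \<in> AM" "y \<in> fst d" and yQ: "y \<in> Q" and r: "r > 0"
    and cpt: "compact (snd d ` (Q \<inter> fst d) \<inter> cball (snd d y) r)"
    and sub: "\<And>w u. w \<in> Q \<Longrightarrow> w \<in> fst d \<Longrightarrow> snd d w \<in> ball (snd d y) r \<Longrightarrow> u \<in> U \<Longrightarrow>
      \<exists>\<omega>. \<omega> 0 = w \<and> has_velocity AM \<omega> (X w u) 0 \<and> (\<forall>\<^sub>F s in at_right 0. \<omega> s \<in> Q)"
    and \<gamma>: "ctrl U \<beta> \<gamma>"
  shows "\<exists>\<delta>>0. \<forall>t. 0 \<le> t \<and> t < \<delta> \<longrightarrow> \<phi> (\<gamma> t) y \<in> Q"
proof -
  note dh = smooth_atlas_chart[OF atlas_M d(1)]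
  obtain r1 K where r1: "r1 > 0" "K \<ge> 0" "cball (snd d y) r1 \<subseteq> snd d ` fst d"
    "\<And>p q u. p \<in> cball (snd d y) r1 \<Longrightarrow> q \<in> cball (snd d y) r1 \<Longrightarrow>
      norm (in_chart AM d (chart_inv d p) (X (chart_inv d p) u) -
        in_chart AM d (chart_inv d q) (X (chart_inv d q) u)) \<le> K * norm u * norm (p - q)"
    by (rule X_lipschitz[OF d]) blast
  define r2 where "r2 = min r r1"
  have r2: "r2 > 0" "r2 \<le> r" "r2 \<le> r1" using r r1 by (auto simp: r2_def)
  define Q2 where "Q2 = snd d ` (Q \<inter> fst d) \<inter> cball (snd d y) r2"
  have "Q2 = (snd d ` (Q \<inter> fst d) \<inter> cball (snd d y) r) \<inter> cball (snd d y) r2"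
    using r2 by (auto simp: Q2_def)
  then have cQ2: "compact Q2" using compact_Int_closed[OF cpt closed_cball] by simp
  obtain \<delta>1 where \<delta>1: "\<delta>1 > 0" "\<forall>t. \<bar>t\<bar> < \<delta>1 \<longrightarrow> (\<exists>u\<in>U. norm u \<le> \<beta> \<and> rlog \<gamma> u t)" and g0: "\<gamma> 0 = \<one>"
    using \<gamma> by (auto simp: ctrl_def)
  then obtain u where u: "\<And>t. \<bar>t\<bar> < \<delta>1 \<Longrightarrow> u t \<in> U \<and> norm (u t) \<le> \<beta> \<and> rlog \<gamma> (u t) t" by metis
  have \<beta>: "\<beta> \<ge> 0" using u[of 0] \<delta>1 norm_ge_zero[of "u 0"] by linarith
  define \<sigma> where "\<sigma> = (\<lambda>t. \<phi> (\<gamma> t) y)"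
  have \<sigma>0: "\<sigma> 0 = y" by (simp add: \<sigma>_def g0)
  have vel: "has_velocity AM \<sigma> (X (\<sigma> t) (u t)) t" if "\<bar>t\<bar> < \<delta>1" for t
    using orbit_velocity[of \<gamma> "u t" t y] u[OF that] by (simp add: \<sigma>_def)
  have ic: "isCont \<sigma> t" if "\<bar>t\<bar> < \<delta>1" for t
    using vel[OF that] by (simp add: has_velocity_def tdiff_def)
  \<comment> \<open>If the orbit stays within \<open>r2 / 3\<close> of \<open>y\<close>, a point
    itself in \<open>Q2\<close>, then nearest points of \<open>Q2\<close> lie within
    \<open>2 r2 / 3\<close> of \<open>y\<close>. They are interior to the ball, so test curves
    issuing from them remain in \<open>Q2\<close> for a while.\<close>
  define N where "N = fst d \<inter> snd d -` ball (snd d y) (r2 / 3)"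
  have N: "open N" "y \<in> N" unfolding N_def using dh d r2
    by (auto intro: continuous_open_preimage)
  obtain \<delta>2 where \<delta>2: "\<delta>2 > 0" "\<And>t. \<bar>t\<bar> < \<delta>2 \<Longrightarrow> \<sigma> t \<in> N"
    using isCont_eventually_in[OF ic[of 0] N(1)] N(2) \<delta>1 \<sigma>0 by (auto simp: eventually_nhds_metric dist_real_def)
  define \<delta> where "\<delta> = min \<delta>1 \<delta>2 / 2"
  have \<delta>: "\<delta> > 0" "\<delta> < \<delta>1" "\<delta> < \<delta>2" using \<delta>1 \<delta>2 by (auto simp: \<delta>_def)
  have inN: "\<sigma> t \<in> fst d" "dist (snd d y) (snd d (\<sigma> t)) < r2 / 3" if "t \<in> {0..\<delta>}" for t
    using \<delta>2(2)[of t] that \<delta> by (auto simp: N_def)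
  have "\<sigma> t \<in> Q" if t: "t \<in> {0..\<delta>}" for t
  proof -
    have "snd d (\<sigma> t) \<in> Q2"
    proof (rule nagumo_invariance[where x="\<lambda>t. snd d (\<sigma> t)" and a=0 and b=\<delta> and K="K * \<beta>"
        and x'="\<lambda>t. in_chart AM d (\<sigma> t) (X (\<sigma> t) (u t))", OF compact_imp_closed[OF cQ2] _ _ _ _ _ t])
      show "snd d (\<sigma> 0) \<in> Q2" using yQ d r2 by (simp add: \<sigma>0 Q2_def)
      show "0 \<le> K * \<beta>" using r1 \<beta> by simp
      have der: "((\<lambda>t. snd d (\<sigma> t)) has_vector_derivative in_chart AM d (\<sigma> t) (X (\<sigma> t) (u t))) (at t)"
        if "0 \<le> t" "t \<le> \<delta>" for t
        using vel[of t] inN(1)[of t] that \<delta> has_velocity_chart[OF atlas_M d(1), of \<sigma> t] by auto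
      then show "0 \<le> t \<Longrightarrow> t < \<delta> \<Longrightarrow> ((\<lambda>t. snd d (\<sigma> t)) has_vector_derivative in_chart AM d (\<sigma> t) (X (\<sigma> t) (u t))) (at t)" for t
        by simp
      show "continuous_on {0..\<delta>} (\<lambda>t. snd d (\<sigma> t))"
        by (intro continuous_at_imp_continuous_on ballI has_vector_derivative_continuous[OF der]) auto
      fix t w assume t: "0 \<le> t" "t < \<delta>" and w: "w \<in> Q2" "dist (snd d (\<sigma> t)) w = infdist (snd d (\<sigma> t)) Q2"
      obtain q where q: "q \<in> Q" "q \<in> fst d" "w = snd d q" using w(1) by (auto simp: Q2_def)
      have near: "dist (snd d y) (snd d (\<sigma> t)) < r2 / 3" using inN(2)[of t] t by simp
      have "snd d y \<in> Q2" using yQ d r2 by (simp add: Q2_def)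
      then have "dist (snd d (\<sigma> t)) w \<le> dist (snd d (\<sigma> t)) (snd d y)" unfolding w(2) by (rule infdist_le)
      then have wy: "dist (snd d y) w < r2"
        using near r2(1) dist_triangle[of "snd d y" w "snd d (\<sigma> t)"] by (simp add: dist_commute)
      obtain \<omega> where \<omega>: "\<omega> 0 = q" "has_velocity AM \<omega> (X q (u t)) 0" "\<forall>\<^sub>F s in at_right 0. \<omega> s \<in> Q"
        using sub[of q "u t"] q wy r2 u[of t] t \<delta> by auto
      have ov: "isCont \<omega> 0" "((\<lambda>s. snd d (\<omega> s)) has_vector_derivative in_chart AM d q (X q (u t))) (at 0)"
        using \<omega>(1,2) q(2) has_velocity_chart[OF atlas_M d(1), of \<omega> 0] by auto
      have "open (fst d \<inter> snd d -` ball (snd d y) r2)" using dh by (auto intro: continuous_open_preimage)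
      from isCont_eventually_in[OF ov(1) this]
      have "\<forall>\<^sub>F s in nhds 0. \<omega> s \<in> fst d \<inter> snd d -` ball (snd d y) r2" using q wy \<omega>(1) by simp
      then have "\<forall>\<^sub>F s in at_right 0. \<omega> s \<in> fst d \<inter> snd d -` ball (snd d y) r2"
        by (rule filter_leD[OF at_within_le_nhds])
      with \<omega>(3) have "\<forall>\<^sub>F s in at_right 0. snd d (\<omega> s) \<in> Q2"
        by eventually_elim (auto simp: Q2_def)
      moreover have "norm (in_chart AM d (\<sigma> t) (X (\<sigma> t) (u t)) - in_chart AM d q (X q (u t))) \<le> K * \<beta> * norm (snd d (\<sigma> t) - w)"
      proof -
        have st: "\<sigma> t \<in> fst d" using inN(1)[of t] t by simp
        have "norm (in_chart AM d (\<sigma> t) (X (\<sigma> t) (u t)) - in_chart AM d q (X q (u t))) \<le> K * norm (u t) * norm (snd d (\<sigma> t) - w)"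
          using r1(4)[of "snd d (\<sigma> t)" w "u t"] near wy r2 dh(5)[OF st] dh(5)[OF q(2)] by (simp add: q(3))
        also have "\<dots> \<le> K * \<beta> * norm (snd d (\<sigma> t) - w)"
          using u[of t] t \<delta> r1(2) by (intro mult_right_mono mult_left_mono) auto
        finally show ?thesis .
      qed
      ultimately show "\<exists>\<omega> v. \<omega> 0 = w \<and> (\<omega> has_vector_derivative v) (at 0) \<and> (\<forall>\<^sub>F s in at_right 0. \<omega> s \<in> Q2) \<and>
        norm (in_chart AM d (\<sigma> t) (X (\<sigma> t) (u t)) - v) \<le> K * \<beta> * norm (snd d (\<sigma> t) - w)"
        using ov(2) \<omega>(1) q(3) by (intro exI[of _ "\<lambda>s. snd d (\<omega> s)"] exI[of _ "in_chart AM d q (X q (u t))"]) auto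
    qed
    then obtain q where q: "q \<in> Q" "q \<in> fst d" "snd d (\<sigma> t) = snd d q" by (auto simp: Q2_def)
    then show ?thesis using dh(5)[OF q(2)] dh(5)[OF inN(1)[OF t]] by simp
  qed
  then show ?thesis using \<delta>(1) unfolding \<sigma>_def by (intro exI[of _ \<delta>]) auto
qed

end

section \<open>The group acting on itself by left multiplication\<close>

context lie_grp
begin

lemma self_action: "smooth_action G AG AG (\<lambda>g h. g \<otimes> h)"
  using lie by unfold_locales (auto simp: lie_group_def m_assoc)

lemma line_velocity:
  assumes "p1 + t *\<^sub>R v \<in> snd c1 ` fst c1"
  shows "has_velocity AG (line v) (from_chart AG c1 (p1 + t *\<^sub>R v) v) t"
proof -
  have "has_velocity euclidean_atlas (\<lambda>s. p1 + s *\<^sub>R v) v t"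
    unfolding has_velocity_euclidean by (auto intro!: derivative_eq_intros)
  from has_velocity_map[OF smooth_atlas_euclidean atlas_G this tdiff_chart_inv[OF atlas_G c1(1) assms]]
  show ?thesis by (simp add: line_def[abs_def] from_chart_def)
qed

lemma line_rlog:
  obtains r where "r > 0" "cball p1 r \<subseteq> snd c1 ` fst c1"
    "\<And>v t. norm v \<le> r \<Longrightarrow> \<bar>t\<bar> \<le> 2 \<Longrightarrow> \<exists>u. norm u \<le> 2 * norm v \<and> rlog (line v) u t"
proof -
  interpret self: smooth_action G AG AG "\<lambda>g h. g \<otimes> h" by (rule self_action)
  obtain r K where r: "r > 0" "K \<ge> 0" "cball (snd c1 \<one>) r \<subseteq> snd c1 ` fst c1"
    "\<And>p q u. p \<in> cball (snd c1 \<one>) r \<Longrightarrow> q \<in> cball (snd c1 \<one>) r \<Longrightarrow>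
      norm (in_chart AG c1 (chart_inv c1 p) (self.X (chart_inv c1 p) u) -
        in_chart AG c1 (chart_inv c1 q) (self.X (chart_inv c1 q) u)) \<le> K * norm u * norm (p - q)"
    by (rule self.X_lipschitz[OF c1]) blast
  \<comment> \<open>For \<open>norm v \<le> s\<close> and times up to 2 the segment stays in the
    ball of radius \<open>r\<close>, and the Lipschitz deviation \<open>K\<close> times
    \<open>2 s\<close> is at most 1/2.\<close>
  define s where "s = min (r / 2) (1 / (4 * (K + 1)))"
  have s: "s > 0" "2 * s \<le> r" "K * (2 * s) \<le> 1 / 2"
  proof -
    show "s > 0" "2 * s \<le> r" using r(1,2) by (auto simp: s_def)
    have "K * (2 * s) \<le> K * (2 * (1 / (4 * (K + 1))))" using r(2) by (intro mult_left_mono) (auto simp: s_def)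
    also have "\<dots> \<le> 1 / 2" using r(2) by (simp add: field_simps)
    finally show "K * (2 * s) \<le> 1 / 2" .
  qed
  have X1: "self.X \<one> u = u" for u
    using tdiff_id(2)[OF atlas_G, of "\<one>" u] by (simp add: self.X_def)
  have "\<exists>u. norm u \<le> 2 * norm v \<and> rlog (line v) u t" if v: "norm v \<le> s" "\<bar>t\<bar> \<le> 2" for v t
  proof -
    define p where "p = p1 + t *\<^sub>R v"
    have pd: "norm (p - p1) \<le> 2 * s"
      using mult_mono[OF v(2) v(1)] by (simp add: p_def)
    then have pr: "p \<in> cball (snd c1 \<one>) r" using s by (simp add: dist_norm p1_def[symmetric] norm_minus_commute)
    then have pp: "p \<in> snd c1 ` fst c1" using r(3) by blast
    define w where "w = from_chart AG c1 p v"
    have vel: "has_velocity AG (line v) w t" using line_velocity[of t v] pp by (simp add: w_def p_def)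
    define u where "u = tangent_map AG AG (\<lambda>h. h \<otimes> inv (line v t)) (line v t) w"
    have rl: "rlog (line v) u t" unfolding u_def by (rule rlog_of_velocity[OF vel])
    have "has_velocity AG (\<lambda>s. line v s \<otimes> \<one>) (self.X (line v t \<otimes> \<one>) u) t" by (rule self.orbit_velocity[OF rl])
    then have "self.X (line v t) u = w" using has_velocity_unique[OF vel] by simp
    moreover have "line v t = chart_inv c1 p" by (simp add: line_def p_def)
    ultimately have vX: "v = in_chart AG c1 (chart_inv c1 p) (self.X (chart_inv c1 p) u)"
      using in_chart_from_chart[OF atlas_G c1(1) pp, of v] by (simp add: w_def)
    have "norm (v - u) \<le> K * norm u * norm (p - p1)"
      using r(4)[OF pr, of p1 u] r(1) vX p1(2) X1 by (simp add: p1_def)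
    also have "\<dots> \<le> K * norm u * (2 * s)" using pd r(2) by (intro mult_left_mono) auto
    also have "\<dots> = (K * (2 * s)) * norm u" by simp
    also have "\<dots> \<le> 1 / 2 * norm u" using s(3) by (rule mult_right_mono) simp
    finally have "norm u \<le> 2 * norm v" using norm_triangle_ineq2[of u v] by (simp add: norm_minus_commute)
    then show ?thesis using rl by blast
  qed
  moreover have "cball p1 s \<subseteq> snd c1 ` fst c1" using r(1,3) s by (auto simp: p1_def subset_iff)
  ultimately show ?thesis using that s(1) by blast
qed

text \<open>A connected group is generated by any neighbourhood of the identity: relating
  \<open>g\<close> to \<open>h\<close> when \<open>inv g \<otimes> h\<close> satisfies
  \<open>P\<close> is an equivalence relation with open classes.\<close>

lemma connected_generated:
  assumes conn: "connected (UNIV :: 'g set)" and r: "r > 0"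
    and loc: "\<And>v. norm v \<le> r \<Longrightarrow> P (line v 1)"
    and one: "P \<one>" and mult: "\<And>g h. P g \<Longrightarrow> P h \<Longrightarrow> P (g \<otimes> h)" and inv: "\<And>g. P g \<Longrightarrow> P (inv g)"
  shows "P g"
proof -
  note ch = smooth_atlas_chart[OF atlas_G c1(1)]
  define N where "N = fst c1 \<inter> snd c1 -` ball p1 r"
  have N: "open N" "\<one> \<in> N" unfolding N_def using ch c1 r by (auto simp: p1_def intro: continuous_open_preimage)
  have NP: "P k" if "k \<in> N" for k
  proof -
    have "norm (snd c1 k - p1) \<le> r" "line (snd c1 k - p1) 1 = k"
      using that ch by (auto simp: N_def line_def dist_norm norm_minus_commute)
    then show ?thesis using loc by metis
  qed
  have "P (inv \<one> \<otimes> g)"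
  proof (rule connected_equivalence_relation[OF conn, where R="\<lambda>g h. P (inv g \<otimes> h)"])
    fix a b assume "P (inv a \<otimes> b)"
    from inv[OF this] show "P (inv b \<otimes> a)" by (simp add: inv_mult_group)
  next
    fix a b c assume "P (inv a \<otimes> b)" "P (inv b \<otimes> c)"
    from mult[OF this] show "P (inv a \<otimes> c)" by (simp add: m_assoc) (simp add: m_assoc[symmetric])
  next
    fix a :: 'g
    have "open ((\<lambda>h. inv a \<otimes> h) -` N)"
      by (intro open_vimage N continuous_intros)
    then show "\<exists>T. openin (top_of_set UNIV) T \<and> a \<in> T \<and> (\<forall>x\<in>T. P (inv a \<otimes> x))"
      using N NP by (intro exI[of _ "(\<lambda>h. inv a \<otimes> h) -` N"]) auto
  qed auto
  then show ?thesis by simp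
qed

text \<open>Takes the place of the closed subgroup theorem. A curve in \<open>S\<close> tangent to
  \<open>u\<close> at the identity, multiplied on the right by \<open>w\<close> in \<open>S\<close>,
  is a curve in \<open>S\<close> tangent to the fundamental field at \<open>w\<close>, so
  \<open>local_invariance\<close> applies to \<open>S\<close>. Only forward times occur, as
  \<open>S\<close> is merely a submonoid.\<close>

lemma closed_submonoid_curve:
  assumes S: "closed S" "\<one> \<in> S" "\<And>g h. g \<in> S \<Longrightarrow> h \<in> S \<Longrightarrow> g \<otimes> h \<in> S"
    and tang: "\<And>u. u \<in> U \<Longrightarrow> \<exists>\<omega>. \<omega> 0 = \<one> \<and> has_velocity AG \<omega> u 0 \<and> (\<forall>\<^sub>F s in at_right 0. \<omega> s \<in> S)"
    and \<gamma>: "ctrl U \<beta> \<gamma>"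
  shows "\<exists>\<delta>>0. \<forall>t. 0 \<le> t \<and> t < \<delta> \<longrightarrow> \<gamma> t \<in> S"
proof -
  interpret self: smooth_action G AG AG "\<lambda>g h. g \<otimes> h" by (rule self_action)
  note ch = smooth_atlas_chart[OF atlas_G c1(1)]
  obtain r where r: "r > 0" "cball p1 r \<subseteq> snd c1 ` fst c1" using line_rlog by metis
  have "snd c1 ` (S \<inter> fst c1) \<inter> cball p1 r = cball p1 r \<inter> chart_inv c1 -` S"
  proof (intro equalityI subsetI)
    fix p assume "p \<in> cball p1 r \<inter> chart_inv c1 -` S"
    moreover then have "p \<in> snd c1 ` fst c1" using r by blast
    ultimately show "p \<in> snd c1 ` (S \<inter> fst c1) \<inter> cball p1 r"
      using ch by (auto intro!: image_eqI[of p _ "chart_inv c1 p"])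
  qed (use ch in auto)
  moreover have "closed (cball p1 r \<inter> chart_inv c1 -` S)"
    by (intro continuous_closed_preimage continuous_on_subset[OF ch(4)] r S) simp
  ultimately have cpt: "compact (snd c1 ` (S \<inter> fst c1) \<inter> cball (snd c1 \<one>) r)"
    using compact_Int_closed[OF compact_cball, of _ p1 r] by (simp add: p1_def[symmetric]) (metis inf.left_idem)
  have "\<exists>\<delta>>0. \<forall>t. 0 \<le> t \<and> t < \<delta> \<longrightarrow> \<gamma> t \<otimes> \<one> \<in> S"
  proof (rule self.local_invariance[OF c1 S(2) r(1) cpt _ \<gamma>])
    fix w u assume w: "w \<in> S" and u: "u \<in> U"
    obtain \<omega> where \<omega>: "\<omega> 0 = \<one>" "has_velocity AG \<omega> u 0" "\<forall>\<^sub>F s in at_right 0. \<omega> s \<in> S"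
      using tang[OF u] by blast
    have "has_velocity AG (\<lambda>s. \<omega> s \<otimes> w) (self.X w u) 0" by (rule self.orbit_velocity_one[OF \<omega>(2,1)])
    moreover have "\<forall>\<^sub>F s in at_right 0. \<omega> s \<otimes> w \<in> S" using \<omega>(3) by eventually_elim (use S(3) w in auto)
    ultimately show "\<exists>\<omega>. \<omega> 0 = w \<and> has_velocity AG \<omega> (self.X w u) 0 \<and> (\<forall>\<^sub>F s in at_right 0. \<omega> s \<in> S)"
      using \<omega>(1) by (intro exI[of _ "\<lambda>s. \<omega> s \<otimes> w"]) auto
  qed
  then show ?thesis by simp
qed

end

section \<open>Propagation along orbits of a connected group\<close>

context smooth_action
begin

text \<open>Connectedness is used twice: the group is generated by end points of segments, and along
  a segment the parameter interval [0,1] is connected, so a relation that holds locally in time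
  holds between its ends.\<close>

lemma connected_orbit_relation:
  assumes conn: "connected (UNIV :: 'g set)"
    and refl: "\<And>x. R x x" and sym: "\<And>x y. R x y \<Longrightarrow> R y x" and trans: "\<And>x y z. R x y \<Longrightarrow> R y z \<Longrightarrow> R x z"
    and loc: "\<And>y \<gamma> \<beta>. ctrl UNIV \<beta> \<gamma> \<Longrightarrow> \<exists>\<delta>>0. \<forall>t. 0 \<le> t \<and> t < \<delta> \<longrightarrow> R y (\<phi> (\<gamma> t) y)"
  shows "R y (\<phi> g y)"
proof -
  obtain r where r: "r > 0" "cball p1 r \<subseteq> snd c1 ` fst c1"
    "\<And>v t. norm v \<le> r \<Longrightarrow> \<bar>t\<bar> \<le> 2 \<Longrightarrow> \<exists>u. norm u \<le> 2 * norm v \<and> rlog (line v) u t"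
    by (rule line_rlog) blast
  have "\<forall>y. R y (\<phi> g y)"
  proof (rule connected_generated[OF conn r(1), where P="\<lambda>g. \<forall>y. R y (\<phi> g y)"])
    fix v :: 'b assume v: "norm v \<le> r"
    have l0: "line v 0 = \<one>" by (simp add: line_def p1)
    show "\<forall>y. R y (\<phi> (line v 1) y)"
    proof
      fix y
      have "R (\<phi> (line v 0) y) (\<phi> (line v 1) y)"
      proof (rule connected_equivalence_relation[of "{0..1::real}", where R="\<lambda>s t. R (\<phi> (line v s) y) (\<phi> (line v t) y)"])
        fix t0 :: real assume t0: "t0 \<in> {0..1}"
        \<comment> \<open>The hypothesis \<open>loc\<close> speaks of forward time only;
          \<open>k = 1\<close> and \<open>k = -1\<close> run the segment away from \<open>t0\<close>
          in both directions.\<close>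
        have c: "ctrl UNIV (2 * norm v) (\<lambda>s. line v (t0 + k * s) \<otimes> inv (line v t0))" if k: "\<bar>k\<bar> = 1" for k
          unfolding ctrl_def
        proof (intro conjI exI[of _ "1::real"] allI impI)
          fix t :: real assume t: "\<bar>t\<bar> < 1"
          have "\<bar>k * t\<bar> < 1" using t k by (simp add: abs_mult)
          then have "\<bar>t0 + k * t\<bar> \<le> 2" using t0 by auto
          then obtain u where u: "norm u \<le> 2 * norm v" "rlog (line v) u (t0 + k * t)" using r(3)[OF v] by blast
          show "\<exists>u\<in>UNIV. norm u \<le> 2 * norm v \<and> rlog (\<lambda>s. line v (t0 + k * s) \<otimes> inv (line v t0)) u t"
            using rlog_shift[OF u(2)] u(1) k by (intro bexI[of _ "k *\<^sub>R u"]) auto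
        qed auto
        have "\<exists>\<delta>>0. \<forall>t. 0 \<le> t \<and> t < \<delta> \<longrightarrow> R (\<phi> (line v t0) y) (\<phi> (line v (t0 + k * t)) y)" if "\<bar>k\<bar> = 1" for k
          using loc[OF c[OF that], of "\<phi> (line v t0) y"] by (simp add: act_mult)
        from this[of 1] this[of "-1"] obtain \<delta>1 \<delta>2 where \<delta>: "\<delta>1 > 0" "\<delta>2 > 0"
          "\<And>t. 0 \<le> t \<Longrightarrow> t < \<delta>1 \<Longrightarrow> R (\<phi> (line v t0) y) (\<phi> (line v (t0 + t)) y)"
          "\<And>t. 0 \<le> t \<Longrightarrow> t < \<delta>2 \<Longrightarrow> R (\<phi> (line v t0) y) (\<phi> (line v (t0 - t)) y)" by auto
        have "R (\<phi> (line v t0) y) (\<phi> (line v t) y)" if "dist t0 t < min \<delta>1 \<delta>2" for t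
          using \<delta>(3)[of "t - t0"] \<delta>(4)[of "t0 - t"] that by (cases "t0 \<le> t") (auto simp: dist_real_def)
        then show "\<exists>T. openin (top_of_set {0..1}) T \<and> t0 \<in> T \<and> (\<forall>x\<in>T. R (\<phi> (line v t0) y) (\<phi> (line v x) y))"
          using t0 \<delta> by (intro exI[of _ "{0..1} \<inter> ball t0 (min \<delta>1 \<delta>2)"]) (auto simp: openin_open_Int)
      qed (auto intro: sym trans)
      then show "R y (\<phi> (line v 1) y)" by (simp add: l0)
    qed
  next
    fix g h assume "\<forall>y. R y (\<phi> g y)" "\<forall>y. R y (\<phi> h y)"
    then show "\<forall>y. R y (\<phi> (g \<otimes> h) y)" unfolding act_mult using trans by blast
  next
    fix g assume g: "\<forall>y. R y (\<phi> g y)"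
    show "\<forall>y. R y (\<phi> (inv g) y)"
    proof
      fix y show "R y (\<phi> (inv g) y)" using g[rule_format, of "\<phi> (inv g) y"] sym by simp
    qed
  qed (simp add: refl)
  then show ?thesis by blast
qed

end

text \<open>The cosets of \<open>S\<close> form an equivalence relation that every driven curve
  respects locally, by \<open>closed_submonoid_curve\<close>.\<close>

lemma (in lie_grp) closed_subgroup_full:
  assumes conn: "connected (UNIV :: 'g set)"
    and S: "closed S" "\<one> \<in> S" "\<And>g h. g \<in> S \<Longrightarrow> h \<in> S \<Longrightarrow> g \<otimes> h \<in> S" "\<And>g. g \<in> S \<Longrightarrow> inv g \<in> S"
    and tang: "\<And>u. \<exists>\<omega>. \<omega> 0 = \<one> \<and> has_velocity AG \<omega> u 0 \<and> (\<forall>\<^sub>F s in at_right 0. \<omega> s \<in> S)"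
  shows "g \<in> S"
proof -
  interpret self: smooth_action G AG AG "\<lambda>g h. g \<otimes> h" by (rule self_action)
  have "(g \<otimes> \<one>) \<otimes> inv \<one> \<in> S"
  proof (rule self.connected_orbit_relation[OF conn, where R="\<lambda>x y. y \<otimes> inv x \<in> S"])
    fix x y assume "y \<otimes> inv x \<in> S"
    from S(4)[OF this] show "x \<otimes> inv y \<in> S" by (simp add: inv_mult_group)
  next
    fix x y z assume 1: "y \<otimes> inv x \<in> S" and 2: "z \<otimes> inv y \<in> S"
    show "z \<otimes> inv x \<in> S" using S(3)[OF 2 1] by (simp add: m_assoc)
  next
    fix y \<gamma> \<beta> assume "ctrl UNIV \<beta> \<gamma>"
    from closed_submonoid_curve[OF S(1-3) tang this]
    show "\<exists>\<delta>>0. \<forall>t. 0 \<le> t \<and> t < \<delta> \<longrightarrow> \<gamma> t \<otimes> y \<otimes> inv y \<in> S" by (simp add: m_assoc)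
  qed (simp add: S)
  then show ?thesis by simp
qed

section \<open>The adjoint representation and the bracket\<close>

text \<open>Picard iteration as a contraction on bounded continuous functions on the whole line;
  both the field and the time variable are truncated so that no domain has to be watched.\<close>

lemma picard_local:
  fixes f :: "'a::euclidean_space \<Rightarrow> 'a"
  assumes r: "r > 0" and K: "K \<ge> 0"
    and lip: "\<And>p q. p \<in> cball x0 r \<Longrightarrow> q \<in> cball x0 r \<Longrightarrow> norm (f p - f q) \<le> K * norm (p - q)"
  obtains \<delta> x where "\<delta> > 0" "x 0 = x0"
    "\<And>t. \<bar>t\<bar> < \<delta> \<Longrightarrow> x t \<in> cball x0 r \<and> (x has_vector_derivative f (x t)) (at t)"
proof -
  let ?B = "cball x0 r"
  \<comment> \<open>Projection to a ball does not increase distances, so \<open>g\<close> is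
    globally Lipschitz with the same constant as \<open>f\<close> on the ball.\<close>
  define g where "g = (\<lambda>y. f (closest_point ?B y))"
  have cp: "closest_point ?B y \<in> ?B" for y using r by (intro closest_point_in_set) auto
  have glip: "norm (g p - g q) \<le> K * norm (p - q)" for p q
  proof -
    have "norm (g p - g q) \<le> K * norm (closest_point ?B p - closest_point ?B q)"
      unfolding g_def by (rule lip[OF cp cp])
    also have "\<dots> \<le> K * norm (p - q)"
      using closest_point_lipschitz[of ?B p q] r K by (intro mult_left_mono) (auto simp: dist_norm)
    finally show ?thesis .
  qed
  have gcont: "continuous_on UNIV g"
    using K glip by (intro lipschitz_on_continuous_on[of K]) (auto simp: lipschitz_on_def dist_norm)
  define M where "M = norm (f x0) + K * r"
  have gM: "norm (g y) \<le> M" for y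
  proof -
    have "norm (f (closest_point ?B y) - f x0) \<le> K * norm (closest_point ?B y - x0)" using cp r by (intro lip) auto
    also have "\<dots> \<le> K * r" using cp[of y] K by (intro mult_left_mono) (auto simp: dist_norm norm_minus_commute)
    finally show ?thesis unfolding g_def M_def using norm_triangle_sub[of "f (closest_point ?B y)" "f x0"] by simp
  qed
  \<comment> \<open>The operator \<open>P\<close> contains two integrals over intervals of length at
    most \<open>2 \<delta>\<close>, so its Lipschitz constant is at most
    \<open>4 \<delta> K \<le> 1 / 2\<close>.\<close>
  define \<delta> where "\<delta> = 1 / (8 * (K + 1))"
  have \<delta>: "\<delta> > 0" "4 * \<delta> * K \<le> 1 / 2"
    using K by (auto simp: \<delta>_def divide_simps)
  \<comment> \<open>Clamps time to the interval on which the integral is taken. The integral starts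
    at the left end and \<open>F y 0\<close> is subtracted, which yields a two-sided solution with
    value \<open>x0\<close> at 0.\<close>
  define c where "c = (\<lambda>t::real. max (- \<delta>) (min \<delta> t))"
  have c: "c t \<in> {-\<delta>..\<delta>}" for t using \<delta> by (auto simp: c_def)
  have c0: "0 \<in> {-\<delta>..\<delta>}" using \<delta> by auto
  have ccont: "continuous_on UNIV c" unfolding c_def by (intro continuous_intros)
  define F where "F = (\<lambda>y t. integral {-\<delta>..t} (\<lambda>s. g (apply_bcontfun y s)))"
  have icont: "continuous_on S (\<lambda>s. g (apply_bcontfun y s))" for y S
    by (intro continuous_on_compose2[OF gcont]) auto
  have Fcont: "continuous_on {-\<delta>..\<delta>} (F y)" for y
    unfolding F_def by (intro indefinite_integral_continuous_1 integrable_continuous_real icont)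
  define P where "P = (\<lambda>y t. x0 + F y (c t) - F y 0)"
  have Fb: "norm (F y t) \<le> M * (t - (- \<delta>))" if "t \<in> {-\<delta>..\<delta>}" for y t
    unfolding F_def by (rule integral_bound) (use that gM icont in auto)
  have M0: "M \<ge> 0" using gM[of x0] norm_ge_zero order_trans by blast
  have Fb': "norm (F y t) \<le> M * (2 * \<delta>)" if "t \<in> {-\<delta>..\<delta>}" for y t
    by (rule order_trans[OF Fb[OF that] mult_left_mono[OF _ M0]]) (use that in auto)
  have Pb: "P y \<in> bcontfun" for y
  proof (rule bcontfun_normI)
    show "continuous_on UNIV (P y)" unfolding P_def
      by (intro continuous_intros continuous_on_compose2[OF Fcont ccont]) (use c in auto)
    show "norm (P y t) \<le> norm x0 + M * (2 * \<delta>) + M * (2 * \<delta>)" for t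
      unfolding P_def using Fb'[OF c, of y t] Fb'[OF c0, of y]
      by (intro order_trans[OF norm_triangle_ineq4] add_mono order_trans[OF norm_triangle_ineq]) auto
  qed
  have contr: "dist (Bcontfun (P y)) (Bcontfun (P z)) \<le> 1 / 2 * dist y z" for y z
  proof (rule dist_bound)
    fix t
    have Fd: "norm (F y t - F z t) \<le> K * dist y z * (2 * \<delta>)" if t: "t \<in> {-\<delta>..\<delta>}" for t
    proof -
      have "F y t - F z t = integral {-\<delta>..t} (\<lambda>s. g (apply_bcontfun y s) - g (apply_bcontfun z s))"
        unfolding F_def by (intro Henstock_Kurzweil_Integration.integral_diff[symmetric] integrable_continuous_real icont)
      also have "norm \<dots> \<le> K * dist y z * (t - (- \<delta>))"
      proof (rule integral_bound)
        show "norm (g (apply_bcontfun y s) - g (apply_bcontfun z s)) \<le> K * dist y z" for s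
          using glip[of "apply_bcontfun y s" "apply_bcontfun z s"] dist_bounded[of y s z] K
          by (metis dist_norm mult_left_mono order_trans)
      qed (use t in \<open>auto intro!: continuous_intros icont\<close>)
      also have "\<dots> \<le> K * dist y z * (2 * \<delta>)" using t K by (intro mult_left_mono) auto
      finally show ?thesis .
    qed
    have eq: "P y t - P z t = (F y (c t) - F z (c t)) - (F y 0 - F z 0)" by (simp add: P_def)
    have "norm (P y t - P z t) \<le> K * dist y z * (2 * \<delta>) + K * dist y z * (2 * \<delta>)"
      unfolding eq using Fd[OF c, of t] Fd[OF c0] norm_triangle_ineq4[of "F y (c t) - F z (c t)" "F y 0 - F z 0"] by linarith
    also have "\<dots> = (4 * \<delta> * K) * dist y z" by simp
    also have "\<dots> \<le> 1 / 2 * dist y z" using \<delta> by (intro mult_right_mono) auto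
    finally show "dist (apply_bcontfun (Bcontfun (P y)) t) (apply_bcontfun (Bcontfun (P z)) t) \<le> 1 / 2 * dist y z"
      by (simp add: Bcontfun_inverse[OF Pb] dist_norm)
  qed
  have "\<exists>!y. Bcontfun (P y) = y"
    by (rule banach_fix_type[of "1 / 2"]) (use contr in auto)
  then obtain y where y: "Bcontfun (P y) = y" by blast
  define x where "x = apply_bcontfun y"
  have xP: "x t = P y t" for t using Bcontfun_inverse[OF Pb, of y] y by (simp add: x_def)
  have x0': "x 0 = x0" using \<delta> by (simp add: xP P_def c_def)
  have der: "(x has_vector_derivative g (x t)) (at t)" if t: "\<bar>t\<bar> < \<delta>" for t
  proof -
    have "((\<lambda>u. integral {-\<delta>..u} (\<lambda>s. g (apply_bcontfun y s))) has_vector_derivative g (apply_bcontfun y t)) (at t within {-\<delta>..\<delta>})"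
      by (rule integral_has_vector_derivative[OF icont]) (use t in auto)
    then have "(F y has_vector_derivative g (x t)) (at t)"
      using t at_within_Icc_at[of "-\<delta>" t \<delta>] by (simp add: F_def x_def)
    then have d: "((\<lambda>t. x0 + F y t - F y 0) has_vector_derivative g (x t)) (at t)"
      by (auto intro!: derivative_eq_intros)
    show ?thesis
      by (rule has_vector_derivative_transform_within_open[OF d, of "{-\<delta><..<\<delta>}"])
        (use t in \<open>auto simp: xP P_def c_def\<close>)
  qed
  \<comment> \<open>For short times the solution of the truncated equation lies in the ball, where
    \<open>g\<close> equals \<open>f\<close>.\<close>
  have "isCont x 0" using has_vector_derivative_continuous[OF der[of 0]] \<delta> by simp
  then obtain d where d: "d > 0" "\<And>t. \<bar>t\<bar> < d \<Longrightarrow> dist (x t) (x 0) < r"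
    using r unfolding continuous_at_eps_delta by (metis dist_real_def diff_zero)
  show ?thesis
  proof (rule that[of "min d \<delta>" x])
    show "min d \<delta> > 0" using d \<delta> by simp
    fix t assume t: "\<bar>t\<bar> < min d \<delta>"
    have "x t \<in> ?B" using d(2)[of t] t x0' by (auto simp: dist_commute)
    then show "x t \<in> ?B \<and> (x has_vector_derivative f (x t)) (at t)"
      using der[of t] t closest_point_self[of "x t" ?B] by (auto simp: g_def)
  qed (rule x0')
qed

lemma velocity_zero_const:
  assumes A: "smooth_atlas A" and v: "\<And>t. t \<in> S \<Longrightarrow> has_velocity A \<sigma> 0 t"
    and S: "open S" "connected S" "s \<in> S" "t \<in> S"
  shows "\<sigma> s = \<sigma> t"
proof (rule connected_equivalence_relation[OF S(2,3,4), where R="\<lambda>s t. \<sigma> s = \<sigma> t"])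
  fix t0 assume t0: "t0 \<in> S"
  define c where "c = chart_at A (\<sigma> t0)"
  have c: "c \<in> A" "\<sigma> t0 \<in> fst c" using chart_at_props[OF A] by (auto simp: c_def)
  note ch = smooth_atlas_chart[OF A c(1)]
  have "isCont \<sigma> t0" using v[OF t0] by (simp add: has_velocity_def tdiff_def)
  then have "\<forall>\<^sub>F t in nhds t0. \<sigma> t \<in> fst c" by (rule isCont_eventually_in[where f=\<sigma>, OF _ ch(1) c(2)])
  moreover have "\<forall>\<^sub>F t in nhds t0. t \<in> S" using S(1) t0 by (rule eventually_nhds_in_open)
  ultimately have "\<forall>\<^sub>F t in nhds t0. \<sigma> t \<in> fst c \<and> t \<in> S" by eventually_elim simp
  then obtain d where d: "d > 0" "\<And>t. dist t t0 < d \<Longrightarrow> \<sigma> t \<in> fst c \<and> t \<in> S"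
    by (auto simp: eventually_nhds_metric)
  have eq: "\<sigma> t0 = \<sigma> t" if t: "t \<in> ball t0 d" for t
  proof -
    have "((\<lambda>s. snd c (\<sigma> s)) has_derivative (\<lambda>h. 0)) (at u within ball t0 d)" if "u \<in> ball t0 d" for u
    proof -
      have u: "\<sigma> u \<in> fst c" "u \<in> S" using d(2)[of u] that by (auto simp: dist_commute)
      have "((\<lambda>s. snd c (\<sigma> s)) has_vector_derivative in_chart A c (\<sigma> u) 0) (at u)"
        using v[OF u(2)] has_velocity_chart[OF A c(1), of \<sigma> u 0] u(1) by simp
      then show ?thesis
        using linear_0[OF linear_in_chart[OF A c(1) u(1)]]
        by (auto simp: has_vector_derivative_def intro: has_derivative_at_withinI)
    qed
    then have "\<exists>k. \<forall>u\<in>ball t0 d. snd c (\<sigma> u) = k"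
      by (intro has_derivative_zero_constant) auto
    then have "snd c (\<sigma> t0) = snd c (\<sigma> t)" using t d(1) by (metis centre_in_ball)
    then show ?thesis using ch(5) c(2) d(2)[of t] t by (metis dist_commute mem_ball)
  qed
  show "\<exists>T. openin (top_of_set S) T \<and> t0 \<in> T \<and> (\<forall>x\<in>T. \<sigma> t0 = \<sigma> x)"
    using t0 d eq by (intro exI[of _ "S \<inter> ball t0 d"]) (auto simp: openin_open_Int)
qed auto

section \<open>Bracket and adjoint action from the second differential of the multiplication\<close>

context lie_grp
begin

abbreviation "br \<equiv> lie_bracket G AG"
abbreviation "LL \<equiv> loc_rep c1 c1 c1 (\<lambda>(g, h). g \<otimes> h)"
abbreviation "LS \<equiv> loc_dom c1 c1 c1 (\<lambda>(g, h). g \<otimes> h)"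

text \<open>The second differential of the multiplication at the pair of identities, in the chart at
  the identity. Its mixed part determines both the bracket and the derivative of \<open>Ad\<close>,
  and its symmetry identifies the two.\<close>

definition H where
  "H a b = frechet_derivative (\<lambda>z. frechet_derivative LL (at z) a) (at (p1, p1)) b"

lemma LL_Ck: "Ck_on r LS LL" and LS_open: "open LS"
  using smooth_bimap.loc_rep_Ck[OF mult_bimap c1(1) c1(1) c1(1)]
    smooth_bimap.loc_dom_open[OF mult_bimap c1(1) c1(1) c1(1)] by auto

lemma LS_1:
  assumes "x \<in> snd c1 ` fst c1"
  shows "(p1, x) \<in> LS" "(x, p1) \<in> LS"
  using assms c1 p1 smooth_atlas_chart(7)[OF atlas_G c1(1) assms] by (auto simp: loc_dom_def)

lemma H_sym: "H a b = H b a"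
  unfolding H_def using second_derivative_symmetric[OF LL_Ck LS_open LS_1(1)[OF p1(1)]] .

lemma LL_D: "z \<in> LS \<Longrightarrow> (LL has_derivative frechet_derivative LL (at z)) (at z)"
  using Ck_on_SucE[OF LL_Ck[of "Suc 0"]] .

lemma LL_DD: "((\<lambda>z. frechet_derivative LL (at z) a) has_derivative H a) (at (p1, p1))"
proof -
  have "Ck_on (Suc 0) LS (\<lambda>z. frechet_derivative LL (at z) a)" using LL_Ck[of "Suc (Suc 0)"]
    unfolding Ck_on.simps(2)[of "Suc 0"] by blast
  from Ck_on_SucE[OF this LS_1(1)[OF p1(1)]] show ?thesis unfolding H_def[abs_def] .
qed

lemma H_linear: "linear (H a)" "linear (\<lambda>a. H a b)"
proof -
  show 1: "linear (H a)" for a using LL_DD by (rule has_derivative_linear)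
  show "linear (\<lambda>a. H a b)" unfolding H_sym[of _ b] by (rule 1)
qed

lemma right_field_chart:
  assumes "x \<in> snd c1 ` fst c1"
  shows "in_chart AG c1 (chart_inv c1 x) (tangent_map AG AG (\<lambda>h. h \<otimes> chart_inv c1 x) \<one> w) =
    frechet_derivative LL (at (p1, x)) (w, 0)"
proof -
  interpret self: smooth_action G AG AG "\<lambda>g h. g \<otimes> h" by (rule self_action)
  show ?thesis using self.X_chart[OF c1(1) assms, of w] by (simp add: self.X_def)
qed

lemma left_field_chart:
  assumes x: "x \<in> snd c1 ` fst c1"
  shows "in_chart AG c1 (chart_inv c1 x) (left_invariant_field G AG v (chart_inv c1 x)) =
    frechet_derivative LL (at (x, p1)) (0, v)"
proof -
  define g where "g = chart_inv c1 x"
  have g: "g \<in> fst c1" "snd c1 g = x" using smooth_atlas_chart[OF atlas_G c1(1)] x by (auto simp: g_def)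
  have z: "from_chart AG c1 x 0 = 0" by (rule linear_0[OF linear_from_chart[OF atlas_G c1(1) x]])
  have z': "tangent_map AG AG (\<lambda>h. h) g 0 = 0" by (rule tdiff_id(2)[OF atlas_G])
  show ?thesis
    using smooth_bimap.loc_rep_tangent[OF mult_bimap c1(1) g(1) c1 c1(1), of 0 v] g z z'
    by (simp add: g_def[symmetric] p1_def[symmetric] left_invariant_field_def)
qed

text \<open>Left multiplication by \<open>g\<close> is conjugation followed by right multiplication
  by \<open>g\<close>. Hence \<open>Ad g\<close> can be read off by comparing a left with a right
  translated vector, both of which are first partial derivatives of the multiplication.\<close>

lemma left_right_field: "left_invariant_field G AG v g = tangent_map AG AG (\<lambda>h. h \<otimes> g) \<one> (Ad g v)"
proof -
  have eq: "(\<lambda>h. g \<otimes> h) = (\<lambda>h. (g \<otimes> h \<otimes> inv g) \<otimes> g)" by (simp add: m_assoc)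
  have "left_invariant_field G AG v g = tangent_map AG AG (\<lambda>h. (g \<otimes> h \<otimes> inv g) \<otimes> g) \<one> v"
    unfolding left_invariant_field_def by (rule arg_cong[OF eq, of "\<lambda>f. tangent_map AG AG f \<one> v"])
  then show ?thesis
    using tdiff_compose(2)[where f="\<lambda>h. g \<otimes> h \<otimes> inv g" and x="\<one>", OF atlas_G atlas_G tdiff_conj tdiff_right[of g], of v]
    by (simp add: Ad_def)
qed

text \<open>In the chart a left invariant field is a partial derivative of the multiplication along
  the slice \<open>(q, p1)\<close>, with value \<open>v\<close> at \<open>p1\<close>;
  differentiating it once more gives one mixed entry of \<open>H\<close>.\<close>

lemma br_H: "br u v = H (0, v) (u, 0) - H (0, u) (v, 0)"
proof -
  define V where "V = (\<lambda>v q. in_chart AG c1 (chart_inv c1 q) (left_invariant_field G AG v (chart_inv c1 q)))"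
  have one: "(\<otimes>) \<one> = (\<lambda>y. y)" by (simp add: fun_eq_iff)
  have V1: "V v p1 = v" for v
    using tdiff_id(2)[OF atlas_G, of "\<one>" v] one by (simp add: V_def p1 left_invariant_field_def)
  have "frechet_derivative (V v) (at p1) u = H (0, v) (u, 0)" for u v
  proof -
    have "((\<lambda>q. (q, p1)) has_derivative (\<lambda>h. (h, 0))) (at p1)" by (auto intro!: derivative_eq_intros)
    from has_derivative_compose[OF this LL_DD]
    have d: "((\<lambda>q. frechet_derivative LL (at (q, p1)) (0, v)) has_derivative (\<lambda>h. H (0, v) (h, 0))) (at p1)" .
    have "(V v has_derivative (\<lambda>h. H (0, v) (h, 0))) (at p1)"
      by (rule has_derivative_transform_within_open[OF d smooth_atlas_chart(2)[OF atlas_G c1(1)] p1(1)])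
        (simp add: V_def left_field_chart)
    then show ?thesis by (metis frechet_derivative_at)
  qed
  then show ?thesis
    unfolding lie_bracket_def vf_bracket_def Let_def c1_def[symmetric] p1_def[symmetric]
    using V1 by (simp add: V_def[abs_def])
qed

lemma br_antisym: "br u v = - br v u"
  by (simp add: br_H)

lemma br_linear2: "linear (br u)"
proof -
  have "linear (\<lambda>v. (0::'b, v))" "linear (\<lambda>v. (v, 0::'b))" by (auto intro!: linearI)
  from linear_compose[OF this(1) H_linear(2)[of "(u, 0)"]] linear_compose[OF this(2) H_linear(1)[of "(0, u)"]]
  have "linear (\<lambda>v. H (0, v) (u, 0))" "linear (\<lambda>v. H (0, u) (v, 0))" by (simp_all add: o_def)
  from linear_compose_sub[OF this] show ?thesis by (simp add: br_H[abs_def])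
qed

lemma br_linear1: "linear (\<lambda>u. br u v)"
  unfolding br_antisym[of _ v] by (rule linear_compose_neg[OF br_linear2])

lemma br_bounded: obtains M where "M \<ge> 0" "\<And>u v. norm (br u v) \<le> M * norm u * norm v"
proof -
  have "bilinear br" by (simp add: bilinear_def br_linear1 br_linear2)
  from bilinear_bounded_pos[OF this] show ?thesis using that less_imp_le by blast
qed

text \<open>With \<open>r\<close> for right and \<open>V\<close> for left translation in the chart,
  \<open>A t = Ad (\<gamma> t) v\<close> satisfies \<open>r (A t) t = V t\<close>. Since
  \<open>r\<close> is a perturbation of the identity of order \<open>t\<close>, this implicit
  equation can be solved to first order, and symmetry of \<open>H\<close> turns the result into the
  bracket.\<close>

lemma Ad_derivative_one:
  assumes g0: "\<gamma> 0 = \<one>" and vel: "has_velocity AG \<gamma> u 0"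
  shows "((\<lambda>t. Ad (\<gamma> t) v) has_vector_derivative br u v) (at 0)"
proof -
  define x where "x = (\<lambda>t. snd c1 (\<gamma> t))"
  have x0: "x 0 = p1" by (simp add: x_def g0 p1_def)
  have ic: "isCont \<gamma> 0" and xd: "(x has_vector_derivative u) (at 0)"
    using has_velocity_chart[OF atlas_G c1(1), of \<gamma> 0 u] vel c1 by (auto simp: x_def g0)
  define r where "r = (\<lambda>w t. frechet_derivative LL (at (p1, x t)) (w, 0))"
  define V where "V = (\<lambda>t. frechet_derivative LL (at (x t, p1)) (0, v))"
  define A where "A = (\<lambda>t. Ad (\<gamma> t) v)"
  have A0: "A 0 = v" by (simp add: A_def g0)
  have r0: "r w 0 = w" for w
    using right_field_chart[OF p1(1), of w] tdiff_id(2)[OF atlas_G, of "\<one>" w] by (simp add: r_def x0 p1)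
  have rd: "(r w has_vector_derivative H (w, 0) (0, u)) (at 0)" for w
  proof -
    have "((\<lambda>t. (p1, x t)) has_derivative (\<lambda>h. (0, h *\<^sub>R u))) (at 0)"
      using xd unfolding has_vector_derivative_def by (auto intro!: derivative_eq_intros)
    from has_derivative_compose[OF this, of "\<lambda>z. frechet_derivative LL (at z) (w, 0)"] LL_DD x0
    have "(r w has_derivative (\<lambda>h. H (w, 0) (0, h *\<^sub>R u))) (at 0)" by (simp add: r_def)
    moreover have "H (w, 0) (0, h *\<^sub>R u) = h *\<^sub>R H (w, 0) (0, u)" for h
      using linear_cmul[OF H_linear(1)[of "(w, 0)"], of h "(0, u)"] by simp
    ultimately show ?thesis by (simp add: has_vector_derivative_def)
  qed
  have Vd: "(V has_vector_derivative H (0, v) (u, 0)) (at 0)"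
  proof -
    have "((\<lambda>t. (x t, p1)) has_derivative (\<lambda>h. (h *\<^sub>R u, 0))) (at 0)"
      using xd unfolding has_vector_derivative_def by (auto intro!: derivative_eq_intros)
    from has_derivative_compose[OF this, of "\<lambda>z. frechet_derivative LL (at z) (0, v)"] LL_DD x0
    have "(V has_derivative (\<lambda>h. H (0, v) (h *\<^sub>R u, 0))) (at 0)" by (simp add: V_def)
    moreover have "H (0, v) (h *\<^sub>R u, 0) = h *\<^sub>R H (0, v) (u, 0)" for h
      using linear_cmul[OF H_linear(1)[of "(0, v)"], of h "(u, 0)"] by simp
    ultimately show ?thesis by (simp add: has_vector_derivative_def)
  qed
  have inc: "\<forall>\<^sub>F t in nhds 0. \<gamma> t \<in> fst c1"
    by (rule isCont_eventually_in[OF ic smooth_atlas_chart(1)[OF atlas_G c1(1)]]) (simp add: g0 c1)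
  define E where "E = (\<lambda>w t. r w t - w)"
  have El: "E w t = (\<Sum>b\<in>Basis. (w \<bullet> b) *\<^sub>R E b t)" if "\<gamma> t \<in> fst c1" for w t
  proof -
    have "(p1, x t) \<in> LS" using that by (intro LS_1(1)) (auto simp: x_def)
    from has_derivative_linear[OF LL_D[OF this]]
    have l: "linear (frechet_derivative LL (at (p1, x t)))" .
    have "linear (\<lambda>w::'b. (w, 0::'b))" by (auto intro!: linearI)
    from linear_compose[OF this l] have "linear (\<lambda>w. r w t)" by (simp add: o_def r_def)
    then have "linear (\<lambda>w. E w t)" unfolding E_def by (intro linear_compose_sub linear_ident)
    then show ?thesis by (rule linear_basis_expansion)
  qed
  have rA: "r (A t) t = V t" if "\<gamma> t \<in> fst c1" for t
  proof -
    have xt: "x t \<in> snd c1 ` fst c1" "chart_inv c1 (x t) = \<gamma> t"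
      using that smooth_atlas_chart[OF atlas_G c1(1)] by (auto simp: x_def)
    show ?thesis
      using right_field_chart[OF xt(1), of "A t"] left_field_chart[OF xt(1), of v]
      by (simp add: xt(2) left_right_field A_def r_def V_def)
  qed
  \<comment> \<open>A bound for the operator norm of the deviation \<open>E\<close> at time
    \<open>t\<close>; it is of order \<open>t\<close>.\<close>
  define \<epsilon> where "\<epsilon> = (\<lambda>t. \<Sum>b\<in>Basis. norm (E b t))"
  have Eb: "norm (E w t) \<le> \<epsilon> t * norm w" if "\<gamma> t \<in> fst c1" for w t
  proof -
    have "norm (E w t) \<le> (\<Sum>b\<in>Basis. norm (E b t) * norm w)"
      unfolding El[OF that, of w] by (rule sum_norm_le) (auto simp: Basis_le_norm mult.commute intro!: mult_right_mono)
    then show ?thesis by (simp add: \<epsilon>_def sum_distrib_right)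
  qed
  define C where "C = (\<Sum>b\<in>Basis. norm (H (b, 0) (0, u)) + 1) + 1"
  have C: "C > 0" unfolding C_def by (intro add_nonneg_pos sum_nonneg) auto
  have small: "\<forall>\<^sub>F t in nhds 0. \<epsilon> t \<le> C * \<bar>t\<bar>"
  proof -
    have "\<forall>\<^sub>F t in nhds 0. norm (E b t) \<le> (norm (H (b, 0) (0, u)) + 1) * \<bar>t\<bar>" for b
    proof -
      obtain d where d: "d > 0" "\<And>y. norm (y - 0) < d \<Longrightarrow> norm (r b y - r b 0 - (y - 0) *\<^sub>R H (b, 0) (0, u)) \<le> 1 * norm (y - 0)"
        using rd[of b] unfolding has_vector_derivative_def has_derivative_at_alt by (metis zero_less_one)
      have "norm (E b t) \<le> (norm (H (b, 0) (0, u)) + 1) * \<bar>t\<bar>" if "dist t 0 < d" for t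
      proof -
        have "norm (E b t) \<le> norm (r b t - b - t *\<^sub>R H (b, 0) (0, u)) + norm (t *\<^sub>R H (b, 0) (0, u))"
          using norm_triangle_ineq[of "r b t - b - t *\<^sub>R H (b, 0) (0, u)" "t *\<^sub>R H (b, 0) (0, u)"] by (simp add: E_def)
        then show ?thesis using d(2)[of t] that by (simp add: r0 algebra_simps)
      qed
      then show ?thesis using d(1) by (auto simp: eventually_nhds_metric)
    qed
    then have "\<forall>\<^sub>F t in nhds 0. \<forall>b\<in>Basis. norm (E b t) \<le> (norm (H (b, 0) (0, u)) + 1) * \<bar>t\<bar>"
      by (intro eventually_ball_finite) auto
    then show ?thesis
    proof eventually_elim
      case (elim t)
      have "\<epsilon> t \<le> (\<Sum>b\<in>Basis. (norm (H (b, 0) (0, u)) + 1) * \<bar>t\<bar>)" unfolding \<epsilon>_def using elim by (intro sum_mono) auto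
      also have "\<dots> \<le> C * \<bar>t\<bar>" by (simp add: C_def sum_distrib_right distrib_right)
      finally show ?case .
    qed
  qed
  have \<epsilon>0: "\<epsilon> t \<ge> 0" for t by (simp add: \<epsilon>_def sum_nonneg)
  have "isCont V 0" using Vd by (rule has_vector_derivative_continuous)
  moreover have V0: "V 0 = v" using rA[of 0] r0 A0 g0 c1 by simp
  ultimately have Vlim: "(V \<longlongrightarrow> v) (nhds 0)"
    by (metis continuous_at tendsto_at_iff_tendsto_nhds)
  \<comment> \<open>\<open>V t - E v t\<close> is the first iterate for the equation
    \<open>A t = V t - E (A t) t\<close>. The remainder is \<open>- E (A t - v) t\<close>, the
    product of an operator of order \<open>t\<close> with a vector tending to 0, hence of smaller
    order than \<open>t\<close>.\<close>
  define \<rho> where "\<rho> = (\<lambda>t. A t - (V t - E v t))"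
  have "(\<rho> has_vector_derivative 0) (at 0)"
    unfolding has_vector_derivative_def has_derivative_at_alt
  proof (intro conjI allI impI)
    fix e :: real assume e: "e > 0"
    have ev1: "\<forall>\<^sub>F t in nhds 0. \<epsilon> t \<le> 1 / 2"
    proof -
      have "\<forall>\<^sub>F t in nhds (0::real). \<bar>t\<bar> < 1 / (2 * C)"
        using C by (auto simp: eventually_nhds_metric dist_real_def intro!: exI[of _ "1 / (2 * C)"])
      with small show ?thesis
      proof eventually_elim
        case (elim t)
        have "C * \<bar>t\<bar> \<le> C * (1 / (2 * C))" using elim C by (intro mult_left_mono) auto
        then show ?case using elim C by simp
      qed
    qed
    \<comment> \<open>The remainder will be at most \<open>C \<bar>t\<bar>\<close> times
      \<open>4 e'\<close>, which is \<open>e \<bar>t\<bar>\<close>.\<close>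
    define e' where "e' = e / (4 * C)"
    have e': "e' > 0" using e C by (simp add: e'_def)
    have ev2: "\<forall>\<^sub>F t in nhds 0. norm (V t - v) < e'" using tendstoD[OF Vlim e'] by (simp add: dist_norm)
    have ev3: "\<forall>\<^sub>F t in nhds 0. \<epsilon> t * (2 * (norm v)) < e'"
    proof -
      have "\<forall>\<^sub>F t in nhds (0::real). \<bar>t\<bar> < e' / (C * (2 * norm v + 1))"
        using C e' by (auto simp: eventually_nhds_metric dist_real_def add_nonneg_pos intro!: exI[of _ "e' / (C * (2 * norm v + 1))"] divide_pos_pos mult_pos_pos)
      with small show ?thesis
      proof eventually_elim
        case (elim t)
        have p: "C * (2 * norm v + 1) > 0" using C by (simp add: add_nonneg_pos)
        have "\<epsilon> t * (2 * norm v) \<le> (C * \<bar>t\<bar>) * (2 * norm v + 1)" using elim \<epsilon>0 C by (intro mult_mono) auto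
        also have "\<dots> = \<bar>t\<bar> * (C * (2 * norm v + 1))" by simp
        also have "\<dots> < e'" using elim(2) p by (simp add: pos_less_divide_eq)
        finally show ?case .
      qed
    qed
    have "\<forall>\<^sub>F t in nhds 0. norm (\<rho> t) \<le> e * \<bar>t\<bar>"
      using inc small ev1 ev2 ev3
    proof eventually_elim
      case (elim t)
      have AV: "A t + E (A t) t = V t" using rA[OF elim(1)] by (simp add: E_def)
      have lin: "E (A t - v) t = E (A t) t - E v t"
        unfolding El[OF elim(1), of "A t - v"] El[OF elim(1), of "A t"] El[OF elim(1), of v]
        by (simp add: inner_diff_left scaleR_diff_left sum_subtractf)
      \<comment> \<open>Nothing is known about the size of \<open>A\<close> beforehand; since
        \<epsilon> is at most 1/2, the term with \<open>A t - v\<close> on the right is absorbed on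
        the left.\<close>
      have Av: "norm (A t - v) \<le> 2 * (norm (V t - v) + \<epsilon> t * norm v)"
      proof -
        have eq: "A t - v = (V t - v) - E v t - E (A t - v) t" using AV lin by (simp add: algebra_simps)
        have "norm ((V t - v) - E v t - E (A t - v) t) \<le> norm (V t - v) + norm (E v t) + norm (E (A t - v) t)"
          by (intro order_trans[OF norm_triangle_ineq4] add_right_mono norm_triangle_ineq4)
        then have "norm (A t - v) \<le> norm (V t - v) + norm (E v t) + norm (E (A t - v) t)"
          unfolding eq[symmetric] .
        also have "\<dots> \<le> norm (V t - v) + \<epsilon> t * norm v + 1 / 2 * norm (A t - v)"
          using Eb[OF elim(1), of v] Eb[OF elim(1), of "A t - v"] mult_right_mono[OF elim(3), of "norm (A t - v)"] by simp
        finally show ?thesis by (simp add: algebra_simps)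
      qed
      have "\<rho> t = - E (A t - v) t" using AV lin by (simp add: \<rho>_def algebra_simps)
      then have "norm (\<rho> t) \<le> \<epsilon> t * norm (A t - v)" using Eb[OF elim(1), of "A t - v"] by simp
      also have "\<dots> \<le> (C * \<bar>t\<bar>) * (4 * e')"
      proof (rule mult_mono)
        show "norm (A t - v) \<le> 4 * e'" using Av elim(4,5) e' by (simp add: algebra_simps)
      qed (use elim C in auto)
      also have "\<dots> = e * \<bar>t\<bar>" using C by (simp add: e'_def)
      finally show ?case .
    qed
    moreover have "\<rho> 0 = 0" by (simp add: \<rho>_def A0 V0 E_def r0)
    ultimately show "\<exists>d>0. \<forall>y. norm (y - 0) < d \<longrightarrow> norm (\<rho> y - \<rho> 0 - (y - 0) *\<^sub>R 0) \<le> e * norm (y - 0)"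
      by (auto simp: eventually_nhds_metric)
  qed simp
  moreover have "((\<lambda>t. V t - E v t) has_vector_derivative H (0, v) (u, 0) - H (v, 0) (0, u)) (at 0)"
    unfolding E_def using Vd rd[of v] by (auto intro!: derivative_eq_intros)
  ultimately have "((\<lambda>t. \<rho> t + (V t - E v t)) has_vector_derivative 0 + (H (0, v) (u, 0) - H (v, 0) (0, u))) (at 0)"
    by (rule has_vector_derivative_add)
  then show ?thesis by (simp add: \<rho>_def A_def[symmetric] br_H H_sym[of "(v, 0)"])
qed

end

section \<open>One-parameter subgroups\<close>

lemma has_velocity_const:
  assumes "smooth_atlas A"
  shows "has_velocity A (\<lambda>s. x) 0 t"
  by (simp add: has_velocity_chart_at[OF assms])

lemma has_velocity_cong:
  assumes "\<forall>\<^sub>F s in nhds t. \<sigma> s = \<tau> s"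
  shows "has_velocity A \<sigma> v t \<longleftrightarrow> has_velocity A \<tau> v t"
  using tangent_map_cong[where B=A, OF smooth_atlas_euclidean assms] by (simp add: has_velocity_def)

context lie_grp
begin

lemma mult_velocity_one:
  assumes "has_velocity AG \<gamma> u t" "has_velocity AG \<eta> v t" "\<gamma> t = \<one>" "\<eta> t = \<one>"
  shows "has_velocity AG (\<lambda>s. \<gamma> s \<otimes> \<eta> s) (u + v) t"
  using smooth_bimap.has_velocity_bimap[OF mult_bimap assms(1,2)] assms(3,4) tdiff_id(2)[OF atlas_G]
  by simp

lemma tdiff_inv: "tdiff AG AG (\<lambda>g. inv g) x"
  using lie by (intro tdiff_smooth_map atlas_G) (simp add: lie_group_def)

lemma inv_velocity_one:
  assumes "has_velocity AG \<gamma> u t" "\<gamma> t = \<one>"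
  shows "has_velocity AG (\<lambda>s. inv (\<gamma> s)) (- u) t"
proof -
  define v where "v = tangent_map AG AG (\<lambda>g. inv g) \<one> u"
  have v: "has_velocity AG (\<lambda>s. inv (\<gamma> s)) v t"
    using has_velocity_map[OF atlas_G atlas_G assms(1) tdiff_inv] assms(2) by (simp add: v_def)
  have "has_velocity AG (\<lambda>s. inv (\<gamma> s) \<otimes> \<gamma> s) (v + u) t"
    by (rule mult_velocity_one[OF v assms(1)]) (simp_all add: assms(2))
  then have "v + u = 0"
    using has_velocity_const[OF atlas_G, of "\<one>" t] has_velocity_unique by simp blast
  then show ?thesis using v by (simp add: eq_neg_iff_add_eq_0[symmetric])
qed

lemma left_right_velocity_zero:
  assumes "has_velocity AG \<gamma> 0 t"
  shows "has_velocity AG (\<lambda>s. g \<otimes> \<gamma> s \<otimes> h) 0 t"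
proof -
  have 1: "has_velocity AG (\<lambda>s. g \<otimes> \<gamma> s) 0 t"
    using has_velocity_map[OF atlas_G atlas_G assms tdiff_left[of g]] linear_0[OF tdiff_linear[OF tdiff_left]] by simp
  show ?thesis
    using has_velocity_map[OF atlas_G atlas_G 1 tdiff_right[of h]] linear_0[OF tdiff_linear[OF tdiff_right]] by simp
qed

text \<open>The curve \<open>inv (\<beta> s) \<otimes> \<alpha> s\<close> has velocity zero, because
  equal logarithmic derivatives cancel after translation to the identity; so it is constant.\<close>

lemma rlog_unique:
  assumes S: "open S" "connected S" "s \<in> S" "t \<in> S"
    and \<alpha>: "\<And>t. t \<in> S \<Longrightarrow> rlog \<alpha> (u t) t" and \<beta>: "\<And>t. t \<in> S \<Longrightarrow> rlog \<beta> (u t) t"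
  shows "inv (\<beta> s) \<otimes> \<alpha> s = inv (\<beta> t) \<otimes> \<alpha> t"
proof (rule velocity_zero_const[OF atlas_G _ S])
  fix t assume t: "t \<in> S"
  have "has_velocity AG (\<lambda>s. inv (\<beta> s \<otimes> inv (\<beta> t)) \<otimes> (\<alpha> s \<otimes> inv (\<alpha> t))) (- u t + u t) t"
    using \<alpha>[OF t] \<beta>[OF t] unfolding rlog_def by (intro mult_velocity_one inv_velocity_one) simp_all
  then have "has_velocity AG (\<lambda>s. inv (\<beta> s \<otimes> inv (\<beta> t)) \<otimes> (\<alpha> s \<otimes> inv (\<alpha> t))) 0 t" by simp
  from left_right_velocity_zero[OF this, of "inv (\<beta> t)" "\<alpha> t"]
  have "has_velocity AG (\<lambda>s. inv (\<beta> t) \<otimes> (inv (\<beta> s \<otimes> inv (\<beta> t)) \<otimes> (\<alpha> s \<otimes> inv (\<alpha> t))) \<otimes> \<alpha> t) 0 t" .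
  moreover have "inv b \<otimes> (inv (b' \<otimes> inv b) \<otimes> (a' \<otimes> inv a)) \<otimes> a = inv b' \<otimes> a'" for a a' b b'
    by (simp add: inv_mult_group m_assoc) (simp add: m_assoc[symmetric])
  ultimately show "has_velocity AG (\<lambda>s. inv (\<beta> s) \<otimes> \<alpha> s) 0 t" by simp
qed

text \<open>Solves the equation of the fundamental field of \<open>u\<close> in the chart at the
  identity; the local homomorphism law is an instance of \<open>rlog_unique\<close>.\<close>

lemma local_one_parameter:
  obtains \<delta> \<gamma> where "\<delta> > 0" "\<gamma> 0 = \<one>" "has_velocity AG \<gamma> u 0"
    "\<And>s t. \<bar>s\<bar> < \<delta> \<Longrightarrow> \<bar>t\<bar> < \<delta> \<Longrightarrow> \<gamma> (s + t) = \<gamma> s \<otimes> \<gamma> t"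
proof -
  interpret self: smooth_action G AG AG "\<lambda>g h. g \<otimes> h" by (rule self_action)
  obtain r K where r: "r > 0" "K \<ge> 0" "cball (snd c1 \<one>) r \<subseteq> snd c1 ` fst c1"
    "\<And>p q u. p \<in> cball (snd c1 \<one>) r \<Longrightarrow> q \<in> cball (snd c1 \<one>) r \<Longrightarrow>
      norm (in_chart AG c1 (chart_inv c1 p) (self.X (chart_inv c1 p) u) -
        in_chart AG c1 (chart_inv c1 q) (self.X (chart_inv c1 q) u)) \<le> K * norm u * norm (p - q)"
    by (rule self.X_lipschitz[OF c1]) blast
  define f where "f = (\<lambda>p. in_chart AG c1 (chart_inv c1 p) (self.X (chart_inv c1 p) u))"
  obtain \<delta> x where x: "\<delta> > 0" "x 0 = p1"
    "\<And>t. \<bar>t\<bar> < \<delta> \<Longrightarrow> x t \<in> cball p1 r \<and> (x has_vector_derivative f (x t)) (at t)"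
    using picard_local[OF r(1), of "K * norm u" p1 f] r(2,4) by (auto simp: f_def p1_def)
  define \<gamma> where "\<gamma> = (\<lambda>t. chart_inv c1 (x t))"
  have g0: "\<gamma> 0 = \<one>" by (simp add: \<gamma>_def x p1)
  have rl: "rlog \<gamma> u t" if t: "\<bar>t\<bar> < \<delta>" for t
  proof -
    have xt: "x t \<in> snd c1 ` fst c1" using x(3)[OF t] r(3) by (auto simp: p1_def)
    have sx: "snd c1 (\<gamma> t) = x t" "\<gamma> t \<in> fst c1" using smooth_atlas_chart[OF atlas_G c1(1)] xt by (auto simp: \<gamma>_def)
    have "has_velocity euclidean_atlas x (f (x t)) t" using x(3)[OF t] by (simp add: has_velocity_euclidean)
    from has_velocity_map[OF smooth_atlas_euclidean atlas_G this tdiff_chart_inv[OF atlas_G c1(1) xt]]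
    have "has_velocity AG \<gamma> (from_chart AG c1 (x t) (f (x t))) t" by (simp add: \<gamma>_def from_chart_def)
    moreover have "from_chart AG c1 (x t) (f (x t)) = self.X (\<gamma> t) u"
      using from_chart_in_chart[OF atlas_G c1(1) sx(2), of "self.X (\<gamma> t) u"] sx(1) by (simp add: f_def \<gamma>_def)
    ultimately have vel: "has_velocity AG \<gamma> (self.X (\<gamma> t) u) t" by simp
    have "tangent_map AG AG (\<lambda>h. (h \<otimes> \<gamma> t) \<otimes> inv (\<gamma> t)) \<one> u =
      tangent_map AG AG (\<lambda>h. h \<otimes> inv (\<gamma> t)) (\<one> \<otimes> \<gamma> t) (tangent_map AG AG (\<lambda>h. h \<otimes> \<gamma> t) \<one> u)"
      by (rule tdiff_compose(2)[OF atlas_G atlas_G tdiff_right tdiff_right])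
    then have "tangent_map AG AG (\<lambda>h. h \<otimes> inv (\<gamma> t)) (\<gamma> t) (self.X (\<gamma> t) u) = u"
      using tdiff_id(2)[OF atlas_G, of "\<one>" u] by (simp add: m_assoc self.X_def)
    then show ?thesis using rlog_of_velocity[OF vel] by simp
  qed
  \<comment> \<open>Both \<open>\<gamma>\<close> and its restart at time \<open>t\<close> have
    constant logarithmic derivative \<open>u\<close>. Halving the time range keeps sums of times
    inside the domain of the solution.\<close>
  have hom: "\<gamma> (s + t) = \<gamma> s \<otimes> \<gamma> t" if s: "\<bar>s\<bar> < \<delta> / 2" and t: "\<bar>t\<bar> < \<delta> / 2" for s t
  proof -
    have "inv (\<gamma> s) \<otimes> (\<gamma> (t + 1 * s) \<otimes> inv (\<gamma> t)) = inv (\<gamma> 0) \<otimes> (\<gamma> (t + 1 * 0) \<otimes> inv (\<gamma> t))"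
    proof (rule rlog_unique[of "{-\<delta>/2<..<\<delta>/2}" s 0 "\<lambda>s. \<gamma> (t + 1 * s) \<otimes> inv (\<gamma> t)" "\<lambda>_. u" \<gamma>])
      fix s assume s: "s \<in> {-\<delta>/2<..<\<delta>/2}"
      have "\<bar>t + 1 * s\<bar> < \<delta>" using s t by auto
      from rlog_shift[OF rl[OF this]] show "rlog (\<lambda>s. \<gamma> (t + 1 * s) \<otimes> inv (\<gamma> t)) u s" by simp
      show "rlog \<gamma> u s" using s by (intro rl) auto
    qed (use s x(1) in \<open>auto simp: abs_less_iff\<close>)
    then have e: "inv (\<gamma> s) \<otimes> (\<gamma> (t + s) \<otimes> inv (\<gamma> t)) = \<one>" by (simp add: g0)
    have "\<gamma> (t + s) \<otimes> inv (\<gamma> t) = \<gamma> s \<otimes> (inv (\<gamma> s) \<otimes> (\<gamma> (t + s) \<otimes> inv (\<gamma> t)))"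
      by (simp add: m_assoc[symmetric])
    then have "\<gamma> (t + s) \<otimes> inv (\<gamma> t) = \<gamma> s" unfolding e by simp
    moreover have "\<gamma> (t + s) = (\<gamma> (t + s) \<otimes> inv (\<gamma> t)) \<otimes> \<gamma> t" by (simp add: m_assoc)
    ultimately show ?thesis by (simp add: add.commute)
  qed
  have "has_velocity AG \<gamma> u 0" using rl[of 0] x(1) by (simp add: rlog_def g0)
  then show ?thesis using that[of "\<delta> / 2" \<gamma>] x(1) g0 hom by simp
qed

text \<open>The local solution is extended to all times by taking high powers of its values at small
  times.\<close>

lemma one_parameter_exists:
  "\<exists>\<gamma>. (\<forall>s t. \<gamma> (s + t) = \<gamma> s \<otimes> \<gamma> t) \<and> has_velocity AG \<gamma> u 0"
proof -
  obtain \<delta> g where d: "\<delta> > 0" and g0: "g 0 = \<one>" and vel: "has_velocity AG g u 0"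
    and hom: "\<And>s t. \<bar>s\<bar> < \<delta> \<Longrightarrow> \<bar>t\<bar> < \<delta> \<Longrightarrow> g (s + t) = g s \<otimes> g t"
    using local_one_parameter[of u] by metis
  \<comment> \<open>The value does not depend on \<open>n\<close> once \<open>t / 2 ^ n\<close> is
    in the local range, because doubling the argument there squares the value.\<close>
  define E where "E = (\<lambda>(n::nat) t. g (t / 2 ^ n) [^] (2 ^ n :: nat))"
  have E_Suc: "E (Suc n) t = E n t" if "\<bar>t\<bar> / 2 ^ n < \<delta>" for n t
  proof -
    define h where "h = t / 2 ^ Suc n"
    define z where "z = \<bar>t\<bar> / 2 ^ n"
    have "\<bar>h\<bar> = z / 2" by (simp add: h_def z_def abs_mult)
    moreover have "z \<ge> 0" "z < \<delta>" using that by (simp_all add: z_def)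
    ultimately have "\<bar>h\<bar> < \<delta>" by linarith
    then have "g (h + h) = g h \<otimes> g h" by (intro hom)
    moreover have "h + h = t / 2 ^ n" by (simp add: h_def field_simps)
    ultimately have "g (t / 2 ^ n) = g h [^] (2::nat)" by (simp add: numeral_2_eq_2)
    then show ?thesis unfolding E_def by (simp add: nat_pow_pow h_def)
  qed
  have E_le: "E m t = E n t" if "n \<le> m" "\<bar>t\<bar> / 2 ^ n < \<delta>" for m n t
    using that(1)
  proof (induction rule: dec_induct)
    case (step k)
    have "\<bar>t\<bar> / 2 ^ k \<le> \<bar>t\<bar> / 2 ^ n" using step.hyps by (intro divide_left_mono power_increasing) auto
    then show ?case using E_Suc[of t k] step that(2) by simp
  qed simp
  have ex: "\<exists>n. \<bar>t\<bar> / 2 ^ n < \<delta>" for t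
  proof -
    obtain n where "\<bar>t\<bar> / \<delta> < 2 ^ n" using real_arch_pow[of 2 "\<bar>t\<bar> / \<delta>"] by auto
    then show ?thesis using d by (intro exI[of _ n]) (simp add: field_simps)
  qed
  define n0 where "n0 = (\<lambda>t. LEAST n. \<bar>t\<bar> / 2 ^ n < \<delta>)"
  define \<gamma> where "\<gamma> = (\<lambda>t. E (n0 t) t)"
  have gE: "\<gamma> t = E m t" if "\<bar>t\<bar> / 2 ^ m < \<delta>" for m t
  proof -
    have "n0 t \<le> m" unfolding n0_def using that by (rule Least_le)
    moreover have "\<bar>t\<bar> / 2 ^ n0 t < \<delta>" unfolding n0_def using ex by (rule LeastI_ex)
    ultimately show ?thesis unfolding \<gamma>_def by (metis E_le)
  qed
  have "\<gamma> (s + t) = \<gamma> s \<otimes> \<gamma> t" for s t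
  proof -
    obtain m where m: "(\<bar>s\<bar> + \<bar>t\<bar>) / 2 ^ m < \<delta>" using ex[of "\<bar>s\<bar> + \<bar>t\<bar>"] by auto
    have le: "\<bar>s\<bar> / 2 ^ m \<le> (\<bar>s\<bar> + \<bar>t\<bar>) / 2 ^ m" "\<bar>t\<bar> / 2 ^ m \<le> (\<bar>s\<bar> + \<bar>t\<bar>) / 2 ^ m"
      "\<bar>s + t\<bar> / 2 ^ m \<le> (\<bar>s\<bar> + \<bar>t\<bar>) / 2 ^ m" by (auto intro!: divide_right_mono)
    have sm: "\<bar>s / 2 ^ m\<bar> < \<delta>" "\<bar>t / 2 ^ m\<bar> < \<delta>" using le m by (auto simp: abs_mult)
    have 1: "g (s / 2 ^ m + t / 2 ^ m) = g (s / 2 ^ m) \<otimes> g (t / 2 ^ m)" by (rule hom[OF sm])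
    \<comment> \<open>Together with the preceding fact this shows that the two factors commute, so
      the power of their product is the product of their powers.\<close>
    have 2: "g (s / 2 ^ m + t / 2 ^ m) = g (t / 2 ^ m) \<otimes> g (s / 2 ^ m)" using hom[OF sm(2,1)] by (simp add: add.commute)
    have "\<gamma> (s + t) = (g (s / 2 ^ m) \<otimes> g (t / 2 ^ m)) [^] (2 ^ m :: nat)"
      using le m by (subst gE[of _ m]) (auto simp: E_def add_divide_distrib 1)
    also have "\<dots> = g (s / 2 ^ m) [^] (2 ^ m :: nat) \<otimes> g (t / 2 ^ m) [^] (2 ^ m :: nat)"
      by (rule pow_mult_distrib) (use 1 2 in auto)
    also have "\<dots> = \<gamma> s \<otimes> \<gamma> t" using le m gE[of s m] gE[of t m] by (simp add: E_def)
    finally show ?thesis .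
  qed
  moreover have "has_velocity AG \<gamma> u 0"
  proof -
    have "\<gamma> t = g t" if "\<bar>t\<bar> < \<delta>" for t using gE[of t 0] that by (simp add: E_def)
    then have "\<forall>\<^sub>F t in nhds 0. \<gamma> t = g t" using d by (auto simp: eventually_nhds_metric dist_real_def)
    from has_velocity_cong[OF this] vel show ?thesis by blast
  qed
  ultimately show ?thesis by blast
qed

lemma one_parameter_props:
  assumes hom: "\<And>s t. \<gamma> (s + t) = \<gamma> s \<otimes> \<gamma> t"
  shows "\<gamma> 0 = \<one>" "inv (\<gamma> t) = \<gamma> (- t)"
    and "has_velocity AG \<gamma> u 0 \<Longrightarrow> rlog \<gamma> u t"
proof -
  have "\<gamma> 0 \<otimes> \<gamma> 0 = \<gamma> 0" using hom[of 0 0] by simp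
  then show g0: "\<gamma> 0 = \<one>" by (simp add: l_cancel_one)
  have "\<gamma> (- t) \<otimes> \<gamma> t = \<one>" using hom[of "- t" t] g0 by simp
  then show inv: "inv (\<gamma> t) = \<gamma> (- t)" for t by (metis car inv_equality add.inverse_inverse add.right_inverse g0 hom)
  assume vel: "has_velocity AG \<gamma> u 0"
  have "(\<lambda>s. \<gamma> s \<otimes> inv (\<gamma> t)) = (\<lambda>s. \<gamma> (s - t))" unfolding inv using hom[of _ "- t"] by simp
  moreover have "has_velocity AG (\<lambda>s. \<gamma> (s - t)) (1 *\<^sub>R u) t"
    by (rule has_velocity_reparam[where h="\<lambda>s. s - t" and k=1, OF atlas_G]) (use vel in \<open>auto intro!: derivative_eq_intros\<close>)
  ultimately show "rlog \<gamma> u t" by (simp add: rlog_def)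
qed

lemma rlog_velocity:
  assumes "rlog \<gamma> u t"
  shows "has_velocity AG \<gamma> (tangent_map AG AG (\<lambda>h. h \<otimes> \<gamma> t) \<one> u) t"
proof -
  interpret self: smooth_action G AG AG "\<lambda>g h. g \<otimes> h" by (rule self_action)
  show ?thesis using self.orbit_velocity[OF assms, of "\<one>"] by (simp add: self.X_def)
qed

text \<open>Bootstrapping: in a chart \<gamma> solves an autonomous equation with smooth right-hand
  side \<Xi>, so each order of differentiability of \<gamma> yields the next.\<close>

lemma one_parameter_smooth:
  assumes rl: "\<And>t. rlog \<gamma> u t"
  shows "smooth_map euclidean_atlas AG \<gamma>"
proof -
  interpret self: smooth_action G AG AG "\<lambda>g h. g \<otimes> h" by (rule self_action)
  have vel: "has_velocity AG \<gamma> (self.X (\<gamma> t) u) t" for t using rlog_velocity[OF rl] by (simp add: self.X_def)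
  have cont: "continuous_on UNIV \<gamma>"
    using vel by (auto simp: continuous_on_eq_continuous_at has_velocity_def tdiff_def)
  have "Ck_on k {t. \<gamma> t \<in> fst d} (\<lambda>t. snd d (\<gamma> t))" if d: "d \<in> AG" for d k
  proof (induction k)
    note dh = smooth_atlas_chart[OF atlas_G d]
    let ?W = "{t. \<gamma> t \<in> fst d}"
    case 0
    show ?case using cont dh(3) by (auto intro!: continuous_on_compose2[OF dh(3)] elim: continuous_on_subset)
  next
    case (Suc k)
    note dh = smooth_atlas_chart[OF atlas_G d]
    let ?W = "{t. \<gamma> t \<in> fst d}" and ?F = "\<lambda>(g, h). g \<otimes> h"
    have W: "open ?W" using open_vimage[OF dh(1) cont] by (simp add: vimage_def)
    define \<Xi> where "\<Xi> = (\<lambda>p. frechet_derivative (loc_rep c1 d d ?F) (at (p1, p)) (u, 0))"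
    have sub: "(p1, p) \<in> loc_dom c1 d d ?F" if "p \<in> snd d ` fst d" for p
      using that dh(7)[OF that] p1 by (auto simp: loc_dom_def)
    have "Ck_on (Suc k) (loc_dom c1 d d ?F) (loc_rep c1 d d ?F)"
      by (rule smooth_bimap.loc_rep_Ck[OF mult_bimap c1(1) d d])
    then have Cz: "Ck_on k (loc_dom c1 d d ?F) (\<lambda>z. frechet_derivative (loc_rep c1 d d ?F) (at z) (u, 0))" by simp
    have Cp: "Ck_on k (snd d ` fst d) (\<lambda>p. (p1, p))"
    proof (cases k)
      case (Suc j)
      show ?thesis unfolding Suc
        by (rule Ck_on_SucI[OF dh(2), where D="\<lambda>p v. (0, v)"])
          (auto intro!: derivative_eq_intros Ck_on_const dh)
    qed (auto intro: continuous_intros)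
    have C\<Xi>: "Ck_on k (snd d ` fst d) \<Xi>" unfolding \<Xi>_def
      by (rule Ck_on_compose[OF dh(2) smooth_bimap.loc_dom_open[OF mult_bimap c1(1) d d] _ Cp Cz]) (use sub in auto)
    show ?case
    proof (rule Ck_on_SucI[OF W, where D="\<lambda>t v. v *\<^sub>R \<Xi> (snd d (\<gamma> t))"])
      fix t assume t: "t \<in> ?W"
      then have gt: "snd d (\<gamma> t) \<in> snd d ` fst d" "chart_inv d (snd d (\<gamma> t)) = \<gamma> t" using dh by auto
      have "((\<lambda>s. snd d (\<gamma> s)) has_vector_derivative in_chart AG d (\<gamma> t) (self.X (\<gamma> t) u)) (at t)"
        using vel[of t] t has_velocity_chart[OF atlas_G d, of \<gamma> t] by simp
      then show "((\<lambda>s. snd d (\<gamma> s)) has_derivative (\<lambda>v. v *\<^sub>R \<Xi> (snd d (\<gamma> t)))) (at t)"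
        using self.X_chart[OF d gt(1), of u] gt(2) by (simp add: \<Xi>_def has_vector_derivative_def)
    next
      fix v :: real
      show "Ck_on k ?W (\<lambda>t. v *\<^sub>R \<Xi> (snd d (\<gamma> t)))"
        by (intro Ck_on_bounded_linear[OF W bounded_linear_scaleR_right] Ck_on_compose[OF W dh(2) _ Suc.IH C\<Xi>]) auto
    qed
  qed
  then show ?thesis using cont
    by (auto simp: smooth_map_def euclidean_atlas_def smooth_on_def o_def vimage_def)
qed

lemma one_parameter_unique:
  assumes "one_parameter_subgroup G AG u \<gamma>" "one_parameter_subgroup G AG u \<eta>"
  shows "\<gamma> = \<eta>"
proof
  fix t
  have hom: "\<alpha> (s + t) = \<alpha> s \<otimes> \<alpha> t" if "one_parameter_subgroup G AG u \<alpha>" for \<alpha> s t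
    using that by (simp add: one_parameter_subgroup_def)
  have rl: "rlog \<alpha> u t" if "one_parameter_subgroup G AG u \<alpha>" for \<alpha> t
  proof -
    have "has_velocity AG \<alpha> u 0"
      using that tdiff_smooth_map[OF smooth_atlas_euclidean atlas_G]
      by (auto simp: one_parameter_subgroup_def has_velocity_def)
    then show "rlog \<alpha> u t" by (rule one_parameter_props(3)[OF hom[OF that]])
  qed
  have "inv (\<eta> t) \<otimes> \<gamma> t = inv (\<eta> 0) \<otimes> \<gamma> 0"
    by (rule rlog_unique[of UNIV t 0 \<gamma> "\<lambda>_. u" \<eta>]) (use rl assms in auto)
  also have "\<dots> = \<one>" using one_parameter_props(1)[OF hom[OF assms(1)]] one_parameter_props(1)[OF hom[OF assms(2)]] by simp
  finally have "\<eta> t \<otimes> (inv (\<eta> t) \<otimes> \<gamma> t) = \<eta> t" by simp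
  then show "\<gamma> t = \<eta> t" by (simp add: m_assoc[symmetric])
qed

definition ex where "ex u = (THE \<gamma>. one_parameter_subgroup G AG u \<gamma>)"

lemma ex_one_parameter: "one_parameter_subgroup G AG u (ex u)"
proof -
  obtain \<gamma> where g: "\<And>s t. \<gamma> (s + t) = \<gamma> s \<otimes> \<gamma> t" "has_velocity AG \<gamma> u 0" using one_parameter_exists by blast
  have "one_parameter_subgroup G AG u \<gamma>"
    unfolding one_parameter_subgroup_def
    using g one_parameter_smooth[OF one_parameter_props(3)[OF g]] by (auto simp: has_velocity_def)
  from theI[of "one_parameter_subgroup G AG u", OF this one_parameter_unique[OF _ this]]
  show ?thesis by (simp add: ex_def)
qed

lemma lie_exp_ex: "lie_exp G AG u = ex u 1"
  by (simp add: lie_exp_def ex_def)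

lemma ex_add: "ex u (s + t) = ex u s \<otimes> ex u t"
  using ex_one_parameter by (simp add: one_parameter_subgroup_def)

lemma ex_velocity: "has_velocity AG (ex u) u 0"
  using ex_one_parameter[of u] tdiff_smooth_map[OF smooth_atlas_euclidean atlas_G]
  by (auto simp: one_parameter_subgroup_def has_velocity_def)

lemma ex_0 [simp]: "ex u 0 = \<one>" and ex_inv: "inv (ex u t) = ex u (- t)" and ex_rlog: "rlog (ex u) u t"
  using one_parameter_props[where \<gamma>="ex u", OF ex_add] ex_velocity by auto

section \<open>Ideals and the nilradical\<close>

lemma Ad_curve_derivative:
  assumes "rlog \<gamma> u t"
  shows "((\<lambda>s. Ad (\<gamma> s) v) has_vector_derivative br u (Ad (\<gamma> t) v)) (at t)"
proof -
  have "rlog (\<lambda>s. \<gamma> (t + 1 * s) \<otimes> inv (\<gamma> t)) (1 *\<^sub>R u) 0" using assms by (intro rlog_shift) simp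
  then have "has_velocity AG (\<lambda>s. \<gamma> (t + s) \<otimes> inv (\<gamma> t)) u 0" by (simp add: rlog_def)
  from Ad_derivative_one[OF _ this, of "Ad (\<gamma> t) v"]
  have d: "((\<lambda>s. Ad (\<gamma> (t + s)) v) has_vector_derivative br u (Ad (\<gamma> t) v)) (at (t - t))"
    by (simp add: Ad_mult[symmetric] m_assoc)
  have "((\<lambda>s. s - t) has_vector_derivative 1) (at t)" by (auto intro!: derivative_eq_intros)
  from vector_diff_chain_at[OF this d] show ?thesis by (simp add: o_def)
qed

text \<open>Both sides are the derivative at 0 of \<open>Ad g (Ad (ex u t) w)\<close>: once as a
  linear image, once through the curve \<open>ex u t\<close> conjugated by \<open>g\<close> and
  applied to \<open>Ad g w\<close>.\<close>

lemma Ad_br: "Ad g (br u w) = br (Ad g u) (Ad g w)"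
proof -
  have "has_velocity AG (\<lambda>s. g \<otimes> ex u s \<otimes> inv g) (Ad g u) 0"
    using has_velocity_map[OF atlas_G atlas_G ex_velocity[of u] tdiff_conj[of g]] by (simp add: Ad_def)
  from Ad_derivative_one[OF _ this, of "Ad g w"]
  have 1: "((\<lambda>t. Ad g (Ad (ex u t) w)) has_vector_derivative br (Ad g u) (Ad g w)) (at 0)"
    by (simp add: Ad_mult)
  have "((\<lambda>t. Ad (ex u t) w) has_vector_derivative br u w) (at 0)"
    using Ad_derivative_one[OF _ ex_velocity] by simp
  then have "((\<lambda>t. Ad g (Ad (ex u t) w)) has_vector_derivative Ad g (br u w)) (at 0)"
    by (rule bounded_linear.has_vector_derivative[OF linear_conv_bounded_linear[THEN iffD1, OF Ad_linear]])
  with 1 show ?thesis using vector_derivative_unique_at by blast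
qed

text \<open>Turns membership into vanishing of scalar functions, which can be differentiated along
  curves.\<close>

lemma in_subspace_iff:
  fixes S :: "'b set"
  assumes "subspace S"
  shows "x \<in> S \<longleftrightarrow> (\<forall>z\<in>orthogonal_comp S. z \<bullet> x = 0)"
proof -
  have "x \<in> S \<longleftrightarrow> x \<in> orthogonal_comp (orthogonal_comp S)" using orthogonal_comp_self[OF assms] by simp
  then show ?thesis by (simp add: orthogonal_comp_def orthogonal_def)
qed

lemma br_invariant_of_Ad_invariant:
  assumes I: "subspace I" and Ad: "\<And>g w. w \<in> I \<Longrightarrow> Ad g w \<in> I" and w: "w \<in> I"
  shows "br u w \<in> I"
  unfolding in_subspace_iff[OF I]
proof
  fix z assume z: "z \<in> orthogonal_comp I"
  have "((\<lambda>t. Ad (ex u t) w) has_vector_derivative br u w) (at 0)"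
    using Ad_derivative_one[OF _ ex_velocity] by simp
  then have "((\<lambda>t. z \<bullet> Ad (ex u t) w) has_vector_derivative z \<bullet> br u w) (at 0)"
    by (rule bounded_linear.has_vector_derivative[OF bounded_linear_inner_right])
  moreover have "(\<lambda>t. z \<bullet> Ad (ex u t) w) = (\<lambda>t. 0)"
    using Ad[OF w] z in_subspace_iff[OF I] by auto
  ultimately show "z \<bullet> br u w = 0" by (metis has_vector_derivative_const vector_derivative_unique_at)
qed

text \<open>\<open>Ad (\<eta> t) w\<close> solves the linear equation driven by
  \<open>br (u t)\<close>. Straight lines in \<open>I\<close> are the test curves for Nagumo's
  theorem, and boundedness of the bracket gives the constant.\<close>

lemma Ad_curve_invariant:
  assumes I: "subspace I" "\<And>u w. w \<in> I \<Longrightarrow> br u w \<in> I" and w: "w \<in> I" and e0: "\<eta> 0 = \<one>"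
    and rl: "\<And>t. 0 \<le> t \<Longrightarrow> t \<le> 1 \<Longrightarrow> \<exists>u. norm u \<le> \<beta> \<and> rlog \<eta> u t"
  shows "Ad (\<eta> 1) w \<in> I"
proof -
  obtain M where M: "M \<ge> 0" "\<And>u v. norm (br u v) \<le> M * norm u * norm v" by (rule br_bounded) blast
  obtain u where u: "\<And>t. 0 \<le> t \<Longrightarrow> t \<le> 1 \<Longrightarrow> norm (u t) \<le> \<beta> \<and> rlog \<eta> (u t) t" using rl by metis
  have \<beta>: "\<beta> \<ge> 0" using u[of 0] norm_ge_zero[of "u 0"] by linarith
  have d: "((\<lambda>t. Ad (\<eta> t) w) has_vector_derivative br (u t) (Ad (\<eta> t) w)) (at t)" if "0 \<le> t" "t \<le> 1" for t
    using Ad_curve_derivative u[OF that] by blast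
  show ?thesis
  proof (rule nagumo_invariance[where x="\<lambda>t. Ad (\<eta> t) w" and Q=I and a=0 and b=1 and K="M * \<beta>"
      and x'="\<lambda>t. br (u t) (Ad (\<eta> t) w)"])
    show "closed I" by (rule closed_subspace[OF I(1)])
    show "Ad (\<eta> 0) w \<in> I" using w e0 by simp
    show "continuous_on {0..1} (\<lambda>t. Ad (\<eta> t) w)"
      by (intro continuous_at_imp_continuous_on ballI has_vector_derivative_continuous[OF d]) auto
    show "0 \<le> M * \<beta>" using M \<beta> by simp
    fix t v :: "real" assume t: "0 \<le> t" "t < 1"
    then show "((\<lambda>t. Ad (\<eta> t) w) has_vector_derivative br (u t) (Ad (\<eta> t) w)) (at t)" using d by simp
  next
    fix t v assume t: "0 \<le> t" "t < (1::real)" and v: "v \<in> I"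
    have "norm (br (u t) (Ad (\<eta> t) w) - br (u t) v) \<le> M * norm (u t) * norm (Ad (\<eta> t) w - v)"
      unfolding linear_diff[OF br_linear2, symmetric] by (rule M(2))
    also have "\<dots> \<le> M * \<beta> * norm (Ad (\<eta> t) w - v)"
      using u[of t] t M(1) by (intro mult_right_mono mult_left_mono) auto
    finally show "\<exists>\<omega> v'. \<omega> 0 = v \<and> (\<omega> has_vector_derivative v') (at 0) \<and> (\<forall>\<^sub>F s in at_right 0. \<omega> s \<in> I) \<and>
        norm (br (u t) (Ad (\<eta> t) w) - v') \<le> M * \<beta> * norm (Ad (\<eta> t) w - v)"
      using I v by (intro exI[of _ "\<lambda>s. v + s *\<^sub>R br (u t) v"] exI[of _ "br (u t) v"])
        (auto intro!: derivative_eq_intros always_eventually subspace_add subspace_scale)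
  qed auto
qed

lemma Ad_invariant_of_br_invariant:
  assumes conn: "connected (UNIV :: 'g set)"
    and I: "subspace I" "\<And>u w. w \<in> I \<Longrightarrow> br u w \<in> I" and w: "w \<in> I"
  shows "Ad g w \<in> I"
proof -
  obtain r where r: "r > 0" "cball p1 r \<subseteq> snd c1 ` fst c1"
    "\<And>v t. norm v \<le> r \<Longrightarrow> \<bar>t\<bar> \<le> 2 \<Longrightarrow> \<exists>u. norm u \<le> 2 * norm v \<and> rlog (line v) u t"
    by (rule line_rlog) blast
  have l0: "line v 0 = \<one>" for v by (simp add: line_def p1)
  have "(\<forall>w\<in>I. Ad g w \<in> I) \<and> (\<forall>w\<in>I. Ad (inv g) w \<in> I)"
  proof (rule connected_generated[OF conn r(1), where P="\<lambda>g. (\<forall>w\<in>I. Ad g w \<in> I) \<and> (\<forall>w\<in>I. Ad (inv g) w \<in> I)"])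
    fix v :: 'b assume v: "norm v \<le> r"
    show "(\<forall>w\<in>I. Ad (line v 1) w \<in> I) \<and> (\<forall>w\<in>I. Ad (inv (line v 1)) w \<in> I)"
    proof (intro conjI ballI)
      fix w assume w: "w \<in> I"
      show "Ad (line v 1) w \<in> I"
        by (rule Ad_curve_invariant[where \<eta>="line v", OF I w l0, where \<beta>="2 * norm v"]) (use r(3)[OF v] in auto)
      \<comment> \<open>The inverse of \<open>line v 1\<close> is reached by running the segment
        backwards from time 1, translated so as to start at the identity.\<close>
      have "Ad (line v (1 + -1 * 1) \<otimes> inv (line v 1)) w \<in> I"
      proof (rule Ad_curve_invariant[OF I w, where \<eta>="\<lambda>s. line v (1 + -1 * s) \<otimes> inv (line v 1)" and \<beta>="2 * norm v"])
        fix t :: real assume t: "0 \<le> t" "t \<le> 1"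
        then have "\<bar>1 + -1 * t\<bar> \<le> 2" by auto
        then obtain u where u: "norm u \<le> 2 * norm v" "rlog (line v) u (1 + -1 * t)" using r(3)[OF v] by blast
        from rlog_shift[OF u(2)] u(1)
        show "\<exists>u. norm u \<le> 2 * norm v \<and> rlog (\<lambda>s. line v (1 + -1 * s) \<otimes> inv (line v 1)) u t"
          by (intro exI[of _ "-1 *\<^sub>R u"]) simp
      qed auto
      then show "Ad (inv (line v 1)) w \<in> I" by (simp add: l0)
    qed
  qed (auto simp: Ad_mult inv_mult_group)
  then show ?thesis using w by blast
qed

lemma lower_central_invariant:
  assumes conn: "connected (UNIV :: 'g set)" and I: "lie_ideal br I"
  shows "subspace (lower_central br I j)" "w \<in> lower_central br I j \<Longrightarrow> Ad g w \<in> lower_central br I j"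
proof -
  have AI: "Ad g w \<in> I" if "w \<in> I" for g w
    using I that by (intro Ad_invariant_of_br_invariant[OF conn]) (auto simp: lie_ideal_def)
  show "subspace (lower_central br I j)" using I by (cases j) (auto simp: lie_ideal_def)
  show "w \<in> lower_central br I j \<Longrightarrow> Ad g w \<in> lower_central br I j"
  proof (induction j arbitrary: w)
    case 0 then show ?case using AI by simp
  next
    case (Suc j)
    let ?B = "{br u v | u v. u \<in> I \<and> v \<in> lower_central br I j}"
    have 1: "Ad g w \<in> span (Ad g ` ?B)" using Suc.prems linear_span_image[OF Ad_linear, of g ?B] by auto
    have "Ad g ` ?B \<subseteq> ?B" using AI Suc.IH by (auto simp: Ad_br) blast
    from subsetD[OF span_mono[OF this] 1] show ?case by simp
  qed
qed

text \<open>The chain is that of iterated brackets with all ideals containing a summand of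
  \<open>a\<close>. Termination is a pigeonhole argument on how often each ideal is used, which
  avoids proving that a sum of nilpotent ideals is nilpotent.\<close>

lemma nilradical_chain:
  assumes conn: "connected (UNIV :: 'g set)" and a: "a \<in> nilradical br"
  obtains D :: "nat \<Rightarrow> 'b set" and m where "D 0 = UNIV" "\<And>i. subspace (D i)" "D m = {0}"
    "\<And>i g w. w \<in> D i \<Longrightarrow> Ad g w \<in> D i" "\<And>i w. w \<in> D i \<Longrightarrow> br a w \<in> D (Suc i)"
proof -
  obtain F c where F: "finite F" "F \<subseteq> \<Union>{I. nilpotent_ideal br I}" "a = (\<Sum>x\<in>F. c x *\<^sub>R x)"
    using a unfolding nilradical_def span_explicit by blast
  have "\<forall>x\<in>F. \<exists>I. nilpotent_ideal br I \<and> x \<in> I" using F(2) by blast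
  then obtain I where I: "\<And>x. x \<in> F \<Longrightarrow> nilpotent_ideal br (I x)" "\<And>x. x \<in> F \<Longrightarrow> x \<in> I x" by metis
  then have "\<forall>x\<in>F. \<exists>j. lower_central br (I x) j = {0}" by (auto simp: nilpotent_ideal_def)
  then obtain s where s: "\<And>x. x \<in> F \<Longrightarrow> lower_central br (I x) (s x) = {0}" by metis
  have idl: "lie_ideal br (I x)" if "x \<in> F" for x using I(1)[OF that] by (simp add: nilpotent_ideal_def)
  have AdI: "Ad g w \<in> I x" if "x \<in> F" "w \<in> I x" for x g w
    using lower_central_invariant(2)[OF conn idl[OF that(1)], of w 0 g] that(2) by simp
  \<comment> \<open>A mere union: by linearity of the bracket in its first argument, brackets with
    \<open>a\<close> are covered by brackets with its span.\<close>
  define J where "J = (\<Union>x\<in>F. I x)"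
  have aJ: "a \<in> span J"
    unfolding F(3) by (intro span_sum span_scale span_base) (use I(2) in \<open>auto simp: J_def\<close>)
  define D where "D = rec_nat UNIV (\<lambda>i S. span {br x y | x y. x \<in> J \<and> y \<in> S})"
  have D0: "D 0 = UNIV" and DS: "D (Suc i) = span {br x y | x y. x \<in> J \<and> y \<in> D i}" for i by (auto simp: D_def)
  have sub: "subspace (D i)" for i by (cases i) (auto simp: D0 DS)
  have AdD: "Ad g w \<in> D i" if "w \<in> D i" for i g w
    using that
  proof (induction i arbitrary: w)
    case (Suc i)
    let ?B = "{br x y | x y. x \<in> J \<and> y \<in> D i}"
    have 1: "Ad g w \<in> span (Ad g ` ?B)" using Suc.prems linear_span_image[OF Ad_linear, of g ?B] by (auto simp: DS)
    have "Ad g ` ?B \<subseteq> ?B"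
    proof
      fix z assume "z \<in> Ad g ` ?B"
      then obtain x y where "x \<in> J" "y \<in> D i" "z = br (Ad g x) (Ad g y)" by (auto simp: Ad_br)
      moreover then have "Ad g x \<in> J" "Ad g y \<in> D i" using AdI Suc.IH by (auto simp: J_def)
      ultimately show "z \<in> ?B" by blast
    qed
    from subsetD[OF span_mono[OF this] 1] show ?case by (simp add: DS)
  qed (simp add: D0)
  have brD: "br a w \<in> D (Suc i)" if "w \<in> D i" for i w
  proof -
    have "span J \<subseteq> (\<lambda>x. br x w) -` D (Suc i)"
      by (rule span_minimal[OF _ linear_subspace_vimage[OF br_linear1 sub]]) (use that in \<open>auto simp: DS intro!: span_base\<close>)
    then show ?thesis using aJ by auto
  qed
  \<comment> \<open>The lower central series shifted by one, with the whole Lie algebra in front,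
    because \<open>D 0\<close> consists of arbitrary vectors.\<close>
  define LC where "LC = (\<lambda>x j. case j of 0 \<Rightarrow> UNIV | Suc j \<Rightarrow> lower_central br (I x) j)"
  have LCsub: "br u w \<in> LC x j" if "x \<in> F" "w \<in> LC x j" for x j u w
    using that br_invariant_of_Ad_invariant[OF lower_central_invariant[OF conn idl[OF that(1)]]]
    by (auto simp: LC_def split: nat.splits)
  have LCSuc: "br u w \<in> LC x (Suc j)" if "x \<in> F" "u \<in> I x" "w \<in> LC x j" for x j u w
  proof (cases j)
    case 0
    have "br w u \<in> I x" using idl[OF that(1)] that(2) by (simp add: lie_ideal_def)
    then have "- br w u \<in> I x" using idl[OF that(1)] by (simp add: lie_ideal_def subspace_neg)
    then show ?thesis using br_antisym[of u w] by (simp add: 0 LC_def)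
  next
    case (Suc i)
    then show ?thesis using that by (auto simp: LC_def intro!: span_base)
  qed
  \<comment> \<open>Here \<open>k x\<close> counts how often the ideal of \<open>x\<close> has been
    used. A bracket with an element of one ideal raises its own count by one and keeps the others,
    since all members of the series are ideals.\<close>
  define W where "W = (\<lambda>i. {w. \<exists>k. (\<Sum>x\<in>F. k x) = (i::nat) \<and> (\<forall>x\<in>F. w \<in> LC x (k x))})"
  have DW: "D i \<subseteq> span (W i)" for i
  proof (induction i)
    case 0
    have "w \<in> W 0" for w by (auto simp: W_def LC_def intro!: exI[of _ "\<lambda>_. 0"])
    then show ?case by (auto intro: span_base)
  next
    case (Suc i)
    have "br x y \<in> span (W (Suc i))" if x: "x \<in> J" and y: "y \<in> D i" for x y
    proof -
      obtain x0 where x0: "x0 \<in> F" "x \<in> I x0" using x by (auto simp: J_def)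
      have "br x w \<in> W (Suc i)" if "w \<in> W i" for w
      proof -
        obtain k where k: "(\<Sum>x\<in>F. k x) = i" "\<And>x. x \<in> F \<Longrightarrow> w \<in> LC x (k x)" using \<open>w \<in> W i\<close> by (auto simp: W_def)
        define k' where "k' = k(x0 := Suc (k x0))"
        have "(\<Sum>x\<in>F. k' x) = Suc i"
          using k(1) F(1) x0(1) by (simp add: k'_def sum.remove[of F x0])
        moreover have "br x w \<in> LC z (k' z)" if "z \<in> F" for z
          using that LCSuc[OF x0 k(2)[OF x0(1)]] LCsub[OF that k(2)[OF that]] by (auto simp: k'_def)
        ultimately show ?thesis by (auto simp: W_def)
      qed
      then have "span (W i) \<subseteq> br x -` span (W (Suc i))"
        by (intro span_minimal linear_subspace_vimage[OF br_linear2] subspace_span) (auto intro: span_base)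
      then show ?thesis using Suc.IH y by auto
    qed
    then show ?case unfolding DS by (intro span_minimal) auto
  qed
  \<comment> \<open>With total weight \<open>m\<close> some count \<open>k x\<close> exceeds
    \<open>s x\<close>; after undoing the shift by one, the vector lies in a vanishing member of the
    lower central series of \<open>I x\<close>.\<close>
  define m where "m = Suc (\<Sum>x\<in>F. s x)"
  have lc0: "lower_central br (I x) j = {0}" if "x \<in> F" "j \<ge> s x" for x j
    using that(2)
  proof (induction rule: dec_induct)
    case base then show ?case using s[OF that(1)] .
  next
    case (step j)
    have "0 \<in> I x" using idl[OF that(1)] by (simp add: lie_ideal_def subspace_0)
    then have "{br u v | u v. u \<in> I x \<and> v \<in> {0}} = {0}" using linear_0[OF br_linear2] by auto
    then show ?case using step.IH by simp
  qed
  have "W m \<subseteq> {0}"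
  proof
    fix w assume "w \<in> W m"
    then obtain k where k: "(\<Sum>x\<in>F. k x) = m" "\<And>x. x \<in> F \<Longrightarrow> w \<in> LC x (k x)" by (auto simp: W_def)
    have "\<exists>x\<in>F. s x < k x"
    proof (rule ccontr)
      assume "\<not> ?thesis"
      then have "(\<Sum>x\<in>F. k x) \<le> (\<Sum>x\<in>F. s x)" by (intro sum_mono) (auto simp: not_less)
      then show False using k(1) by (simp add: m_def)
    qed
    then obtain x where x: "x \<in> F" "s x < k x" by blast
    then obtain j where "k x = Suc j" "s x \<le> j" by (metis Suc_le_D Suc_le_eq less_Suc_eq_le)
    then show "w \<in> {0}" using k(2)[OF x(1)] lc0[OF x(1)] by (simp add: LC_def)
  qed
  then have "D m \<subseteq> {0}" using DW[of m] span_mono[of "W m" "{0}"] by auto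
  then have "D m = {0}" using subspace_0[OF sub[of m]] by auto
  then show ?thesis using that[OF D0 sub _ AdD brD] by simp
qed

text \<open>The derivative of \<open>Ad (ex a t) w\<close> is a bracket of \<open>a\<close> with an
  element of \<open>D\<close>, so every functional vanishing on \<open>D'\<close> is constant along
  the curve.\<close>

lemma Ad_exp_unipotent:
  assumes D: "subspace D" "subspace D'" "\<And>g w. w \<in> D \<Longrightarrow> Ad g w \<in> D" "\<And>w. w \<in> D \<Longrightarrow> br a w \<in> D'"
    and w: "w \<in> D"
  shows "Ad (ex a 1) w - w \<in> D'"
  unfolding in_subspace_iff[OF D(2)]
proof
  fix z assume z: "z \<in> orthogonal_comp D'"
  have d: "((\<lambda>t. z \<bullet> Ad (ex a t) w) has_vector_derivative 0) (at t)" for t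
  proof -
    have "((\<lambda>t. z \<bullet> Ad (ex a t) w) has_vector_derivative z \<bullet> br a (Ad (ex a t) w)) (at t)"
      by (rule bounded_linear.has_vector_derivative[OF bounded_linear_inner_right Ad_curve_derivative[OF ex_rlog]])
    moreover have "z \<bullet> br a (Ad (ex a t) w) = 0" using D(3,4) w z in_subspace_iff[OF D(2)] by blast
    ultimately show ?thesis by simp
  qed
  have "\<exists>c. \<forall>t\<in>UNIV. z \<bullet> Ad (ex a t) w = c"
    by (rule has_derivative_zero_constant) (use d in \<open>auto simp: has_vector_derivative_def\<close>)
  then obtain c where "\<And>t. z \<bullet> Ad (ex a t) w = c" by blast
  from this[of 1] this[of 0] have "z \<bullet> Ad (ex a 1) w = z \<bullet> Ad (ex a 0) w" by simp
  then show "z \<bullet> (Ad (ex a 1) w - w) = 0" by (simp add: inner_diff_right)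
qed

end

section \<open>Uniform estimates on a compact Riemannian manifold\<close>

text \<open>A strict inequality on the unit sphere over one point survives over a neighbourhood; its
  applications then extend it to all vectors by homogeneity.\<close>

lemma sphere_tube:
  fixes H :: "'x::topological_space \<Rightarrow> 'e::euclidean_space \<Rightarrow> real"
  assumes S: "open S" "z0 \<in> S" and cont: "continuous_on (S \<times> UNIV) (\<lambda>(z, v). H z v)"
    and neg: "\<And>v. norm v = 1 \<Longrightarrow> H z0 v < 0"
  obtains Z where "open Z" "z0 \<in> Z" "Z \<subseteq> S" "\<And>z v. z \<in> Z \<Longrightarrow> norm v = 1 \<Longrightarrow> H z v < 0"
proof -
  let ?W = "(S \<times> UNIV) \<inter> (\<lambda>(z, v). H z v) -` {..<0}"
  have "open ?W" by (intro continuous_open_preimage[OF cont] open_Times S open_UNIV open_lessThan)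
  moreover have "{z0} \<times> sphere 0 1 \<subseteq> ?W" using S neg by auto
  ultimately obtain X0 where "z0 \<in> X0" "open X0" "X0 \<times> sphere 0 1 \<subseteq> ?W"
    using Elementary_Topology.tube_lemma[OF compact_sphere] by metis
  then show ?thesis using that[of "X0 \<inter> S"] S by force
qed

lemma compact_tube:
  fixes P :: "'g::topological_space \<Rightarrow> 'm::topological_space \<Rightarrow> bool"
  assumes K: "compact (UNIV :: 'm set)"
    and loc: "\<And>x. \<exists>Q. open Q \<and> (g0, x) \<in> Q \<and> (\<forall>(g, y)\<in>Q. P g y)"
  obtains W where "open W" "g0 \<in> W" "\<And>g x. g \<in> W \<Longrightarrow> P g x"
proof -
  define U where "U = \<Union>{V. open V \<and> (\<forall>(g, y)\<in>V. P g y)}"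
  have "open U" unfolding U_def by (rule open_Union) blast
  moreover have "{g0} \<times> UNIV \<subseteq> U"
  proof
    fix z assume "z \<in> {g0} \<times> (UNIV :: 'm set)"
    then have z: "z = (g0, snd z)" by auto
    obtain Q where Q: "open Q" "(g0, snd z) \<in> Q" "\<forall>(g, y)\<in>Q. P g y" using loc[of "snd z"] by blast
    show "z \<in> U" unfolding U_def by (rule UnionI[of Q]) (use Q z in auto)
  qed
  ultimately obtain X0 where X0: "g0 \<in> X0" "open X0" "X0 \<times> UNIV \<subseteq> U"
    using Elementary_Topology.tube_lemma[OF K] by metis
  have "P g x" if "g \<in> X0" for g x
  proof -
    have "(g, x) \<in> U" using X0(3) that by blast
    then show ?thesis unfolding U_def by blast
  qed
  then show ?thesis using that[of X0] X0 by blast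
qed

text \<open>Monotonicity in the constant allows passing to the maximum over a finite
  subcover.\<close>

lemma compact_uniform_bound:
  fixes P :: "real \<Rightarrow> 'm::topological_space \<Rightarrow> bool"
  assumes K: "compact (UNIV :: 'm set)" and mono: "\<And>C C' x. P C x \<Longrightarrow> C \<le> C' \<Longrightarrow> P C' x"
    and loc: "\<And>x. \<exists>Q C. open Q \<and> x \<in> Q \<and> (\<forall>y\<in>Q. P C y)"
  obtains C where "\<And>x. P C x"
proof -
  obtain O' C where OC: "\<And>x. open (O' x)" "\<And>x. x \<in> O' x" "\<And>x y. y \<in> O' x \<Longrightarrow> P (C x) y"
    using loc by metis
  obtain F where F: "finite F" "UNIV \<subseteq> (\<Union>x\<in>F. O' x)"
    using compactE_image[OF K, of UNIV O'] OC by (metis UNIV_I UN_I subsetI)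
  have "P (Max (C ` F)) y" for y
  proof -
    obtain x where "x \<in> F" "y \<in> O' x" using F(2) by blast
    then show ?thesis using mono[OF OC(3)] F(1) by simp
  qed
  then show ?thesis using that by blast
qed

locale riem_action = smooth_action G AG AM \<phi>
  for G :: "'g::{t2_space,second_countable_topology} monoid" (structure)
    and AG :: "('g, 'b::euclidean_space) atlas"
    and AM :: "('m::{t2_space,second_countable_topology}, 'e::euclidean_space) atlas"
    and \<phi> :: "'g \<Rightarrow> 'm \<Rightarrow> 'm" +
  fixes \<rho> :: "'m \<Rightarrow> 'e \<Rightarrow> 'e \<Rightarrow> real"
  assumes compact_M: "compact (UNIV :: 'm set)" and riem: "riemannian_metric AM \<rho>"
    and conn: "connected (UNIV :: 'g set)"
    and discrete_stab: "discrete (stabilizer G \<phi> x)"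
begin

definition N where "N x v = rnorm \<rho> x v"

lemma rho_bilinear: "bilinear (\<rho> x)" and rho_sym: "\<rho> x v w = \<rho> x w v"
  and rho_pos: "v \<noteq> 0 \<Longrightarrow> \<rho> x v v > 0"
  using riem by (auto simp: riemannian_metric_def)

lemma rho_simps:
  "\<rho> x (u + v) w = \<rho> x u w + \<rho> x v w" "\<rho> x w (u + v) = \<rho> x w u + \<rho> x w v"
  "\<rho> x (c *\<^sub>R v) w = c * \<rho> x v w" "\<rho> x w (c *\<^sub>R v) = c * \<rho> x w v"
  "\<rho> x 0 w = 0" "\<rho> x w 0 = 0"
  using bilinear_ladd[OF rho_bilinear] bilinear_radd[OF rho_bilinear] bilinear_lmul[OF rho_bilinear]
    bilinear_rmul[OF rho_bilinear] bilinear_lzero[OF rho_bilinear] bilinear_rzero[OF rho_bilinear]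
  by simp_all

lemma rho_nonneg: "\<rho> x v v \<ge> 0"
  using rho_pos[of v x] rho_simps(5)[of x 0] by (cases "v = 0") auto

lemma N_nonneg [simp]: "N x v \<ge> 0"
  by (simp add: N_def rnorm_def rho_nonneg)

lemma N_zero [simp]: "N x 0 = 0"
  by (simp add: N_def rnorm_def rho_simps)

lemma N_pos: "v \<noteq> 0 \<Longrightarrow> N x v > 0"
  by (simp add: N_def rnorm_def rho_pos)

lemma N_scale: "N x (c *\<^sub>R v) = \<bar>c\<bar> * N x v"
  by (simp add: N_def rnorm_def rho_simps real_sqrt_mult mult.assoc[symmetric] power2_eq_square[symmetric])

lemma N_square: "(N x v)\<^sup>2 = \<rho> x v v"
  by (simp add: N_def rnorm_def rho_nonneg)

lemma N_triangle: "N x (v + w) \<le> N x v + N x w"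
proof (cases "w = 0")
  case False
  define t where "t = - (\<rho> x v w / \<rho> x w w)"
  have p: "\<rho> x w w > 0" using rho_pos[OF False] .
  have "0 \<le> \<rho> x (v + t *\<^sub>R w) (v + t *\<^sub>R w)" by (rule rho_nonneg)
  also have "\<dots> = \<rho> x v v + 2 * t * \<rho> x v w + t * t * \<rho> x w w"
    by (simp add: rho_simps rho_sym[of x w v] algebra_simps)
  also have "\<dots> = \<rho> x v v - (\<rho> x v w)\<^sup>2 / \<rho> x w w"
    using p by (simp add: t_def field_simps power2_eq_square)
  finally have "(\<rho> x v w)\<^sup>2 \<le> \<rho> x v v * \<rho> x w w" using p by (simp add: field_simps)
  also have "\<dots> = (N x v * N x w)\<^sup>2" by (simp add: N_square power_mult_distrib)
  finally have cs: "\<rho> x v w \<le> N x v * N x w" by (rule power2_le_imp_le) simp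
  have "(N x (v + w))\<^sup>2 = (N x v)\<^sup>2 + 2 * \<rho> x v w + (N x w)\<^sup>2"
    by (simp add: N_square rho_simps rho_sym[of x w v])
  also have "\<dots> \<le> (N x v + N x w)\<^sup>2" using cs by (simp add: power2_sum)
  finally show ?thesis by (rule power2_le_imp_le) simp
qed simp

lemma N_minus: "N x (- v) = N x v"
  using N_scale[of x "-1" v] by simp

lemma N_triangle_diff: "N x (v - w) \<le> N x v + N x w"
  using N_triangle[of x v "- w"] by (simp add: N_minus)

lemma N_triangle_sub: "N x v - N x w \<le> N x (v + w)"
  using N_triangle_diff[of x "v + w" w] by simp

text \<open>The Riemannian norm in the coordinates of \<open>d\<close>: \<open>v\<close> is a
  coordinate vector and \<open>p\<close> a coordinate point.\<close>

definition Nch where "Nch d p v = N (chart_inv d p) (from_chart AM d p v)"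

lemma Nch_continuous:
  assumes d: "d \<in> AM"
  shows "continuous_on ((snd d ` fst d) \<times> UNIV) (\<lambda>(p, v). Nch d p v)"
proof -
  note dh = smooth_atlas_chart[OF atlas_M d]
  let ?S = "snd d ` fst d"
  define R where "R = (\<lambda>p a b. \<rho> (chart_inv d p) (from_chart AM d p a) (from_chart AM d p b))"
  have c: "continuous_on ?S (\<lambda>p. R p a b)" for a b
  proof -
    have "smooth_on ?S (\<lambda>p. R p a b)" using riem d unfolding R_def riemannian_metric_def by blast
    then show ?thesis unfolding smooth_on_def using Ck_on_imp_continuous_on by blast
  qed
  have lin1: "R p v b = (\<Sum>a\<in>Basis. (v \<bullet> a) *\<^sub>R R p a b)" and lin2: "R p b v = (\<Sum>a\<in>Basis. (v \<bullet> a) *\<^sub>R R p b a)"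
    if "p \<in> ?S" for p v b
  proof -
    note l = linear_from_chart[OF atlas_M d that]
    have l1: "linear (\<lambda>v. R p v b)" and l2: "linear (\<lambda>v. R p b v)"
      unfolding R_def by (intro linearI; simp add: linear_add[OF l] linear_cmul[OF l] rho_simps)+
    show "R p v b = (\<Sum>a\<in>Basis. (v \<bullet> a) *\<^sub>R R p a b)" by (rule linear_basis_expansion[OF l1])
    show "R p b v = (\<Sum>a\<in>Basis. (v \<bullet> a) *\<^sub>R R p b a)" by (rule linear_basis_expansion[OF l2])
  qed
  have "continuous_on (?S \<times> UNIV) (\<lambda>z. sqrt (\<Sum>a\<in>Basis. (snd z \<bullet> a) *\<^sub>R (\<Sum>b\<in>Basis. (snd z \<bullet> b) *\<^sub>R R (fst z) a b)))"
    by (intro continuous_intros continuous_on_compose2[OF c]) auto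
  then show ?thesis
  proof (rule continuous_on_eq)
    fix z assume "z \<in> ?S \<times> (UNIV :: 'e set)"
    then have "fst z \<in> ?S" by auto
    then show "sqrt (\<Sum>a\<in>Basis. (snd z \<bullet> a) *\<^sub>R (\<Sum>b\<in>Basis. (snd z \<bullet> b) *\<^sub>R R (fst z) a b)) = (case z of (p, v) \<Rightarrow> Nch d p v)"
      by (subst lin2[symmetric], assumption, subst lin1[symmetric], assumption)
        (simp add: Nch_def N_def rnorm_def R_def case_prod_beta)
  qed
qed

lemma Nch_scale:
  assumes "d \<in> AM" "p \<in> snd d ` fst d"
  shows "Nch d p (c *\<^sub>R v) = \<bar>c\<bar> * Nch d p v"
  by (simp add: Nch_def linear_cmul[OF linear_from_chart[OF atlas_M assms]] N_scale)

lemma Nch_pos: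
  assumes d: "d \<in> AM" "p \<in> snd d ` fst d" and v: "v \<noteq> 0"
  shows "Nch d p v > 0"
proof -
  have "from_chart AM d p v \<noteq> 0"
    using in_chart_from_chart[OF atlas_M d, of v] v
      linear_0[OF linear_in_chart[OF atlas_M d(1) smooth_atlas_chart(7)[OF atlas_M d]]] by auto
  then show ?thesis by (simp add: Nch_def N_pos)
qed

lemma norm_one_scale:
  fixes v :: "'x::real_normed_vector"
  assumes "v \<noteq> 0"
  obtains w where "norm w = 1" "v = norm v *\<^sub>R w"
  using that[of "(1 / norm v) *\<^sub>R v"] assms by simp

lemma Nch_bounds:
  assumes d: "d \<in> AM" and K: "compact K" "K \<subseteq> snd d ` fst d"
  obtains A where "A \<ge> 1" "\<And>p v. p \<in> K \<Longrightarrow> Nch d p v \<le> A * norm v" "\<And>p v. p \<in> K \<Longrightarrow> norm v \<le> A * Nch d p v"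
proof (cases "K = {}")
  case True
  then show ?thesis using that[of 1] by simp
next
  case False
  let ?K = "K \<times> sphere (0::'e) 1"
  have cK: "compact ?K" by (intro compact_Times K compact_sphere)
  have ne: "?K \<noteq> {}" using False by simp
  have cont: "continuous_on ?K (\<lambda>(p, v). Nch d p v)"
    by (rule continuous_on_subset[OF Nch_continuous[OF d]]) (use K in auto)
  obtain zm where zm: "zm \<in> ?K" "\<And>z. z \<in> ?K \<Longrightarrow> (case zm of (p, v) \<Rightarrow> Nch d p v) \<le> (case z of (p, v) \<Rightarrow> Nch d p v)"
    using continuous_attains_inf[OF cK ne cont] by blast
  obtain zM where zM: "zM \<in> ?K" "\<And>z. z \<in> ?K \<Longrightarrow> (case z of (p, v) \<Rightarrow> Nch d p v) \<le> (case zM of (p, v) \<Rightarrow> Nch d p v)"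
    using continuous_attains_sup[OF cK ne cont] by blast
  define m M where "m = (case zm of (p, v) \<Rightarrow> Nch d p v)" and "M = (case zM of (p, v) \<Rightarrow> Nch d p v)"
  have m: "m > 0" using zm(1) K by (auto simp: m_def intro!: Nch_pos[OF d])
  define A where "A = Max {1, M, 1 / m}"
  have A: "A \<ge> 1" "M \<le> A" "1 / m \<le> A" by (auto simp: A_def)
  have b: "Nch d p v \<le> A * norm v \<and> norm v \<le> A * Nch d p v" if p: "p \<in> K" for p v
  proof (cases "v = 0")
    case True
    then show ?thesis using Nch_scale[OF d, of p 0 0] p K by auto
  next
    case False
    obtain w where w: "norm w = 1" "v = norm v *\<^sub>R w" by (rule norm_one_scale[OF False])
    have e: "Nch d p v = norm v * Nch d p w" using Nch_scale[OF d, of p "norm v" w] p K w(2) by auto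
    have "m \<le> Nch d p w" "Nch d p w \<le> M" using zm(2)[of "(p, w)"] zM(2)[of "(p, w)"] p w by (auto simp: m_def M_def)
    then have "Nch d p w \<le> A" "1 \<le> A * Nch d p w"
      using A m mult_mono[of "1 / m" A m "Nch d p w"] by auto
    then show ?thesis using e mult_left_mono[of "Nch d p w" A "norm v"] mult_left_mono[of 1 "A * Nch d p w" "norm v"]
      by (simp add: mult_ac)
  qed
  then show ?thesis using that[OF A(1)] by blast
qed

section \<open>Uniform bounds for the tangent maps and the fundamental fields\<close>

lemma T_loc:
  assumes c: "c \<in> AG" and d: "d \<in> AM" and e: "e \<in> AM" and z: "z \<in> loc_dom c d e (\<lambda>(g, x). \<phi> g x)"
  shows "N (\<phi> (chart_inv c (fst z)) (chart_inv d (snd z)))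
      (T (chart_inv c (fst z)) (chart_inv d (snd z)) (from_chart AM d (snd z) v)) =
    Nch e (loc_rep c d e (\<lambda>(g, x). \<phi> g x) z) (frechet_derivative (loc_rep c d e (\<lambda>(g, x). \<phi> g x)) (at z) (0, v))"
    and "loc_rep c d e (\<lambda>(g, x). \<phi> g x) z \<in> snd e ` fst e"
proof -
  note ch = smooth_atlas_chart[OF atlas_G c] and dh = smooth_atlas_chart[OF atlas_M d] and eh = smooth_atlas_chart[OF atlas_M e]
  define g x where "g = chart_inv c (fst z)" and "x = chart_inv d (snd z)"
  have g: "g \<in> fst c" "snd c g = fst z" and x: "x \<in> fst d" "snd d x = snd z" and y: "\<phi> g x \<in> fst e"
    using z ch dh by (auto simp: loc_dom_def g_def x_def)
  have z0: "tangent_map AG AM (\<lambda>h. \<phi> h x) g (from_chart AG c (snd c g) 0) = 0"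
  proof -
    have "snd c g \<in> snd c ` fst c" using g(1) by simp
    from linear_0[OF linear_from_chart[OF atlas_G c this]]
    show ?thesis using linear_0[OF tdiff_linear[OF tdiff_orbit]] by simp
  qed
  have D: "frechet_derivative (loc_rep c d e (\<lambda>(g, x). \<phi> g x)) (at z) (0, v) =
      in_chart AM e (\<phi> g x) (T g x (from_chart AM d (snd z) v))"
    using smooth_bimap.loc_rep_tangent[OF act_bimap c g(1) d x(1) e, of 0 v] y z0 g(2) x(2)
    by (simp add: T_def)
  have L: "loc_rep c d e (\<lambda>(g, x). \<phi> g x) z = snd e (\<phi> g x)" by (simp add: loc_rep_def g_def x_def)
  show "loc_rep c d e (\<lambda>(g, x). \<phi> g x) z \<in> snd e ` fst e" using L y by simp
  show "N (\<phi> (chart_inv c (fst z)) (chart_inv d (snd z)))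
      (T (chart_inv c (fst z)) (chart_inv d (snd z)) (from_chart AM d (snd z) v)) =
    Nch e (loc_rep c d e (\<lambda>(g, x). \<phi> g x) z) (frechet_derivative (loc_rep c d e (\<lambda>(g, x). \<phi> g x)) (at z) (0, v))"
    unfolding g_def[symmetric] x_def[symmetric] Nch_def D L eh(5)[OF y] from_chart_in_chart[OF atlas_M e y] ..
qed

lemma T_loc_continuous:
  assumes c: "c \<in> AG" and d: "d \<in> AM" and e: "e \<in> AM"
  shows "continuous_on (loc_dom c d e (\<lambda>(g, x). \<phi> g x) \<times> UNIV) (\<lambda>(z, v).
    Nch e (loc_rep c d e (\<lambda>(g, x). \<phi> g x) z) (frechet_derivative (loc_rep c d e (\<lambda>(g, x). \<phi> g x)) (at z) (0, v)))"
proof -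
  let ?F = "\<lambda>(g, x). \<phi> g x" let ?S = "loc_dom c d e ?F" and ?L = "loc_rep c d e ?F"
  have C1: "Ck_on (Suc 0) ?S ?L" by (rule smooth_bimap.loc_rep_Ck[OF act_bimap c d e])
  have L: "continuous_on ?S ?L" using C1 by (rule Ck_on_imp_continuous_on)
  have D: "continuous_on (?S \<times> UNIV) (\<lambda>(z, v). frechet_derivative ?L (at z) v)" by (rule C1_derivative_continuous[OF C1])
  have D': "continuous_on (?S \<times> UNIV) (\<lambda>z. frechet_derivative ?L (at (fst z)) (0, snd z))"
  proof -
    have "continuous_on (?S \<times> UNIV) (\<lambda>z. case (fst z, (0, snd z)) of (z, v) \<Rightarrow> frechet_derivative ?L (at z) v)"
      by (rule continuous_on_compose2[OF D]) (auto intro!: continuous_intros)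
    then show ?thesis by simp
  qed
  have L': "continuous_on (?S \<times> UNIV) (\<lambda>z. ?L (fst z))"
    by (rule continuous_on_compose2[OF L continuous_on_fst[OF continuous_on_id]]) auto
  have "continuous_on (?S \<times> UNIV) (\<lambda>z. case (?L (fst z), frechet_derivative ?L (at (fst z)) (0, snd z)) of (p, v) \<Rightarrow> Nch e p v)"
    by (rule continuous_on_compose2[OF Nch_continuous[OF e] continuous_on_Pair[OF L' D']])
      (use T_loc(2)[OF c d e] in auto)
  then show ?thesis by (simp add: case_prod_beta)
qed

text \<open>Fixing \<open>x\<close> and \<open>v\<close> while \<open>g\<close> varies is what
  closedness of the stabilizer of the splitting requires later.\<close>

lemma TN_continuous: "continuous_on UNIV (\<lambda>g. N (\<phi> g x) (T g x v))"
proof -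
  have "isCont (\<lambda>g. N (\<phi> g x) (T g x v)) g0" for g0
  proof -
    define c d e where "c = chart_at AG g0" and "d = chart_at AM x" and "e = chart_at AM (\<phi> g0 x)"
    have c: "c \<in> AG" "g0 \<in> fst c" and d: "d \<in> AM" "x \<in> fst d" and e: "e \<in> AM" "\<phi> g0 x \<in> fst e"
      using chart_at_props[OF atlas_G] chart_at_props[OF atlas_M] by (auto simp: c_def d_def e_def)
    note ch = smooth_atlas_chart[OF atlas_G c(1)] and dh = smooth_atlas_chart[OF atlas_M d(1)]
    let ?F = "\<lambda>(g, x). \<phi> g x" let ?S = "loc_dom c d e ?F" and ?L = "loc_rep c d e ?F"
    have opS: "open ?S" by (rule smooth_bimap.loc_dom_open[OF act_bimap c(1) d(1) e(1)])
    define w where "w = in_chart AM d x v"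
    have w: "from_chart AM d (snd d x) w = v" by (simp add: w_def from_chart_in_chart[OF atlas_M d])
    have cc: "continuous_on (fst c) (\<lambda>g. (snd c g, snd d x))" using ch(3) by (intro continuous_intros)
    define O' where "O' = fst c \<inter> (\<lambda>g. (snd c g, snd d x)) -` ?S"
    have O': "open O'" unfolding O'_def by (rule continuous_open_preimage[OF cc ch(1) opS])
    have g0: "g0 \<in> O'" using smooth_bimap.in_loc_dom[OF act_bimap c(1) d(1) e(1) c(2) d(2)] e c by (simp add: O'_def)
    have "continuous_on O' (\<lambda>g. case ((snd c g, snd d x), w) of (z, v) \<Rightarrow>
        Nch e (?L z) (frechet_derivative ?L (at z) (0, v)))"
      by (rule continuous_on_compose2[OF T_loc_continuous[OF c(1) d(1) e(1)]])
        (auto simp: O'_def intro!: continuous_on_Pair continuous_on_const continuous_on_subset[OF ch(3)])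
    moreover have "(case ((snd c g, snd d x), w) of (z, v) \<Rightarrow>
        Nch e (?L z) (frechet_derivative ?L (at z) (0, v))) = N (\<phi> g x) (T g x v)" if "g \<in> O'" for g
      using T_loc(1)[OF c(1) d(1) e(1), of "(snd c g, snd d x)" w] that ch(5)[of g] dh(5)[OF d(2)] w by (simp add: O'_def)
    ultimately have "continuous_on O' (\<lambda>g. N (\<phi> g x) (T g x v))" by (rule continuous_on_eq)
    then show ?thesis using O' g0 by (simp add: continuous_on_eq_continuous_at)
  qed
  then show ?thesis by (simp add: continuous_at_imp_continuous_on)
qed

text \<open>At the identity the tangent map is the identity, so 2 is a strict bound on unit vectors;
  it persists near each point and, by compactness of the manifold, uniformly over it.\<close>

lemma T_near_one:
  obtains W where "open W" "\<one> \<in> W" "\<And>k x v. k \<in> W \<Longrightarrow> N (\<phi> k x) (T k x v) \<le> 2 * N x v"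
proof -
  have "\<exists>Q. open Q \<and> (\<one>, x0) \<in> Q \<and> (\<forall>(k, x)\<in>Q. \<forall>v. N (\<phi> k x) (T k x v) \<le> 2 * N x v)" for x0
  proof -
    define d where "d = chart_at AM x0"
    have d: "d \<in> AM" "x0 \<in> fst d" using chart_at_props[OF atlas_M] by (auto simp: d_def)
    note ch = smooth_atlas_chart[OF atlas_G c1(1)] and dh = smooth_atlas_chart[OF atlas_M d(1)]
    let ?F = "\<lambda>(g, x). \<phi> g x" let ?S = "loc_dom c1 d d ?F" and ?L = "loc_rep c1 d d ?F"
    have opS: "open ?S" by (rule smooth_bimap.loc_dom_open[OF act_bimap c1(1) d(1) d(1)])
    have z0: "(p1, snd d x0) \<in> ?S"
      using smooth_bimap.in_loc_dom[OF act_bimap c1(1) d(1) d(1) c1(2) d(2)] d by (simp add: p1_def)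
    define H where "H = (\<lambda>z v. Nch d (?L z) (frechet_derivative ?L (at z) (0, v)) - 2 * Nch d (snd z) v)"
    have "continuous_on (?S \<times> UNIV) (\<lambda>y. case (snd (fst y), snd y) of (p, v) \<Rightarrow> Nch d p v)"
      by (rule continuous_on_compose2[OF Nch_continuous[OF d(1)]])
        (auto intro!: continuous_intros simp: loc_dom_def)
    then have cont: "continuous_on (?S \<times> UNIV) (\<lambda>(z, v). H z v)"
      using T_loc_continuous[OF c1(1) d(1) d(1)] unfolding H_def
      by (auto simp: case_prod_beta intro!: continuous_intros)
    have neg: "H (p1, snd d x0) v < 0" if "norm v = 1" for v
    proof -
      have "Nch d (?L (p1, snd d x0)) (frechet_derivative ?L (at (p1, snd d x0)) (0, v)) = Nch d (snd d x0) v"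
        using T_loc(1)[OF c1(1) d(1) d(1) z0, of v] p1 dh(5)[OF d(2)] by (simp add: Nch_def)
      moreover have "Nch d (snd d x0) v > 0" using that d by (intro Nch_pos) auto
      ultimately show ?thesis by (simp add: H_def)
    qed
    obtain Z where Z: "open Z" "(p1, snd d x0) \<in> Z" "Z \<subseteq> ?S" "\<And>z v. z \<in> Z \<Longrightarrow> norm v = 1 \<Longrightarrow> H z v < 0"
      by (rule sphere_tube[OF opS z0 cont neg]) blast+
    have cc: "continuous_on (fst c1 \<times> fst d) (\<lambda>y. (snd c1 (fst y), snd d (snd y)))"
      by (intro continuous_on_Pair continuous_on_compose2[OF ch(3) continuous_on_fst[OF continuous_on_id]]
          continuous_on_compose2[OF dh(3) continuous_on_snd[OF continuous_on_id]]) auto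
    define O' where "O' = (fst c1 \<times> fst d) \<inter> (\<lambda>y. (snd c1 (fst y), snd d (snd y))) -` Z"
    have "open O'" unfolding O'_def by (rule continuous_open_preimage[OF cc open_Times[OF ch(1) dh(1)] Z(1)])
    moreover have "(\<one>, x0) \<in> O'" using c1 d Z(2) by (simp add: O'_def p1_def)
    moreover have "N (\<phi> k x) (T k x v) \<le> 2 * N x v" if kx: "(k, x) \<in> O'" for k x v
    proof -
      have k: "k \<in> fst c1" "x \<in> fst d" "(snd c1 k, snd d x) \<in> Z" using kx by (auto simp: O'_def)
      define v' where "v' = in_chart AM d x v"
      have v': "from_chart AM d (snd d x) v' = v" by (simp add: v'_def from_chart_in_chart[OF atlas_M d(1) k(2)])
      have xi: "snd d x \<in> snd d ` fst d" using k by simp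
      show ?thesis
      proof (cases "v' = 0")
        case True
        then have "v = 0" using v' linear_0[OF linear_from_chart[OF atlas_M d(1) xi]] by simp
        then show ?thesis using linear_0[OF T_linear] by simp
      next
        case False
        obtain w where w: "norm w = 1" "v' = norm v' *\<^sub>R w" by (rule norm_one_scale[OF False])
        define v1 where "v1 = from_chart AM d (snd d x) w"
        have v1: "v = norm v' *\<^sub>R v1" using v' w(2) linear_cmul[OF linear_from_chart[OF atlas_M d(1) xi], of "norm v'" w] by (metis v1_def)
        have "N (\<phi> k x) (T k x v1) < 2 * N x v1"
          using Z(4)[OF k(3) w(1)] T_loc(1)[OF c1(1) d(1) d(1) subsetD[OF Z(3) k(3)], of w] ch(5)[OF k(1)] dh(5)[OF k(2)]
          by (simp add: H_def Nch_def v1_def)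
        from mult_left_mono[OF less_imp_le[OF this], of "norm v'"] show ?thesis
          by (simp add: v1 N_scale linear_cmul[OF T_linear] del: norm_scaleR)
      qed
    qed
    ultimately show ?thesis by (intro exI[of _ O']) auto
  qed
  from compact_tube[OF compact_M this] show ?thesis using that by metis
qed

text \<open>The bounds multiply under composition, so it suffices to have one near the identity. The
  bound for the inverse is carried along since the generation argument needs inverses.\<close>

lemma T_bounded: "\<exists>C\<ge>1. \<forall>x v. N (\<phi> g x) (T g x v) \<le> C * N x v"
proof -
  obtain W where W: "open W" "\<one> \<in> W" "\<And>k x v. k \<in> W \<Longrightarrow> N (\<phi> k x) (T k x v) \<le> 2 * N x v" by (rule T_near_one) blast
  define W' where "W' = W \<inter> (\<lambda>g. inv g) -` W"
  have W': "open W'" "\<one> \<in> W'" unfolding W'_def using W by (auto intro!: open_Int open_vimage continuous_inv)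
  define B where "B = (\<lambda>g. \<exists>C\<ge>1. \<forall>x v. N (\<phi> g x) (T g x v) \<le> C * N x v)"
  have B1: "B g" if "g \<in> W" for g using W(3)[OF that] unfolding B_def by (intro exI[of _ 2]) auto
  have Bm: "B (g \<otimes> h)" if "B g" "B h" for g h
  proof -
    obtain C where C1: "C \<ge> 1" "\<forall>x v. N (\<phi> g x) (T g x v) \<le> C * N x v" using \<open>B g\<close> unfolding B_def by blast
    obtain C' where C2: "C' \<ge> 1" "\<forall>x v. N (\<phi> h x) (T h x v) \<le> C' * N x v" using \<open>B h\<close> unfolding B_def by blast
    note C = C1(1) C1(2)[rule_format] C2(1) C2(2)[rule_format]
    have "N (\<phi> (g \<otimes> h) x) (T (g \<otimes> h) x v) \<le> C * C' * N x v" for x v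
      using order_trans[OF C(2)[of "\<phi> h x" "T h x v"] mult_left_mono[OF C(4)[of x v], of C]] C(1)
      by (simp add: act_mult T_mult mult.assoc)
    moreover have "C * C' \<ge> 1" using mult_mono[OF C(1,3)] C(1) by simp
    ultimately show ?thesis unfolding B_def by blast
  qed
  note ch = smooth_atlas_chart[OF atlas_G c1(1)]
  have "open (snd c1 ` fst c1 \<inter> chart_inv c1 -` W')" by (rule continuous_open_preimage[OF ch(4,2) W'(1)])
  moreover have "p1 \<in> snd c1 ` fst c1 \<inter> chart_inv c1 -` W'" using p1 W' by simp
  ultimately obtain r where r: "r > 0" "cball p1 r \<subseteq> snd c1 ` fst c1 \<inter> chart_inv c1 -` W'"
    using open_contains_cball by blast
  have "B g \<and> B (inv g)"
  proof (rule connected_generated[OF conn r(1), where P="\<lambda>g. B g \<and> B (inv g)"])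
    fix v :: 'b assume "norm v \<le> r"
    then have "p1 + v \<in> cball p1 r" by (simp add: dist_norm)
    then have "line v 1 \<in> W'" using r(2) by (auto simp: line_def)
    then show "B (line v 1) \<and> B (inv (line v 1))" using B1 by (simp add: W'_def)
  qed (use Bm B1[OF W(2)] in \<open>auto simp: inv_mult_group\<close>)
  then show ?thesis by (simp add: B_def)
qed

lemma Ad_ex_self: "Ad (ex u t) u = u"
proof -
  have "has_velocity AG (\<lambda>s. ex u t \<otimes> ex u s \<otimes> inv (ex u t)) (Ad (ex u t) u) 0"
    using has_velocity_map[OF atlas_G atlas_G ex_velocity[of u] tdiff_conj[of "ex u t"]] by (simp add: Ad_def)
  moreover have "ex u t \<otimes> ex u s \<otimes> inv (ex u t) = ex u s" for s
    by (simp add: ex_inv ex_add[symmetric])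
  ultimately show ?thesis using ex_velocity[of u] has_velocity_unique by simp blast
qed

text \<open>If the fundamental field of \<open>u\<close> vanishes at \<open>y\<close>, the
  one-parameter subgroup of \<open>u\<close> fixes \<open>y\<close>. Discreteness of the stabilizer
  makes it constant near 0, so its velocity \<open>u\<close> is zero.\<close>

lemma X_injective:
  assumes "X y u = 0"
  shows "u = 0"
proof -
  have "has_velocity AM (\<lambda>s. \<phi> (ex u s) y) 0 t" for t
  proof -
    have "X (\<phi> (ex u t) y) u = T (ex u t) y (X y u)" by (simp add: T_X Ad_ex_self)
    then have "X (\<phi> (ex u t) y) u = 0" using assms linear_0[OF T_linear] by simp
    then show ?thesis using orbit_velocity[OF ex_rlog[of u t], of y] by simp
  qed
  then have fx: "\<phi> (ex u t) y = y" for t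
    using velocity_zero_const[OF atlas_M, of UNIV "\<lambda>s. \<phi> (ex u s) y" t 0] by simp
  have st: "ex u t \<in> stabilizer G \<phi> y" for t by (simp add: stabilizer_def fx)
  have "\<one> isolated_in stabilizer G \<phi> y" using discrete_stab[of y] st[of 0] by (simp add: discrete_def)
  then obtain V where V: "open V" "V \<inter> stabilizer G \<phi> y = {\<one>}" by (auto simp: isolated_in_def)
  have "isCont (ex u) 0" using ex_velocity[of u] by (simp add: has_velocity_def tdiff_def)
  from isCont_eventually_in[OF this V(1)] have "\<forall>\<^sub>F t in nhds 0. ex u t \<in> V" using V(2) by auto
  then have "\<forall>\<^sub>F t in nhds 0. ex u t = \<one>" by eventually_elim (use V st in blast)
  from has_velocity_cong[OF this, of AG u] ex_velocity[of u] have "has_velocity AG (\<lambda>s. \<one>) u 0" by simp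
  then show ?thesis using has_velocity_const[OF atlas_G] has_velocity_unique by blast
qed

text \<open>Norms on the Lie algebra and along the orbits are uniformly comparable, which lets
  growth of \<open>Ad\<close> be read as growth of the tangent maps along orbits.\<close>

lemma X_bounds:
  obtains C where "C \<ge> 1" "\<And>x u. N x (X x u) \<le> C * norm u" "\<And>x u. norm u \<le> C * N x (X x u)"
proof -
  define P where "P = (\<lambda>C x. C \<ge> 1 \<and> (\<forall>u. N x (X x u) \<le> C * norm u \<and> norm u \<le> C * N x (X x u)))"
  have mono: "P C' x" if "P C x" "C \<le> C'" for C C' x
    unfolding P_def
  proof (intro conjI allI)
    show "1 \<le> C'" using that by (simp add: P_def)
    fix u
    have "N x (X x u) \<le> C * norm u" "norm u \<le> C * N x (X x u)" using that by (auto simp: P_def)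
    then show "N x (X x u) \<le> C' * norm u" "norm u \<le> C' * N x (X x u)"
      using mult_right_mono[OF that(2), of "norm u"] mult_right_mono[OF that(2), of "N x (X x u)"] by auto
  qed
  have "\<exists>Q C. open Q \<and> x0 \<in> Q \<and> (\<forall>x\<in>Q. P C x)" for x0
  proof -
    define d where "d = chart_at AM x0"
    have d: "d \<in> AM" "x0 \<in> fst d" using chart_at_props[OF atlas_M] by (auto simp: d_def)
    note dh = smooth_atlas_chart[OF atlas_M d(1)]
    let ?F = "\<lambda>(g, x). \<phi> g x" let ?S = "loc_dom c1 d d ?F" and ?L = "loc_rep c1 d d ?F"
    obtain r where r: "r > 0" "cball (snd d x0) r \<subseteq> snd d ` fst d"
      using open_contains_cball dh(2) d(2) by blast
    let ?K = "cball (snd d x0) r"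
    obtain A where A: "A \<ge> 1" "\<And>p v. p \<in> ?K \<Longrightarrow> Nch d p v \<le> A * norm v" "\<And>p v. p \<in> ?K \<Longrightarrow> norm v \<le> A * Nch d p v"
      by (rule Nch_bounds[OF d(1) compact_cball r(2)]) blast
    define \<xi> where "\<xi> = (\<lambda>p u. frechet_derivative ?L (at (p1, p)) (u, 0))"
    have inS: "(p1, p) \<in> ?S" if "p \<in> ?K" for p
      using that r(2) p1 dh(7) by (auto simp: loc_dom_def)
    have C1: "Ck_on (Suc 0) ?S ?L" by (rule smooth_bimap.loc_rep_Ck[OF act_bimap c1(1) d(1) d(1)])
    have cx: "continuous_on (?K \<times> UNIV) (\<lambda>z. norm (\<xi> (fst z) (snd z)))"
    proof -
      have "continuous_on (?K \<times> UNIV) (\<lambda>z. case ((p1, fst z), (snd z, 0)) of (z, v) \<Rightarrow> frechet_derivative ?L (at z) v)"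
        by (rule continuous_on_compose2[OF C1_derivative_continuous[OF C1]]) (use inS in \<open>auto intro!: continuous_intros\<close>)
      then show ?thesis by (simp add: \<xi>_def continuous_on_norm)
    qed
    have XN: "N (chart_inv d p) (X (chart_inv d p) u) = Nch d p (\<xi> p u)" and Xx: "X (chart_inv d p) u = from_chart AM d p (\<xi> p u)"
      if "p \<in> ?K" for p u
    proof -
      have pi: "p \<in> snd d ` fst d" using that r(2) by blast
      show "X (chart_inv d p) u = from_chart AM d p (\<xi> p u)"
        using from_chart_in_chart[OF atlas_M d(1) dh(7)[OF pi], of "X (chart_inv d p) u"] X_chart[OF d(1) pi, of u] dh(6)[OF pi]
        by (simp add: \<xi>_def)
      then show "N (chart_inv d p) (X (chart_inv d p) u) = Nch d p (\<xi> p u)" by (simp add: Nch_def)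
    qed
    have \<xi>lin: "linear (\<xi> p)" if "p \<in> ?K" for p
    proof -
      have "linear (\<lambda>u::'b. (u, 0::'e))" by (auto intro!: linearI)
      from linear_compose[OF this has_derivative_linear[OF Ck_on_SucE[OF C1 inS[OF that]]]]
      show ?thesis by (simp add: \<xi>_def[abs_def] o_def)
    qed
    let ?KS = "?K \<times> sphere (0::'b) 1"
    have cK: "compact ?KS" by (intro compact_Times compact_cball compact_sphere)
    have ne: "?KS \<noteq> {}" using r(1) by auto
    have cont: "continuous_on ?KS (\<lambda>z. norm (\<xi> (fst z) (snd z)))" by (rule continuous_on_subset[OF cx]) auto
    obtain zm where zm: "zm \<in> ?KS" "\<And>z. z \<in> ?KS \<Longrightarrow> norm (\<xi> (fst zm) (snd zm)) \<le> norm (\<xi> (fst z) (snd z))"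
      using continuous_attains_inf[OF cK ne cont] by blast
    obtain zM where zM: "zM \<in> ?KS" "\<And>z. z \<in> ?KS \<Longrightarrow> norm (\<xi> (fst z) (snd z)) \<le> norm (\<xi> (fst zM) (snd zM))"
      using continuous_attains_sup[OF cK ne cont] by blast
    define m M where "m = norm (\<xi> (fst zm) (snd zm))" and "M = norm (\<xi> (fst zM) (snd zM))"
    have m: "m > 0"
    proof -
      have k: "fst zm \<in> ?K" "snd zm \<noteq> 0" using zm(1) by auto
      have "X (chart_inv d (fst zm)) (snd zm) \<noteq> 0" using X_injective k(2) by blast
      then have "\<xi> (fst zm) (snd zm) \<noteq> 0"
        using Xx[OF k(1), of "snd zm"] linear_0[OF linear_from_chart[OF atlas_M d(1)]] k(1) r(2) by auto
      then show ?thesis by (simp add: m_def)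
    qed
    define C where "C = Max {1, A * M, A / m}"
    have C: "C \<ge> 1" "A * M \<le> C" "A / m \<le> C" by (auto simp: C_def)
    have PC: "P C (chart_inv d p)" if p: "p \<in> ?K" for p
      unfolding P_def
    proof (intro conjI allI C(1))
      fix u
      have b: "norm (\<xi> p u) \<le> M * norm u \<and> m * norm u \<le> norm (\<xi> p u)"
      proof (cases "u = 0")
        case True then show ?thesis using linear_0[OF \<xi>lin[OF p]] by simp
      next
        case False
        obtain w where w: "norm w = 1" "u = norm u *\<^sub>R w" by (rule norm_one_scale[OF False])
        have "\<xi> p u = norm u *\<^sub>R \<xi> p w" using linear_cmul[OF \<xi>lin[OF p], of "norm u" w] w(2) by simp
        then show ?thesis using zm(2)[of "(p, w)"] zM(2)[of "(p, w)"] p w(1)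
          by (simp add: m_def M_def mult.commute mult_left_mono)
      qed
      have "N (chart_inv d p) (X (chart_inv d p) u) \<le> A * norm (\<xi> p u)" using A(2)[OF p] XN[OF p] by simp
      also have "\<dots> \<le> A * (M * norm u)" using b A(1) by (intro mult_left_mono) auto
      also have "\<dots> \<le> C * norm u" using mult_right_mono[OF C(2), of "norm u"] by (simp add: mult.assoc)
      finally show "N (chart_inv d p) (X (chart_inv d p) u) \<le> C * norm u" .
      have "m * norm u \<le> A * N (chart_inv d p) (X (chart_inv d p) u)"
        using b A(3)[OF p, of "\<xi> p u"] XN[OF p, of u] by simp
      then have "norm u \<le> A / m * N (chart_inv d p) (X (chart_inv d p) u)" using m by (simp add: field_simps)
      also have "\<dots> \<le> C * N (chart_inv d p) (X (chart_inv d p) u)" by (intro mult_right_mono C) simp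
      finally show "norm u \<le> C * N (chart_inv d p) (X (chart_inv d p) u)" .
    qed
    have "open (fst d \<inter> snd d -` ball (snd d x0) r)" by (rule continuous_open_preimage[OF dh(3,1)]) simp
    moreover have "P C x" if "x \<in> fst d \<inter> snd d -` ball (snd d x0) r" for x
      using PC[of "snd d x"] that dh(5)[of x] by auto
    ultimately show ?thesis using d(2) r(1) by (intro exI[of _ "fst d \<inter> snd d -` ball (snd d x0) r"] exI[of _ C]) auto
  qed
  note loc = this
  obtain C where "\<And>x. P C x"
    by (rule compact_uniform_bound[where P=P, OF compact_M mono loc]) blast+
  then show ?thesis using that[of C] by (auto simp: P_def)
qed

end

section \<open>The hyperbolic splitting\<close>

lemma poly_exp_tendsto_0:
  assumes "\<kappa> > 0"
  shows "(\<lambda>n. A * (1 + real n) ^ d * exp (- \<kappa> * real n)) \<longlonglongrightarrow> 0"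
proof -
  have "filterlim (\<lambda>n. \<kappa> * (1 + real n)) at_top sequentially"
    by (intro filterlim_tendsto_pos_mult_at_top[OF tendsto_const assms]
        filterlim_tendsto_add_at_top[OF tendsto_const] filterlim_real_sequentially)
  from filterlim_compose[OF tendsto_power_div_exp_0 this]
  have "(\<lambda>n. (A * exp \<kappa> / \<kappa> ^ d) * ((\<kappa> * (1 + real n)) ^ d / exp (\<kappa> * (1 + real n)))) \<longlonglongrightarrow> (A * exp \<kappa> / \<kappa> ^ d) * 0"
    by (intro tendsto_mult tendsto_const)
  moreover have "(A * exp \<kappa> / \<kappa> ^ d) * ((\<kappa> * (1 + real n)) ^ d / exp (\<kappa> * (1 + real n))) = A * (1 + real n) ^ d * exp (- \<kappa> * real n)" for n
  proof -
    have p: "(\<kappa> * (1 + real n)) ^ d = \<kappa> ^ d * (1 + real n) ^ d" by (rule power_mult_distrib)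
    have e: "exp (\<kappa> * (1 + real n)) = exp \<kappa> * exp (\<kappa> * real n)" by (simp add: distrib_left exp_add)
    show ?thesis unfolding p e using assms by (simp add: exp_minus field_simps)
  qed
  ultimately show ?thesis by simp
qed

lemma poly_exp_small:
  assumes "\<kappa> > 0" "\<epsilon> > 0"
  obtains n :: nat where "n \<ge> 1" "A * (1 + real n) ^ d * exp (- \<kappa> * real n) < \<epsilon>"
proof -
  have "\<forall>\<^sub>F n in sequentially. A * (1 + real n) ^ d * exp (- \<kappa> * real n) < \<epsilon>"
    by (rule order_tendstoD(2)[OF poly_exp_tendsto_0[OF assms(1)] assms(2)])
  then have "\<forall>\<^sub>F n in sequentially. n \<ge> 1 \<and> A * (1 + real n) ^ d * exp (- \<kappa> * real n) < \<epsilon>"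
    using eventually_ge_at_top[of 1] by eventually_elim auto
  then obtain n where "n \<ge> 1" "A * (1 + real n) ^ d * exp (- \<kappa> * real n) < \<epsilon>"
    unfolding eventually_sequentially by blast
  then show ?thesis using that by blast
qed

text \<open>The telescoping sum expresses the power through differences \<open>Ad f w - w\<close>,
  which lie one step deeper in the chain; summing \<open>n\<close> terms raises the degree by
  one.\<close>

lemma (in lie_grp) Ad_pow_growth:
  assumes D: "D 0 = UNIV" "D m = {0}" "\<And>i w. w \<in> D i \<Longrightarrow> Ad f w - w \<in> D (Suc i)"
  shows "\<exists>C\<ge>1. \<forall>n w. norm (Ad (f [^] (n::nat)) w) \<le> C * (1 + real n) ^ m * norm w"
proof -
  have "linear (\<lambda>w. Ad f w - w)" by (intro linear_compose_sub Ad_linear linear_ident)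
  then obtain M where M: "M > 0" "\<And>w. norm (Ad f w - w) \<le> M * norm w" by (rule linear_bounded_pos) (metis mult.commute)
  have tele: "Ad (f [^] (n::nat)) w = w + (\<Sum>k<n. Ad (f [^] k) (Ad f w - w))" for n w
  proof (induction n)
    case (Suc n)
    have "Ad (f [^] Suc n) w = Ad (f [^] n) (Ad f w)" by (simp add: Ad_mult)
    also have "\<dots> = Ad (f [^] n) w + Ad (f [^] n) (Ad f w - w)" by (simp add: linear_diff[OF Ad_linear])
    finally show ?case using Suc by simp
  qed simp
  \<comment> \<open>Vectors at depth \<open>m - j\<close> grow with degree at most \<open>j\<close>;
    the induction starts at \<open>D m = {0}\<close>.\<close>
  have "\<exists>C\<ge>1. \<forall>n. \<forall>w\<in>D (m - j). norm (Ad (f [^] (n::nat)) w) \<le> C * (1 + real n) ^ j * norm w" if "j \<le> m" for j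
    using that
  proof (induction j)
    case 0
    then show ?case using D(2) linear_0[OF Ad_linear] by (intro exI[of _ 1]) auto
  next
    case (Suc j)
    then obtain C where C: "C \<ge> 1" "\<And>n w. w \<in> D (m - j) \<Longrightarrow> norm (Ad (f [^] (n::nat)) w) \<le> C * (1 + real n) ^ j * norm w" by auto
    have "norm (Ad (f [^] (n::nat)) w) \<le> (1 + C * M) * (1 + real n) ^ Suc j * norm w" if w: "w \<in> D (m - Suc j)" for n w
    proof -
      have wD: "Ad f w - w \<in> D (m - j)" using D(3)[OF w] Suc.prems by (simp add: Suc_diff_Suc)
      have "norm (\<Sum>k<n. Ad (f [^] k) (Ad f w - w)) \<le> (\<Sum>k<n. C * (1 + real n) ^ j * (M * norm w))"
      proof (rule sum_norm_le)
        fix k assume k: "k \<in> {..<n}"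
        have "norm (Ad (f [^] k) (Ad f w - w)) \<le> C * (1 + real k) ^ j * norm (Ad f w - w)" by (rule C(2)[OF wD])
        also have "\<dots> \<le> C * (1 + real n) ^ j * (M * norm w)"
          using C(1) k M by (intro mult_mono power_mono) auto
        finally show "norm (Ad (f [^] k) (Ad f w - w)) \<le> C * (1 + real n) ^ j * (M * norm w)" .
      qed
      also have "\<dots> = real n * (C * M * (1 + real n) ^ j * norm w)" by simp
      also have "\<dots> \<le> (1 + real n) * (C * M * (1 + real n) ^ j * norm w)"
        using C(1) M(1) by (intro mult_right_mono) auto
      finally have 1: "norm (\<Sum>k<n. Ad (f [^] k) (Ad f w - w)) \<le> C * M * (1 + real n) ^ Suc j * norm w" by (simp add: mult_ac)
      have "1 * norm w \<le> (1 + real n) ^ Suc j * norm w" by (intro mult_right_mono one_le_power) auto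
      then show ?thesis unfolding tele[of n w]
        using 1 norm_triangle_ineq[of w "\<Sum>k<n. Ad (f [^] k) (Ad f w - w)"] by (simp add: algebra_simps)
    qed
    moreover have "1 + C * M \<ge> 1" using C(1) M(1) by simp
    ultimately show ?case by blast
  qed
  from this[of m] show ?thesis using D(1) by auto
qed

text \<open>Exponential rates on the two bundles and polynomial bounds along the orbits for both
  \<open>f\<close> and \<open>inv f\<close>. One set of constants serves both directions, so the
  hypotheses are symmetric under time reversal.\<close>

locale hyp_action = riem_action G AG AM \<phi> \<rho>
  for G :: "'g::{t2_space,second_countable_topology} monoid" (structure)
    and AG :: "('g, 'b::euclidean_space) atlas"
    and AM :: "('m::{t2_space,second_countable_topology}, 'e::euclidean_space) atlas"
    and \<phi> :: "'g \<Rightarrow> 'm \<Rightarrow> 'm" and \<rho> :: "'m \<Rightarrow> 'e \<Rightarrow> 'e \<Rightarrow> real" +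
  fixes f :: 'g and Es Eu :: "'m \<Rightarrow> 'e set" and C \<kappa> :: real and d :: nat
  assumes sub_s: "subspace (Es x)" and sub_u: "subspace (Eu x)"
    and decomp: "\<exists>u b z. u \<in> Es x \<and> z \<in> Eu x \<and> v = u + (X x b + z)"
    and inv_s: "v \<in> Es x \<Longrightarrow> T f x v \<in> Es (\<phi> f x)" and inv_s': "v \<in> Es x \<Longrightarrow> T (inv f) x v \<in> Es (\<phi> (inv f) x)"
    and inv_u: "v \<in> Eu x \<Longrightarrow> T f x v \<in> Eu (\<phi> f x)" and inv_u': "v \<in> Eu x \<Longrightarrow> T (inv f) x v \<in> Eu (\<phi> (inv f) x)"
    and C: "C \<ge> 1" and \<kappa>: "\<kappa> > 0"
    and con_s: "v \<in> Es x \<Longrightarrow> N (\<phi> (f [^] n) x) (T (f [^] n) x v) \<le> C * exp (- \<kappa> * real n) * N x v"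
    and con_u: "v \<in> Eu x \<Longrightarrow> N (\<phi> ((inv f) [^] n) x) (T ((inv f) [^] n) x v) \<le> C * exp (- \<kappa> * real n) * N x v"
    and pol: "N (\<phi> (f [^] n) x) (T (f [^] n) x (X x b)) \<le> C * (1 + real n) ^ d * N x (X x b)"
    and pol': "N (\<phi> ((inv f) [^] n) x) (T ((inv f) [^] n) x (X x b)) \<le> C * (1 + real n) ^ d * N x (X x b)"
begin

text \<open>Time reversal exchanges the two bundles; each result on \<open>Es\<close> below gives
  one on \<open>Eu\<close> through this interpretation.\<close>

lemma mirror: "hyp_action G AG AM \<phi> \<rho> (inv f) Eu Es C \<kappa> d"
proof unfold_locales
  fix x v
  obtain u b z where "u \<in> Es x" "z \<in> Eu x" "v = u + (X x b + z)" using decomp by blast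
  then show "\<exists>u b z. u \<in> Eu x \<and> z \<in> Es x \<and> v = u + (X x b + z)"
    by (intro exI[of _ z] exI[of _ b] exI[of _ u]) auto
qed (use sub_s sub_u inv_s inv_s' inv_u inv_u' C \<kappa> con_s con_u pol pol' in auto)

lemma T_simps: "T g x (v + w) = T g x v + T g x w" "T g x (v - w) = T g x v - T g x w" "T g x 0 = 0"
  using linear_add[OF T_linear] linear_diff[OF T_linear] linear_0[OF T_linear] by auto

lemma pow_inv: "(inv f) [^] (n::nat) = inv (f [^] n)"
  by (simp add: nat_pow_inv)

lemma inv_s_pow: "v \<in> Es x \<Longrightarrow> T (f [^] (n::nat)) x v \<in> Es (\<phi> (f [^] n) x)"
  by (induction n arbitrary: x v) (auto simp: T_mult act_mult intro: inv_s)

lemma inv_u_pow: "v \<in> Eu x \<Longrightarrow> T (f [^] (n::nat)) x v \<in> Eu (\<phi> (f [^] n) x)"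
  by (induction n arbitrary: x v) (auto simp: T_mult act_mult intro: inv_u)

lemma exp_u:
  assumes "z \<in> Eu x"
  shows "N x z \<le> C * exp (- \<kappa> * real n) * N (\<phi> (f [^] n) x) (T (f [^] n) x z)"
  using con_u[OF inv_u_pow[OF assms, of n], of n] by (simp add: pow_inv)

lemma pol_low: "N x (X x b) \<le> C * (1 + real n) ^ d * N (\<phi> (f [^] n) x) (T (f [^] n) x (X x b))"
  using pol'[of n "\<phi> (f [^] n) x" "Ad (f [^] n) b"] by (simp add: pow_inv T_X[symmetric])

text \<open>A uniform angle between the orbits and \<open>Eu\<close>, obtained from the dynamics. If
  the orbit part is not much larger than \<open>z\<close>, enough iterates make the image of
  \<open>z\<close> dominate, and near cancellation at \<open>x\<close> would contradict boundedness
  of the iterate. Otherwise the triangle inequality suffices.\<close>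

lemma tz_bound: "\<exists>B\<ge>1. \<forall>x b. \<forall>z\<in>Eu x. N x (X x b) \<le> B * N x (X x b + z) \<and> N x z \<le> B * N x (X x b + z)"
proof -
  \<comment> \<open>With \<open>P\<close> the polynomial and \<open>e\<close> the exponential
    factor, the constant bounds \<open>C e (1 + 2 C P)\<close> from above as
    \<open>P \<ge> 1\<close>; being below 1, it makes the expanded \<open>z\<close> exceed the orbit
    part by at least the length of \<open>z\<close>.\<close>
  obtain n where n: "n \<ge> 1" "(2 * C\<^sup>2 + C) * (1 + real n) ^ d * exp (- \<kappa> * real n) < 1"
    using poly_exp_small[OF \<kappa>, of 1 "2 * C\<^sup>2 + C" d] by auto
  obtain K where K: "K \<ge> 1" "\<And>x v. N (\<phi> (f [^] n) x) (T (f [^] n) x v) \<le> K * N x v" using T_bounded by blast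
  define P where "P = (1 + real n) ^ d"
  have P: "P \<ge> 1" by (simp add: P_def)
  have "N x (X x b) \<le> (2 + K) * N x (X x b + z) \<and> N x z \<le> (2 + K) * N x (X x b + z)" if z: "z \<in> Eu x" for x b z
  proof (cases "N x (X x b) \<le> 2 * N x z")
    case True
    define y where "y = \<phi> (f [^] n) x"
    define e where "e = exp (- \<kappa> * real n)"
    have e: "e > 0" by (simp add: e_def)
    have "N y (T (f [^] n) x (X x b)) \<le> C * P * N x (X x b)" using pol[of n x b] by (simp add: y_def P_def)
    also have "\<dots> \<le> C * P * (2 * N x z)" using True C P by (intro mult_left_mono) auto
    finally have 1: "N y (T (f [^] n) x (X x b)) \<le> 2 * C * P * N x z" by simp
    have 2: "N x z \<le> C * e * N y (T (f [^] n) x z)" using exp_u[OF z, of n] by (simp add: y_def e_def)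
    have 3: "(2 * C\<^sup>2 + C) * P * e \<le> 1" using n(2) by (simp add: P_def e_def)
    have "C * e * N x z \<le> C * P * e * N x z" using C P e by (intro mult_right_mono) auto
    then have "C * e * N x z + C * e * (2 * C * P * N x z) \<le> (2 * C\<^sup>2 + C) * P * e * N x z"
      by (simp add: algebra_simps power2_eq_square)
    also have "\<dots> \<le> N x z" using mult_right_mono[OF 3, of "N x z"] by simp
    also have "\<dots> \<le> C * e * N y (T (f [^] n) x z)" by (rule 2)
    finally have "C * e * (N x z + 2 * C * P * N x z) \<le> C * e * N y (T (f [^] n) x z)" by (simp add: algebra_simps)
    then have "N x z + 2 * C * P * N x z \<le> N y (T (f [^] n) x z)" using C e by simp
    then have "N x z \<le> N y (T (f [^] n) x (X x b + z))"
      using 1 N_triangle_sub[of y "T (f [^] n) x z" "T (f [^] n) x (X x b)"] by (simp add: T_simps add.commute)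
    also have "\<dots> \<le> K * N x (X x b + z)" using K(2) by (simp add: y_def)
    finally have z': "N x z \<le> K * N x (X x b + z)" .
    moreover have "N x (X x b) \<le> N x (X x b + z) + N x z" using N_triangle_diff[of x "X x b + z" z] by simp
    ultimately show ?thesis using N_nonneg[of x "X x b + z"] unfolding distrib_right by (intro conjI; linarith)
  next
    case False
    have "N x (X x b) \<le> N x (X x b + z) + N x z" using N_triangle_diff[of x "X x b + z" z] by simp
    moreover have "0 \<le> K * N x (X x b + z)" using K(1) by simp
    ultimately show ?thesis using False N_nonneg[of x z] N_nonneg[of x "X x b + z"]
      unfolding distrib_right by (intro conjI; linarith)
  qed
  then show ?thesis using K(1) by (intro exI[of _ "2 + K"]) auto
qed

text \<open>Each component shrinks at most polynomially, and \<open>tz_bound\<close>, applied at the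
  image point, bounds the components there by the image of the whole vector.\<close>

lemma cu_growth: "\<exists>D\<ge>1. \<forall>x b. \<forall>z\<in>Eu x. \<forall>n.
    N x (X x b + z) \<le> D * (1 + real n) ^ d * N (\<phi> (f [^] n) x) (T (f [^] n) x (X x b + z))"
proof -
  obtain B where B: "B \<ge> 1" "\<And>x b z. z \<in> Eu x \<Longrightarrow> N x (X x b) \<le> B * N x (X x b + z) \<and> N x z \<le> B * N x (X x b + z)"
    using tz_bound by blast
  have "N x (X x b + z) \<le> (2 * B * C) * (1 + real n) ^ d * N (\<phi> (f [^] n) x) (T (f [^] n) x (X x b + z))"
    if z: "z \<in> Eu x" for x b z n
  proof -
    define y where "y = \<phi> (f [^] n) x"
    define q where "q = T (f [^] n) x (X x b + z)"
    have q: "q = X y (Ad (f [^] n) b) + T (f [^] n) x z" by (simp add: q_def T_simps T_X y_def)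
    have b: "N y (T (f [^] n) x (X x b)) \<le> B * N y q" "N y (T (f [^] n) x z) \<le> B * N y q"
      using B(2)[of "T (f [^] n) x z" y "Ad (f [^] n) b"] inv_u_pow[OF z, of n] by (auto simp: q T_X y_def)
    have P: "(1 + real n) ^ d \<ge> 1" by simp
    have "N x (X x b) \<le> C * (1 + real n) ^ d * (B * N y q)"
      using pol_low[of x b n] b(1) C P by (auto simp: y_def intro: order_trans mult_left_mono)
    moreover have "N x z \<le> C * (1 + real n) ^ d * (B * N y q)"
    proof -
      have "N x z \<le> C * exp (- \<kappa> * real n) * N y (T (f [^] n) x z)" using exp_u[OF z, of n] by (simp add: y_def)
      also have "\<dots> \<le> C * (1 + real n) ^ d * (B * N y q)"
        using C P b(2) \<kappa> by (intro mult_mono) (auto intro: order_trans[of _ 1])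
      finally show ?thesis .
    qed
    ultimately show ?thesis using N_triangle[of x "X x b" z] by (simp add: y_def q_def mult_ac)
  qed
  moreover have "2 * B * C \<ge> 1" using mult_mono[OF B(1) C] B(1) by simp
  ultimately show ?thesis by blast
qed

text \<open>The argument of \<open>tz_bound\<close> once more, now between \<open>Es\<close> and the
  centre-unstable directions: under iteration the former part shrinks exponentially and the latter
  only polynomially. It also implies that the decomposition is unique.\<close>

lemma projection_bound: "\<exists>B\<ge>1. \<forall>x b. \<forall>u\<in>Es x. \<forall>z\<in>Eu x.
    N x u \<le> B * N x (u + (X x b + z)) \<and> N x (X x b + z) \<le> B * N x (u + (X x b + z))"
proof -
  obtain D where D: "D \<ge> 1" "\<And>x b z n. z \<in> Eu x \<Longrightarrow>
      N x (X x b + z) \<le> D * (1 + real n) ^ d * N (\<phi> (f [^] n) x) (T (f [^] n) x (X x b + z))"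
    using cu_growth by blast
  obtain n where n: "n \<ge> 1" "(4 * C * D) * (1 + real n) ^ d * exp (- \<kappa> * real n) < 1"
    using poly_exp_small[OF \<kappa>, of 1 "4 * C * D" d] by auto
  obtain K where K: "K \<ge> 1" "\<And>x v. N (\<phi> (f [^] n) x) (T (f [^] n) x v) \<le> K * N x v" using T_bounded by blast
  define P where "P = (1 + real n) ^ d"
  have P: "P \<ge> 1" by (simp add: P_def)
  define B where "B = 2 + 2 * D * P * K"
  have DPK: "0 \<le> 2 * D * P * K" using D(1) P K(1) by simp
  have "N x u \<le> B * N x (u + q) \<and> N x q \<le> B * N x (u + q)"
    if u: "u \<in> Es x" and z: "z \<in> Eu x" and q: "q = X x b + z" for x b u z q
  proof (cases "N x u \<le> 2 * N x q")
    case True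
    define y where "y = \<phi> (f [^] n) x"
    define e where "e = exp (- \<kappa> * real n)"
    have e: "e > 0" by (simp add: e_def)
    have 1: "N y (T (f [^] n) x u) \<le> 2 * C * e * N x q"
  proof -
      have "C * e * N x u \<le> C * e * (2 * N x q)" using C e by (intro mult_left_mono True) auto
      then show ?thesis using con_s[OF u, of n] by (simp add: y_def e_def)
    qed
    have 2: "N x q \<le> D * P * N y (T (f [^] n) x q)" using D(2)[OF z, of b n] by (simp add: q y_def P_def)
    have "4 * C * D * P * e \<le> 1" using n(2) by (simp add: P_def e_def)
    from mult_right_mono[OF this, of "N x q"] have "2 * (D * P) * (2 * C * e * N x q) \<le> N x q" by (simp add: mult_ac)
    moreover have "2 * (D * P) * N y (T (f [^] n) x u) \<le> 2 * (D * P) * (2 * C * e * N x q)"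
      using D(1) P by (intro mult_left_mono 1) auto
    ultimately have "2 * (D * P) * N y (T (f [^] n) x u) \<le> N x q" by linarith
    moreover have "N y (T (f [^] n) x q) \<le> N y (T (f [^] n) x (u + q)) + N y (T (f [^] n) x u)"
      using N_triangle_sub[of y "T (f [^] n) x q" "T (f [^] n) x u"] by (simp add: T_simps add.commute)
    then have "D * P * N y (T (f [^] n) x q) \<le> D * P * (N y (T (f [^] n) x (u + q)) + N y (T (f [^] n) x u))"
      using D(1) P by (intro mult_left_mono) auto
    ultimately have "N x q \<le> 2 * D * P * N y (T (f [^] n) x (u + q))" using 2 by (simp add: algebra_simps)
    also have "\<dots> \<le> 2 * D * P * (K * N x (u + q))"
      using K(2)[of x "u + q"] D(1) P by (intro mult_left_mono) (auto simp: y_def)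
    finally have "N x q \<le> 2 * D * P * K * N x (u + q)" by simp
    moreover have "N x u \<le> N x (u + q) + N x q" using N_triangle_diff[of x "u + q" q] by simp
    ultimately show ?thesis using N_nonneg[of x "u + q"] unfolding B_def distrib_right by (intro conjI; linarith)
  next
    case False
    have "N x u \<le> N x (u + q) + N x q" using N_triangle_diff[of x "u + q" q] by simp
    moreover have "0 \<le> 2 * D * P * K * N x (u + q)" using DPK by simp
    ultimately show ?thesis using False N_nonneg[of x q] N_nonneg[of x "u + q"]
      unfolding B_def distrib_right by (intro conjI; linarith)
  qed
  then show ?thesis using DPK by (intro exI[of _ B]) (auto simp: B_def)
qed

text \<open>Projections are bounded, so an exponentially contracted vector has an exponentially
  contracted centre-unstable part, which \<open>cu_growth\<close> forbids unless it is zero. Control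
  along multiples of \<open>m\<close> suffices, as needed for conjugates of a power of
  \<open>f\<close>.\<close>

lemma in_Es_if_contracted:
  assumes m: "m \<ge> 1" and \<eta>: "\<eta> > 0"
    and b: "\<And>n. N (\<phi> (f [^] (m * n)) x) (T (f [^] (m * n)) x v) \<le> K * exp (- \<eta> * real n)"
  shows "v \<in> Es x"
proof -
  obtain D where D: "D \<ge> 1" "\<And>x b z n. z \<in> Eu x \<Longrightarrow>
      N x (X x b + z) \<le> D * (1 + real n) ^ d * N (\<phi> (f [^] n) x) (T (f [^] n) x (X x b + z))"
    using cu_growth by blast
  obtain B where B: "B \<ge> 1" "\<And>x b u z. u \<in> Es x \<Longrightarrow> z \<in> Eu x \<Longrightarrow>
      N x u \<le> B * N x (u + (X x b + z)) \<and> N x (X x b + z) \<le> B * N x (u + (X x b + z))"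
    using projection_bound by blast
  obtain u b z where v: "u \<in> Es x" "z \<in> Eu x" "v = u + (X x b + z)" using decomp by blast
  define q where "q = X x b + z"
  have le: "N x q \<le> D * real m ^ d * B * K * (1 + real n) ^ d * exp (- \<eta> * real n)" for n
  proof -
    define k where "k = m * n"
    define y where "y = \<phi> (f [^] k) x"
    have Tq: "T (f [^] k) x q = X y (Ad (f [^] k) b) + T (f [^] k) x z" by (simp add: q_def T_simps T_X y_def)
    have Tv: "T (f [^] k) x v = T (f [^] k) x u + T (f [^] k) x q" by (simp add: v(3) q_def T_simps)
    have "N y (T (f [^] k) x q) \<le> B * N y (T (f [^] k) x v)"
      using B(2)[OF inv_s_pow[OF v(1), of k] inv_u_pow[OF v(2), of k], of "Ad (f [^] k) b"] by (simp add: y_def Tv Tq)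
    also have "\<dots> \<le> B * (K * exp (- \<eta> * real n))" using b[of n] B(1) by (intro mult_left_mono) (auto simp: y_def k_def)
    finally have 1: "N y (T (f [^] k) x q) \<le> B * (K * exp (- \<eta> * real n))" .
    \<comment> \<open>Rewrites the polynomial in \<open>m n\<close> as a polynomial in
      \<open>n\<close>, to be compared with the rate in \<open>n\<close>.\<close>
    have "1 + real k \<le> real m * (1 + real n)" using m by (simp add: k_def algebra_simps)
    then have "(1 + real k) ^ d \<le> (real m * (1 + real n)) ^ d" by (intro power_mono) auto
    then have 2: "D * (1 + real k) ^ d \<le> D * (real m ^ d * (1 + real n) ^ d)"
      using D(1) by (intro mult_left_mono) (auto simp: power_mult_distrib)
    have "N x q \<le> D * (1 + real k) ^ d * N y (T (f [^] k) x q)" using D(2)[OF v(2), of b k] by (simp add: q_def y_def)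
    also have "\<dots> \<le> D * (real m ^ d * (1 + real n) ^ d) * (B * (K * exp (- \<eta> * real n)))"
      using 2 1 D(1) by (intro mult_mono) auto
    finally show ?thesis by (simp add: mult_ac)
  qed
  have "N x q \<le> 0"
    by (rule LIMSEQ_le_const[OF poly_exp_tendsto_0[OF \<eta>, of "D * real m ^ d * B * K" d]]) (use le in blast)
  then have "q = 0" using N_pos[of q x] by (cases "q = 0") auto
  then show ?thesis using v by (simp add: q_def)
qed

text \<open>A description by weak inequalities with fixed constants; it makes preservation of
  \<open>Es\<close> a closed condition.\<close>

lemma Es_char: "v \<in> Es x \<longleftrightarrow> (\<forall>n. N (\<phi> (f [^] n) x) (T (f [^] n) x v) \<le> C * exp (- \<kappa> * real n) * N x v)"
  using con_s in_Es_if_contracted[of 1 \<kappa> x v "C * N x v"] \<kappa> by (auto simp: mult_ac)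

text \<open>Only an inclusion of fibres; equality will follow because \<open>SS\<close> is closed
  under inverses.\<close>

definition pres where "pres E g \<longleftrightarrow> (\<forall>x. \<forall>v\<in>E x. T g x v \<in> E (\<phi> g x))"
definition SS where "SS = {g. pres Es g \<and> pres Eu g}"

text \<open>By \<open>Es_char\<close>, preservation is a family of inequalities between functions
  that are continuous in \<open>g\<close>.\<close>

lemma closed_pres_s: "closed {g. pres Es g}"
proof -
  have "{g. pres Es g} = (\<Inter>x. \<Inter>v\<in>Es x. \<Inter>n. {g. N (\<phi> (f [^] (n::nat) \<otimes> g) x) (T (f [^] n \<otimes> g) x v) \<le>
      C * exp (- \<kappa> * real n) * N (\<phi> g x) (T g x v)})"
    unfolding pres_def Es_char[of "T _ _ _"] T_mult act_mult by auto
  moreover have "continuous_on UNIV (\<lambda>g. N (\<phi> (h \<otimes> g) x) (T (h \<otimes> g) x v))" for h x v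
    by (rule continuous_on_compose2[OF TN_continuous]) (auto intro!: continuous_intros)
  ultimately show ?thesis
    by (simp only:) (intro closed_INT ballI closed_Collect_le continuous_on_mult_left TN_continuous)
qed

lemma SS_one: "\<one> \<in> SS"
  by (simp add: SS_def pres_def)

lemma SS_mult: "g \<in> SS \<Longrightarrow> h \<in> SS \<Longrightarrow> g \<otimes> h \<in> SS"
  by (auto simp: SS_def pres_def T_mult act_mult)

lemma SS_f: "f \<in> SS"
  using inv_s inv_u by (simp add: SS_def pres_def)

text \<open>\<open>g\<close> respects all three summands of the splitting, so the centre-unstable
  part of a preimage of a vector of \<open>Es\<close> is mapped to zero, by uniqueness of the
  decomposition at the image. This is where preservation of both bundles is used together.\<close>

lemma pres_s_inv:
  assumes "g \<in> SS"
  shows "pres Es (inv g)"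
  unfolding pres_def
proof (intro allI ballI)
  fix y w assume w: "w \<in> Es y"
  define x where "x = \<phi> (inv g) y"
  have y: "y = \<phi> g x" by (simp add: x_def)
  define v where "v = T (inv g) y w"
  have Tv: "T g x v = w" by (simp add: v_def x_def)
  obtain u b z where v: "u \<in> Es x" "z \<in> Eu x" "v = u + (X x b + z)" using decomp by blast
  obtain B where B: "\<And>x b u z. u \<in> Es x \<Longrightarrow> z \<in> Eu x \<Longrightarrow>
      N x u \<le> B * N x (u + (X x b + z)) \<and> N x (X x b + z) \<le> B * N x (u + (X x b + z))"
    using projection_bound by blast
  define q where "q = X x b + z"
  have Tq: "T g x q = X y (Ad g b) + T g x z" by (simp add: q_def T_simps T_X y)
  have 1: "T g x u - w \<in> Es y" using assms v(1) w by (auto simp: SS_def pres_def y intro: subspace_diff[OF sub_s])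
  have 2: "T g x z \<in> Eu y" using assms v(2) by (auto simp: SS_def pres_def y)
  have "w = T g x u + T g x q" using Tv by (simp add: v(3) q_def[symmetric] T_simps)
  then have "T g x u - w + T g x q = 0" by simp
  then have "N y (T g x q) \<le> 0" using B[OF 1 2, of "Ad g b"] by (simp add: Tq)
  then have "T g x q = 0" using N_pos[of "T g x q" y] by (cases "T g x q = 0") auto
  then have "q = T (inv g) (\<phi> g x) 0" by (metis T_inv(1))
  then have "q = 0" by (simp add: T_simps)
  then show "T (inv g) y w \<in> Es (\<phi> (inv g) y)" using v by (simp add: v_def[symmetric] x_def[symmetric] q_def)
qed

lemma closed_SS: "closed SS" and SS_inv: "g \<in> SS \<Longrightarrow> inv g \<in> SS"
proof -
  interpret m: hyp_action G AG AM \<phi> \<rho> "inv f" Eu Es C \<kappa> d by (rule mirror)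
  have "SS = {g. pres Es g} \<inter> {g. m.pres Eu g}" by (auto simp: SS_def pres_def m.pres_def)
  then show "closed SS" using closed_pres_s m.closed_pres_s by auto
  show "g \<in> SS \<Longrightarrow> inv g \<in> SS"
    using pres_s_inv[of g] m.pres_s_inv[of g] by (auto simp: SS_def pres_def m.SS_def m.pres_def)
qed

text \<open>The conjugate \<open>inv h f^m h\<close> differs from \<open>f^m\<close> by an element near the identity, so it contracts \<open>Es\<close> like \<open>f^m\<close>.\<close>
lemma conjugate_near_one_s:
  obtains V where "open V" "\<one> \<in> V" "\<And>h. h \<in> V \<Longrightarrow> inv h \<otimes> f \<otimes> h \<in> SS \<Longrightarrow> pres Es h"
proof -
  \<comment> \<open>The power contracts \<open>Es\<close> by 1/4; the factor 2 allowed by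
    \<open>W\<close> leaves a contraction by 1/2 for the conjugate.\<close>
  obtain m where m: "m \<ge> 1" "C * (1 + real m) ^ 0 * exp (- \<kappa> * real m) < 1 / 4"
    by (rule poly_exp_small[OF \<kappa>, of "1 / 4" C 0]) auto
  obtain W where W: "open W" "\<one> \<in> W" "\<And>k x v. k \<in> W \<Longrightarrow> N (\<phi> k x) (T k x v) \<le> 2 * N x v" by (rule T_near_one) blast
  define V where "V = (\<lambda>h. inv h \<otimes> f [^] m \<otimes> h \<otimes> inv (f [^] m)) -` W"
  have V: "open V" unfolding V_def by (intro open_vimage W continuous_intros)
  have V1: "\<one> \<in> V" using W(2) by (simp add: V_def)
  have "pres Es h" if h: "h \<in> V" and S: "inv h \<otimes> f \<otimes> h \<in> SS" for h
    unfolding pres_def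
  proof (intro allI ballI)
    fix x v assume v: "v \<in> Es x"
    define f' where "f' = inv h \<otimes> f \<otimes> h"
    have f'pow: "f' [^] (k::nat) = inv h \<otimes> f [^] k \<otimes> h" for k
    proof (induction k)
      case (Suc k)
      then show ?case by (simp add: f'_def m_assoc) (simp add: m_assoc[symmetric])
    qed simp
    define F where "F = f' [^] m"
    have Fpow: "F [^] (n::nat) \<in> SS" for n
    proof -
      have "f' [^] (k::nat) \<in> SS" for k using S SS_one SS_mult by (induction k) (auto simp: f'_def)
      then show ?thesis by (simp add: F_def nat_pow_pow)
    qed
    have half: "N (\<phi> F x) (T F x v) \<le> 1 / 2 * N x v" if v: "v \<in> Es x" for x v
    proof -
      define k where "k = inv h \<otimes> f [^] m \<otimes> h \<otimes> inv (f [^] m)"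
      have k: "k \<in> W" using h by (simp add: V_def k_def)
      have F: "F = k \<otimes> f [^] m" by (simp add: F_def f'pow k_def m_assoc)
      have "N (\<phi> F x) (T F x v) \<le> 2 * N (\<phi> (f [^] m) x) (T (f [^] m) x v)" unfolding F T_mult act_mult by (rule W(3)[OF k])
      also have "\<dots> \<le> 2 * (C * exp (- \<kappa> * real m) * N x v)" using con_s[OF v, of m] by simp
      also have "\<dots> \<le> 2 * (1 / 4 * N x v)" using m(2) by (intro mult_left_mono mult_right_mono) auto
      finally show ?thesis by simp
    qed
    have pw: "N (\<phi> (F [^] (n::nat)) x) (T (F [^] n) x v) \<le> (1 / 2) ^ n * N x v" for n
    proof (induction n)
      case (Suc n)
      have e: "F [^] Suc n = F \<otimes> F [^] n" by (rule nat_pow_Suc2) simp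
      have "T (F [^] n) x v \<in> Es (\<phi> (F [^] n) x)" using Fpow[of n] v by (simp add: SS_def pres_def)
      from half[OF this] show ?case using Suc unfolding e T_mult act_mult by simp
    qed simp
    obtain K where K: "K \<ge> 1" "\<And>x v. N (\<phi> h x) (T h x v) \<le> K * N x v" using T_bounded by blast
    show "T h x v \<in> Es (\<phi> h x)"
    proof (rule in_Es_if_contracted[OF m(1), of "ln 2" _ _ "K * N x v"])
      fix n :: nat
      have "F [^] n = f' [^] (m * n)" by (simp add: F_def nat_pow_pow)
      \<comment> \<open>Transfers contraction under the conjugate at \<open>x\<close> to contraction
        under \<open>f\<close> at \<open>\<phi> h x\<close>, at the cost of the constant
        \<open>K\<close> of \<open>h\<close>.\<close>
      then have "f [^] (m * n) \<otimes> h = h \<otimes> F [^] n" unfolding f'pow by (simp add: m_assoc[symmetric])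
      then have "N (\<phi> (f [^] (m * n)) (\<phi> h x)) (T (f [^] (m * n)) (\<phi> h x) (T h x v)) = N (\<phi> h (\<phi> (F [^] n) x)) (T h (\<phi> (F [^] n) x) (T (F [^] n) x v))"
        unfolding T_mult[symmetric] act_mult[symmetric] by simp
      also have "\<dots> \<le> K * ((1 / 2) ^ n * N x v)" using K pw[of n] by (meson mult_left_mono order_trans zero_le_one)
      also have "(1 / 2) ^ n = exp (- ln 2 * real n)" by (simp add: exp_minus exp_of_nat2_mult power_one_over inverse_eq_divide)
      finally show "N (\<phi> (f [^] (m * n)) (\<phi> h x)) (T (f [^] (m * n)) (\<phi> h x) (T h x v)) \<le> K * N x v * exp (- ln 2 * real n)"
        by (simp add: mult_ac)
    qed simp
  qed
  then show ?thesis using that[OF V V1] by blast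
qed

lemma conjugate_near_one:
  obtains V where "open V" "\<one> \<in> V" "\<And>h. h \<in> V \<Longrightarrow> inv h \<otimes> f \<otimes> h \<in> SS \<Longrightarrow> h \<in> SS"
proof -
  interpret m: hyp_action G AG AM \<phi> \<rho> "inv f" Eu Es C \<kappa> d by (rule mirror)
  obtain V1 where V1: "open V1" "\<one> \<in> V1" "\<And>h. h \<in> V1 \<Longrightarrow> inv h \<otimes> f \<otimes> h \<in> SS \<Longrightarrow> pres Es h"
    by (rule conjugate_near_one_s) blast
  obtain V2 where V2: "open V2" "\<one> \<in> V2" "\<And>h. h \<in> V2 \<Longrightarrow> inv h \<otimes> inv f \<otimes> h \<in> m.SS \<Longrightarrow> m.pres Eu h"
    by (rule m.conjugate_near_one_s) blast
  have "h \<in> SS" if h: "h \<in> V1 \<inter> V2" and S: "inv h \<otimes> f \<otimes> h \<in> SS" for h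
  proof -
    have "inv (inv h \<otimes> f \<otimes> h) \<in> SS" by (rule SS_inv[OF S])
    then have "inv h \<otimes> inv f \<otimes> h \<in> SS" by (simp add: inv_mult_group m_assoc)
    then have "inv h \<otimes> inv f \<otimes> h \<in> m.SS" by (auto simp: SS_def pres_def m.SS_def m.pres_def)
    then show ?thesis using V1(3) V2(3) h S by (auto simp: SS_def pres_def m.pres_def)
  qed
  then show ?thesis using that[of "V1 \<inter> V2"] V1 V2 by auto
qed

text \<open>The inductive step: the commutator curve \<open>c\<close> measures how far conjugation
  by \<open>ex u s\<close> moves \<open>f\<close>, and everything that drives it lies one level
  deeper in the chain.\<close>

lemma ex_preserves:
  assumes D: "subspace D'" "\<And>g w. w \<in> D' \<Longrightarrow> Ad g w \<in> D'"
    and IH: "\<And>w t. w \<in> D' \<Longrightarrow> ex w t \<in> SS" and u: "Ad f u - u \<in> D'"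
  shows "ex u t \<in> SS"
proof -
  define c where "c = (\<lambda>s. inv (ex u s) \<otimes> f \<otimes> ex u s \<otimes> inv f)"
  \<comment> \<open>The logarithmic derivative of \<open>c\<close>. It stays in \<open>D'\<close>
    because \<open>Ad f u - u\<close> lies there and \<open>D'\<close> is invariant under
    \<open>Ad\<close>.\<close>
  define z where "z = (\<lambda>s. Ad (inv (ex u s)) (Ad f u - u))"
  have rl: "rlog c (z s) s" for s
  proof -
    have f1: "has_velocity AG (\<lambda>s. f \<otimes> ex u s \<otimes> inv f) (Ad f u) 0"
      using has_velocity_map[OF atlas_G atlas_G ex_velocity[of u] tdiff_conj[of f]] by (simp add: Ad_def)
    have "has_velocity AG (\<lambda>s. inv (ex u s) \<otimes> (f \<otimes> ex u s \<otimes> inv f)) (- u + Ad f u) 0"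
      by (rule mult_velocity_one[OF inv_velocity_one[OF ex_velocity] f1]) simp_all
    from has_velocity_map[OF atlas_G atlas_G this tdiff_conj[of "inv (ex u s)"]]
    have "has_velocity AG (\<lambda>r. inv (ex u s) \<otimes> (inv (ex u r) \<otimes> (f \<otimes> ex u r \<otimes> inv f)) \<otimes> inv (inv (ex u s))) (z s) (s - s)"
      by (simp add: z_def Ad_def)
    moreover have "((\<lambda>r. r - s) has_real_derivative 1) (at s)" by (auto intro!: derivative_eq_intros)
    ultimately
    have "has_velocity AG (\<lambda>r. inv (ex u s) \<otimes> (inv (ex u (r - s)) \<otimes> (f \<otimes> ex u (r - s) \<otimes> inv f)) \<otimes> inv (inv (ex u s))) (1 *\<^sub>R z s) s"
      by (rule has_velocity_reparam[where h="\<lambda>r. r - s" and k=1 and t=s, OF atlas_G])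
    \<comment> \<open>\<open>c r\<close> relative to \<open>c s\<close> is \<open>c (r - s)\<close>
      conjugated by \<open>inv (ex u s)\<close>; hence the derivative at 0 determines the one at
      every \<open>s\<close>.\<close>
    moreover have "inv (ex u s) \<otimes> (inv (ex u (r - s)) \<otimes> (f \<otimes> ex u (r - s) \<otimes> inv f)) \<otimes> inv (inv (ex u s)) = c r \<otimes> inv (c s)" for r
    proof -
      have 1: "inv (ex u s) \<otimes> inv (ex u (r - s)) = inv (ex u r)" by (simp add: ex_inv ex_add[symmetric])
      have 2: "ex u (r - s) = ex u r \<otimes> inv (ex u s)" by (simp add: ex_inv ex_add[symmetric])
      have "inv (ex u s) \<otimes> (inv (ex u (r - s)) \<otimes> (f \<otimes> ex u (r - s) \<otimes> inv f)) \<otimes> inv (inv (ex u s)) =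
        (inv (ex u s) \<otimes> inv (ex u (r - s))) \<otimes> (f \<otimes> ex u (r - s) \<otimes> inv f \<otimes> ex u s)" by (simp add: m_assoc)
      also have "\<dots> = inv (ex u r) \<otimes> (f \<otimes> (ex u r \<otimes> inv (ex u s)) \<otimes> inv f \<otimes> ex u s)" unfolding 1 unfolding 2 ..
      also have "\<dots> = c r \<otimes> inv (c s)"
        by (simp add: c_def inv_mult_group m_assoc) (simp add: m_assoc[symmetric])
      finally show ?thesis .
    qed
    ultimately show ?thesis unfolding rlog_def scaleR_one by simp
  qed
  have zD: "z s \<in> D'" for s using D(2)[OF u] by (simp add: z_def)
  have "isCont (\<lambda>s. Ad (ex u s) (Ad f u - u)) 0"
    by (rule has_vector_derivative_continuous[OF Ad_curve_derivative[OF ex_rlog]])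
  then have "\<forall>\<^sub>F s in nhds 0. Ad (ex u s) (Ad f u - u) \<in> ball (Ad f u - u) 1"
    by (rule isCont_eventually_in) auto
  then obtain \<delta> where \<delta>: "\<delta> > 0" "\<And>s. \<bar>s\<bar> < \<delta> \<Longrightarrow> dist (Ad f u - u) (Ad (ex u s) (Ad f u - u)) < 1"
    by (auto simp: eventually_nhds_metric dist_real_def)
  have "ctrl D' (norm (Ad f u - u) + 1) c"
    unfolding ctrl_def
  proof (intro conjI exI[of _ \<delta>] allI impI bexI[OF _ zD])
    show "c 0 = \<one>" by (simp add: c_def)
    fix s assume "\<bar>s\<bar> < \<delta>"
    then have "norm (z s - (Ad f u - u)) < 1" using \<delta>(2)[of "- s"] by (simp add: z_def ex_inv dist_norm norm_minus_commute)
    then show "norm (z s) \<le> norm (Ad f u - u) + 1" using norm_triangle_sub[of "z s" "Ad f u - u"] by linarith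
    show "rlog c (z s) s" by (rule rl)
  qed (rule \<delta>)
  note ctrl_c = this
  \<comment> \<open>The induction hypothesis supplies the one-parameter subgroups of
    \<open>D'\<close> as test curves inside \<open>SS\<close>.\<close>
  have "\<exists>\<omega>. \<omega> 0 = \<one> \<and> has_velocity AG \<omega> w 0 \<and> (\<forall>\<^sub>F s in at_right 0. \<omega> s \<in> SS)" if "w \<in> D'" for w
    using IH[OF that] ex_velocity[of w] by (intro exI[of _ "ex w"]) auto
  from closed_submonoid_curve[OF closed_SS SS_one SS_mult this ctrl_c]
  have "\<exists>\<delta>>0. \<forall>t. 0 \<le> t \<and> t < \<delta> \<longrightarrow> c t \<in> SS" .
  then obtain \<delta>1 where \<delta>1: "\<delta>1 > 0" "\<And>t. 0 \<le> t \<Longrightarrow> t < \<delta>1 \<Longrightarrow> c t \<in> SS" by blast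
  obtain V where V: "open V" "\<one> \<in> V" "\<And>h. h \<in> V \<Longrightarrow> inv h \<otimes> f \<otimes> h \<in> SS \<Longrightarrow> h \<in> SS" by (rule conjugate_near_one) blast
  have "isCont (ex u) 0" using ex_velocity[of u] by (simp add: has_velocity_def tdiff_def)
  from isCont_eventually_in[OF this V(1)] have "\<forall>\<^sub>F t in nhds 0. ex u t \<in> V" using V(2) by simp
  then obtain \<delta>2 where \<delta>2: "\<delta>2 > 0" "\<And>t. \<bar>t\<bar> < \<delta>2 \<Longrightarrow> ex u t \<in> V"
    by (auto simp: eventually_nhds_metric dist_real_def)
  define \<delta>3 where "\<delta>3 = min \<delta>1 \<delta>2"
  have small: "ex u t \<in> SS" if "0 \<le> t" "t < \<delta>3" for t
  proof (rule V(3))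
    show "ex u t \<in> V" using \<delta>2(2)[of t] that by (simp add: \<delta>3_def)
    have "c t \<otimes> f \<in> SS" using SS_mult[OF \<delta>1(2) SS_f] that by (simp add: \<delta>3_def)
    then show "inv (ex u t) \<otimes> f \<otimes> ex u t \<in> SS" by (simp add: c_def m_assoc)
  qed
  \<comment> \<open>Larger times are reached by powers of \<open>ex u (t / n)\<close> with
    \<open>t / n\<close> small.\<close>
  have nonneg: "ex u t \<in> SS" if t: "0 \<le> t" for t
  proof -
    have \<delta>3: "\<delta>3 > 0" using \<delta>1 \<delta>2 by (simp add: \<delta>3_def)
    obtain n where n: "t / \<delta>3 < real n" "n > 0" using reals_Archimedean2[of "max 1 (t / \<delta>3)"] by force
    define s where "s = t / real n"
    have s: "0 \<le> s" "s < \<delta>3" using t n \<delta>3 by (auto simp: s_def field_simps)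
    have "ex u (real k * s) \<in> SS" for k
    proof (induction k)
      case (Suc k)
      have "ex u (real (Suc k) * s) = ex u s \<otimes> ex u (real k * s)" by (simp add: ex_add[symmetric] algebra_simps)
      then show ?case using SS_mult[OF small[OF s] Suc] by simp
    qed (simp add: SS_one)
    from this[of n] show ?thesis using n(2) by (simp add: s_def)
  qed
  show ?thesis
  proof (cases "0 \<le> t")
    case False
    then have "inv (ex u (- t)) \<in> SS" by (intro SS_inv nonneg) simp
    then show ?thesis by (simp add: ex_inv)
  qed (rule nonneg)
qed

lemma all_preserve:
  assumes D: "D 0 = UNIV" "\<And>i. subspace (D i)" "D m = {0}" "\<And>i g w. w \<in> D i \<Longrightarrow> Ad g w \<in> D i"
    "\<And>i w. w \<in> D i \<Longrightarrow> Ad f w - w \<in> D (Suc i)"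
  shows "g \<in> SS"
proof -
  have "\<forall>w\<in>D i. \<forall>t. ex w t \<in> SS" if "i \<le> m" for i
    using that
  proof (induction rule: inc_induct)
    case base
    have "ex 0 t = \<one>" for t
    proof -
      have "one_parameter_subgroup G AG 0 (\<lambda>t. \<one>)"
      proof -
        have "rlog (\<lambda>t. \<one>) 0 t" for t unfolding rlog_def by (simp add: has_velocity_const[OF atlas_G])
        from one_parameter_smooth[OF this] show ?thesis
          using has_velocity_const[OF atlas_G, of "\<one>" 0] by (simp add: one_parameter_subgroup_def has_velocity_def)
      qed
      from one_parameter_unique[OF ex_one_parameter this] show ?thesis by simp
    qed
    then show ?case using D(3) SS_one by auto
  next
    case (step i)
    show ?case
    proof (intro ballI allI)
      fix w t assume w: "w \<in> D i"
      show "ex w t \<in> SS"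
        by (rule ex_preserves[of "D (Suc i)", OF D(2) D(4) _ D(5)[OF w]]) (use step.IH in blast)+
    qed
  qed
  \<comment> \<open>At the top of the chain every direction is tangent to the closed subgroup
    \<open>SS\<close>, so connectedness makes it the whole group.\<close>
  then have "ex w t \<in> SS" for w t using D(1) by (metis UNIV_I le0)
  then have "\<exists>\<omega>. \<omega> 0 = \<one> \<and> has_velocity AG \<omega> u 0 \<and> (\<forall>\<^sub>F s in at_right 0. \<omega> s \<in> SS)" for u
    using ex_velocity by (intro exI[of _ "ex u"]) auto
  from closed_subgroup_full[OF conn closed_SS SS_one SS_mult SS_inv this] show ?thesis .
qed

end

section \<open>Foliations\<close>

definition same_leaf where "same_leaf \<F> x y \<longleftrightarrow> (\<exists>L\<in>\<F>. x \<in> L \<and> y \<in> L)"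

lemma same_leaf_props:
  assumes "partition_on UNIV \<F>"
  shows "same_leaf \<F> x x" "same_leaf \<F> x y \<Longrightarrow> same_leaf \<F> y x"
    "same_leaf \<F> x y \<Longrightarrow> same_leaf \<F> y z \<Longrightarrow> same_leaf \<F> x z"
proof -
  have "x \<in> \<Union>\<F>" using partition_onD1[OF assms] by simp
  then show "same_leaf \<F> x x" by (auto simp: same_leaf_def)
  show "same_leaf \<F> x y \<Longrightarrow> same_leaf \<F> y x" by (auto simp: same_leaf_def)
  have "L = L'" if "L \<in> \<F>" "L' \<in> \<F>" "y \<in> L" "y \<in> L'" for L L'
    using partition_onD2[OF assms] that unfolding disjoint_def by blast
  then show "same_leaf \<F> x y \<Longrightarrow> same_leaf \<F> y z \<Longrightarrow> same_leaf \<F> x z"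
    unfolding same_leaf_def by metis
qed

text \<open>The definition gives the velocity of \<theta> along \<open>P\<close> only at parameter
  0. A point on a line parallel to \<open>P\<close> may be taken as new base point, which yields it
  at every parameter \<tau>.\<close>

lemma foliation_chart:
  fixes A :: "('m::{t2_space,second_countable_topology}, 'e::euclidean_space) atlas"
  assumes A: "smooth_atlas A" and fol: "foliation_tangent_to A E \<F>"
  obtains U and \<psi> :: "'m \<Rightarrow> 'e" and \<theta> P Y where "open U" "y \<in> U" "\<And>p. \<theta> p \<in> U" "\<And>p. \<psi> (\<theta> p) = p" "\<And>w. w \<in> U \<Longrightarrow> \<theta> (\<psi> w) = w"
    "continuous_on U \<psi>" "continuous_on UNIV \<theta>" "subspace P"
    "\<And>L w. L \<in> \<F> \<Longrightarrow> w \<in> L \<Longrightarrow> w \<in> U \<Longrightarrow> path_component_set (L \<inter> U) w = \<theta> ` {\<psi> w + e | e. e \<in> P}"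
    "\<And>w e. w \<in> U \<Longrightarrow> e \<in> P \<Longrightarrow> same_leaf \<F> w (\<theta> (\<psi> w + e))"
    "\<And>w e \<tau>. w \<in> U \<Longrightarrow> e \<in> P \<Longrightarrow> has_velocity A (\<lambda>t. \<theta> (\<psi> w + t *\<^sub>R e)) (Y e (\<theta> (\<psi> w + \<tau> *\<^sub>R e))) \<tau>"
    "\<And>e. e \<in> P \<Longrightarrow> continuous_vector_field_on A U (Y e)"
    "\<And>w. w \<in> U \<Longrightarrow> (\<lambda>e. Y e w) ` P = E w"
proof -
  have part: "partition_on UNIV \<F>" using fol by (simp add: foliation_tangent_to_def)
  have "\<exists>U (\<psi> :: 'm \<Rightarrow> 'e) \<theta> P X.
        open U \<and> y \<in> U \<and> homeomorphism U UNIV \<psi> \<theta> \<and> subspace P \<and>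
        (\<forall>L\<in>\<F>. \<forall>y\<in>L \<inter> U. path_component_set (L \<inter> U) y = \<theta> ` {\<psi> y + e | e. e \<in> P}) \<and>
        (\<forall>e\<in>P. continuous_vector_field_on A U (X e)) \<and>
        (\<forall>y\<in>U. \<forall>e\<in>P.
           ((\<lambda>t::real. snd (chart_at A y) (\<theta> (\<psi> y + t *\<^sub>R e))) has_vector_derivative X e y) (at 0)) \<and>
        (\<forall>y\<in>U. inj_on (\<lambda>e. X e y) P \<and> (\<lambda>e. X e y) ` P = E y)"
    using fol unfolding foliation_tangent_to_def by blast
  then obtain U and \<psi> :: "'m \<Rightarrow> 'e" and \<theta> P Y where *: "open U" "y \<in> U" "homeomorphism U UNIV \<psi> \<theta>" "subspace P"
        "\<forall>L\<in>\<F>. \<forall>y\<in>L \<inter> U. path_component_set (L \<inter> U) y = \<theta> ` {\<psi> y + e | e. e \<in> P}"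
        "\<forall>e\<in>P. continuous_vector_field_on A U (Y e)"
        "\<forall>y\<in>U. \<forall>e\<in>P.
           ((\<lambda>t::real. snd (chart_at A y) (\<theta> (\<psi> y + t *\<^sub>R e))) has_vector_derivative Y e y) (at 0)"
        "\<forall>y\<in>U. inj_on (\<lambda>e. Y e y) P \<and> (\<lambda>e. Y e y) ` P = E y"
    by (elim exE conjE) blast
  have h: "\<theta> p \<in> U" "\<psi> (\<theta> p) = p" for p using *(3) by (auto simp: homeomorphism_def)
  have h': "\<theta> (\<psi> w) = w" if "w \<in> U" for w using *(3) that by (auto simp: homeomorphism_def)
  have c: "continuous_on U \<psi>" "continuous_on UNIV \<theta>" using *(3) by (auto simp: homeomorphism_def)
  have sl: "same_leaf \<F> w (\<theta> (\<psi> w + e))" if w: "w \<in> U" and e: "e \<in> P" for w e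
  proof -
    obtain L where L: "L \<in> \<F>" "w \<in> L" using same_leaf_props(1)[OF part, of w] by (auto simp: same_leaf_def)
    have "\<theta> (\<psi> w + e) \<in> path_component_set (L \<inter> U) w" using *(5) L w e by blast
    then have "\<theta> (\<psi> w + e) \<in> L" using path_component_subset[of "L \<inter> U" w] by blast
    then show ?thesis using L by (auto simp: same_leaf_def)
  qed
  have vel: "has_velocity A (\<lambda>t. \<theta> (\<psi> w + t *\<^sub>R e)) (Y e (\<theta> (\<psi> w + \<tau> *\<^sub>R e))) \<tau>"
    if w: "w \<in> U" and e: "e \<in> P" for w e \<tau>
  proof -
    define w' where "w' = \<theta> (\<psi> w + \<tau> *\<^sub>R e)"
    have w': "w' \<in> U" "\<psi> w' = \<psi> w + \<tau> *\<^sub>R e" using h by (auto simp: w'_def)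
    have "continuous_on UNIV (\<lambda>t. \<theta> (\<psi> w' + t *\<^sub>R e))"
      by (intro continuous_on_compose2[OF c(2)] continuous_intros) auto
    then have ic: "isCont (\<lambda>t. \<theta> (\<psi> w' + t *\<^sub>R e)) 0" by (simp add: continuous_on_eq_continuous_at)
    have "((\<lambda>t. snd (chart_at A w') (\<theta> (\<psi> w' + t *\<^sub>R e))) has_vector_derivative Y e w') (at 0)"
      using *(7) w'(1) e by blast
    then have "has_velocity A (\<lambda>t. \<theta> (\<psi> w' + t *\<^sub>R e)) (Y e w') (\<tau> - \<tau>)"
      using has_velocity_chart_at[OF A, of "\<lambda>t. \<theta> (\<psi> w' + t *\<^sub>R e)" "Y e w'" 0] ic h'[OF w'(1)] by simp
    moreover have "((\<lambda>r. r - \<tau>) has_real_derivative 1) (at \<tau>)" by (auto intro!: derivative_eq_intros)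
    ultimately have "has_velocity A (\<lambda>t. \<theta> (\<psi> w' + (t - \<tau>) *\<^sub>R e)) (1 *\<^sub>R Y e w') \<tau>"
      by (rule has_velocity_reparam[where h="\<lambda>t. t - \<tau>" and k=1 and t=\<tau>, OF A])
    moreover have "\<psi> w' + (t - \<tau>) *\<^sub>R e = \<psi> w + t *\<^sub>R e" for t by (simp add: w'(2) algebra_simps)
    ultimately show ?thesis by (simp add: w'_def)
  qed
  have pc: "path_component_set (L \<inter> U) w = \<theta> ` {\<psi> w + e | e. e \<in> P}" if "L \<in> \<F>" "w \<in> L" "w \<in> U" for L w
    using *(5) that by blast
  have cv: "continuous_vector_field_on A U (Y e)" if "e \<in> P" for e using *(6) that by blast
  have im: "(\<lambda>e. Y e w) ` P = E w" if "w \<in> U" for w using *(8) that by blast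
  show ?thesis by (rule that[OF *(1,2) h h' c *(4) pc sl vel cv im])
qed

lemma chart_preimage_compact:
  assumes A: "smooth_atlas A" and d: "d \<in> A" and sub: "cball p r \<subseteq> snd d ` fst d" and Q: "closed Q"
  shows "compact (snd d ` (Q \<inter> fst d) \<inter> cball p r)"
proof -
  note dh = smooth_atlas_chart[OF A d]
  have "snd d ` (Q \<inter> fst d) \<inter> cball p r = cball p r \<inter> chart_inv d -` Q"
  proof (intro equalityI subsetI)
    fix q assume q: "q \<in> cball p r \<inter> chart_inv d -` Q"
    then have "q \<in> snd d ` fst d" using sub by blast
    then show "q \<in> snd d ` (Q \<inter> fst d) \<inter> cball p r"
      using q dh by (auto intro!: image_eqI[of q _ "chart_inv d q"])
  qed (use dh in auto)
  moreover have "closed (cball p r \<inter> chart_inv d -` Q)"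
    by (intro continuous_closed_preimage continuous_on_subset[OF dh(4) sub] Q) simp
  ultimately show ?thesis by (metis bounded_cball bounded_Int compact_eq_bounded_closed)
qed

context smooth_action
begin

text \<open>Using the hypothesis for \<open>g\<close> shows that the image lies in one leaf, and
  using it for the inverse that it fills this leaf.\<close>

lemma foliation_invariantI:
  assumes part: "partition_on UNIV \<F>"
    and R: "\<And>g x y. same_leaf \<F> x y \<Longrightarrow> same_leaf \<F> (\<phi> g x) (\<phi> g y)"
  shows "foliation_invariant G \<phi> \<F>"
  unfolding foliation_invariant_def
proof (intro ballI)
  fix g L assume L: "L \<in> \<F>"
  have uniq: "y \<in> L'" if "L' \<in> \<F>" "x \<in> L'" "same_leaf \<F> x y" for L' x y
    using that partition_onD2[OF part] unfolding same_leaf_def disjoint_def by blast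
  have "L \<noteq> {}" using L partition_onD3[OF part] by metis
  then obtain x where x: "x \<in> L" by blast
  obtain L' where L': "L' \<in> \<F>" "\<phi> g x \<in> L'"
    using same_leaf_props(1)[OF part, of "\<phi> g x"] by (auto simp: same_leaf_def)
  have "\<phi> g ` L = L'"
  proof (intro equalityI subsetI)
    fix z assume "z \<in> \<phi> g ` L"
    then obtain y where y: "y \<in> L" "z = \<phi> g y" by blast
    have "same_leaf \<F> x y" using L x y by (auto simp: same_leaf_def)
    from uniq[OF L' R[OF this]] show "z \<in> L'" using y by simp
  next
    fix z assume "z \<in> L'"
    then have "same_leaf \<F> (\<phi> g x) z" using L' by (auto simp: same_leaf_def)
    from R[OF this, of "inv g"] have "same_leaf \<F> x (\<phi> (inv g) z)" by simp
    from uniq[OF L x this] show "z \<in> \<phi> g ` L" by (intro image_eqI[of _ _ "\<phi> (inv g) z"]) simp_all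
  qed
  then show "\<phi> g ` L \<in> \<F>" using L' by simp
qed

text \<open>Every leaf is a union of orbits: a compact piece of a plaque is locally invariant.\<close>
lemma foliation_saturated:
  assumes conn: "connected (UNIV :: 'g set)" and fol: "foliation_tangent_to AM E \<F>" and XE: "\<And>x u. X x u \<in> E x"
  shows "foliation_invariant G \<phi> \<F>"
proof -
  have part: "partition_on UNIV \<F>" using fol by (simp add: foliation_tangent_to_def)
  note sl = same_leaf_props[OF part]
  have "same_leaf \<F> y (\<phi> g y)" for g y
  proof (rule connected_orbit_relation[OF conn, where R="same_leaf \<F>"])
    fix y \<gamma> \<beta> assume ct: "ctrl UNIV \<beta> \<gamma>"
    obtain U and \<psi> :: "'m \<Rightarrow> 'e" and \<theta> P Y where fc: "open U" "y \<in> U" "\<And>p. \<theta> p \<in> U" "\<And>p. \<psi> (\<theta> p) = p" "\<And>w. w \<in> U \<Longrightarrow> \<theta> (\<psi> w) = w"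
      "continuous_on U \<psi>" "continuous_on UNIV \<theta>" "subspace P"
      "\<And>w e. w \<in> U \<Longrightarrow> e \<in> P \<Longrightarrow> same_leaf \<F> w (\<theta> (\<psi> w + e))"
      "\<And>w e \<tau>. w \<in> U \<Longrightarrow> e \<in> P \<Longrightarrow> has_velocity AM (\<lambda>t. \<theta> (\<psi> w + t *\<^sub>R e)) (Y e (\<theta> (\<psi> w + \<tau> *\<^sub>R e))) \<tau>"
      "\<And>w. w \<in> U \<Longrightarrow> (\<lambda>e. Y e w) ` P = E w"
      by (rule foliation_chart[OF atlas_M fol, of y]) blast
    \<comment> \<open>The part of the plaque of \<open>y\<close> over the closed unit ball of
      \<open>P\<close>: compact, hence closed in the manifold, unlike the leaf as a whole.\<close>
    define Q where "Q = \<theta> ` ((\<lambda>e. \<psi> y + e) ` (P \<inter> cball 0 1))"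
    have "compact (P \<inter> cball (0::'e) 1)" using closed_Int_compact[OF closed_subspace[OF fc(8)] compact_cball] .
    then have "compact Q" unfolding Q_def
      by (intro compact_continuous_image continuous_on_subset[OF fc(7)] continuous_intros) auto
    then have Qc: "closed Q" by (rule compact_imp_closed)
    have P0: "0 \<in> P" using subspace_0[OF fc(8)] .
    have yQ: "y \<in> Q" unfolding Q_def using P0 fc(5)[OF fc(2)]
      by (intro image_eqI[of _ _ "\<psi> y"] image_eqI[of _ _ 0]) auto
    define d where "d = chart_at AM y"
    have d: "d \<in> AM" "y \<in> fst d" using chart_at_props[OF atlas_M] by (auto simp: d_def)
    note dh = smooth_atlas_chart[OF atlas_M d(1)]
    \<comment> \<open>Points of \<open>Q\<close> in \<open>V\<close> have plaque coordinate of norm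
      less than 1, so short moves along the plaque do not leave \<open>Q\<close>.\<close>
    define V where "V = U \<inter> \<psi> -` ball (\<psi> y) 1"
    have V: "open V" "y \<in> V" unfolding V_def using fc by (auto intro: continuous_open_preimage)
    have "open (snd d ` fst d \<inter> chart_inv d -` V)" by (rule continuous_open_preimage[OF dh(4,2) V(1)])
    moreover have "snd d y \<in> snd d ` fst d \<inter> chart_inv d -` V" using d V dh by auto
    ultimately obtain r where r: "r > 0" "cball (snd d y) r \<subseteq> snd d ` fst d \<inter> chart_inv d -` V"
      using open_contains_cball by blast
    have "\<exists>\<delta>>0. \<forall>t. 0 \<le> t \<and> t < \<delta> \<longrightarrow> \<phi> (\<gamma> t) y \<in> Q"
    proof (rule local_invariance[OF d yQ r(1) _ _ ct])
      show "compact (snd d ` (Q \<inter> fst d) \<inter> cball (snd d y) r)"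
        by (rule chart_preimage_compact[OF atlas_M d(1) _ Qc]) (use r in blast)
      fix w u assume w: "w \<in> Q" "w \<in> fst d" "snd d w \<in> ball (snd d y) r"
      have "chart_inv d (snd d w) \<in> V" using subsetD[OF r(2), of "snd d w"] w(3) by simp
      then have wV: "w \<in> V" using dh(5)[OF w(2)] by simp
      obtain e where e: "e \<in> P" "w = \<theta> (\<psi> y + e)" using w(1) by (auto simp: Q_def)
      have pw: "\<psi> w = \<psi> y + e" and wU: "w \<in> U" using fc(3,4) e(2) by auto
      have ne: "norm e < 1" using wV pw by (auto simp: V_def dist_norm)
      obtain e' where e': "e' \<in> P" "Y e' w = X w u" using XE[of w u] fc(11)[OF wU] by (metis imageE)
      define \<omega> where "\<omega> = (\<lambda>s. \<theta> (\<psi> w + s *\<^sub>R e'))"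
      have w0: "\<omega> 0 = w" using fc(5)[OF wU] by (simp add: \<omega>_def)
      have "has_velocity AM \<omega> (X w u) 0" using fc(10)[OF wU e'(1), of 0] fc(5)[OF wU] e'(2) by (simp add: \<omega>_def)
      moreover have "\<forall>\<^sub>F s in at_right 0. \<omega> s \<in> Q"
      proof -
        have "isCont (\<lambda>s. e + s *\<^sub>R e') 0" by (intro continuous_intros)
        from isCont_eventually_in[OF this, of "ball 0 1"] ne
        have "\<forall>\<^sub>F s in nhds 0. e + s *\<^sub>R e' \<in> ball 0 1" by simp
        then have "\<forall>\<^sub>F s in at_right 0. e + s *\<^sub>R e' \<in> ball 0 1" by (rule filter_leD[OF at_within_le_nhds])
        then show ?thesis
        proof eventually_elim
          case (elim s)
          have "e + s *\<^sub>R e' \<in> P" using fc(8) e(1) e'(1) by (simp add: subspace_add subspace_scale)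
          then show ?case unfolding Q_def \<omega>_def pw using elim
            by (intro image_eqI[of _ _ "\<psi> y + (e + s *\<^sub>R e')"] image_eqI[of _ _ "e + s *\<^sub>R e'"]) (auto simp: add.assoc)
        qed
      qed
      ultimately show "\<exists>\<omega>. \<omega> 0 = w \<and> has_velocity AM \<omega> (X w u) 0 \<and> (\<forall>\<^sub>F s in at_right 0. \<omega> s \<in> Q)"
        using w0 by blast
    qed
    moreover have "same_leaf \<F> y q" if "q \<in> Q" for q using that fc(9)[OF fc(2)] by (auto simp: Q_def)
    ultimately show "\<exists>\<delta>>0. \<forall>t. 0 \<le> t \<and> t < \<delta> \<longrightarrow> same_leaf \<F> y (\<phi> (\<gamma> t) y)" by blast
  next
    show "same_leaf \<F> x x" for x by (rule sl(1))
    show "same_leaf \<F> y x" if "same_leaf \<F> x y" for x y using that by (rule sl(2))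
    show "same_leaf \<F> x z" if "same_leaf \<F> x y" "same_leaf \<F> y z" for x y z using that by (rule sl(3))
  qed
  note orb = this
  show ?thesis
  proof (rule foliation_invariantI[OF part])
    fix g x y assume "same_leaf \<F> x y"
    from sl(3)[OF this orb] have "same_leaf \<F> x (\<phi> g y)" .
    from sl(3)[OF sl(2)[OF orb] this] show "same_leaf \<F> (\<phi> g x) (\<phi> g y)" .
  qed
qed

text \<open>First-order expansion with an error uniform in both points, and with the differential
  taken at the moving point \<open>q\<close> instead of the centre.\<close>

lemma linearize_local:
  assumes d: "d \<in> AM" "y0 \<in> fst d" and d': "d' \<in> AM" "\<phi> g y0 \<in> fst d'" and \<eta>: "\<eta> > 0"
  obtains r where "r > 0" "cball (snd d y0) r \<subseteq> snd d ` fst d"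
    "\<And>p. p \<in> cball (snd d y0) r \<Longrightarrow> \<phi> g (chart_inv d p) \<in> fst d'"
    "\<And>p q. p \<in> cball (snd d y0) r \<Longrightarrow> q \<in> cball (snd d y0) r \<Longrightarrow>
      norm (snd d' (\<phi> g (chart_inv d p)) - snd d' (\<phi> g (chart_inv d q)) -
        in_chart AM d' (\<phi> g (chart_inv d q)) (T g (chart_inv d q) (from_chart AM d q (p - q)))) \<le> \<eta> * norm (p - q)"
proof -
  note dh = smooth_atlas_chart[OF atlas_M d(1)]
  define S where "S = snd d ` fst d \<inter> (\<lambda>p. \<phi> g (chart_inv d p)) -` fst d'"
  define q0 where "q0 = snd d y0"
  define G where "G = (\<lambda>p. snd d' (\<phi> g (chart_inv d p)))"
  define DG where "DG = (\<lambda>q v. in_chart AM d' (\<phi> g (chart_inv d q)) (T g (chart_inv d q) (from_chart AM d q v)))"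
  define c where "c = chart_at AG g"
  have c: "c \<in> AG" "g \<in> fst c" using chart_at_props[OF atlas_G] by (auto simp: c_def)
  note ch = smooth_atlas_chart[OF atlas_G c(1)]
  let ?F = "\<lambda>(g, x). \<phi> g x" let ?L = "loc_rep c d d' ?F" and ?LD = "loc_dom c d d' ?F"
  have gg: "chart_inv c (snd c g) = g" using ch(5) c(2) by simp
  have SL: "(snd c g, q) \<in> ?LD" if "q \<in> S" for q
    using that c gg by (auto simp: S_def loc_dom_def)
  have GL: "G = (\<lambda>q. ?L (snd c g, q))" by (simp add: G_def loc_rep_def gg)
  have opS: "open S"
  proof -
    have "continuous_on (snd d ` fst d) (\<lambda>p. case (g, chart_inv d p) of (g, x) \<Rightarrow> \<phi> g x)"
      by (rule continuous_on_compose2[OF continuous_act]) (auto intro!: continuous_intros dh)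
    then show ?thesis unfolding S_def
      using dh(2) smooth_atlas_chart(1)[OF atlas_M d'(1)] by (intro continuous_open_preimage) auto
  qed
  have q0S: "q0 \<in> S" using d d' dh by (auto simp: S_def q0_def)
  have C1: "Ck_on (Suc 0) ?LD ?L" by (rule smooth_bimap.loc_rep_Ck[OF act_bimap c(1) d(1) d'(1)])
  have der: "(G has_derivative (\<lambda>v. frechet_derivative ?L (at (snd c g, q)) (0, v))) (at q)" if "q \<in> S" for q
  proof -
    have "((\<lambda>q. (snd c g, q)) has_derivative (\<lambda>v. (0, v))) (at q)" by (auto intro!: derivative_eq_intros)
    from has_derivative_compose[OF this Ck_on_SucE[OF C1 SL[OF that]]] show ?thesis by (simp add: GL)
  qed
  have DGL: "DG q v = frechet_derivative ?L (at (snd c g, q)) (0, v)" if q: "q \<in> S" for q v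
  proof -
    define x where "x = chart_inv d q"
    have x: "x \<in> fst d" "snd d x = q" "\<phi> g x \<in> fst d'" using q dh by (auto simp: S_def x_def)
    have z0: "tangent_map AG AM (\<lambda>h. \<phi> h x) g (from_chart AG c (snd c g) 0) = 0"
    proof -
      have "snd c g \<in> snd c ` fst c" using c(2) by simp
      from linear_0[OF linear_from_chart[OF atlas_G c(1) this]]
      show ?thesis using linear_0[OF tdiff_linear[OF tdiff_orbit]] by simp
    qed
    show ?thesis
      using smooth_bimap.loc_rep_tangent[OF act_bimap c d(1) x(1) d'(1), of 0 v] x z0
      by (simp add: DG_def T_def x_def[symmetric])
  qed
  define H where "H = (\<lambda>q v. norm (DG q v - DG q0 v) - \<eta> / 2)"
  have contD: "continuous_on (S \<times> UNIV) (\<lambda>z. DG (fst z) (snd z))"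
  proof -
    have "continuous_on (S \<times> UNIV) (\<lambda>z. case ((snd c g, fst z), (0, snd z)) of (z, v) \<Rightarrow> frechet_derivative ?L (at z) v)"
      by (rule continuous_on_compose2[OF C1_derivative_continuous[OF C1]]) (use SL in \<open>auto intro!: continuous_intros\<close>)
    then show ?thesis by (rule continuous_on_eq) (auto simp: DGL)
  qed
  have "continuous_on (S \<times> UNIV) (\<lambda>z. DG (fst (q0, snd z)) (snd (q0, snd z)))"
    by (rule continuous_on_compose2[OF contD]) (use q0S in \<open>auto intro!: continuous_intros\<close>)
  then have "continuous_on (S \<times> UNIV) (\<lambda>z. DG q0 (snd z))" by simp
  with contD have "continuous_on (S \<times> UNIV) (\<lambda>(q, v). H q v)"
    unfolding H_def case_prod_beta by (intro continuous_intros)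
  then obtain Z where Z: "open Z" "q0 \<in> Z" "Z \<subseteq> S" "\<And>q v. q \<in> Z \<Longrightarrow> norm v = 1 \<Longrightarrow> H q v < 0"
    by (rule sphere_tube[OF opS q0S, of H]) (use \<eta> in \<open>auto simp: H_def\<close>)
  obtain r where r: "r > 0" "cball q0 r \<subseteq> Z" using Z(1,2) open_contains_cball by blast
  have DGlin: "linear (DG q)" if "q \<in> S" for q
  proof -
    have "DG q = (\<lambda>v. frechet_derivative ?L (at (snd c g, q)) (0, v))" by (rule ext) (rule DGL[OF that])
    then show ?thesis using has_derivative_linear[OF der[OF that]] by simp
  qed
  have small: "norm (DG q v - DG q0 v) \<le> \<eta> / 2 * norm v" if q: "q \<in> cball q0 r" for q v
  proof (cases "v = 0")
    case True
    then show ?thesis using linear_0[OF DGlin] q r Z(3) q0S by (simp add: subset_iff)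
  next
    case False
    obtain w where w: "norm w = 1" "v = norm v *\<^sub>R w"
      using False by (intro that[of "(1 / norm v) *\<^sub>R v"]) auto
    have qS: "q \<in> S" using q r(2) Z(3) by blast
    have "norm (DG q w - DG q0 w) < \<eta> / 2" using Z(4)[of q w] q r(2) w(1) by (auto simp: H_def)
    then have "norm v * norm (DG q w - DG q0 w) \<le> norm v * (\<eta> / 2)" by (intro mult_left_mono) auto
    moreover have "DG q v - DG q0 v = norm v *\<^sub>R (DG q w - DG q0 w)"
      using linear_cmul[OF DGlin[OF qS], of "norm v" w] linear_cmul[OF DGlin[OF q0S], of "norm v" w] w(2)
      by (simp add: scaleR_diff_right)
    ultimately show ?thesis by (simp add: mult.commute)
  qed
  have lin: "norm (G p - G q - DG q (p - q)) \<le> \<eta> * norm (p - q)" if p: "p \<in> cball q0 r" and q: "q \<in> cball q0 r" for p q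
  proof -
    \<comment> \<open>Subtracting the differential at the centre leaves a map with Lipschitz
      constant \<open>\<eta> / 2\<close>; replacing it by the differential at \<open>q\<close> costs
      another \<open>\<eta> / 2\<close>.\<close>
    define h where "h = (\<lambda>p. G p - DG q0 p)"
    have bl0: "bounded_linear (DG q0)" using DGlin[OF q0S] linear_conv_bounded_linear by blast
    have "norm (h p - h q) \<le> \<eta> / 2 * norm (p - q)"
    proof (rule differentiable_bound[of "cball q0 r" h "\<lambda>p v. DG p v - DG q0 v"])
      fix p' assume p': "p' \<in> cball q0 r"
      then have pS: "p' \<in> S" using r(2) Z(3) by blast
      have "DG p' = (\<lambda>v. frechet_derivative ?L (at (snd c g, p')) (0, v))" by (rule ext) (rule DGL[OF pS])
      then have "(G has_derivative DG p') (at p')" using der[OF pS] by simp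
      then show "(h has_derivative (\<lambda>v. DG p' v - DG q0 v)) (at p' within cball q0 r)"
        unfolding h_def
        by (rule has_derivative_at_withinI[OF has_derivative_diff[OF _ bounded_linear_imp_has_derivative[OF bl0]]])
      show "onorm (\<lambda>v. DG p' v - DG q0 v) \<le> \<eta> / 2" by (rule onorm_le) (rule small[OF p'])
    qed (use p q in auto)
    moreover have eq: "G p - G q - DG q (p - q) = (h p - h q) - (DG q (p - q) - DG q0 (p - q))"
      by (simp add: h_def linear_diff[OF DGlin[OF q0S]])
    ultimately have "norm (G p - G q - DG q (p - q)) \<le> \<eta> / 2 * norm (p - q) + \<eta> / 2 * norm (p - q)"
      unfolding eq using small[OF q, of "p - q"] norm_triangle_ineq4[of "h p - h q" "DG q (p - q) - DG q0 (p - q)"] by linarith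
    then show ?thesis by simp
  qed
  show ?thesis
  proof (rule that[OF r(1)])
    show "cball (snd d y0) r \<subseteq> snd d ` fst d" using r(2) Z(3) by (auto simp: q0_def S_def)
    show "\<phi> g (chart_inv d p) \<in> fst d'" if "p \<in> cball (snd d y0) r" for p
      using that r(2) Z(3) by (auto simp: q0_def S_def)
    fix p q assume "p \<in> cball (snd d y0) r" "q \<in> cball (snd d y0) r"
    from lin[OF this[folded q0_def]] show "norm (snd d' (\<phi> g (chart_inv d p)) - snd d' (\<phi> g (chart_inv d q)) -
        in_chart AM d' (\<phi> g (chart_inv d q)) (T g (chart_inv d q) (from_chart AM d q (p - q)))) \<le> \<eta> * norm (p - q)"
      by (simp add: G_def DG_def)
  qed
qed

end

section \<open>Uniqueness of the strong stable foliation\<close>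

context riem_action
begin

definition ball_in where
  "ball_in x s \<longleftrightarrow> cball (snd (chart_at AM x) x) s \<subseteq> snd (chart_at AM x) ` fst (chart_at AM x)"

definition core where
  "core x s = {y \<in> fst (chart_at AM x). snd (chart_at AM x) y \<in> cball (snd (chart_at AM x) x) s}"

lemma core_closed:
  assumes "ball_in x s"
  shows "closed (core x s)"
proof -
  let ?d = "chart_at AM x"
  have d: "?d \<in> AM" using chart_at_props[OF atlas_M] by blast
  note dh = smooth_atlas_chart[OF atlas_M d]
  have sub: "cball (snd ?d x) s \<subseteq> snd ?d ` fst ?d" using assms by (simp add: ball_in_def)
  have "core x s = chart_inv ?d ` cball (snd ?d x) s"
  proof (intro equalityI subsetI)
    fix y assume "y \<in> core x s"
    then show "y \<in> chart_inv ?d ` cball (snd ?d x) s"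
      using dh(5)[of y] by (auto simp: core_def intro!: image_eqI[of y _ "snd ?d y"])
  next
    fix y assume "y \<in> chart_inv ?d ` cball (snd ?d x) s"
    then obtain p where p: "p \<in> cball (snd ?d x) s" "y = chart_inv ?d p" by blast
    then have "p \<in> snd ?d ` fst ?d" using sub by blast
    then show "y \<in> core x s" using p dh by (simp add: core_def)
  qed
  then show ?thesis
    using compact_imp_closed[OF compact_continuous_image[OF continuous_on_subset[OF dh(4) sub] compact_cball]] by simp
qed

text \<open>Finitely many charts with one comparison constant \<open>A\<close>. The cores cover the
  manifold, and \<open>r0\<close> is the margin within which a displacement starting in a core can
  still be measured in its chart.\<close>

lemma chart_family:
  obtains F \<rho>' A r0 where "finite F" "A \<ge> 1" "r0 > 0" "\<And>x. x \<in> F \<Longrightarrow> ball_in x (\<rho>' x + r0)"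
    "\<And>x. x \<in> F \<Longrightarrow> \<rho>' x > 0"
    "\<And>y. \<exists>x\<in>F. y \<in> core x (\<rho>' x)"
    "\<And>x p v. x \<in> F \<Longrightarrow> p \<in> cball (snd (chart_at AM x) x) (\<rho>' x + r0) \<Longrightarrow>
      Nch (chart_at AM x) p v \<le> A * norm v \<and> norm v \<le> A * Nch (chart_at AM x) p v"
proof -
  have "\<exists>r>0. ball_in x (2 * r)" for x
  proof -
    let ?d = "chart_at AM x"
    have d: "?d \<in> AM" "x \<in> fst ?d" using chart_at_props[OF atlas_M] by auto
    obtain r where "r > 0" "cball (snd ?d x) r \<subseteq> snd ?d ` fst ?d"
      using open_contains_cball smooth_atlas_chart(2)[OF atlas_M d(1)] d(2) by blast
    then show ?thesis by (intro exI[of _ "r / 2"]) (simp add: ball_in_def)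
  qed
  then obtain r where r: "\<And>x. r x > 0" "\<And>x. ball_in x (2 * r x)" by metis
  define V where "V = (\<lambda>x. fst (chart_at AM x) \<inter> snd (chart_at AM x) -` ball (snd (chart_at AM x) x) (r x))"
  have V: "open (V x)" "x \<in> V x" for x
  proof -
    have d: "chart_at AM x \<in> AM" "x \<in> fst (chart_at AM x)" using chart_at_props[OF atlas_M] by auto
    note dh = smooth_atlas_chart[OF atlas_M d(1)]
    show "open (V x)" unfolding V_def by (rule continuous_open_preimage[OF dh(3,1)]) simp
    show "x \<in> V x" using d r(1) by (simp add: V_def)
  qed
  obtain F where F: "finite F" "UNIV \<subseteq> (\<Union>x\<in>F. V x)"
    using compactE_image[OF compact_M, of UNIV V] V by (metis UNIV_I UN_I subsetI)
  have "\<exists>A\<ge>1. \<forall>p\<in>cball (snd (chart_at AM x) x) (2 * r x). \<forall>v.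
      Nch (chart_at AM x) p v \<le> A * norm v \<and> norm v \<le> A * Nch (chart_at AM x) p v" for x
  proof -
    have d: "chart_at AM x \<in> AM" using chart_at_props[OF atlas_M] by auto
    have "cball (snd (chart_at AM x) x) (2 * r x) \<subseteq> snd (chart_at AM x) ` fst (chart_at AM x)" using r(2) by (simp add: ball_in_def)
    from Nch_bounds[OF d compact_cball this] show ?thesis by metis
  qed
  then obtain A' where A': "\<And>x. A' x \<ge> 1" "\<And>x p v. p \<in> cball (snd (chart_at AM x) x) (2 * r x) \<Longrightarrow>
      Nch (chart_at AM x) p v \<le> A' x * norm v \<and> norm v \<le> A' x * Nch (chart_at AM x) p v" by metis
  define A where "A = Max (insert 1 (A' ` F))"
  define r0 where "r0 = Min (insert 1 (r ` F))"
  have A: "A \<ge> 1" "\<And>x. x \<in> F \<Longrightarrow> A' x \<le> A" using F(1) by (auto simp: A_def)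
  have r0: "r0 > 0" "\<And>x. x \<in> F \<Longrightarrow> r0 \<le> r x" using F(1) r(1) by (auto simp: r0_def)
  show ?thesis
  proof (rule that[OF F(1) A(1) r0(1), of r])
    fix x assume x: "x \<in> F"
    have le: "r x + r0 \<le> 2 * r x" using r0(2)[OF x] by simp
    show "ball_in x (r x + r0)" using r(2)[of x] subset_cball[OF le, of "snd (chart_at AM x) x"] unfolding ball_in_def by blast
    show "r x > 0" by (rule r)
    fix p v assume p: "p \<in> cball (snd (chart_at AM x) x) (r x + r0)"
    then have "p \<in> cball (snd (chart_at AM x) x) (2 * r x)" using subset_cball[OF le] by blast
    from A'(2)[OF this, of v]
    have 1: "Nch (chart_at AM x) p v \<le> A' x * norm v" "norm v \<le> A' x * Nch (chart_at AM x) p v" by auto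
    have "A' x * norm v \<le> A * norm v" by (rule mult_right_mono[OF A(2)[OF x]]) simp
    moreover have "A' x * Nch (chart_at AM x) p v \<le> A * Nch (chart_at AM x) p v"
      by (rule mult_right_mono[OF A(2)[OF x]]) (simp add: Nch_def)
    ultimately show "Nch (chart_at AM x) p v \<le> A * norm v \<and> norm v \<le> A * Nch (chart_at AM x) p v" using 1 by linarith
  next
    fix y
    obtain x where "x \<in> F" "y \<in> V x" using F(2) by blast
    then show "\<exists>x\<in>F. y \<in> core x (r x)" by (auto simp: V_def core_def intro!: bexI[of _ x])
  qed
qed

text \<open>Since the cores are closed, the condition is vacuous near any point violating a
  membership, so every point has a neighbourhood with a common radius and compactness
  applies.\<close>

lemma uniform_linearization:
  assumes F: "finite F" "\<And>x. x \<in> F \<Longrightarrow> ball_in x (\<rho>' x)" and \<eta>: "\<eta> > 0"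
  obtains r where "r > 0"
    "\<And>x x' y p q. x \<in> F \<Longrightarrow> x' \<in> F \<Longrightarrow> y \<in> core x (\<rho>' x) \<Longrightarrow> \<phi> g y \<in> core x' (\<rho>' x') \<Longrightarrow>
      p \<in> cball (snd (chart_at AM x) y) r \<Longrightarrow> q \<in> cball (snd (chart_at AM x) y) r \<Longrightarrow>
      norm (snd (chart_at AM x') (\<phi> g (chart_inv (chart_at AM x) p)) - snd (chart_at AM x') (\<phi> g (chart_inv (chart_at AM x) q)) -
        in_chart AM (chart_at AM x') (\<phi> g (chart_inv (chart_at AM x) q)) (T g (chart_inv (chart_at AM x) q) (from_chart AM (chart_at AM x) q (p - q))))
      \<le> \<eta> * norm (p - q)"
proof -
  define lin where "lin = (\<lambda>x x' y r. \<forall>p\<in>cball (snd (chart_at AM x) y) r. \<forall>q\<in>cball (snd (chart_at AM x) y) r.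
      norm (snd (chart_at AM x') (\<phi> g (chart_inv (chart_at AM x) p)) - snd (chart_at AM x') (\<phi> g (chart_inv (chart_at AM x) q)) -
        in_chart AM (chart_at AM x') (\<phi> g (chart_inv (chart_at AM x) q)) (T g (chart_inv (chart_at AM x) q) (from_chart AM (chart_at AM x) q (p - q))))
      \<le> \<eta> * norm (p - q))"
  \<comment> \<open>The radius is encoded as \<open>1 / C\<close>, so that the property is monotone
    in \<open>C\<close> as \<open>compact_uniform_bound\<close> demands.\<close>
  define P where "P = (\<lambda>x x' C y. C > 0 \<and> (y \<in> core x (\<rho>' x) \<and> \<phi> g y \<in> core x' (\<rho>' x') \<longrightarrow> lin x x' y (1 / C)))"
  have lin_mono: "lin x x' y r'" if "lin x x' y r" "r' \<le> r" for x x' y r r'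
    using that(1) subset_cball[OF that(2), of "snd (chart_at AM x) y"] unfolding lin_def by blast
  have "\<exists>C. \<forall>y. P x x' C y" if x: "x \<in> F" and x': "x' \<in> F" for x x'
  proof -
    have mono: "P x x' C' y" if "P x x' C y" "C \<le> C'" for C C' y
      using that lin_mono[of x x' y "1 / C" "1 / C'"] by (auto simp: P_def frac_le)
    have loc: "\<exists>Q C. open Q \<and> y0 \<in> Q \<and> (\<forall>y\<in>Q. P x x' C y)" for y0
    proof (cases "y0 \<in> core x (\<rho>' x) \<and> \<phi> g y0 \<in> core x' (\<rho>' x')")
      case False
      have "open (- core x (\<rho>' x))" using core_closed[OF F(2)[OF x]] by (rule open_Compl)
      moreover have "continuous_on UNIV (\<phi> g)"
      proof -
        have "continuous_on UNIV (\<lambda>x. case (g, x) of (g, x) \<Rightarrow> \<phi> g x)"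
          by (rule continuous_on_compose2[OF continuous_act]) (auto intro!: continuous_intros)
        then show ?thesis by simp
      qed
      then have "open (\<phi> g -` (- core x' (\<rho>' x')))" using core_closed[OF F(2)[OF x']] by (intro open_vimage) auto
      ultimately have "open (- core x (\<rho>' x) \<union> \<phi> g -` (- core x' (\<rho>' x')))" by (rule open_Un)
      then show ?thesis using False
        by (intro exI[of _ "- core x (\<rho>' x) \<union> \<phi> g -` (- core x' (\<rho>' x'))"] exI[of _ 1]) (auto simp: P_def)
    next
      case True
      let ?d = "chart_at AM x" and ?d' = "chart_at AM x'"
      have d: "?d \<in> AM" "y0 \<in> fst ?d" and d': "?d' \<in> AM" "\<phi> g y0 \<in> fst ?d'"
        using chart_at_props[OF atlas_M] True by (auto simp: core_def)
      note dh = smooth_atlas_chart[OF atlas_M d(1)]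
      obtain r where r: "r > 0" "\<And>p q. p \<in> cball (snd ?d y0) r \<Longrightarrow> q \<in> cball (snd ?d y0) r \<Longrightarrow>
        norm (snd ?d' (\<phi> g (chart_inv ?d p)) - snd ?d' (\<phi> g (chart_inv ?d q)) -
        in_chart AM ?d' (\<phi> g (chart_inv ?d q)) (T g (chart_inv ?d q) (from_chart AM ?d q (p - q)))) \<le> \<eta> * norm (p - q)"
        by (rule linearize_local[OF d d' \<eta>]) blast
      have "lin x x' y (r / 2)" if y: "snd ?d y \<in> ball (snd ?d y0) (r / 2)" for y
      proof -
        have "cball (snd ?d y) (r / 2) \<subseteq> cball (snd ?d y0) r"
          using y by (intro cball_subset_cball_iff[THEN iffD2]) (auto simp: dist_commute)
        then show ?thesis unfolding lin_def using r(2) by blast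
      qed
      moreover have "open (fst ?d \<inter> snd ?d -` ball (snd ?d y0) (r / 2))" by (rule continuous_open_preimage[OF dh(3,1)]) simp
      ultimately show ?thesis using r(1) d(2)
        by (intro exI[of _ "fst ?d \<inter> snd ?d -` ball (snd ?d y0) (r / 2)"] exI[of _ "2 / r"]) (auto simp: P_def)
    qed
    obtain C where "\<And>y. P x x' C y"
      by (rule compact_uniform_bound[where P="P x x'", OF compact_M mono loc]) blast+
    then show ?thesis by blast
  qed
  then obtain C where C: "\<And>x x' y. x \<in> F \<Longrightarrow> x' \<in> F \<Longrightarrow> P x x' (C x x') y" by metis
  define r where "r = Min (insert 1 ((\<lambda>(x, x'). 1 / C x x') ` (F \<times> F)))"
  have "r > 0" using F(1) C by (auto simp: r_def P_def)
  moreover have "r \<le> 1 / C x x'" if "x \<in> F" "x' \<in> F" for x x'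
    unfolding r_def using F(1) that by (intro Min_le) (auto intro!: image_eqI[of _ _ "(x, x')"])
  then have "lin x x' y r" if "x \<in> F" "x' \<in> F" "y \<in> core x (\<rho>' x)" "\<phi> g y \<in> core x' (\<rho>' x')" for x x' y
    using C[OF that(1,2), of y] that lin_mono[of x x' y "1 / C x x'" r] by (auto simp: P_def)
  ultimately show ?thesis using that[of r] unfolding lin_def by blast
qed

end

section \<open>Curves tangent to the stable bundle\<close>

context hyp_action
begin

text \<open>\<open>l\<close> bounds the speed over a parameter interval of length one, and thus also
  the length. Continuity of the velocity is not part of the notion, which keeps it stable under the
  tangent maps.\<close>

definition escurve where
  "escurve l y z \<longleftrightarrow> (\<exists>\<sigma>. \<sigma> 0 = y \<and> \<sigma> 1 = z \<and>
     (\<forall>t\<in>{0..1}. \<exists>v\<in>Es (\<sigma> t). has_velocity AM \<sigma> v t \<and> N (\<sigma> t) v \<le> l))"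

text \<open>Chains of \<open>k\<close> such curves are needed because a point of a plaque is reached
  by moving in \<open>k\<close> basis directions in turn.\<close>

primrec echain where
  "echain 0 l y z \<longleftrightarrow> y = z"
| "echain (Suc k) l y z \<longleftrightarrow> (\<exists>w. echain k l y w \<and> escurve l w z)"

lemma escurve_mono: "escurve l y z \<Longrightarrow> l \<le> l' \<Longrightarrow> escurve l' y z"
  unfolding escurve_def
  by (elim exE conjE) (intro exI conjI ballI, assumption, assumption, blast intro: order_trans)

lemma escurve_image:
  assumes "escurve l y z"
  shows "escurve (C * exp (- \<kappa> * real m) * l) (\<phi> (f [^] m) y) (\<phi> (f [^] m) z)"
proof -
  obtain \<sigma> where \<sigma>: "\<sigma> 0 = y" "\<sigma> 1 = z" "\<And>t. t \<in> {0..1} \<Longrightarrow> \<exists>v\<in>Es (\<sigma> t). has_velocity AM \<sigma> v t \<and> N (\<sigma> t) v \<le> l"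
    using assms unfolding escurve_def by blast
  have "\<exists>v\<in>Es (\<phi> (f [^] m) (\<sigma> t)). has_velocity AM (\<lambda>s. \<phi> (f [^] m) (\<sigma> s)) v t \<and>
      N (\<phi> (f [^] m) (\<sigma> t)) v \<le> C * exp (- \<kappa> * real m) * l" if t: "t \<in> {0..1}" for t
  proof -
    obtain v where v: "v \<in> Es (\<sigma> t)" "has_velocity AM \<sigma> v t" "N (\<sigma> t) v \<le> l" using \<sigma>(3)[OF t] by blast
    have "has_velocity AM (\<lambda>s. \<phi> (f [^] m) (\<sigma> s)) (T (f [^] m) (\<sigma> t) v) t"
      unfolding T_def by (rule has_velocity_map[OF atlas_M atlas_M v(2) tdiff_act])
    moreover have "N (\<phi> (f [^] m) (\<sigma> t)) (T (f [^] m) (\<sigma> t) v) \<le> C * exp (- \<kappa> * real m) * l"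
      by (rule order_trans[OF con_s[OF v(1)] mult_left_mono[OF v(3)]]) (use C in simp)
    ultimately show ?thesis using inv_s_pow[OF v(1)] by blast
  qed
  then show ?thesis unfolding escurve_def using \<sigma>(1,2) by (intro exI[of _ "\<lambda>s. \<phi> (f [^] m) (\<sigma> s)"]) auto
qed

lemma echain_image:
  "echain k l y z \<Longrightarrow> echain k (C * exp (- \<kappa> * real m) * l) (\<phi> (f [^] m) y) (\<phi> (f [^] m) z)"
proof (induction k arbitrary: z)
  case (Suc k)
  then obtain w where "echain k l y w" "escurve l w z" by auto
  from Suc.IH[OF this(1)] escurve_image[OF this(2)] show ?case by auto
qed simp

lemma escurve_sub:
  assumes \<sigma>: "\<And>t. t \<in> {0..1} \<Longrightarrow> \<exists>v\<in>Es (\<sigma> t). has_velocity AM \<sigma> v t \<and> N (\<sigma> t) v \<le> l"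
    and t: "s \<in> {0..1}" "t \<in> {0..1}"
  shows "escurve (\<bar>t - s\<bar> * l) (\<sigma> s) (\<sigma> t)"
  unfolding escurve_def
proof (intro exI conjI ballI)
  fix r :: real assume r: "r \<in> {0..1}"
  define h where "h = (\<lambda>r. s + r * (t - s))"
  have "h r = (1 - r) * s + r * t" by (simp add: h_def algebra_simps)
  moreover have "0 \<le> (1 - r) * s + r * t" "(1 - r) * s + r * t \<le> 1"
    using r t convex_bound_le[of s 1 t "1 - r" r] by auto
  ultimately have "h r \<in> {0..1}" by auto
  then obtain v where v: "v \<in> Es (\<sigma> (h r))" "has_velocity AM \<sigma> v (h r)" "N (\<sigma> (h r)) v \<le> l" using \<sigma> by blast
  have "has_velocity AM (\<lambda>r. \<sigma> (h r)) ((t - s) *\<^sub>R v) r"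
    by (rule has_velocity_reparam[where h=h and \<sigma>=\<sigma> and t=r, OF atlas_M v(2)])
      (auto simp: h_def intro!: derivative_eq_intros)
  moreover have "(t - s) *\<^sub>R v \<in> Es (\<sigma> (h r))" using v(1) sub_s by (rule_tac subspace_scale)
  moreover have "N (\<sigma> (h r)) ((t - s) *\<^sub>R v) \<le> \<bar>t - s\<bar> * l" unfolding N_scale using v(3) by (intro mult_left_mono) auto
  ultimately show "\<exists>v\<in>Es (\<sigma> (s + r * (t - s))). has_velocity AM (\<lambda>r. \<sigma> (s + r * (t - s))) v r \<and> N (\<sigma> (s + r * (t - s))) v \<le> \<bar>t - s\<bar> * l"
    unfolding h_def by blast
qed auto

text \<open>First exit argument: as long as the curve stays in the chart ball \<open>B\<close>, the
  mean value inequality keeps it in the smaller compact set \<open>K\<close>; at a first exit time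
  it would still be in the closed set \<open>K\<close>, which lies in the open set
  \<open>B\<close>.\<close>

lemma escurve_displacement:
  assumes c: "c \<in> AM" and sub: "cball p0 s \<subseteq> snd c ` fst c"
    and A: "A \<ge> 1" "\<And>p v. p \<in> cball p0 s \<Longrightarrow> norm v \<le> A * Nch c p v"
    and y: "y \<in> fst c" "norm (snd c y - p0) + A * l < s" and e: "escurve l y z"
  shows "z \<in> fst c \<and> norm (snd c z - snd c y) \<le> A * l"
proof -
  note dh = smooth_atlas_chart[OF atlas_M c]
  obtain \<sigma> where \<sigma>: "\<sigma> 0 = y" "\<sigma> 1 = z" "\<And>t. t \<in> {0..1} \<Longrightarrow> \<exists>v\<in>Es (\<sigma> t). has_velocity AM \<sigma> v t \<and> N (\<sigma> t) v \<le> l"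
    using e unfolding escurve_def by blast
  have ic: "isCont \<sigma> t" if "t \<in> {0..1}" for t using \<sigma>(3)[OF that] by (auto simp: has_velocity_def tdiff_def)
  then have cont: "continuous_on {0..1} \<sigma>" by (simp add: continuous_at_imp_continuous_on)
  have l0: "l \<ge> 0"
  proof -
    obtain v where "N (\<sigma> 0) v \<le> l" using \<sigma>(3)[of 0] by auto
    then show ?thesis using order_trans[OF N_nonneg] by blast
  qed
  define B where "B = fst c \<inter> snd c -` ball p0 s"
  have Bo: "open B" unfolding B_def by (rule continuous_open_preimage[OF dh(3,1)]) simp
  define K where "K = chart_inv c ` cball (snd c y) (A * l)"
  have in_s: "cball (snd c y) (A * l) \<subseteq> ball p0 s"
  proof
    fix p assume "p \<in> cball (snd c y) (A * l)"
    moreover have "dist p0 (snd c y) + A * l < s" using y(2) by (simp add: dist_norm norm_minus_commute)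
    ultimately show "p \<in> ball p0 s" using dist_triangle[of p0 p "snd c y"] by simp
  qed
  have Ksub: "cball (snd c y) (A * l) \<subseteq> snd c ` fst c"
    by (rule subset_trans[OF in_s subset_trans[OF ball_subset_cball sub]])
  have Kc: "closed K" unfolding K_def
    by (rule compact_imp_closed[OF compact_continuous_image[OF continuous_on_subset[OF dh(4) Ksub] compact_cball]])
  have KB: "K \<subseteq> B"
  proof
    fix x assume "x \<in> K"
    then obtain p where p: "p \<in> cball (snd c y) (A * l)" "x = chart_inv c p" by (auto simp: K_def)
    then have "p \<in> snd c ` fst c" "p \<in> ball p0 s" using Ksub in_s by auto
    then show "x \<in> B" using p dh by (simp add: B_def)
  qed
  have yK: "y \<in> K" unfolding K_def using dh(5)[OF y(1)] A l0 by (intro image_eqI[of _ _ "snd c y"]) auto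
  have step: "\<sigma> t \<in> K" if t: "t \<in> {0..1}" and B: "\<And>r. r \<in> {0..t} \<Longrightarrow> \<sigma> r \<in> B" for t
  proof -
    have der: "\<exists>v. ((\<lambda>r. snd c (\<sigma> r)) has_vector_derivative v) (at r) \<and> norm v \<le> A * l" if r: "r \<in> {0..t}" for r
    proof -
      have r1: "r \<in> {0..1}" using r t by auto
      obtain v where v: "has_velocity AM \<sigma> v r" "N (\<sigma> r) v \<le> l" using \<sigma>(3)[OF r1] by blast
      have rB: "\<sigma> r \<in> fst c" "snd c (\<sigma> r) \<in> cball p0 s" using B[OF r] by (auto simp: B_def)
      have "norm (in_chart AM c (\<sigma> r) v) \<le> A * Nch c (snd c (\<sigma> r)) (in_chart AM c (\<sigma> r) v)" by (rule A(2)[OF rB(2)])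
      also have "Nch c (snd c (\<sigma> r)) (in_chart AM c (\<sigma> r) v) = N (\<sigma> r) v"
        by (simp add: Nch_def dh(5)[OF rB(1)] from_chart_in_chart[OF atlas_M c rB(1)])
      also have "A * N (\<sigma> r) v \<le> A * l" by (rule mult_left_mono[OF v(2)]) (use A(1) in simp)
      finally have "norm (in_chart AM c (\<sigma> r) v) \<le> A * l" .
      then show ?thesis using has_velocity_chart[OF atlas_M c, of \<sigma> r v] rB(1) v(1) by blast
    qed
    then obtain v where v: "\<And>r. r \<in> {0..t} \<Longrightarrow> ((\<lambda>r. snd c (\<sigma> r)) has_vector_derivative v r) (at r)" "\<And>r. r \<in> {0..t} \<Longrightarrow> norm (v r) \<le> A * l" by metis
    have "norm (snd c (\<sigma> t) - snd c (\<sigma> 0)) \<le> A * l * norm (t - 0)"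
    proof (rule differentiable_bound[of "{0..t}" "\<lambda>r. snd c (\<sigma> r)" "\<lambda>r h. h *\<^sub>R v r"])
      fix r assume r: "r \<in> {0..t}"
      show "((\<lambda>r. snd c (\<sigma> r)) has_derivative (\<lambda>h. h *\<^sub>R v r)) (at r within {0..t})"
        using v(1)[OF r] unfolding has_vector_derivative_def by (rule has_derivative_at_withinI)
      show "onorm (\<lambda>h. h *\<^sub>R v r) \<le> A * l"
        by (rule onorm_le) (use mult_right_mono[OF v(2)[OF r]] in \<open>simp add: mult.commute\<close>)
    qed (use t in auto)
    also have "\<dots> \<le> A * l * 1" using t A l0 by (intro mult_left_mono) auto
    finally have "snd c (\<sigma> t) \<in> cball (snd c y) (A * l)" by (simp add: \<sigma>(1) dist_norm norm_minus_commute)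
    moreover have "\<sigma> t \<in> fst c" using B[of t] t by (auto simp: B_def)
    ultimately show ?thesis unfolding K_def by (intro image_eqI[of _ _ "snd c (\<sigma> t)"]) (simp_all add: dh(5))
  qed
  have allB: "\<sigma> t \<in> B" if t: "t \<in> {0..1}" for t
  proof (rule ccontr)
    assume nB: "\<sigma> t \<notin> B"
    define Z where "Z = {0..1} \<inter> \<sigma> -` (- B)"
    have "closed Z" unfolding Z_def using Bo by (intro continuous_closed_preimage[OF cont]) auto
    then have "compact Z" unfolding Z_def by (simp add: compact_eq_bounded_closed bounded_Int)
    moreover have "Z \<noteq> {}" using t nB by (auto simp: Z_def)
    ultimately obtain t1 where t1: "t1 \<in> Z" "\<And>t. t \<in> Z \<Longrightarrow> t1 \<le> t" using compact_attains_inf[of Z] by blast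
    have t1': "t1 \<in> {0..1}" "\<sigma> t1 \<notin> B" using t1(1) by (auto simp: Z_def)
    have before: "\<sigma> r \<in> B" if "r \<in> {0..<t1}" for r
    proof (rule ccontr)
      assume "\<sigma> r \<notin> B"
      then have "r \<in> Z" using that t1' by (auto simp: Z_def)
      from t1(2)[OF this] show False using that by simp
    qed
    have inK: "\<sigma> r \<in> K" if r: "r \<in> {0..<t1}" for r
      by (rule step) (use r t1' before in auto)
    have "t1 \<noteq> 0" using t1'(2) yK KB \<sigma>(1) by auto
    then have lp: "t1 islimpt {0..<t1}" using t1'(1) by (simp add: islimpt_Ico)
    have "closed ({0..1} \<inter> \<sigma> -` K)" by (intro continuous_closed_preimage[OF cont] Kc) simp
    moreover have "{0..<t1} \<subseteq> {0..1} \<inter> \<sigma> -` K" using inK t1' by auto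
    ultimately have "t1 \<in> {0..1} \<inter> \<sigma> -` K" using lp unfolding closed_limpt by (metis islimpt_subset)
    then show False using KB t1'(2) by auto
  qed
  have "z \<in> K" using step[of 1] allB \<sigma>(2) by simp
  then obtain p where p: "p \<in> cball (snd c y) (A * l)" "z = chart_inv c p" by (auto simp: K_def)
  then have "snd c z = p" "z \<in> fst c" using dh(6,7)[of p] Ksub by auto
  then show ?thesis using p(1) by (simp add: dist_norm norm_minus_commute)
qed

lemma echain_displacement:
  assumes c: "c \<in> AM" and sub: "cball p0 s \<subseteq> snd c ` fst c"
    and A: "A \<ge> 1" "\<And>p v. p \<in> cball p0 s \<Longrightarrow> norm v \<le> A * Nch c p v"
    and y: "y \<in> fst c" and l: "l \<ge> 0"
  shows "norm (snd c y - p0) + real k * (A * l) < s \<Longrightarrow> echain k l y z \<Longrightarrow>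
    z \<in> fst c \<and> norm (snd c z - snd c y) \<le> real k * (A * l)"
proof (induction k arbitrary: z)
  case 0
  then show ?case using y by simp
next
  case (Suc k)
  have Al: "0 \<le> A * l" using A(1) l by simp
  obtain w where w: "echain k l y w" "escurve l w z" using Suc.prems(2) by auto
  have "norm (snd c y - p0) + real k * (A * l) < s" using Suc.prems(1) Al by (simp add: distrib_right)
  from Suc.IH[OF this w(1)] have 1: "w \<in> fst c" "norm (snd c w - snd c y) \<le> real k * (A * l)" by auto
  have "norm (snd c w - p0) + A * l < s"
    using 1(2) Suc.prems(1) norm_triangle_ineq[of "snd c w - snd c y" "snd c y - p0"] by (simp add: distrib_right)
  from escurve_displacement[OF c sub A 1(1) this w(2)]
  show ?case using 1(2) norm_triangle_ineq[of "snd c z - snd c w" "snd c w - snd c y"] by (auto simp: distrib_right)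
qed

text \<open>The cone of aperture \<open>M\<close> around the centre-unstable directions; both
  components are arguments so that the size of \<open>q\<close> can be followed under
  iteration.\<close>

definition cone where
  "cone M w v u q \<longleftrightarrow> u \<in> Es w \<and> (\<exists>b. \<exists>z\<in>Eu w. q = X w b + z) \<and> v = u + q \<and> N w u \<le> M * N w q"

text \<open>Under \<open>f^m\<close> a displacement in the cone stays in the cone and its centre-unstable part shrinks
  at a slower rate than curves tangent to \<open>Es\<close>; iterating this contradicts a nonzero displacement
  between the end points of two such curves.\<close>
lemma escurve_cone_trivial:
  assumes F: "finite F" "\<And>x. x \<in> F \<Longrightarrow> ball_in x (\<rho>' x + r0)" "\<And>y. \<exists>x\<in>F. y \<in> core x (\<rho>' x)" and r0: "r0 > 0"
    and A: "A \<ge> 1" "\<And>x p v. x \<in> F \<Longrightarrow> p \<in> cball (snd (chart_at AM x) x) (\<rho>' x + r0) \<Longrightarrow>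
      Nch (chart_at AM x) p v \<le> A * norm v \<and> norm v \<le> A * Nch (chart_at AM x) p v"
    and M: "M \<ge> 1"
  shows "\<exists>\<epsilon>>0. \<forall>x\<in>F. \<forall>y\<in>core x (\<rho>' x). \<forall>w z u q. echain k \<epsilon> y w \<longrightarrow> escurve \<epsilon> y z \<longrightarrow>
    cone M w (from_chart AM (chart_at AM x) (snd (chart_at AM x) w) (snd (chart_at AM x) z - snd (chart_at AM x) w)) u q \<longrightarrow> q = 0"
proof -
  obtain D where D: "D \<ge> 1" "\<And>x b z n. z \<in> Eu x \<Longrightarrow>
      N x (X x b + z) \<le> D * (1 + real n) ^ d * N (\<phi> (f [^] n) x) (T (f [^] n) x (X x b + z))"
    using cu_growth by blast
  obtain B where B: "B \<ge> 1" "\<And>x b u z. u \<in> Es x \<Longrightarrow> z \<in> Eu x \<Longrightarrow>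
      N x u \<le> B * N x (u + (X x b + z)) \<and> N x (X x b + z) \<le> B * N x (u + (X x b + z))"
    using projection_bound by blast
  obtain m where m: "m \<ge> 1" "(4 * C * D) * (1 + real m) ^ d * exp (- \<kappa> * real m) < 1"
    using poly_exp_small[OF \<kappa>, of 1 "4 * C * D" d] by auto
  \<comment> \<open>Under \<open>f^m\<close>, centre-unstable vectors shrink at most by the factor
    \<alpha> and stable ones at least by \<beta>; \<open>m\<close> was chosen to give
    \<open>4 \<beta> \<le> \<alpha>\<close>.\<close>
  define \<alpha> where "\<alpha> = 1 / (D * (1 + real m) ^ d)"
  define \<beta> where "\<beta> = C * exp (- \<kappa> * real m)"
  have DP: "D * (1 + real m) ^ d \<ge> 1" using mult_mono[OF D(1), of 1 "(1 + real m) ^ d"] D(1) by simp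
  have \<alpha>: "\<alpha> > 0" "\<alpha> \<le> 1" using DP by (auto simp: \<alpha>_def)
  have \<beta>: "\<beta> > 0" "4 * \<beta> \<le> \<alpha>"
  proof -
    show "\<beta> > 0" using C by (simp add: \<beta>_def)
    have "(4 * \<beta>) * (D * (1 + real m) ^ d) \<le> 1" using m(2) by (simp add: \<beta>_def mult_ac)
    then show "4 * \<beta> \<le> \<alpha>" using DP by (simp add: \<alpha>_def pos_le_divide_eq)
  qed
  \<comment> \<open>The linearization error is weakened twice by the chart comparison
    \<open>A\<close>, by \<open>1 + M\<close> when the displacement is bounded by \<open>q\<close>,
    and by \<open>B\<close> when it is split; with this \<eta> each component is at most
    \<open>\<alpha> / 4\<close> times the norm of \<open>q\<close>.\<close>
  define \<eta> where "\<eta> = \<alpha> / (4 * B * A\<^sup>2 * (1 + M))"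
  have den: "4 * B * A\<^sup>2 * (1 + M) > 0" using B(1) A(1) M by simp
  have \<eta>: "\<eta> > 0" "B * A\<^sup>2 * \<eta> * (1 + M) = \<alpha> / 4"
    using \<alpha>(1) den by (auto simp: \<eta>_def field_simps)
  have ball_in': "ball_in x (\<rho>' x)" if "x \<in> F" for x
    using F(2)[OF that] r0 subset_cball[of "\<rho>' x" "\<rho>' x + r0"] unfolding ball_in_def by (meson le_add_same_cancel1 less_imp_le subset_trans)
  define g where "g = f [^] m"
  obtain r1 where r1: "r1 > 0"
    "\<And>x x' y p q. x \<in> F \<Longrightarrow> x' \<in> F \<Longrightarrow> y \<in> core x (\<rho>' x) \<Longrightarrow> \<phi> g y \<in> core x' (\<rho>' x') \<Longrightarrow>
      p \<in> cball (snd (chart_at AM x) y) r1 \<Longrightarrow> q \<in> cball (snd (chart_at AM x) y) r1 \<Longrightarrow>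
      norm (snd (chart_at AM x') (\<phi> g (chart_inv (chart_at AM x) p)) - snd (chart_at AM x') (\<phi> g (chart_inv (chart_at AM x) q)) -
        in_chart AM (chart_at AM x') (\<phi> g (chart_inv (chart_at AM x) q)) (T g (chart_inv (chart_at AM x) q) (from_chart AM (chart_at AM x) q (p - q))))
      \<le> \<eta> * norm (p - q)"
    by (rule uniform_linearization[where F=F and \<rho>'=\<rho>' and \<eta>=\<eta> and g=g, OF F(1) ball_in' \<eta>(1)]) blast+
  define \<mu> where "\<mu> = min r0 r1"
  have \<mu>: "\<mu> > 0" "\<mu> \<le> r0" "\<mu> \<le> r1" using r0 r1(1) by (auto simp: \<mu>_def)
  \<comment> \<open>The chain and the further curve displace by at most
    \<open>(k + 1) A \<epsilon> = \<mu> / 2\<close> in total, which is within the chart margin and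
    the radius of linearization.\<close>
  define \<epsilon> where "\<epsilon> = \<mu> / (2 * ((real k + 1) * A))"
  have kA: "(real k + 1) * A > 0" using A(1) by (intro mult_pos_pos) auto
  have \<epsilon>: "\<epsilon> > 0" using \<mu>(1) kA by (simp add: \<epsilon>_def)
  have "a * (\<mu> / (2 * a)) = \<mu> / 2" if "a > 0" for a :: real using that by simp
  from this[OF kA] have "((real k + 1) * A) * \<epsilon> = \<mu> / 2" unfolding \<epsilon>_def .
  then have \<epsilon>2: "(real k + 1) * (A * \<epsilon>) = \<mu> / 2" by (simp only: mult.assoc)
  have disp: "w \<in> fst (chart_at AM x) \<and> z \<in> fst (chart_at AM x) \<and>
      norm (snd (chart_at AM x) w - snd (chart_at AM x) y) \<le> real k * (A * l) \<and>
      norm (snd (chart_at AM x) z - snd (chart_at AM x) y) \<le> A * l \<and>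
      snd (chart_at AM x) w \<in> cball (snd (chart_at AM x) x) (\<rho>' x + r0) \<and>
      snd (chart_at AM x) w \<in> cball (snd (chart_at AM x) y) r1 \<and> snd (chart_at AM x) z \<in> cball (snd (chart_at AM x) y) r1"
    if x: "x \<in> F" and y: "y \<in> core x (\<rho>' x)" and e: "echain k l y w" "escurve l y z" and l: "0 \<le> l" "l \<le> \<epsilon>" for x y w z l
  proof -
    let ?c = "chart_at AM x"
    have c: "?c \<in> AM" using chart_at_props[OF atlas_M] by blast
    have sub: "cball (snd ?c x) (\<rho>' x + r0) \<subseteq> snd ?c ` fst ?c" using F(2)[OF x] by (simp add: ball_in_def)
    have yc: "y \<in> fst ?c" "norm (snd ?c y - snd ?c x) \<le> \<rho>' x" using y by (auto simp: core_def dist_norm norm_minus_commute)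
    have Al: "0 \<le> A * l" "A * l \<le> A * \<epsilon>" using A(1) l by (auto intro: mult_left_mono)
    have "(real k + 1) * (A * l) \<le> (real k + 1) * (A * \<epsilon>)" by (rule mult_left_mono[OF Al(2)]) simp
    then have kl: "real k * (A * l) + A * l \<le> \<mu> / 2" unfolding \<epsilon>2 by (simp only: distrib_right mult_1)
    have kl': "0 \<le> real k * (A * l)" using Al by simp
    have b: "\<And>p v. p \<in> cball (snd ?c x) (\<rho>' x + r0) \<Longrightarrow> norm v \<le> A * Nch ?c p v" using A(2)[OF x] by blast
    have 1: "w \<in> fst ?c \<and> norm (snd ?c w - snd ?c y) \<le> real k * (A * l)"
      by (rule echain_displacement[OF c sub A(1) b yc(1) l(1) _ e(1)]) (use yc kl kl' Al \<mu> in linarith)+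
    have 2: "z \<in> fst ?c \<and> norm (snd ?c z - snd ?c y) \<le> A * l"
      by (rule escurve_displacement[OF c sub A(1) b yc(1) _ e(2)]) (use yc kl kl' Al \<mu> in linarith)+
    have "norm (snd ?c w - snd ?c x) \<le> \<rho>' x + r0"
    proof -
      have "norm (snd ?c w - snd ?c x) \<le> norm (snd ?c w - snd ?c y) + norm (snd ?c y - snd ?c x)"
        using norm_triangle_ineq[of "snd ?c w - snd ?c y" "snd ?c y - snd ?c x"] by simp
      then show ?thesis using 1 yc(2) kl kl' Al \<mu> by linarith
    qed
    moreover have "norm (snd ?c w - snd ?c y) \<le> r1" "norm (snd ?c z - snd ?c y) \<le> r1"
      using 1 2 kl kl' Al \<mu> by linarith+
    ultimately show ?thesis using 1 2 by (simp add: dist_norm norm_minus_commute)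
  qed
  \<comment> \<open>One step applies \<open>f^m\<close> to all points, passes to a chart whose core
    contains the image of \<open>y\<close>, and replaces \<open>l\<close> by
    \<open>\<beta> l\<close>, while \<open>q\<close> keeps at least \<open>\<alpha> / 2\<close> of
    its size. Hence the statement is generalized over the chart, the points and
    \<open>l\<close>.\<close>
  have iter: "N w q \<le> (2 * \<beta> / \<alpha>) ^ n * (B * A * ((real k + 1) * (A * l)))"
    if "x \<in> F" "y \<in> core x (\<rho>' x)" "echain k l y w" "escurve l y z" "0 \<le> l" "l \<le> \<epsilon>"
      "cone M w (from_chart AM (chart_at AM x) (snd (chart_at AM x) w) (snd (chart_at AM x) z - snd (chart_at AM x) w)) u q"
    for n x y w z l u q
    using that
  proof (induction n arbitrary: x y w z l u q)
    case (0 x y w z l u q)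
    let ?c = "chart_at AM x"
    note dp = disp[OF "0.prems"(1-6)]
    define v where "v = snd ?c z - snd ?c w"
    obtain b \<zeta> where q: "\<zeta> \<in> Eu w" "q = X w b + \<zeta>" "u \<in> Es w" "from_chart AM ?c (snd ?c w) v = u + q"
      using "0.prems"(7) by (auto simp: cone_def v_def)
    have c: "?c \<in> AM" using chart_at_props[OF atlas_M] by blast
    have "N w q \<le> B * N w (from_chart AM ?c (snd ?c w) v)" using B(2)[OF q(3,1), of b] q by simp
    also have "N w (from_chart AM ?c (snd ?c w) v) = Nch ?c (snd ?c w) v"
      using dp smooth_atlas_chart(5)[OF atlas_M c] by (simp add: Nch_def)
    also have "B * Nch ?c (snd ?c w) v \<le> B * (A * norm v)"
      using A(2)[OF "0.prems"(1), of "snd ?c w" v] dp B(1) by (intro mult_left_mono) auto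
    also have "\<dots> \<le> B * (A * ((real k + 1) * (A * l)))"
    proof (intro mult_left_mono)
      have "norm v \<le> norm (snd ?c z - snd ?c y) + norm (snd ?c w - snd ?c y)"
        using norm_triangle_ineq4[of "snd ?c z - snd ?c y" "snd ?c w - snd ?c y"] by (simp add: v_def)
      then show "norm v \<le> (real k + 1) * (A * l)" using dp by (simp add: distrib_right)
    qed (use B(1) A(1) in auto)
    finally show ?case by (simp add: mult.assoc)
  next
    case (Suc n x y w z l u q)
    let ?c = "chart_at AM x"
    note dp = disp[OF Suc.prems(1-6)]
    obtain x' where x': "x' \<in> F" "\<phi> g y \<in> core x' (\<rho>' x')" using F(3) by blast
    let ?c' = "chart_at AM x'"
    have c: "?c \<in> AM" "?c' \<in> AM" using chart_at_props[OF atlas_M] by auto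
    note ch = smooth_atlas_chart[OF atlas_M c(1)] and ch' = smooth_atlas_chart[OF atlas_M c(2)]
    define l' where "l' = \<beta> * l"
    have e': "echain k l' (\<phi> g y) (\<phi> g w)" "escurve l' (\<phi> g y) (\<phi> g z)"
      using echain_image[OF Suc.prems(3), of m] escurve_image[OF Suc.prems(4), of m] by (auto simp: l'_def \<beta>_def g_def)
    have "\<beta> \<le> 1" using \<beta> \<alpha> by linarith
    then have l': "0 \<le> l'" "l' \<le> \<epsilon>"
      using \<beta>(1) Suc.prems(5,6) mult_right_mono[of \<beta> 1 l] by (auto simp: l'_def)
    note dp' = disp[OF x' e' l']
    \<comment> \<open>\<open>tv\<close> and \<open>tv'\<close> are the tangent vectors at
      \<open>w\<close> and at its image that represent the chart displacements; \<open>err\<close>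
      is the deviation of the displacement from its linearization.\<close>
    define v where "v = snd ?c z - snd ?c w"
    define tv where "tv = from_chart AM ?c (snd ?c w) v"
    define v' where "v' = snd ?c' (\<phi> g z) - snd ?c' (\<phi> g w)"
    define tv' where "tv' = from_chart AM ?c' (snd ?c' (\<phi> g w)) v'"
    define err where "err = tv' - T g w tv"
    have w: "w \<in> fst ?c" "z \<in> fst ?c" and w': "\<phi> g w \<in> fst ?c'" using dp dp' by auto
    have iw: "chart_inv ?c (snd ?c w) = w" "chart_inv ?c (snd ?c z) = z" using ch(5) w by auto
    have iw': "chart_inv ?c' (snd ?c' (\<phi> g w)) = \<phi> g w" using ch'(5) w' by auto
    obtain b \<zeta> where q: "\<zeta> \<in> Eu w" "q = X w b + \<zeta>" "u \<in> Es w" "tv = u + q" "N w u \<le> M * N w q"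
      using Suc.prems(7) by (auto simp: cone_def v_def tv_def)
    have Nv: "norm v \<le> A * N w tv"
      using A(2)[OF Suc.prems(1), of "snd ?c w" v] dp by (simp add: Nch_def tv_def iw)
    have "N w tv \<le> N w u + N w q" unfolding q(4) by (rule N_triangle)
    also have "\<dots> \<le> (1 + M) * N w q" using q(5) by (simp add: distrib_right)
    finally have Ntv: "N w tv \<le> (1 + M) * N w q" .
    have Nerr: "N (\<phi> g w) err \<le> A * (\<eta> * (A * ((1 + M) * N w q)))"
    proof -
      define ev where "ev = v' - in_chart AM ?c' (\<phi> g w) (T g w tv)"
      have "norm ev \<le> \<eta> * norm v"
        using r1(2)[OF Suc.prems(1) x'(1) Suc.prems(2) x'(2), of "snd ?c z" "snd ?c w"] dp
        by (simp add: iw ev_def v'_def tv_def v_def)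
      also have "\<dots> \<le> \<eta> * (A * ((1 + M) * N w q))"
      proof (rule mult_left_mono)
        have "A * N w tv \<le> A * ((1 + M) * N w q)" by (rule mult_left_mono[OF Ntv]) (use A(1) in simp)
        then show "norm v \<le> A * ((1 + M) * N w q)" using Nv by linarith
      qed (use \<eta>(1) in simp)
      finally have 1: "norm ev \<le> \<eta> * (A * ((1 + M) * N w q))" .
      have wi: "snd ?c' (\<phi> g w) \<in> snd ?c' ` fst ?c'" using w' by simp
      have "err = from_chart AM ?c' (snd ?c' (\<phi> g w)) ev"
        by (simp add: ev_def err_def tv'_def linear_diff[OF linear_from_chart[OF atlas_M c(2) wi]] from_chart_in_chart[OF atlas_M c(2) w'])
      then have "N (\<phi> g w) err = Nch ?c' (snd ?c' (\<phi> g w)) ev" by (simp add: Nch_def iw')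
      also have "\<dots> \<le> A * norm ev" using A(2)[OF x'(1), of "snd ?c' (\<phi> g w)" ev] dp' by simp
      also have "\<dots> \<le> A * (\<eta> * (A * ((1 + M) * N w q)))" using A(1) by (intro mult_left_mono 1) simp
      finally show ?thesis .
    qed
    obtain ue be \<zeta>e where er: "ue \<in> Es (\<phi> g w)" "\<zeta>e \<in> Eu (\<phi> g w)" "err = ue + (X (\<phi> g w) be + \<zeta>e)" using decomp by blast
    define qe where "qe = X (\<phi> g w) be + \<zeta>e"
    have B4: "B * (A * (\<eta> * (A * ((1 + M) * N w q)))) = \<alpha> / 4 * N w q"
      using \<eta>(2) by (simp add: power2_eq_square mult_ac)
    have ue: "N (\<phi> g w) ue \<le> \<alpha> / 4 * N w q" and qe: "N (\<phi> g w) qe \<le> \<alpha> / 4 * N w q"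
    proof -
      have "B * N (\<phi> g w) err \<le> \<alpha> / 4 * N w q" using mult_left_mono[OF Nerr, of B] B(1) B4 by simp
      moreover have "N (\<phi> g w) ue \<le> B * N (\<phi> g w) err" "N (\<phi> g w) qe \<le> B * N (\<phi> g w) err"
        using B(2)[OF er(1,2), of be] er(3) by (auto simp: qe_def)
      ultimately show "N (\<phi> g w) ue \<le> \<alpha> / 4 * N w q" "N (\<phi> g w) qe \<le> \<alpha> / 4 * N w q" by linarith+
    qed
    define u' where "u' = T g w u + ue"
    define q' where "q' = T g w q + qe"
    have tv': "tv' = u' + q'" using er(3) by (simp add: err_def u'_def q'_def qe_def q(4) T_simps algebra_simps)
    have uE: "u' \<in> Es (\<phi> g w)" unfolding u'_def using inv_s_pow[OF q(3), of m] er(1) by (intro subspace_add[OF sub_s]) (simp_all add: g_def)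
    have zE: "T g w \<zeta> + \<zeta>e \<in> Eu (\<phi> g w)" using inv_u_pow[OF q(1), of m] er(2) by (intro subspace_add[OF sub_u]) (simp_all add: g_def)
    have qE: "q' = X (\<phi> g w) (Ad g b + be) + (T g w \<zeta> + \<zeta>e)"
      by (simp add: q'_def qe_def q(2) T_simps T_X linear_add[OF X_linear])
    have Tq: "\<alpha> * N w q \<le> N (\<phi> g w) (T g w q)"
      using D(2)[OF q(1), of b m] DP by (simp add: q(2) g_def \<alpha>_def pos_divide_le_eq mult.commute)
    have Nq': "\<alpha> / 2 * N w q \<le> N (\<phi> g w) q'"
    proof -
      have "\<alpha> / 2 * N w q \<le> \<alpha> * N w q - \<alpha> / 4 * N w q" using \<alpha>(1) by (simp add: algebra_simps)
      also have "\<dots> \<le> N (\<phi> g w) (T g w q) - N (\<phi> g w) qe" using Tq qe by linarith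
      also have "\<dots> \<le> N (\<phi> g w) q'" unfolding q'_def by (rule N_triangle_sub)
      finally show ?thesis .
    qed
    \<comment> \<open>The stable part contributes at most \<open>\<alpha> / 4\<close> times
      \<open>M\<close> and the error at most \<open>\<alpha> / 4\<close>; as
      \<open>M \<ge> 1\<close>, together they do not exceed \<open>M\<close> times the lower bound
      \<open>\<alpha> / 2\<close> for \<open>q'\<close>, so the cone is preserved.\<close>
    have Nu': "N (\<phi> g w) u' \<le> M * N (\<phi> g w) q'"
    proof -
      have "N (\<phi> g w) (T g w u) \<le> \<beta> * N w u" using con_s[OF q(3), of m] by (simp add: g_def \<beta>_def)
      also have "\<dots> \<le> \<alpha> / 4 * (M * N w q)" using \<beta> q(5) by (intro mult_mono) auto
      finally have 1: "N (\<phi> g w) u' \<le> \<alpha> / 4 * (M * N w q) + \<alpha> / 4 * N w q"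
        using ue N_triangle[of "\<phi> g w" "T g w u" ue] by (simp add: u'_def)
      have "\<alpha> / 4 * N w q \<le> \<alpha> / 4 * (M * N w q)" using \<alpha>(1) mult_right_mono[OF M, of "N w q"] by (intro mult_left_mono) auto
      moreover have "M * (\<alpha> / 2 * N w q) = 2 * (\<alpha> / 4 * (M * N w q))" by simp
      ultimately have "N (\<phi> g w) u' \<le> M * (\<alpha> / 2 * N w q)" using 1 by linarith
      also have "\<dots> \<le> M * N (\<phi> g w) q'" using M by (intro mult_left_mono Nq') simp
      finally show ?thesis .
    qed
    have "cone M (\<phi> g w) tv' u' q'" unfolding cone_def using uE zE qE tv' Nu' by blast
    from Suc.IH[OF x' e' l' this[unfolded tv'_def v'_def]]
    have "N (\<phi> g w) q' \<le> (2 * \<beta> / \<alpha>) ^ n * (B * A * ((real k + 1) * (A * l')))" .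
    then have "\<alpha> / 2 * N w q \<le> (2 * \<beta> / \<alpha>) ^ n * (B * A * ((real k + 1) * (A * (\<beta> * l))))"
      using Nq' by (simp add: l'_def)
    then have "N w q \<le> 2 / \<alpha> * ((2 * \<beta> / \<alpha>) ^ n * (B * A * ((real k + 1) * (A * (\<beta> * l)))))"
      using \<alpha>(1) by (simp add: field_simps)
    also have "\<dots> = (2 * \<beta> / \<alpha>) ^ Suc n * (B * A * ((real k + 1) * (A * l)))" by (simp add: mult_ac)
    finally show ?case .
  qed
  \<comment> \<open>The ratio is at most 1/2, so letting the number of iterates grow forces
    \<open>q\<close> to vanish.\<close>
  have half: "0 \<le> 2 * \<beta> / \<alpha>" "2 * \<beta> / \<alpha> < 1" using \<alpha> \<beta> by (auto simp: field_simps)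
  have "q = 0" if h: "x \<in> F" "y \<in> core x (\<rho>' x)" "echain k \<epsilon> y w" "escurve \<epsilon> y z"
    "cone M w (from_chart AM (chart_at AM x) (snd (chart_at AM x) w) (snd (chart_at AM x) z - snd (chart_at AM x) w)) u q"
    for x y w z u q
  proof -
    define c where "c = B * A * ((real k + 1) * (A * \<epsilon>))"
    have "(\<lambda>n. (2 * \<beta> / \<alpha>) ^ n * c) \<longlonglongrightarrow> 0 * c"
      by (intro tendsto_mult tendsto_const LIMSEQ_realpow_zero half)
    moreover have "N w q \<le> (2 * \<beta> / \<alpha>) ^ n * c" for n
      unfolding c_def using iter[OF h(1-4) _ order_refl h(5)] \<epsilon> by simp
    ultimately have "N w q \<le> 0 * c" by (intro LIMSEQ_le_const) blast+
    then show ?thesis using N_pos[of q w] by (cases "q = 0") auto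
  qed
  then show ?thesis using \<epsilon> by blast
qed

text \<open>\<open>Y\<close> is a continuous field for each fixed direction, but nothing uniform in
  the direction is given. Moving along finitely many basis directions, one after the other, needs
  only the bound \<open>M\<close> for these fields.\<close>

lemma plaque_chain:
  fixes \<theta> :: "'e \<Rightarrow> 'm" and xs :: "'e list"
  assumes th: "\<And>p. \<theta> p \<in> U" "\<And>p. \<psi> (\<theta> p) = p" "\<And>w. w \<in> U \<Longrightarrow> \<theta> (\<psi> w) = w" and P: "subspace P" and y: "y \<in> U"
    and vel: "\<And>w e \<tau>. w \<in> U \<Longrightarrow> e \<in> P \<Longrightarrow> has_velocity AM (\<lambda>t. \<theta> (\<psi> w + t *\<^sub>R e)) (Y e (\<theta> (\<psi> w + \<tau> *\<^sub>R e))) \<tau>"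
    and YE: "\<And>w e. w \<in> U \<Longrightarrow> e \<in> P \<Longrightarrow> Y e w \<in> Es w"
    and xs: "set xs \<subseteq> P" "\<And>b. b \<in> set xs \<Longrightarrow> norm b = 1"
    and M: "\<And>p b. p \<in> cball (\<psi> y) 1 \<Longrightarrow> b \<in> set xs \<Longrightarrow> N (\<theta> p) (Y b (\<theta> p)) \<le> M"
    and c: "\<And>i. i < length xs \<Longrightarrow> \<bar>c i\<bar> \<le> s" and s: "s \<ge> 0" "real (length xs) * s \<le> 1" "s * M \<le> l"
  shows "n \<le> length xs \<Longrightarrow> echain n l y (\<theta> (\<psi> y + (\<Sum>i<n. c i *\<^sub>R xs ! i)))"
proof (induction n)
  case 0
  then show ?case using th(3)[OF y] by simp
next
  case (Suc n)
  define p where "p = \<psi> y + (\<Sum>i<n. c i *\<^sub>R xs ! i)"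
  define b where "b = xs ! n"
  have b: "b \<in> set xs" "b \<in> P" "norm b = 1" using Suc.prems xs by (auto simp: b_def)
  have cn: "\<bar>c n\<bar> \<le> s" using c Suc.prems by simp
  have near: "p + t *\<^sub>R b \<in> cball (\<psi> y) 1" if t: "\<bar>t\<bar> \<le> s" for t
  proof -
    have "norm (\<Sum>i<n. c i *\<^sub>R xs ! i) \<le> (\<Sum>i<n. s)"
      using c xs(2) Suc.prems by (intro sum_norm_le) auto
    then have "norm ((\<Sum>i<n. c i *\<^sub>R xs ! i) + t *\<^sub>R b) \<le> real n * s + s"
      using norm_triangle_ineq[of "\<Sum>i<n. c i *\<^sub>R xs ! i" "t *\<^sub>R b"] t b(3) by simp
    also have "\<dots> \<le> real (length xs) * s" using Suc.prems mult_right_mono[of "real n + 1" "real (length xs)" s] s(1) by (simp add: distrib_right)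
    finally have "norm ((\<Sum>i<n. c i *\<^sub>R xs ! i) + t *\<^sub>R b) \<le> 1" using s(2) by linarith
    moreover have "dist (\<psi> y) (\<psi> y + v) = norm v" for v by (simp add: dist_norm)
    ultimately show ?thesis by (simp add: p_def add.assoc)
  qed
  have "escurve l (\<theta> p) (\<theta> (p + c n *\<^sub>R b))"
    unfolding escurve_def
  proof (intro exI[of _ "\<lambda>t. \<theta> (p + (c n * t) *\<^sub>R b)"] conjI ballI)
    fix t :: real assume t: "t \<in> {0..1}"
    define w where "w = \<theta> (p + (c n * t) *\<^sub>R b)"
    have ct: "\<bar>c n * t\<bar> \<le> s" using t cn by (simp add: abs_mult) (metis abs_ge_zero mult_left_le order_trans)
    have "has_velocity AM (\<lambda>t. \<theta> (p + t *\<^sub>R b)) (Y b w) (c n * t)" using vel[OF th(1)[of p] b(2), of "c n * t"] by (simp add: th(2) w_def)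
    then have "has_velocity AM (\<lambda>t. \<theta> (p + (c n * t) *\<^sub>R b)) (c n *\<^sub>R Y b w) t"
      by (rule has_velocity_reparam[where h="\<lambda>t. c n * t" and \<sigma>="\<lambda>t. \<theta> (p + t *\<^sub>R b)", OF atlas_M]) (auto intro!: derivative_eq_intros)
    moreover have "c n *\<^sub>R Y b w \<in> Es w" using YE[OF th(1) b(2)] by (intro subspace_scale[OF sub_s]) (simp add: w_def)
    moreover have "N w (c n *\<^sub>R Y b w) \<le> l"
    proof -
      have 1: "N w (Y b w) \<le> M" unfolding w_def by (rule M[OF near[OF ct] b(1)])
      have "\<bar>c n\<bar> * N w (Y b w) \<le> s * M" using cn 1 s(1) by (intro mult_mono) auto
      then show ?thesis using s(3) by (simp add: N_scale)
    qed
    ultimately show "\<exists>v\<in>Es (\<theta> (p + (c n * t) *\<^sub>R b)). has_velocity AM (\<lambda>t. \<theta> (p + (c n * t) *\<^sub>R b)) v t \<and> N (\<theta> (p + (c n * t) *\<^sub>R b)) v \<le> l"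
      unfolding w_def by blast
  qed auto
  moreover have "echain n l y (\<theta> p)" using Suc by (simp add: p_def)
  ultimately show ?case by (auto simp: p_def b_def add.assoc)
qed

end

context riem_action
begin

text \<open>Continuous vector fields are defined chart by chart, so the speed is examined near each
  point in one chart, through \<open>Nch_continuous\<close>.\<close>

lemma speed_continuous:
  fixes \<theta> :: "'e \<Rightarrow> 'm"
  assumes th: "\<And>p. \<theta> p \<in> U" "continuous_on UNIV \<theta>" and Y: "continuous_vector_field_on AM U Y"
  shows "continuous_on UNIV (\<lambda>p. N (\<theta> p) (Y (\<theta> p)))"
proof -
  have "isCont (\<lambda>p. N (\<theta> p) (Y (\<theta> p))) p0" for p0
  proof -
    define d where "d = chart_at AM (\<theta> p0)"
    have d: "d \<in> AM" "\<theta> p0 \<in> fst d" using chart_at_props[OF atlas_M] by (auto simp: d_def)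
    note dh = smooth_atlas_chart[OF atlas_M d(1)]
    define V where "V = \<theta> -` fst d"
    have V: "open V" "p0 \<in> V" unfolding V_def using th(2) dh(1) d(2) by (auto intro: open_vimage)
    have tV: "continuous_on V \<theta>" by (rule continuous_on_subset[OF th(2)]) simp
    have "continuous_on (U \<inter> fst d) (\<lambda>y. in_chart AM d y (Y y))" using Y d(1) by (auto simp: continuous_vector_field_on_def)
    then have "continuous_on V (\<lambda>p. in_chart AM d (\<theta> p) (Y (\<theta> p)))"
      by (rule continuous_on_compose2[OF _ tV]) (use th(1) in \<open>auto simp: V_def\<close>)
    moreover have "continuous_on V (\<lambda>p. snd d (\<theta> p))"
      by (rule continuous_on_compose2[OF dh(3) tV]) (auto simp: V_def)
    ultimately have "continuous_on V (\<lambda>p. (snd d (\<theta> p), in_chart AM d (\<theta> p) (Y (\<theta> p))))" by (intro continuous_intros)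
    then have "continuous_on V (\<lambda>p. case (snd d (\<theta> p), in_chart AM d (\<theta> p) (Y (\<theta> p))) of (p, v) \<Rightarrow> Nch d p v)"
      by (rule continuous_on_compose2[OF Nch_continuous[OF d(1)]]) (auto simp: V_def)
    then have "continuous_on V (\<lambda>p. N (\<theta> p) (Y (\<theta> p)))"
      by (rule continuous_on_eq) (auto simp: V_def Nch_def dh(5) from_chart_in_chart[OF atlas_M d(1)])
    then show ?thesis using V continuous_on_eq_continuous_at by blast
  qed
  then show ?thesis by (simp add: continuous_on_eq_continuous_at)
qed

end

context hyp_action
begin

text \<open>In chart coordinates let \<open>w\<close> be the point of the plaque of \<open>y\<close>
  nearest to \<open>z\<close>. The displacement from \<open>w\<close> to \<open>z\<close> is
  orthogonal to \<open>Es\<close>, which forces a definite centre-unstable component, while both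
  points are reached from \<open>y\<close> along \<open>Es\<close>. Then
  \<open>escurve_cone_trivial\<close> leaves only \<open>z = w\<close>.\<close>

lemma es_local:
  assumes fol: "foliation_tangent_to AM Es \<F>"
  obtains \<epsilon> where "\<epsilon> > 0" "\<And>z. escurve \<epsilon> y z \<Longrightarrow> same_leaf \<F> y z"
proof -
  obtain F \<rho>' A r0 where F: "finite F" "A \<ge> 1" "r0 > 0" "\<And>x. x \<in> F \<Longrightarrow> ball_in x (\<rho>' x + r0)"
    "\<And>x. x \<in> F \<Longrightarrow> \<rho>' x > 0" "\<And>y. \<exists>x\<in>F. y \<in> core x (\<rho>' x)"
    "\<And>x p v. x \<in> F \<Longrightarrow> p \<in> cball (snd (chart_at AM x) x) (\<rho>' x + r0) \<Longrightarrow>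
      Nch (chart_at AM x) p v \<le> A * norm v \<and> norm v \<le> A * Nch (chart_at AM x) p v"
    by (rule chart_family) blast
  obtain x where x: "x \<in> F" "y \<in> core x (\<rho>' x)" using F(6) by blast
  define c where "c = chart_at AM x"
  have c: "c \<in> AM" using chart_at_props[OF atlas_M] by (auto simp: c_def)
  note ch = smooth_atlas_chart[OF atlas_M c]
  have yc: "y \<in> fst c" "norm (snd c y - snd c x) \<le> \<rho>' x" using x(2) by (auto simp: core_def c_def dist_norm norm_minus_commute)
  have sub: "cball (snd c x) (\<rho>' x + r0) \<subseteq> snd c ` fst c" using F(4)[OF x(1)] by (simp add: ball_in_def c_def)
  have NA: "Nch c p v \<le> A * norm v" "norm v \<le> A * Nch c p v" if "p \<in> cball (snd c x) (\<rho>' x + r0)" for p v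
    using F(7)[OF x(1), of p v] that by (auto simp: c_def)
  obtain U and \<psi> :: "'m \<Rightarrow> 'e" and \<theta> P Y where fc: "open U" "y \<in> U" "\<And>p. \<theta> p \<in> U" "\<And>p. \<psi> (\<theta> p) = p" "\<And>w. w \<in> U \<Longrightarrow> \<theta> (\<psi> w) = w"
    "continuous_on U \<psi>" "continuous_on UNIV \<theta>" "subspace P"
    "\<And>w e. w \<in> U \<Longrightarrow> e \<in> P \<Longrightarrow> same_leaf \<F> w (\<theta> (\<psi> w + e))"
    "\<And>w e \<tau>. w \<in> U \<Longrightarrow> e \<in> P \<Longrightarrow> has_velocity AM (\<lambda>t. \<theta> (\<psi> w + t *\<^sub>R e)) (Y e (\<theta> (\<psi> w + \<tau> *\<^sub>R e))) \<tau>"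
    "\<And>e. e \<in> P \<Longrightarrow> continuous_vector_field_on AM U (Y e)"
    "\<And>w. w \<in> U \<Longrightarrow> (\<lambda>e. Y e w) ` P = Es w"
    by (rule foliation_chart[OF atlas_M fol, of y]) blast
  obtain B where B: "B \<subseteq> P" "pairwise orthogonal B" "\<And>b. b \<in> B \<Longrightarrow> norm b = 1" "independent B" "span B = P"
    by (rule orthonormal_basis_subspace[OF fc(8)]) blast
  have finB: "finite B" using B(4) by (rule independent_imp_finite)
  obtain xs where xs: "set xs = B" "distinct xs" using finite_distinct_list[OF finB] by blast
  define k where "k = length xs"
  have expand: "(\<Sum>i<k. (e \<bullet> xs ! i) *\<^sub>R xs ! i) = e" if "e \<in> P" for e
  proof -
    have "(\<Sum>i<k. (e \<bullet> xs ! i) *\<^sub>R xs ! i) = (\<Sum>b\<in>B. (e \<bullet> b) *\<^sub>R b)"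
      by (rule sum.reindex_bij_betw[of "nth xs"]) (use xs in \<open>auto simp: k_def intro!: bij_betw_nth\<close>)
    also have "\<dots> = e" by (rule orthonormal_basis_expand[OF B(2,3) _ finB]) (use that B(5) in auto)
    finally show ?thesis .
  qed
  have "\<exists>M. \<forall>p\<in>cball (\<psi> y) 1. N (\<theta> p) (Y b (\<theta> p)) \<le> M" if "b \<in> P" for b
  proof -
    have "continuous_on (cball (\<psi> y) 1) (\<lambda>p. N (\<theta> p) (Y b (\<theta> p)))"
      by (rule continuous_on_subset[OF speed_continuous[OF fc(3,7) fc(11)[OF that]]]) simp
    from continuous_attains_sup[OF compact_cball _ this] show ?thesis by auto
  qed
  then obtain Mb where Mb: "\<And>b p. b \<in> P \<Longrightarrow> p \<in> cball (\<psi> y) 1 \<Longrightarrow> N (\<theta> p) (Y b (\<theta> p)) \<le> Mb b" by metis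
  define M' where "M' = Max (insert 1 (Mb ` B))"
  have M': "M' \<ge> 1" "\<And>b. b \<in> B \<Longrightarrow> Mb b \<le> M'" using finB by (auto simp: M'_def)
  have MB: "N (\<theta> p) (Y b (\<theta> p)) \<le> M'" if "p \<in> cball (\<psi> y) 1" "b \<in> set xs" for p b
    using Mb[of b p] M'(2)[of b] that B(1) xs(1) by force
  have A2: "A\<^sup>2 \<ge> 1" using F(2) by simp
  obtain \<epsilon>1 where e1: "\<epsilon>1 > 0" "\<And>w z u q. echain k \<epsilon>1 y w \<Longrightarrow> escurve \<epsilon>1 y z \<Longrightarrow>
    cone (A\<^sup>2) w (from_chart AM c (snd c w) (snd c z - snd c w)) u q \<Longrightarrow> q = 0"
    using escurve_cone_trivial[OF F(1,4,6,3,2,7) A2, of k] x unfolding c_def by blast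
  \<comment> \<open>A plaque point with coordinates at most \<open>s\<close> is reached by
    \<open>k\<close> moves that remain within distance 1 of \<open>\<psi> y\<close> and have speed
    at most \<open>s M' \<le> \<epsilon>1\<close>.\<close>
  define s where "s = min (1 / (real k + 1)) (\<epsilon>1 / M')"
  have s: "s > 0" using e1(1) M'(1) by (simp add: s_def)
  have sk: "real k * s \<le> 1"
  proof -
    have "real k * s \<le> real k * (1 / (real k + 1))" by (rule mult_left_mono) (auto simp: s_def)
    also have "\<dots> \<le> 1" by simp
    finally show ?thesis .
  qed
  have sM: "s * M' \<le> \<epsilon>1"
  proof -
    have "s * M' \<le> \<epsilon>1 / M' * M'" by (rule mult_right_mono) (use M'(1) in \<open>auto simp: s_def\<close>)
    then show ?thesis using M'(1) by simp
  qed
  define V where "V = U \<inter> \<psi> -` ball (\<psi> y) s"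
  have V: "open V" "y \<in> V" unfolding V_def using fc s by (auto intro: continuous_open_preimage)
  have "open (snd c ` fst c \<inter> chart_inv c -` V)" by (rule continuous_open_preimage[OF ch(4,2) V(1)])
  moreover have "snd c y \<in> snd c ` fst c \<inter> chart_inv c -` V" using yc(1) V ch by auto
  ultimately obtain r' where r': "r' > 0" "cball (snd c y) r' \<subseteq> snd c ` fst c \<inter> chart_inv c -` V"
    using open_contains_cball by blast
  define r where "r = min r' r0"
  have r: "r > 0" "r \<le> r0" "cball (snd c y) r \<subseteq> snd c ` fst c \<inter> chart_inv c -` V"
    using r' F(3) subset_cball[of r r' "snd c y"] by (auto simp: r_def)
  \<comment> \<open>\<open>z\<close> is within \<open>r / 4\<close> of \<open>y\<close>, and so is
    its nearest point within \<open>r / 2\<close>: the minimum over \<open>Q\<close> is attained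
    strictly inside the ball, where moves along the plaque are unrestricted.\<close>
  define \<epsilon> where "\<epsilon> = min \<epsilon>1 (r / (4 * A))"
  have \<epsilon>: "\<epsilon> > 0" "\<epsilon> \<le> \<epsilon>1" using e1(1) r(1) F(2) by (auto simp: \<epsilon>_def)
  have Ae: "A * \<epsilon> \<le> r / 4"
  proof -
    have "A * \<epsilon> \<le> A * (r / (4 * A))" by (rule mult_left_mono) (use F(2) in \<open>auto simp: \<epsilon>_def\<close>)
    then show ?thesis using F(2) by simp
  qed
  have "same_leaf \<F> y z" if z: "escurve \<epsilon> y z" for z
  proof -
    have zc: "z \<in> fst c" "norm (snd c z - snd c y) \<le> A * \<epsilon>"
      using escurve_displacement[OF c sub F(2) NA(2) yc(1) _ z] yc(2) Ae r(1,2) F(3) by auto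
    define Q where "Q = cball (snd c y) r \<inter> (\<lambda>p. \<psi> (chart_inv c p) - \<psi> y) -` P"
    have "continuous_on (cball (snd c y) r) (\<lambda>p. \<psi> (chart_inv c p) - \<psi> y)"
      by (intro continuous_intros continuous_on_compose2[OF fc(6) continuous_on_subset[OF ch(4)]]) (use r(3) in \<open>auto simp: V_def\<close>)
    then have "closed Q" unfolding Q_def by (rule continuous_closed_preimage[OF _ closed_cball closed_subspace[OF fc(8)]])
    moreover have yQ: "snd c y \<in> Q" using ch(5)[OF yc(1)] subspace_0[OF fc(8)] r(1) by (simp add: Q_def)
    ultimately obtain w where w: "w \<in> Q" "\<And>p. p \<in> Q \<Longrightarrow> dist (snd c z) w \<le> dist (snd c z) p"
      using distance_attains_inf[of Q "snd c z"] by blast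
    define \<nu> where "\<nu> = snd c z - w"
    have nw: "norm \<nu> \<le> A * \<epsilon>" using w(2)[OF yQ] zc(2) by (simp add: dist_norm \<nu>_def)
    have wy: "dist (snd c y) w < r"
    proof -
      have "dist (snd c y) w \<le> norm (snd c z - snd c y) + norm \<nu>"
        using dist_triangle[of "snd c y" w "snd c z"] by (simp add: dist_norm \<nu>_def norm_minus_commute)
      then show ?thesis using nw zc(2) Ae r(1) by linarith
    qed
    define w' where "w' = chart_inv c w"
    have wim: "w \<in> snd c ` fst c" using w(1) r(3) by (auto simp: Q_def)
    have w': "w' \<in> fst c" "snd c w' = w" using ch(6,7)[OF wim] by (auto simp: w'_def)
    have w'V: "w' \<in> V" using w(1) r(3) by (auto simp: Q_def w'_def)
    then have w'U: "w' \<in> U" by (simp add: V_def)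
    define e0 where "e0 = \<psi> w' - \<psi> y"
    have e0: "e0 \<in> P" "norm e0 \<le> s" "w' = \<theta> (\<psi> y + e0)"
      using w(1) w'V fc(5)[OF w'U] by (auto simp: Q_def e0_def w'_def V_def dist_norm norm_minus_commute)
    have "echain k \<epsilon>1 y (\<theta> (\<psi> y + (\<Sum>i<k. (e0 \<bullet> xs ! i) *\<^sub>R xs ! i)))"
    proof (rule plaque_chain[where \<psi>=\<psi> and \<theta>=\<theta> and U=U and Y=Y and s=s and M=M' and P=P, OF fc(3,4,5,8,2,10)])
      show "Y e w \<in> Es w" if "w \<in> U" "e \<in> P" for w e using fc(12)[OF that(1)] that(2) by blast
      show "set xs \<subseteq> P" using B(1) xs(1) by simp
      show "norm b = 1" if "b \<in> set xs" for b using B(3) xs(1) that by simp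
      show "N (\<theta> p) (Y b (\<theta> p)) \<le> M'" if "p \<in> cball (\<psi> y) 1" "b \<in> set xs" for p b by (rule MB[OF that])
      show "\<bar>e0 \<bullet> xs ! i\<bar> \<le> s" if "i < length xs" for i
      proof -
        have "norm (xs ! i) = 1" using B(3)[of "xs ! i"] nth_mem[OF that] xs(1) by simp
        then have "\<bar>e0 \<bullet> xs ! i\<bar> \<le> norm e0" using Cauchy_Schwarz_ineq2[of e0 "xs ! i"] by simp
        then show ?thesis using e0(2) by linarith
      qed
    qed (use s sk sM in \<open>auto simp: k_def\<close>)
    then have ew: "echain k \<epsilon>1 y w'" using expand[OF e0(1)] e0(3) by simp
    \<comment> \<open>Vectors of \<open>Es\<close> at \<open>w'\<close> are velocities of curves in
      the plaque, and along such a curve the squared distance to \<open>z\<close> has a local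
      minimum at 0.\<close>
    have perp: "\<nu> \<bullet> in_chart AM c w' v = 0" if v: "v \<in> Es w'" for v
    proof -
      obtain e where e: "e \<in> P" "v = Y e w'" using fc(12)[OF w'U] v by blast
      define \<sigma> where "\<sigma> = (\<lambda>t. \<theta> (\<psi> w' + t *\<^sub>R e))"
      have \<sigma>0: "\<sigma> 0 = w'" using fc(5)[OF w'U] by (simp add: \<sigma>_def)
      have "has_velocity AM \<sigma> v 0" using fc(10)[OF w'U e(1), of 0] e(2) \<sigma>0 by (simp add: \<sigma>_def)
      then have ic: "isCont \<sigma> 0" and der: "((\<lambda>t. snd c (\<sigma> t)) has_vector_derivative in_chart AM c w' v) (at 0)"
        using has_velocity_chart[OF atlas_M c, of \<sigma> 0 v] w'(1) \<sigma>0 by auto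
      define h where "h = (\<lambda>t. (snd c z - snd c (\<sigma> t)) \<bullet> (snd c z - snd c (\<sigma> t)))"
      have "(h has_real_derivative (- 2 * (\<nu> \<bullet> in_chart AM c w' v))) (at 0)"
        unfolding h_def has_field_derivative_def
        by (rule has_derivative_eq_rhs, (rule derivative_intros der[unfolded has_vector_derivative_def])+)
          (auto simp: \<sigma>0 w'(2) \<nu>_def inner_commute algebra_simps fun_eq_iff)
      moreover have "open (fst c \<inter> snd c -` ball (snd c y) r)" by (rule continuous_open_preimage[OF ch(3,1)]) simp
      then have "\<forall>\<^sub>F t in nhds 0. \<sigma> t \<in> fst c \<inter> snd c -` ball (snd c y) r"
        by (rule isCont_eventually_in[OF ic]) (use w' wy \<sigma>0 in auto)
      then obtain \<delta> where \<delta>: "\<delta> > 0" "\<And>t. dist t 0 < \<delta> \<Longrightarrow> \<sigma> t \<in> fst c \<inter> snd c -` ball (snd c y) r"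
        unfolding eventually_nhds_metric by blast
      have "h 0 \<le> h t" if t: "\<bar>0 - t\<bar> < \<delta>" for t
      proof -
        have st: "\<sigma> t \<in> fst c" "snd c (\<sigma> t) \<in> ball (snd c y) r" using \<delta>(2)[of t] t by (auto simp: dist_norm)
        have "\<psi> (\<sigma> t) - \<psi> y = e0 + t *\<^sub>R e" by (simp add: \<sigma>_def fc(4) e0_def)
        also have "\<dots> \<in> P" using e0(1) e(1) fc(8) by (simp add: subspace_add subspace_scale)
        finally have "snd c (\<sigma> t) \<in> Q" using st ch(5)[OF st(1)] by (simp add: Q_def)
        from w(2)[OF this] have "norm (snd c z - w) \<le> norm (snd c z - snd c (\<sigma> t))" by (simp add: dist_norm)
        then have "(norm (snd c z - w))\<^sup>2 \<le> (norm (snd c z - snd c (\<sigma> t)))\<^sup>2" by (rule power_mono) simp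
        then show ?thesis by (simp add: h_def \<sigma>0 w'(2) power2_norm_eq_inner)
      qed
      then have "- 2 * (\<nu> \<bullet> in_chart AM c w' v) = 0" by (intro DERIV_local_min[OF calculation \<delta>(1)]) blast
      then show ?thesis by simp
    qed
    obtain u b \<zeta> where dec: "u \<in> Es w'" "\<zeta> \<in> Eu w'" "from_chart AM c w \<nu> = u + (X w' b + \<zeta>)" using decomp by blast
    define q where "q = X w' b + \<zeta>"
    define \<mu> where "\<mu> = in_chart AM c w' u"
    define \<eta> where "\<eta> = in_chart AM c w' q"
    have "in_chart AM c w' (from_chart AM c w \<nu>) = \<nu>" using in_chart_from_chart[OF atlas_M c wim] by (simp add: w'_def)
    then have split: "\<nu> = \<mu> + \<eta>" using dec(3) linear_add[OF linear_in_chart[OF atlas_M c w'(1)]] by (simp add: q_def \<mu>_def \<eta>_def)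
    have "\<nu> \<bullet> \<mu> = 0" using perp[OF dec(1)] by (simp add: \<mu>_def)
    \<comment> \<open>Pythagoras for \<open>\<eta> = \<nu> - \<mu>\<close>: the centre-unstable part
      is at least as long as the stable one and vanishes only with \<nu>. Passing to Riemannian
      norms and back costs \<open>A\<close> twice, whence the aperture \<open>A^2\<close> of the
      cone.\<close>
    then have "\<eta> \<bullet> \<eta> = \<nu> \<bullet> \<nu> + \<mu> \<bullet> \<mu>" using split by (simp add: inner_simps inner_commute)
    then have nn: "norm \<mu> \<le> norm \<eta>" "\<eta> = 0 \<Longrightarrow> \<nu> = 0"
      by (simp_all add: norm_eq_sqrt_inner add_nonneg_eq_0_iff)
    have wA: "w \<in> cball (snd c x) (\<rho>' x + r0)"
      using dist_triangle[of "snd c x" w "snd c y"] wy yc(2) r(2) by (simp add: dist_norm norm_minus_commute)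
    have Nu: "N w' u = Nch c w \<mu>" "N w' q = Nch c w \<eta>"
      using from_chart_in_chart[OF atlas_M c w'(1)] w'(2) by (simp_all add: Nch_def \<mu>_def \<eta>_def w'_def[symmetric])
    have "N w' u \<le> A * norm \<mu>" unfolding Nu by (rule NA(1)[OF wA])
    also have "\<dots> \<le> A * norm \<eta>" by (rule mult_left_mono[OF nn(1)]) (use F(2) in simp)
    also have "\<dots> \<le> A * (A * N w' q)" unfolding Nu by (rule mult_left_mono[OF NA(2)[OF wA]]) (use F(2) in simp)
    finally have "N w' u \<le> A\<^sup>2 * N w' q" by (simp add: power2_eq_square mult.assoc)
    then have "cone (A\<^sup>2) w' (from_chart AM c (snd c w') (snd c z - snd c w')) u q"
      using dec by (auto simp: cone_def w'(2) \<nu>_def q_def)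
    from e1(2)[OF ew escurve_mono[OF z \<epsilon>(2)] this] have "\<eta> = 0"
      using linear_0[OF linear_in_chart[OF atlas_M c w'(1)]] by (simp add: \<eta>_def)
    from nn(2)[OF this] have "snd c z = snd c w'" by (simp add: \<nu>_def w'(2))
    then have "z = w'" using ch(5) zc(1) w'(1) by metis
    then show ?thesis using fc(9)[OF fc(2) e0(1)] e0(3) by simp
  qed
  then show ?thesis using that \<epsilon>(1) by blast
qed

text \<open>A short piece of the curve, rescaled to the unit interval, has small speed, so
  \<open>es_local\<close> applies around every time and connectedness of the interval
  concludes.\<close>

lemma escurve_same_leaf:
  assumes fol: "foliation_tangent_to AM Es \<F>" and e: "escurve M y z"
  shows "same_leaf \<F> y z"
proof -
  have part: "partition_on UNIV \<F>" using fol by (simp add: foliation_tangent_to_def)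
  note sl = same_leaf_props[OF part]
  obtain \<sigma> where \<sigma>: "\<sigma> 0 = y" "\<sigma> 1 = z" "\<And>t. t \<in> {0..1} \<Longrightarrow> \<exists>v\<in>Es (\<sigma> t). has_velocity AM \<sigma> v t \<and> N (\<sigma> t) v \<le> M"
    using e unfolding escurve_def by blast
  have "N (\<sigma> 0) (SOME v. N (\<sigma> 0) v \<le> M) \<le> M" by (rule someI_ex) (use \<sigma>(3)[of 0] in auto)
  then have M: "M \<ge> 0" by (rule order_trans[OF N_nonneg])
  have "same_leaf \<F> (\<sigma> 0) (\<sigma> 1)"
  proof (rule connected_equivalence_relation[of "{0..1}" 0 1 "\<lambda>s t. same_leaf \<F> (\<sigma> s) (\<sigma> t)"])
    fix a :: real assume a: "a \<in> {0..1}"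
    obtain \<epsilon> where \<epsilon>: "\<epsilon> > 0" "\<And>z. escurve \<epsilon> (\<sigma> a) z \<Longrightarrow> same_leaf \<F> (\<sigma> a) z" by (rule es_local[OF fol]) blast
    define \<delta> where "\<delta> = \<epsilon> / (M + 1)"
    have \<delta>: "\<delta> > 0" using \<epsilon>(1) M by (simp add: \<delta>_def)
    have "same_leaf \<F> (\<sigma> a) (\<sigma> t)" if t: "t \<in> {0..1}" "t \<in> ball a \<delta>" for t
    proof (rule \<epsilon>(2), rule escurve_mono[OF escurve_sub[OF \<sigma>(3) a t(1)]])
      have "\<bar>t - a\<bar> * M \<le> \<delta> * (M + 1)" using t(2) M by (intro mult_mono) (auto simp: dist_norm)
      then show "\<bar>t - a\<bar> * M \<le> \<epsilon>" using M by (simp add: \<delta>_def)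
    qed auto
    then show "\<exists>T. openin (top_of_set {0..1}) T \<and> a \<in> T \<and> (\<forall>x\<in>T. same_leaf \<F> (\<sigma> a) (\<sigma> x))"
      using a \<delta> by (intro exI[of _ "{0..1} \<inter> ball a \<delta>"]) (auto intro: openin_open_Int)
  qed (auto intro: sl)
  then show ?thesis using \<sigma>(1,2) by simp
qed

text \<open>Two points of a leaf are joined by a path that is merely continuous. Locally it stays in
  one plaque, where it is replaced by a straight segment tangent to \<open>Es\<close>; the image of
  the segment is again tangent to \<open>Es\<close>.\<close>

lemma strong_foliation_invariant:
  assumes fol: "foliation_tangent_to AM Es \<F>" and inv: "\<And>g. g \<in> SS"
  shows "foliation_invariant G \<phi> \<F>"
proof (rule foliation_invariantI)
  show part: "partition_on UNIV \<F>" using fol by (simp add: foliation_tangent_to_def)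
  note sl = same_leaf_props[OF part]
  fix g x y assume "same_leaf \<F> x y"
  then obtain L where L: "L \<in> \<F>" "x \<in> L" "y \<in> L" by (auto simp: same_leaf_def)
  have "path_connected L" using fol L(1) by (simp add: foliation_tangent_to_def)
  then obtain p where p: "path p" "path_image p \<subseteq> L" "pathstart p = x" "pathfinish p = y"
    using L unfolding path_connected_def by blast
  have pc: "continuous_on {0..1} p" using p(1) by (simp add: path_def)
  have pL: "p t \<in> L" if "t \<in> {0..1}" for t using p(2) that by (auto simp: path_image_def)
  obtain K where K: "K \<ge> 1" "\<And>x v. N (\<phi> g x) (T g x v) \<le> K * N x v" using T_bounded by blast
  have "same_leaf \<F> (\<phi> g (p 0)) (\<phi> g (p 1))"
  proof (rule connected_equivalence_relation[of "{0..1}" 0 1 "\<lambda>s t. same_leaf \<F> (\<phi> g (p s)) (\<phi> g (p t))"])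
    fix a :: real assume a: "a \<in> {0..1}"
    obtain U and \<psi> :: "'m \<Rightarrow> 'e" and \<theta> P Y where fc: "open U" "p a \<in> U" "\<And>p. \<theta> p \<in> U" "\<And>p. \<psi> (\<theta> p) = p" "\<And>w. w \<in> U \<Longrightarrow> \<theta> (\<psi> w) = w"
      "continuous_on UNIV \<theta>"
      "\<And>L w. L \<in> \<F> \<Longrightarrow> w \<in> L \<Longrightarrow> w \<in> U \<Longrightarrow> path_component_set (L \<inter> U) w = \<theta> ` {\<psi> w + e | e. e \<in> P}"
      "\<And>w e \<tau>. w \<in> U \<Longrightarrow> e \<in> P \<Longrightarrow> has_velocity AM (\<lambda>t. \<theta> (\<psi> w + t *\<^sub>R e)) (Y e (\<theta> (\<psi> w + \<tau> *\<^sub>R e))) \<tau>"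
      "\<And>e. e \<in> P \<Longrightarrow> continuous_vector_field_on AM U (Y e)"
      "\<And>w. w \<in> U \<Longrightarrow> (\<lambda>e. Y e w) ` P = Es w"
      by (rule foliation_chart[OF atlas_M fol, of "p a"]) blast
    obtain S where S: "open S" "a \<in> S" "\<And>t. t \<in> {0..1} \<Longrightarrow> t \<in> S \<Longrightarrow> p t \<in> U"
      using pc[unfolded continuous_on_topological, rule_format, OF a fc(1,2)] by blast
    obtain \<delta> where \<delta>: "\<delta> > 0" "ball a \<delta> \<subseteq> S" using S(1,2) open_contains_ball by blast
    define J where "J = {0..1} \<inter> ball a \<delta>"
    have "path_connected (p ` J)"
      by (intro path_connected_continuous_image continuous_on_subset[OF pc] convex_imp_path_connected)
        (auto simp: J_def intro!: convex_Int)
    moreover have "p ` J \<subseteq> L \<inter> U" using pL S(3) \<delta>(2) by (auto simp: J_def)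
    moreover have aJ: "a \<in> J" using a \<delta>(1) by (simp add: J_def)
    \<comment> \<open>A leaf may meet \<open>U\<close> in many plaques; the path itself shows that
      \<open>p t\<close> lies in the same one as \<open>p a\<close>.\<close>
    ultimately have pcs: "p t \<in> path_component_set (L \<inter> U) (p a)" if "t \<in> J" for t
      using that path_component_of_subset[of "p ` J" "L \<inter> U" "p a" "p t"] by (auto simp: path_connected_component)
    have "same_leaf \<F> (\<phi> g (p a)) (\<phi> g (p t))" if t: "t \<in> J" for t
    proof -
      obtain e where e: "e \<in> P" "p t = \<theta> (\<psi> (p a) + e)" using pcs[OF t] fc(7)[OF L(1) pL[OF a] fc(2)] by auto
      define \<sigma> where "\<sigma> = (\<lambda>s. \<theta> (\<psi> (p a) + s *\<^sub>R e))"
      have "continuous_on {0..1} (\<lambda>s. \<psi> (p a) + s *\<^sub>R e)" by (intro continuous_intros)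
      from continuous_on_compose2[OF speed_continuous[OF fc(3,6) fc(9)[OF e(1)]] this]
      have "continuous_on {0..1} (\<lambda>s. N (\<sigma> s) (Y e (\<sigma> s)))" by (simp add: \<sigma>_def)
      from continuous_attains_sup[OF compact_Icc _ this]
      have "\<exists>M. \<forall>s\<in>{0..1}. N (\<sigma> s) (Y e (\<sigma> s)) \<le> M" by auto
      then obtain M where M: "\<And>s. s \<in> {0..1} \<Longrightarrow> N (\<sigma> s) (Y e (\<sigma> s)) \<le> M" by blast
      have "escurve (K * M) (\<phi> g (p a)) (\<phi> g (p t))"
        unfolding escurve_def
      proof (intro exI[of _ "\<lambda>s. \<phi> g (\<sigma> s)"] conjI ballI)
        show "\<phi> g (\<sigma> 0) = \<phi> g (p a)" "\<phi> g (\<sigma> 1) = \<phi> g (p t)" using fc(5)[OF fc(2)] e(2) by (auto simp: \<sigma>_def)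
        fix s :: real assume s: "s \<in> {0..1}"
        have "has_velocity AM \<sigma> (Y e (\<sigma> s)) s" using fc(8)[OF fc(2) e(1), of s] by (simp add: \<sigma>_def)
        from has_velocity_map[OF atlas_M atlas_M this tdiff_act]
        have "has_velocity AM (\<lambda>s. \<phi> g (\<sigma> s)) (T g (\<sigma> s) (Y e (\<sigma> s))) s" by (simp add: T_def)
        moreover have "Y e (\<sigma> s) \<in> Es (\<sigma> s)" using fc(10)[OF fc(3)] e(1) by (auto simp: \<sigma>_def)
        then have "T g (\<sigma> s) (Y e (\<sigma> s)) \<in> Es (\<phi> g (\<sigma> s))" using inv[of g] by (simp add: SS_def pres_def)
        moreover have "N (\<phi> g (\<sigma> s)) (T g (\<sigma> s) (Y e (\<sigma> s))) \<le> K * M"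
          by (rule order_trans[OF K(2) mult_left_mono[OF M[OF s]]]) (use K(1) in simp)
        ultimately show "\<exists>v\<in>Es (\<phi> g (\<sigma> s)). has_velocity AM (\<lambda>s. \<phi> g (\<sigma> s)) v s \<and> N (\<phi> g (\<sigma> s)) v \<le> K * M" by blast
      qed
      then show ?thesis by (rule escurve_same_leaf[OF fol])
    qed
    then show "\<exists>T. openin (top_of_set {0..1}) T \<and> a \<in> T \<and> (\<forall>t\<in>T. same_leaf \<F> (\<phi> g (p a)) (\<phi> g (p t)))"
      using aJ by (intro exI[of _ J]) (auto simp: J_def intro: openin_open_Int)
  qed (auto intro: sl)
  then show "same_leaf \<F> (\<phi> g x) (\<phi> g y)" using p(3,4) by (simp add: pathstart_def pathfinish_def)
qed

end

section \<open>Anosov elements of the nilradical\<close>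

context smooth_action
begin

lemma act_pow: "\<phi> g ^^ j = \<phi> (g [^] (j::nat))"
proof (induction j)
  case (Suc j)
  then show ?case by (auto simp: fun_eq_iff act_mult funpow_Suc_right simp del: funpow.simps)
qed (simp add: fun_eq_iff)

lemma inv_act: "inv_into UNIV (\<phi> g) = \<phi> (inv g)"
  by (rule Hilbert_Choice.inv_equality) simp_all

lemma bundle_invariant_iff: "bundle_invariant AM (\<phi> g) E \<longleftrightarrow>
    (\<forall>x. \<forall>v\<in>E x. T g x v \<in> E (\<phi> g x)) \<and> (\<forall>x. \<forall>v\<in>E x. T (inv g) x v \<in> E (\<phi> (inv g) x))"
proof (intro iffI conjI allI ballI)
  assume b: "bundle_invariant AM (\<phi> g) E"
  fix x v assume v: "v \<in> E x"
  show "T g x v \<in> E (\<phi> g x)" using b v unfolding bundle_invariant_def T_def by blast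
  have "T g (\<phi> (inv g) x) ` E (\<phi> (inv g) x) = E (\<phi> g (\<phi> (inv g) x))" using b unfolding bundle_invariant_def T_def by blast
  then obtain w where w: "w \<in> E (\<phi> (inv g) x)" "v = T g (\<phi> (inv g) x) w" using v by auto
  then show "T (inv g) x v \<in> E (\<phi> (inv g) x)" using T_inv(1)[of g "\<phi> (inv g) x" w] by simp
next
  assume b: "(\<forall>x. \<forall>v\<in>E x. T g x v \<in> E (\<phi> g x)) \<and> (\<forall>x. \<forall>v\<in>E x. T (inv g) x v \<in> E (\<phi> (inv g) x))"
  show "bundle_invariant AM (\<phi> g) E"
    unfolding bundle_invariant_def
  proof (intro allI equalityI subsetI)
    fix x v assume "v \<in> tangent_map AM AM (\<phi> g) x ` E x"
    then show "v \<in> E (\<phi> g x)" using b unfolding T_def[symmetric] by blast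
  next
    fix x v assume "v \<in> E (\<phi> g x)"
    then have "T (inv g) (\<phi> g x) v \<in> E x" using b act_inv(1)[of g x] by metis
    moreover have "v = T g x (T (inv g) (\<phi> g x) v)" using T_inv(2)[of g "\<phi> g x" v] by simp
    ultimately show "v \<in> tangent_map AM AM (\<phi> g) x ` E x" unfolding T_def[symmetric] by blast
  qed
qed

end

context riem_action
begin

lemma norm_on_bound:
  assumes E: "subspace (E x)" and n: "norm_on AM \<rho> (\<phi> g) E x \<le> ennreal c" and c: "c \<ge> 0" and v: "v \<in> E x"
  shows "N (\<phi> g x) (T g x v) \<le> c * N x v"
proof (cases "v = 0")
  case True
  then show ?thesis using linear_0[OF T_linear] by simp
next
  case False
  define w where "w = (1 / N x v) *\<^sub>R v"
  have p: "N x v > 0" by (rule N_pos[OF False])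
  have w: "w \<in> E x" "N x w = 1" using p v E by (auto simp: w_def N_scale intro: subspace_scale)
  have "ennreal (N (\<phi> g x) (T g x w)) \<le> norm_on AM \<rho> (\<phi> g) E x"
    unfolding norm_on_def N_def T_def using w by (intro SUP_upper) (simp add: N_def)
  then have "ennreal (N (\<phi> g x) (T g x w)) \<le> ennreal c" using n by (rule order_trans)
  then have "N (\<phi> g x) (T g x w) \<le> c" using c by (simp add: ennreal_le_iff)
  moreover have "T g x w = (1 / N x v) *\<^sub>R T g x v" by (simp add: w_def linear_cmul[OF T_linear])
  ultimately show ?thesis using p by (simp add: N_scale field_simps)
qed

text \<open>By \<open>T_X\<close> the tangent map acts on fundamental vectors through
  \<open>Ad\<close>, whose powers grow polynomially, and \<open>X_bounds\<close> compares the norms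
  on both ends.\<close>

lemma orbit_growth:
  assumes D: "D 0 = UNIV" "D m = {0}" "\<And>i w. w \<in> D i \<Longrightarrow> Ad f w - w \<in> D (Suc i)"
  shows "\<exists>C\<ge>1. \<forall>n x b. N (\<phi> (f [^] (n::nat)) x) (T (f [^] n) x (X x b)) \<le> C * (1 + real n) ^ m * N x (X x b)"
proof -
  obtain C where C: "C \<ge> 1" "\<And>n w. norm (Ad (f [^] (n::nat)) w) \<le> C * (1 + real n) ^ m * norm w"
    using Ad_pow_growth[of D m f, OF D] by blast
  obtain K where K: "K \<ge> 1" "\<And>x u. N x (X x u) \<le> K * norm u" "\<And>x u. norm u \<le> K * N x (X x u)"
    by (rule X_bounds) blast
  have "N (\<phi> (f [^] n) x) (T (f [^] n) x (X x b)) \<le> (K * C * K) * (1 + real n) ^ m * N x (X x b)" for n :: nat and x b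
  proof -
    have "N (\<phi> (f [^] n) x) (T (f [^] n) x (X x b)) \<le> K * norm (Ad (f [^] n) b)" unfolding T_X by (rule K(2))
    also have "\<dots> \<le> K * (C * (1 + real n) ^ m * norm b)" by (rule mult_left_mono[OF C(2)]) (use K(1) in simp)
    also have "\<dots> \<le> K * (C * (1 + real n) ^ m * (K * N x (X x b)))"
      by (intro mult_left_mono K(3)) (use K(1) C(1) in auto)
    finally show ?thesis by (simp add: mult_ac)
  qed
  moreover have "K * C * K \<ge> 1" using K(1) C(1) by (metis mult_ge1_I)
  ultimately show ?thesis by blast
qed

lemma anosov_hyp_action:
  assumes xi: "xi_anosov G AG AM \<rho> \<phi> (Es, Eu) a"
    and D: "D 0 = UNIV" "\<And>i. subspace (D i)" "D m = {0}" "\<And>i g w. w \<in> D i \<Longrightarrow> Ad g w \<in> D i"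
      "\<And>i w. w \<in> D i \<Longrightarrow> Ad (ex a 1) w - w \<in> D (Suc i)"
  shows "\<exists>C \<kappa>. hyp_action G AG AM \<phi> \<rho> (ex a 1) Es Eu C \<kappa> m"
proof -
  define f where "f = ex a 1"
  have split: "continuous_G_splitting G AG AM \<phi> (Es, Eu)"
    and inv: "bundle_invariant AM (\<phi> f) Es" "bundle_invariant AM (\<phi> f) Eu"
    using xi by (auto simp: xi_anosov_def Let_def lie_exp_ex f_def)
  obtain \<kappa> C0 where k: "\<kappa> > 0" "C0 > 0"
    "\<And>x j. norm_on AM \<rho> (\<phi> f ^^ j) Es x \<le> ennreal (C0 * exp (- \<kappa> * real j))"
    "\<And>x j. norm_on AM \<rho> (inv_into UNIV (\<phi> f) ^^ j) Eu x \<le> ennreal (C0 * exp (- \<kappa> * real j))"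
    using xi by (auto simp: xi_anosov_def Let_def lie_exp_ex f_def)
  have sub: "subspace (E x)" if "continuous_subbundle AM E" for E :: "'m \<Rightarrow> 'e set" and x
    using that unfolding continuous_subbundle_def by (metis subspace_span)
  have subs: "subspace (Es x)" "subspace (Eu x)" for x
    using split sub by (auto simp: continuous_G_splitting_def)
  \<comment> \<open>Unipotence passes to the inverse, since \<open>Ad (inv f) w - w\<close> is minus
    the image of \<open>Ad f w - w\<close> under \<open>Ad (inv f)\<close>. This gives the
    polynomial bound in backward time.\<close>
  have D5': "Ad (inv f) w - w \<in> D (Suc i)" if "w \<in> D i" for w i
  proof -
    have "- Ad (inv f) (Ad f w - w) \<in> D (Suc i)" using D(5)[OF that] D(2,4) by (simp add: f_def subspace_neg)
    then show ?thesis by (simp add: linear_diff[OF Ad_linear])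
  qed
  obtain C1 where C1: "C1 \<ge> 1" "\<And>n x b. N (\<phi> (f [^] (n::nat)) x) (T (f [^] n) x (X x b)) \<le> C1 * (1 + real n) ^ m * N x (X x b)"
    using orbit_growth[of D m f, OF D(1,3)] D(5) unfolding f_def by blast
  obtain C2 where C2: "C2 \<ge> 1" "\<And>n x b. N (\<phi> (inv f [^] (n::nat)) x) (T (inv f [^] n) x (X x b)) \<le> C2 * (1 + real n) ^ m * N x (X x b)"
    using orbit_growth[of D m "inv f", OF D(1,3)] D5' by blast
  define C where "C = max C0 (max C1 C2)"
  have C: "C \<ge> 1" "C0 \<le> C" "C1 \<le> C" "C2 \<le> C" using C1(1) C2(1) by (auto simp: C_def)
  have "hyp_action G AG AM \<phi> \<rho> f Es Eu C \<kappa> m"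
  proof (rule hyp_action.intro[OF riem_action_axioms hyp_action_axioms.intro])
    show "subspace (Es x)" "subspace (Eu x)" for x by (rule subs)+
    fix x v
    have "\<exists>!p. case p of (u, w, z) \<Rightarrow> u \<in> Es x \<and> w \<in> orbit_tangent G AG AM \<phi> x \<and> z \<in> Eu x \<and> v = u + w + z"
      using split by (simp add: continuous_G_splitting_def)
    then obtain u w z where "u \<in> Es x" "w \<in> orbit_tangent G AG AM \<phi> x" "z \<in> Eu x" "v = u + w + z" by auto
    then show "\<exists>u b z. u \<in> Es x \<and> z \<in> Eu x \<and> v = u + (X x b + z)"
      by (auto simp: orbit_tangent_def X_def add.assoc)
    show "T f x v \<in> Es (\<phi> f x)" "T (inv f) x v \<in> Es (\<phi> (inv f) x)" if "v \<in> Es x"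
      using inv(1) that unfolding bundle_invariant_iff by auto
    show "T f x v \<in> Eu (\<phi> f x)" "T (inv f) x v \<in> Eu (\<phi> (inv f) x)" if "v \<in> Eu x"
      using inv(2) that unfolding bundle_invariant_iff by auto
    fix n :: nat
    have le: "C0 * exp (- \<kappa> * real n) * N x v \<le> C * exp (- \<kappa> * real n) * N x v" using C(2) by (intro mult_right_mono) auto
    show "N (\<phi> (f [^] n) x) (T (f [^] n) x v) \<le> C * exp (- \<kappa> * real n) * N x v" if "v \<in> Es x"
      by (rule order_trans[OF norm_on_bound[OF subs(1) k(3)[unfolded act_pow] _ that] le]) (use k(2) in simp)
    show "N (\<phi> (inv f [^] n) x) (T (inv f [^] n) x v) \<le> C * exp (- \<kappa> * real n) * N x v" if "v \<in> Eu x"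
      by (rule order_trans[OF norm_on_bound[OF subs(2) k(4)[unfolded inv_act act_pow] _ that] le]) (use k(2) in simp)
    fix b
    show "N (\<phi> (f [^] n) x) (T (f [^] n) x (X x b)) \<le> C * (1 + real n) ^ m * N x (X x b)"
      by (rule order_trans[OF C1(2)]) (use C(3) in \<open>intro mult_right_mono; simp\<close>)
    show "N (\<phi> (inv f [^] n) x) (T (inv f [^] n) x (X x b)) \<le> C * (1 + real n) ^ m * N x (X x b)"
      by (rule order_trans[OF C2(2)]) (use C(4) in \<open>intro mult_right_mono; simp\<close>)
  qed (use C(1) k(1) in auto)
  then show ?thesis unfolding f_def by blast
qed

end

theorem theorem1:
  fixes G :: "'g::{t2_space,second_countable_topology} monoid"
    and AG :: "('g, 'b::euclidean_space) atlas"
    and AM :: "('m::{t2_space,second_countable_topology}, 'e::euclidean_space) atlas"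
    and \<rho> :: "'m \<Rightarrow> 'e \<Rightarrow> 'e \<Rightarrow> real"
    and \<phi> :: "'g \<Rightarrow> 'm \<Rightarrow> 'm"
    and n k :: nat
    and a :: 'b
    and Ess Euu :: "'m \<Rightarrow> 'e set"
  assumes "lie_group G AG" and "DIM('b) = k"
    and "connected (UNIV :: 'g set)" and "simply_connected (UNIV :: 'g set)"
    and "smooth_atlas AM" and "compact (UNIV :: 'm set)" and "DIM('e) = n + k"
    and "riemannian_metric AM \<rho>"
    and "nil_anosov_action G AG AM \<rho> \<phi>"
    and "a \<in> nilradical (lie_bracket G AG)"
    and "xi_anosov G AG AM \<rho> \<phi> (Ess, Euu) a"
  shows "(\<forall>g\<in>carrier G. bundle_invariant AM (\<phi> g) Ess \<and> bundle_invariant AM (\<phi> g) Euu) \<and>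
         (\<forall>E \<in> {Ess, Euu, bundle_sum (orbit_tangent G AG AM \<phi>) Ess,
                 bundle_sum (orbit_tangent G AG AM \<phi>) Euu}.
            \<forall>\<F>. foliation_tangent_to AM E \<F> \<longrightarrow> foliation_invariant G \<phi> \<F>)"
proof -
  have grp: "group G" and car: "carrier G = UNIV" using assms(1) by (auto simp: lie_group_def)
  have act: "group_action G UNIV \<phi>" "smooth_map (product_atlas AG AM) AM (\<lambda>(g, x). \<phi> g x)"
    "\<And>x. discrete (stabilizer G \<phi> x)"
    using assms(9) by (auto simp: nil_anosov_action_def smooth_locally_free_action_def)
  interpret riem_action G AG AM \<phi> \<rho>
  proof (intro riem_action.intro smooth_action.intro lie_grp.intro riem_action_axioms.intro
      smooth_action_axioms.intro lie_grp_axioms.intro grp assms(1,3,5,6,8) act)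
    show "\<phi> (g \<otimes>\<^bsub>G\<^esub> h) x = \<phi> g (\<phi> h x)" for g h x
      using group_action.composition_rule[OF act(1)] car by simp
    show "\<phi> \<one>\<^bsub>G\<^esub> x = x" for x
      using group_action.id_eq_one[OF act(1)] by (metis UNIV_I restrict_apply')
  qed
  obtain D :: "nat \<Rightarrow> 'b set" and m where D: "D 0 = UNIV" "\<And>i. subspace (D i)" "D m = {0}"
    "\<And>i g w. w \<in> D i \<Longrightarrow> Ad g w \<in> D i" "\<And>i w. w \<in> D i \<Longrightarrow> br a w \<in> D (Suc i)"
    by (rule nilradical_chain[OF assms(3,10)]) blast
  have un: "Ad (ex a 1) w - w \<in> D (Suc i)" if "w \<in> D i" for w i
    by (rule Ad_exp_unipotent[OF D(2) D(2) D(4) D(5) that])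
  obtain C \<kappa> where "hyp_action G AG AM \<phi> \<rho> (ex a 1) Ess Euu C \<kappa> m"
    using anosov_hyp_action[OF assms(11), of D m, OF D(1-4) un] by blast
  then interpret h: hyp_action G AG AM \<phi> \<rho> "ex a 1" Ess Euu C \<kappa> m .
  interpret h': hyp_action G AG AM \<phi> \<rho> "inv\<^bsub>G\<^esub> (ex a 1)" Euu Ess C \<kappa> m by (rule h.mirror)
  have SS: "g \<in> h.SS" for g by (rule h.all_preserve[of D m, OF D(1-4) un])
  then have SS': "g \<in> h'.SS" for g by (simp add: h.SS_def h'.SS_def h.pres_def h'.pres_def)
  \<comment> \<open>Take the zero vector in the second summand.\<close>
  have Xin: "X x u \<in> bundle_sum (orbit_tangent G AG AM \<phi>) E x" if "subspace (E x)" for x u and E :: "'m \<Rightarrow> 'e set"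
    using subspace_0[OF that] by (force simp: bundle_sum_def orbit_tangent_def X_def)
  show ?thesis
  proof (intro conjI ballI allI impI)
    show "bundle_invariant AM (\<phi> g) Ess" "bundle_invariant AM (\<phi> g) Euu" for g
      using SS[of g] SS[of "inv\<^bsub>G\<^esub> g"] unfolding bundle_invariant_iff by (auto simp: h.SS_def h.pres_def)
    fix E \<F> assume E: "E \<in> {Ess, Euu, bundle_sum (orbit_tangent G AG AM \<phi>) Ess, bundle_sum (orbit_tangent G AG AM \<phi>) Euu}"
      and fol: "foliation_tangent_to AM E \<F>"
    \<comment> \<open>The two weak bundles are treated together, as bundles containing the orbit
      directions; the second strong bundle is the first one for the reversed dynamics.\<close>
    from E consider "E = Ess" | "E = Euu" | "\<And>x u. X x u \<in> E x" using Xin h.sub_s h.sub_u by blast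
    then show "foliation_invariant G \<phi> \<F>"
    proof cases
      case 1
      then show ?thesis using h.strong_foliation_invariant[OF _ SS] fol by simp
    next
      case 2
      then show ?thesis using h'.strong_foliation_invariant[OF _ SS'] fol by simp
    next
      case 3
      then show ?thesis by (rule foliation_saturated[OF assms(3) fol])
    qed
  qed
qed

end
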